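(* Let $k$ be a field, $G$ a finite group, $H=\mathcal{O}_k(G)$, and $\sigma$ a lazy two-cocycle of $H$. If $\mathcal{B}\subset\mathcal{U}$ is a classical (affine) versal extension for $G$ over $k$, then ${}_\sigma\mathcal{B}\subset{}_\sigma\mathcal{U}$ is a versal extension for forms of ${}_\sigma H$, where ${}_\sigma H$ is regarded as a left $H$-comodule algebra. That is: identifying ${}_\sigma\mathcal{B}$ with $\mathcal{B}$, for every field $K\supseteq k$, every form of ${}_\sigma H$ over $K$ is isomorphic to ${}_\sigma\mathcal{U}\otimes_{\mathcal{B}}K$ for some $k$-algebra morphism $\mathcal{B}\to K$, and conversely for every $k$-algebra morphism $\mathcal{B}\to K$ the algebra ${}_\sigma\mathcal{U}\otimes_{\mathcal{B}}K$ is a form of ${}_\sigma H$ over $K$.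
   Context: $\mathcal{O}_k(G)$ is the Hopf algebra of $k$-valued functions on $G$; left $\mathcal{O}_k(G)$-comodule algebras are the same as right $G$-algebras. A two-cocycle of $H$ is a convolution-invertible bilinear form $\sigma:H\times H\to k$ with $\sum\sigma(x_1,y_1)\sigma(x_2y_2,z)=\sum\sigma(y_1,z_1)\sigma(x,y_2z_2)$; it is lazy if $\sum\sigma(x_1,y_1)x_2y_2=\sum\sigma(x_2,y_2)x_1y_1$. For a left $H$-comodule algebra $A$ with coaction $a\mapsto\sum a_{-1}\otimes a_0$, ${}_\sigma A$ is the comodule $A$ with product $a*_\sigma b=\sum\sigma(a_{-1},b_{-1})a_0b_0$; for $\sigma$ lazy it is again a left $H$-comodule algebra. In particular ${}_\sigma H$ is defined by taking $A=H$. A cleft left Galois object of a Hopf algebra $L$ over a field $K$ is a left $L$-comodule algebra $A'\neq0$ with coinvariants $K$ that is a Hopf-Galois extension of $K$ and is cleft (the cleft condition is automatic when $L$ is finite-dimensional). For a cleft left Galois object $A$ of $H$ and a field $K\supseteq k$ with algebraic closure $\bar K$, a form of $A$ over $K$ is a cleft Hopf-Galois extension $A'$ of $K$ with structure Hopf algebra $H\otimes_kK$ such that $A'\otimes_K\bar K\cong A\otimes_k\bar K$ (as comodule algebras). A classical versal extension (affine case): $U$ is an affine $k$-variety on which $G$ acts freely, $B=U/G$, $\mathcal{U}$ and $\mathcal{B}=\mathcal{U}^G$ are their algebras of functions, and for every field $K\supseteq k$: (i) every $G$-torsor over $K$ is isomorphic to $\mathrm{Spec}(\mathcal{U}\otimes_{\mathcal{B}}K)$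 for some $k$-algebra morphism $\mathcal{B}\to K$; (ii) for every $k$-algebra morphism $\mathcal{B}\to K$, $\mathrm{Spec}(\mathcal{U}\otimes_{\mathcal{B}}K)$ is a $G$-torsor over $K$. The algebra $\mathcal{U}$ is viewed as a left $H$-comodule algebra through the $G$-action. Since $G$ acts trivially on $\mathcal{B}$, there is a natural identification of ${}_\sigma\mathcal{B}$ with $\mathcal{B}$. *)

theory Defs
  imports "HOL-Algebra.Generated_Rings" "HOL-Algebra.Algebraic_Closure" "HOL-Algebra.Free_Abelian_Groups"
begin

section \<open>Algebras with a group action, alias comodule algebras\<close>

text \<open>
  Throughout, \<open>G\<close> is a finite group and \<open>R\<close> a commutative ring. A left comodule algebra over the
  Hopf algebra \<open>O_R(G)\<close> of \<open>R\<close>-valued functions on \<open>G\<close> is the same as a right \<open>G\<close>-algebra over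
  \<open>R\<close>: the coaction is \<open>a \<mapsto> \<Sum>g\<in>G. e_g \<otimes> (a \<cdot> g)\<close>, where \<open>e_g\<close> is the indicator function of \<open>g\<close>.
  The field \<open>gact\<close> holds the right action. If \<open>G\<close> acts on a space from the left, the induced
  right action on functions is \<open>(f \<cdot> g)(x) = f (g x)\<close>.
\<close>

record ('r, 'a, 'g) galg = "('r, 'a) module" +
  gact :: "'a \<Rightarrow> 'g \<Rightarrow> 'a"

definition G_algebra :: "('r, 'q) ring_scheme \<Rightarrow> ('g, 'm) monoid_scheme \<Rightarrow> ('r, 'a, 'g) galg \<Rightarrow> bool"
  where "G_algebra R G A \<longleftrightarrow>
    group G \<and> module R A \<and> ring A \<and>
    (\<forall>r\<in>carrier R. \<forall>a\<in>carrier A. \<forall>b\<in>carrier A.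
       (r \<odot>\<^bsub>A\<^esub> a) \<otimes>\<^bsub>A\<^esub> b = r \<odot>\<^bsub>A\<^esub> (a \<otimes>\<^bsub>A\<^esub> b) \<and> a \<otimes>\<^bsub>A\<^esub> (r \<odot>\<^bsub>A\<^esub> b) = r \<odot>\<^bsub>A\<^esub> (a \<otimes>\<^bsub>A\<^esub> b)) \<and>
    (\<forall>g\<in>carrier G. (\<lambda>a. gact A a g) \<in> ring_hom A A \<and>
       (\<forall>r\<in>carrier R. \<forall>a\<in>carrier A. gact A (r \<odot>\<^bsub>A\<^esub> a) g = r \<odot>\<^bsub>A\<^esub> gact A a g)) \<and>
    (\<forall>a\<in>carrier A. gact A a \<one>\<^bsub>G\<^esub> = a \<and>
       (\<forall>g\<in>carrier G. \<forall>h\<in>carrier G. gact A a (g \<otimes>\<^bsub>G\<^esub> h) = gact A (gact A a g) h))"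

definition galg_isomorphic ::
    "('r, 'q) ring_scheme \<Rightarrow> ('g, 'm) monoid_scheme \<Rightarrow> ('r, 'a, 'g) galg \<Rightarrow> ('r, 'b, 'g) galg \<Rightarrow> bool"
  where "galg_isomorphic R G A C \<longleftrightarrow> (\<exists>h \<in> ring_iso A C.
    (\<forall>r\<in>carrier R. \<forall>a\<in>carrier A. h (r \<odot>\<^bsub>A\<^esub> a) = r \<odot>\<^bsub>C\<^esub> h a) \<and>
    (\<forall>g\<in>carrier G. \<forall>a\<in>carrier A. h (gact A a g) = gact C (h a) g))"

text \<open>The coinvariants \<open>A^G\<close>, as a subalgebra.\<close>

definition invariants :: "('g, 'm) monoid_scheme \<Rightarrow> ('r, 'a, 'g) galg \<Rightarrow> ('r, 'a, 'g) galg"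
  where "invariants G A = A\<lparr>carrier := {a \<in> carrier A. \<forall>g\<in>carrier G. gact A a g = a}\<rparr>"

definition linear_map ::
    "('r, 'q) ring_scheme \<Rightarrow> ('r, 'a, 'm) module_scheme \<Rightarrow> ('r, 'b, 'n) module_scheme \<Rightarrow> ('a \<Rightarrow> 'b) \<Rightarrow> bool"
  where "linear_map R M N f \<longleftrightarrow> f \<in> carrier M \<rightarrow> carrier N \<and>
    (\<forall>x\<in>carrier M. \<forall>y\<in>carrier M. f (x \<oplus>\<^bsub>M\<^esub> y) = f x \<oplus>\<^bsub>N\<^esub> f y) \<and>
    (\<forall>r\<in>carrier R. \<forall>x\<in>carrier M. f (r \<odot>\<^bsub>M\<^esub> x) = r \<odot>\<^bsub>N\<^esub> f x)"

section \<open>The Hopf algebra of functions on a finite group\<close>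

text \<open>
  Functions are extensional. As a comodule algebra over itself, \<open>O_R(G)\<close> has the coaction
  \<open>\<Delta> f = \<Sum>g. e_g \<otimes> f(g _)\<close>, that is, the action \<open>(f \<cdot> g)(h) = f(g h)\<close>.
\<close>

definition fun_alg :: "('r, 'q) ring_scheme \<Rightarrow> ('g, 'm) monoid_scheme \<Rightarrow> ('r, 'g \<Rightarrow> 'r, 'g) galg"
  where "fun_alg R G =
    \<lparr>carrier = carrier G \<rightarrow>\<^sub>E carrier R,
     monoid.mult = (\<lambda>x y. \<lambda>g\<in>carrier G. x g \<otimes>\<^bsub>R\<^esub> y g),
     monoid.one = (\<lambda>g\<in>carrier G. \<one>\<^bsub>R\<^esub>),
     ring.zero = (\<lambda>g\<in>carrier G. \<zero>\<^bsub>R\<^esub>),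
     ring.add = (\<lambda>x y. \<lambda>g\<in>carrier G. x g \<oplus>\<^bsub>R\<^esub> y g),
     smult = (\<lambda>r x. \<lambda>g\<in>carrier G. r \<otimes>\<^bsub>R\<^esub> x g),
     gact = (\<lambda>x g. \<lambda>h\<in>carrier G. x (g \<otimes>\<^bsub>G\<^esub> h))\<rparr>"

definition delta_fun :: "('r, 'q) ring_scheme \<Rightarrow> ('g, 'm) monoid_scheme \<Rightarrow> 'g \<Rightarrow> ('g \<Rightarrow> 'r)"
  where "delta_fun R G g = (\<lambda>h\<in>carrier G. if h = g then \<one>\<^bsub>R\<^esub> else \<zero>\<^bsub>R\<^esub>)"

definition counit :: "('g, 'm) monoid_scheme \<Rightarrow> ('g \<Rightarrow> 'r) \<Rightarrow> 'r"
  where "counit G x = x \<one>\<^bsub>G\<^esub>"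

text \<open>
  \<open>sweedler R G A M F a\<close> is the Sweedler sum \<open>\<Sum> F(a\<^sub>-\<^sub>1, a\<^sub>0)\<close>, with values in \<open>M\<close>, for \<open>a\<close> in the
  comodule algebra \<open>A\<close>. For \<open>A = fun_alg R G\<close> it is \<open>\<Sum> F(a\<^sub>1, a\<^sub>2)\<close>.
\<close>

definition sweedler ::
    "('r, 'q) ring_scheme \<Rightarrow> ('g, 'm) monoid_scheme \<Rightarrow> ('r, 'a, 'g) galg \<Rightarrow> ('b, 'n) ring_scheme \<Rightarrow>
     (('g \<Rightarrow> 'r) \<Rightarrow> 'a \<Rightarrow> 'b) \<Rightarrow> 'a \<Rightarrow> 'b"
  where "sweedler R G A M F a = (\<Oplus>\<^bsub>M\<^esub>g\<in>carrier G. F (delta_fun R G g) (gact A a g))"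

section \<open>Lazy two-cocycles and twisting\<close>

definition bilinear_form ::
    "('r, 'q) ring_scheme \<Rightarrow> ('g, 'm) monoid_scheme \<Rightarrow> (('g \<Rightarrow> 'r) \<Rightarrow> ('g \<Rightarrow> 'r) \<Rightarrow> 'r) \<Rightarrow> bool"
  where "bilinear_form R G s \<longleftrightarrow> (let H = fun_alg R G in
    (\<forall>x\<in>carrier H. \<forall>y\<in>carrier H. s x y \<in> carrier R) \<and>
    (\<forall>x\<in>carrier H. \<forall>x'\<in>carrier H. \<forall>y\<in>carrier H.
       s (x \<oplus>\<^bsub>H\<^esub> x') y = s x y \<oplus>\<^bsub>R\<^esub> s x' y \<and> s y (x \<oplus>\<^bsub>H\<^esub> x') = s y x \<oplus>\<^bsub>R\<^esub> s y x') \<and>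
    (\<forall>r\<in>carrier R. \<forall>x\<in>carrier H. \<forall>y\<in>carrier H.
       s (r \<odot>\<^bsub>H\<^esub> x) y = r \<otimes>\<^bsub>R\<^esub> s x y \<and> s x (r \<odot>\<^bsub>H\<^esub> y) = r \<otimes>\<^bsub>R\<^esub> s x y))"

definition convolution_inverse_forms ::
    "('r, 'q) ring_scheme \<Rightarrow> ('g, 'm) monoid_scheme \<Rightarrow> (('g \<Rightarrow> 'r) \<Rightarrow> ('g \<Rightarrow> 'r) \<Rightarrow> 'r) \<Rightarrow>
     (('g \<Rightarrow> 'r) \<Rightarrow> ('g \<Rightarrow> 'r) \<Rightarrow> 'r) \<Rightarrow> bool"
  where "convolution_inverse_forms R G s t \<longleftrightarrow> (let H = fun_alg R G in
    \<forall>x\<in>carrier H. \<forall>y\<in>carrier H.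
      sweedler R G H R (\<lambda>x1 x2. sweedler R G H R (\<lambda>y1 y2. s x1 y1 \<otimes>\<^bsub>R\<^esub> t x2 y2) y) x
        = counit G x \<otimes>\<^bsub>R\<^esub> counit G y \<and>
      sweedler R G H R (\<lambda>x1 x2. sweedler R G H R (\<lambda>y1 y2. t x1 y1 \<otimes>\<^bsub>R\<^esub> s x2 y2) y) x
        = counit G x \<otimes>\<^bsub>R\<^esub> counit G y)"

definition two_cocycle ::
    "('r, 'q) ring_scheme \<Rightarrow> ('g, 'm) monoid_scheme \<Rightarrow> (('g \<Rightarrow> 'r) \<Rightarrow> ('g \<Rightarrow> 'r) \<Rightarrow> 'r) \<Rightarrow> bool"
  where "two_cocycle R G s \<longleftrightarrow> (let H = fun_alg R G in
    bilinear_form R G s \<and>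
    (\<exists>t. bilinear_form R G t \<and> convolution_inverse_forms R G s t) \<and>
    (\<forall>x\<in>carrier H. \<forall>y\<in>carrier H. \<forall>z\<in>carrier H.
      sweedler R G H R (\<lambda>x1 x2. sweedler R G H R (\<lambda>y1 y2. s x1 y1 \<otimes>\<^bsub>R\<^esub> s (x2 \<otimes>\<^bsub>H\<^esub> y2) z) y) x =
      sweedler R G H R (\<lambda>y1 y2. sweedler R G H R (\<lambda>z1 z2. s y1 z1 \<otimes>\<^bsub>R\<^esub> s x (y2 \<otimes>\<^bsub>H\<^esub> z2)) z) y))"

definition lazy_two_cocycle ::
    "('r, 'q) ring_scheme \<Rightarrow> ('g, 'm) monoid_scheme \<Rightarrow> (('g \<Rightarrow> 'r) \<Rightarrow> ('g \<Rightarrow> 'r) \<Rightarrow> 'r) \<Rightarrow> bool"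
  where "lazy_two_cocycle R G s \<longleftrightarrow> (let H = fun_alg R G in
    two_cocycle R G s \<and>
    (\<forall>x\<in>carrier H. \<forall>y\<in>carrier H.
      sweedler R G H H (\<lambda>x1 x2. sweedler R G H H (\<lambda>y1 y2. s x1 y1 \<odot>\<^bsub>H\<^esub> (x2 \<otimes>\<^bsub>H\<^esub> y2)) y) x =
      sweedler R G H H (\<lambda>x1 x2. sweedler R G H H (\<lambda>y1 y2. s x2 y2 \<odot>\<^bsub>H\<^esub> (x1 \<otimes>\<^bsub>H\<^esub> y1)) y) x))"

text \<open>
  Cocycles are not assumed to be normalised. The cocycle identity gives \<open>s(1,x) = s(x,1) = s(1,1) \<epsilon>(x)\<close>,
  so the unit of the twisted product is \<open>s(1,1)\<^sup>-\<^sup>1 1\<close>. Only the multiplication and the unit of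
  \<open>A\<close> change; the \<open>R\<close>-module and the \<open>G\<close>-action (the comodule) do not.
\<close>

definition twist_unit ::
    "('r, 'q) ring_scheme \<Rightarrow> ('g, 'm) monoid_scheme \<Rightarrow> (('g \<Rightarrow> 'r) \<Rightarrow> ('g \<Rightarrow> 'r) \<Rightarrow> 'r) \<Rightarrow> 'r"
  where "twist_unit R G s = inv\<^bsub>R\<^esub> (s \<one>\<^bsub>fun_alg R G\<^esub> \<one>\<^bsub>fun_alg R G\<^esub>)"

definition twist ::
    "('r, 'q) ring_scheme \<Rightarrow> ('g, 'm) monoid_scheme \<Rightarrow> (('g \<Rightarrow> 'r) \<Rightarrow> ('g \<Rightarrow> 'r) \<Rightarrow> 'r) \<Rightarrow>
     ('r, 'a, 'g) galg \<Rightarrow> ('r, 'a, 'g) galg"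
  where "twist R G s A = A
    \<lparr>monoid.mult := (\<lambda>a b. sweedler R G A A (\<lambda>a1 a0. sweedler R G A A (\<lambda>b1 b0. s a1 b1 \<odot>\<^bsub>A\<^esub> (a0 \<otimes>\<^bsub>A\<^esub> b0)) b) a),
     monoid.one := twist_unit R G s \<odot>\<^bsub>A\<^esub> \<one>\<^bsub>A\<^esub>\<rparr>"

text \<open>
  The natural identification of \<open>B = A^G\<close> with its twist: for invariant \<open>b, b'\<close> the twisted product
  is \<open>s(1,1) b b'\<close>, so \<open>b \<mapsto> s(1,1)\<^sup>-\<^sup>1 b\<close> is an isomorphism of algebras from \<open>B\<close> onto its twist.
\<close>

definition twist_ident ::
    "('r, 'q) ring_scheme \<Rightarrow> ('g, 'm) monoid_scheme \<Rightarrow> (('g \<Rightarrow> 'r) \<Rightarrow> ('g \<Rightarrow> 'r) \<Rightarrow> 'r) \<Rightarrow>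
     ('r, 'a, 'g) galg \<Rightarrow> 'a \<Rightarrow> 'a"
  where "twist_ident R G s A b = twist_unit R G s \<odot>\<^bsub>A\<^esub> b"

section \<open>Tensor products and base change\<close>

text \<open>
  \<open>A \<otimes>\<^sub>R C\<close> is the free abelian group on \<open>A \<times> C\<close> modulo the subgroup generated by the bilinearity
  relations. It is a multiplicatively written group record; its elements are cosets.
\<close>

definition tensor_rels ::
    "('r, 'q) ring_scheme \<Rightarrow> ('r, 'a, 'm) module_scheme \<Rightarrow> ('r, 'c, 'n) module_scheme \<Rightarrow> ('a \<times> 'c \<Rightarrow>\<^sub>0 int) set"
  where "tensor_rels R A C =
    {frag_of (a \<oplus>\<^bsub>A\<^esub> a', c) - frag_of (a, c) - frag_of (a', c) | a a' c.
       a \<in> carrier A \<and> a' \<in> carrier A \<and> c \<in> carrier C} \<union>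
    {frag_of (a, c \<oplus>\<^bsub>C\<^esub> c') - frag_of (a, c) - frag_of (a, c') | a c c'.
       a \<in> carrier A \<and> c \<in> carrier C \<and> c' \<in> carrier C} \<union>
    {frag_of (r \<odot>\<^bsub>A\<^esub> a, c) - frag_of (a, r \<odot>\<^bsub>C\<^esub> c) | r a c.
       r \<in> carrier R \<and> a \<in> carrier A \<and> c \<in> carrier C}"

definition tensor_null ::
    "('r, 'q) ring_scheme \<Rightarrow> ('r, 'a, 'm) module_scheme \<Rightarrow> ('r, 'c, 'n) module_scheme \<Rightarrow> ('a \<times> 'c \<Rightarrow>\<^sub>0 int) set"
  where "tensor_null R A C =
    generate (free_Abelian_group (carrier A \<times> carrier C)) (tensor_rels R A C)"

definition tensor_group ::
    "('r, 'q) ring_scheme \<Rightarrow> ('r, 'a, 'm) module_scheme \<Rightarrow> ('r, 'c, 'n) module_scheme \<Rightarrow>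
     ('a \<times> 'c \<Rightarrow>\<^sub>0 int) set monoid"
  where "tensor_group R A C =
    free_Abelian_group (carrier A \<times> carrier C) Mod tensor_null R A C"

definition tens ::
    "('r, 'q) ring_scheme \<Rightarrow> ('r, 'a, 'm) module_scheme \<Rightarrow> ('r, 'c, 'n) module_scheme \<Rightarrow>
     'a \<Rightarrow> 'c \<Rightarrow> ('a \<times> 'c \<Rightarrow>\<^sub>0 int) set"
  where "tens R A C a c =
    tensor_null R A C #>\<^bsub>free_Abelian_group (carrier A \<times> carrier C)\<^esub> frag_of (a, c)"

text \<open>
  \<open>tensor_lift P F\<close> is the homomorphism \<open>A \<otimes>\<^sub>R C \<rightarrow> P\<close> into a commutative group \<open>P\<close> with
  \<open>a \<otimes> c \<mapsto> F a c\<close>, for balanced biadditive \<open>F\<close>: the induced map on the free abelian group is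
  constant on each coset.
\<close>

definition tensor_lift ::
    "('p, 'n) monoid_scheme \<Rightarrow> ('a \<Rightarrow> 'c \<Rightarrow> 'p) \<Rightarrow> ('a \<times> 'c \<Rightarrow>\<^sub>0 int) set \<Rightarrow> 'p"
  where "tensor_lift P F t =
    the_elem ((\<lambda>f. finprod P
       (\<lambda>(a, c). F a c [^]\<^bsub>P\<^esub> Poly_Mapping.lookup f (a, c)) (Poly_Mapping.keys f)) ` t)"

definition algebra_via :: "('r \<Rightarrow> 'c) \<Rightarrow> ('c, 'q) ring_scheme \<Rightarrow> ('r, 'c) module"
  where "algebra_via \<phi> K =
    \<lparr>carrier = carrier K, monoid.mult = monoid.mult K, monoid.one = monoid.one K, ring.zero = ring.zero K, ring.add = ring.add K,
     smult = (\<lambda>r x. \<phi> r \<otimes>\<^bsub>K\<^esub> x)\<rparr>"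

text \<open>
  The \<open>K\<close>-algebra \<open>A \<otimes>\<^sub>R K\<close>, for a commutative ring \<open>K\<close> viewed as an \<open>R\<close>-algebra via \<open>\<phi> : R \<rightarrow> K\<close>,
  with \<open>y (a \<otimes> x) = a \<otimes> y x\<close> and \<open>(a \<otimes> x) \<cdot> g = (a \<cdot> g) \<otimes> x\<close>.
\<close>

definition base_change ::
    "('r, 'q) ring_scheme \<Rightarrow> ('r \<Rightarrow> 'c) \<Rightarrow> ('c, 'm) ring_scheme \<Rightarrow> ('r, 'a, 'g) galg \<Rightarrow>
     ('c, ('a \<times> 'c \<Rightarrow>\<^sub>0 int) set, 'g) galg"
  where "base_change R \<phi> K A =
    (let C = algebra_via \<phi> K; T = tensor_group R A C in
    \<lparr>carrier = carrier T,
     monoid.mult = (\<lambda>t u. tensor_lift T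
       (\<lambda>a x. tensor_lift T (\<lambda>b y. tens R A C (a \<otimes>\<^bsub>A\<^esub> b) (x \<otimes>\<^bsub>K\<^esub> y)) u) t),
     monoid.one = tens R A C \<one>\<^bsub>A\<^esub> \<one>\<^bsub>K\<^esub>,
     ring.zero = \<one>\<^bsub>T\<^esub>,
     ring.add = monoid.mult T,
     smult = (\<lambda>y. tensor_lift T (\<lambda>a x. tens R A C a (y \<otimes>\<^bsub>K\<^esub> x))),
     gact = (\<lambda>t g. tensor_lift T (\<lambda>a x. tens R A C (gact A a g) x) t)\<rparr>)"

text \<open>
  For \<open>j : B \<rightarrow> V\<close> with values in the central invariants of \<open>V\<close>, \<open>change_scalars j V\<close> is \<open>V\<close> as a
  \<open>G\<close>-algebra over \<open>B\<close>, and \<open>specialise B j V \<phi> K\<close> is \<open>V \<otimes>\<^sub>B K\<close>.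
\<close>

definition change_scalars :: "('b \<Rightarrow> 'a) \<Rightarrow> ('r, 'a, 'g) galg \<Rightarrow> ('b, 'a, 'g) galg"
  where "change_scalars j V =
    \<lparr>carrier = carrier V, monoid.mult = monoid.mult V, monoid.one = monoid.one V, ring.zero = ring.zero V, ring.add = ring.add V,
     smult = (\<lambda>b v. j b \<otimes>\<^bsub>V\<^esub> v), gact = gact V\<rparr>"

definition specialise ::
    "('b, 'q) ring_scheme \<Rightarrow> ('b \<Rightarrow> 'a) \<Rightarrow> ('r, 'a, 'g) galg \<Rightarrow> ('b \<Rightarrow> 'c) \<Rightarrow> ('c, 'm) ring_scheme \<Rightarrow>
     ('c, ('a \<times> 'c \<Rightarrow>\<^sub>0 int) set, 'g) galg"
  where "specialise B j V \<phi> K = base_change B \<phi> K (change_scalars j V)"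

section \<open>Galois objects, torsors and forms\<close>

text \<open>
  The canonical map \<open>A \<otimes>\<^sub>R A \<rightarrow> O_R(G) \<otimes> A\<close>, \<open>a \<otimes> b \<mapsto> \<Sum> a\<^sub>-\<^sub>1 \<otimes> a\<^sub>0 b\<close>, where \<open>O_R(G) \<otimes> A\<close> is
  identified with the functions from \<open>G\<close> to \<open>A\<close>: \<open>a \<otimes> b\<close> goes to \<open>g \<mapsto> (a \<cdot> g) b\<close>.
\<close>

definition canonical_map ::
    "('g, 'm) monoid_scheme \<Rightarrow> ('r, 'a, 'g) galg \<Rightarrow> ('a \<times> 'a \<Rightarrow>\<^sub>0 int) set \<Rightarrow> 'g \<Rightarrow> 'a"
  where "canonical_map G A t =
    (\<lambda>g\<in>carrier G. tensor_lift (add_monoid A) (\<lambda>a b. gact A a g \<otimes>\<^bsub>A\<^esub> b) t)"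

definition canonical_map_bijective ::
    "('r, 'q) ring_scheme \<Rightarrow> ('g, 'm) monoid_scheme \<Rightarrow> ('r, 'a, 'g) galg \<Rightarrow> bool"
  where "canonical_map_bijective R G A \<longleftrightarrow>
    bij_betw (canonical_map G A) (carrier (tensor_group R A A)) (carrier G \<rightarrow>\<^sub>E carrier A)"

definition cleft :: "('r, 'q) ring_scheme \<Rightarrow> ('g, 'm) monoid_scheme \<Rightarrow> ('r, 'a, 'g) galg \<Rightarrow> bool"
  where "cleft R G A \<longleftrightarrow> (let H = fun_alg R G in
    \<exists>\<gamma> \<gamma>'. linear_map R H A \<gamma> \<and> linear_map R H A \<gamma>' \<and>
      (\<forall>x\<in>carrier H. \<forall>g\<in>carrier G. \<gamma> (gact H x g) = gact A (\<gamma> x) g) \<and>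
      (\<forall>x\<in>carrier H.
        sweedler R G H A (\<lambda>x1 x2. \<gamma> x1 \<otimes>\<^bsub>A\<^esub> \<gamma>' x2) x = counit G x \<odot>\<^bsub>A\<^esub> \<one>\<^bsub>A\<^esub> \<and>
        sweedler R G H A (\<lambda>x1 x2. \<gamma>' x1 \<otimes>\<^bsub>A\<^esub> \<gamma> x2) x = counit G x \<odot>\<^bsub>A\<^esub> \<one>\<^bsub>A\<^esub>))"

definition cleft_galois_object ::
    "('r, 'q) ring_scheme \<Rightarrow> ('g, 'm) monoid_scheme \<Rightarrow> ('r, 'a, 'g) galg \<Rightarrow> bool"
  where "cleft_galois_object K G A \<longleftrightarrow>
    G_algebra K G A \<and> carrier A \<noteq> {\<zero>\<^bsub>A\<^esub>} \<and>
    carrier (invariants G A) = {x \<odot>\<^bsub>A\<^esub> \<one>\<^bsub>A\<^esub> | x. x \<in> carrier K} \<and>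
    canonical_map_bijective K G A \<and> cleft K G A"

text \<open>
  \<open>Spec T\<close> is a \<open>G\<close>-torsor over the field \<open>K\<close>: a nonempty affine \<open>K\<close>-scheme \<open>X\<close> with a \<open>G\<close>-action
  such that \<open>G \<times> X \<rightarrow> X \<times> X\<close>, \<open>(g, x) \<mapsto> (g x, x)\<close>, is an isomorphism; on functions this is the
  canonical map. (Torsors under a finite group are affine.)
\<close>

definition torsor :: "('r, 'q) ring_scheme \<Rightarrow> ('g, 'm) monoid_scheme \<Rightarrow> ('r, 'a, 'g) galg \<Rightarrow> bool"
  where "torsor K G T \<longleftrightarrow>
    G_algebra K G T \<and> cring T \<and> carrier T \<noteq> {\<zero>\<^bsub>T\<^esub>} \<and> canonical_map_bijective K G T"

text \<open>A field extension of \<open>k\<close> is a field \<open>K\<close> with a homomorphism \<open>\<iota> : k \<rightarrow> K\<close>.\<close>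

definition form_of ::
    "'k ring \<Rightarrow> ('g, 'm) monoid_scheme \<Rightarrow> ('k, 'a, 'g) galg \<Rightarrow> 'c ring \<Rightarrow> ('k \<Rightarrow> 'c) \<Rightarrow>
     ('c, 'b, 'g) galg \<Rightarrow> bool"
  where "form_of k G A K \<iota> A' \<longleftrightarrow>
    cleft_galois_object K G A' \<and>
    galg_isomorphic (field.alg_closure K) G
      (base_change K (ring.indexed_const K) (field.alg_closure K) A')
      (base_change k (ring.indexed_const K \<circ> \<iota>) (field.alg_closure K) A)"

section \<open>Versal extensions\<close>

definition affine_variety :: "'k ring \<Rightarrow> ('k, 'a, 'g) galg \<Rightarrow> bool"
  where "affine_variety k U \<longleftrightarrow>
    cring U \<and>
    (\<exists>S. finite S \<and> S \<subseteq> carrier U \<and>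
       generate_ring U (S \<union> {c \<odot>\<^bsub>U\<^esub> \<one>\<^bsub>U\<^esub> | c. c \<in> carrier k}) = carrier U) \<and>
    (\<forall>u\<in>carrier U. \<forall>n::nat. u [^]\<^bsub>U\<^esub> n = \<zero>\<^bsub>U\<^esub> \<longrightarrow> u = \<zero>\<^bsub>U\<^esub>)"

text \<open>Homomorphisms of \<open>k\<close>-algebras from \<open>B\<close> to the extension field \<open>K\<close>, alias \<open>K\<close>-points of \<open>Spec B\<close>.\<close>

definition points ::
    "'k ring \<Rightarrow> ('k, 'a, 'g) galg \<Rightarrow> ('c, 'q) ring_scheme \<Rightarrow> ('k \<Rightarrow> 'c) \<Rightarrow> ('a \<Rightarrow> 'c) set"
  where "points k B K \<iota> =
    {\<phi> \<in> ring_hom B K. \<forall>c\<in>carrier k. \<phi> (c \<odot>\<^bsub>B\<^esub> \<one>\<^bsub>B\<^esub>) = \<iota> c}"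

text \<open>Free action on a variety: no nontrivial element fixes a point over the algebraic closure.\<close>

definition acts_freely :: "'k ring \<Rightarrow> ('g, 'm) monoid_scheme \<Rightarrow> ('k, 'a, 'g) galg \<Rightarrow> bool"
  where "acts_freely k G U \<longleftrightarrow>
    (\<forall>p \<in> points k U (field.alg_closure k) (ring.indexed_const k). \<forall>g\<in>carrier G.
       (\<forall>u\<in>carrier U. p (gact U u g) = p u) \<longrightarrow> g = \<one>\<^bsub>G\<^esub>)"

text \<open>
  A formula cannot quantify over types, so the type arguments fix the types of the fields \<open>K\<close> and of
  the torsors or forms over them. Both are arbitrary.
\<close>

definition classical_versal ::
    "'c itself \<Rightarrow> 't itself \<Rightarrow> 'k ring \<Rightarrow> ('g, 'm) monoid_scheme \<Rightarrow> ('k, 'u, 'g) galg \<Rightarrow> bool"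
  where "classical_versal TC TT k G U \<longleftrightarrow> (let B = invariants G U in
    G_algebra k G U \<and> affine_variety k U \<and> acts_freely k G U \<and>
    (\<forall>(K :: 'c ring) \<iota>. field K \<and> \<iota> \<in> ring_hom k K \<longrightarrow>
      (\<forall>T :: ('c, 't, 'g) galg. torsor K G T \<longrightarrow>
         (\<exists>\<phi> \<in> points k B K \<iota>. galg_isomorphic K G T (specialise B (\<lambda>b. b) U \<phi> K))) \<and>
      (\<forall>\<phi> \<in> points k B K \<iota>. torsor K G (specialise B (\<lambda>b. b) U \<phi> K))))"

definition versal_for_forms ::
    "'c itself \<Rightarrow> 't itself \<Rightarrow> 'k ring \<Rightarrow> ('g, 'm) monoid_scheme \<Rightarrow> ('k, 'a, 'g) galg \<Rightarrow>
     ('k, 'b, 'g) galg \<Rightarrow> ('b \<Rightarrow> 'v) \<Rightarrow> ('k, 'v, 'g) galg \<Rightarrow> bool"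
  where "versal_for_forms TC TT k G A B j V \<longleftrightarrow>
    (\<forall>(K :: 'c ring) \<iota>. field K \<and> \<iota> \<in> ring_hom k K \<longrightarrow>
      (\<forall>A' :: ('c, 't, 'g) galg. form_of k G A K \<iota> A' \<longrightarrow>
         (\<exists>\<phi> \<in> points k B K \<iota>. galg_isomorphic K G A' (specialise B j V \<phi> K))) \<and>
      (\<forall>\<phi> \<in> points k B K \<iota>. form_of k G A K \<iota> (specialise B j V \<phi> K)))"

end

theory Submission
  imports Defs
begin

text \<open>
  In the basis of delta functions a lazy cocycle is a function \<open>c\<close> on \<open>G \<times> G\<close>, invariant under simultaneous
  conjugation, and the twist of a \<open>G\<close>-algebra \<open>A\<close> has the product \<open>a * b = \<Sum> c(g,h) (a \<cdot> g) (b \<cdot> h)\<close>. The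
  convolution inverse \<open>d\<close> of \<open>c\<close> undoes the twist, and twisting is compatible with extension of scalars and
  with homomorphisms. So twisting is an equivalence, and the idea of the proof is that it matches the torsors of
  \<open>G\<close> over \<open>K\<close> with the forms of the twist of \<open>H = O_k(G)\<close> over \<open>K\<close>. Because the twist of \<open>U \<otimes>\<^sub>B K\<close>
  is the twist of \<open>U\<close> tensored with \<open>K\<close> (\<open>twisted_specialise\<close>), versality then passes from the one side to the other.

  From torsors to forms (\<open>twisted_cleft_galois\<close>, \<open>twisted_torsor_base_change\<close>): let \<open>V\<close> be the twist of a torsor
  \<open>T\<close>. The canonical map of \<open>V\<close> is that of \<open>T\<close> followed by an invertible operator made from \<open>c\<close>, so it is
  bijective too, and the invariants stay the same. A torsor has a point over the algebraically closed field
  \<open>L\<close>, hence \<open>T \<otimes> L\<close> is the algebra of functions on \<open>G\<close>, and \<open>V \<otimes> L\<close> is its twist. The remaining condition is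
  that \<open>V\<close> is cleft. This follows from a normal basis \<open>{v \<cdot> g}\<close> of \<open>V\<close> (\<open>normal_cleft\<close>), and being a normal
  basis depends only on the module and the action, which \<open>V\<close> shares with \<open>T\<close>. So everything is reduced to the
  normal basis theorem for torsors (\<open>normal_basis\<close>): over an infinite field a generic vector generates a normal basis,
  over a finite field the vectors with a given annihilator in the group algebra are counted.

  From forms to torsors (\<open>untwist\<close>): a form \<open>A'\<close> embeds, by a homomorphism, into the twist of the functions on \<open>G\<close>
  with values in \<open>L\<close>. Twisting \<open>A'\<close> back by \<open>d\<close> gives an algebra \<open>T\<close> that embeds into the functions themselves. Hence \<open>T\<close>
  is associative and commutative, it is a torsor because its twist \<open>A'\<close> is Galois, and an isomorphism of \<open>T\<close> with a
  specialisation of \<open>U\<close> is also one of \<open>A'\<close> with a specialisation of the twist of \<open>U\<close>.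
\<close>

text \<open>An index that is a single name is written as a subscript.\<close>

syntax "_index" :: "logic \<Rightarrow> index" ("\<^sub>_" [1000] 1000)

section \<open>Finite sums and products\<close>

lemma (in comm_monoid) finprod_swap:
  assumes "finite A" "finite B" "\<And>i j. i \<in> A \<Longrightarrow> j \<in> B \<Longrightarrow> f i j \<in> carrier G"
  shows "(\<Otimes>i\<in>A. \<Otimes>j\<in>B. f i j) = (\<Otimes>j\<in>B. \<Otimes>i\<in>A. f i j)"
  using assms(1,3)
proof (induction A rule: finite_induct)
  case empty
  then show ?case by simp
next
  case (insert x F)
  have "(\<Otimes>i\<in>insert x F. \<Otimes>j\<in>B. f i j) = (\<Otimes>j\<in>B. f x j) \<otimes> (\<Otimes>j\<in>B. \<Otimes>i\<in>F. f i j)"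
    using insert by (subst finprod_insert) (auto intro!: finprod_closed)
  also have "\<dots> = (\<Otimes>j\<in>B. f x j \<otimes> (\<Otimes>i\<in>F. f i j))"
    using insert by (subst finprod_multf) (auto intro!: finprod_closed)
  also have "\<dots> = (\<Otimes>j\<in>B. \<Otimes>i\<in>insert x F. f i j)"
    using insert by (intro finprod_cong') (auto intro!: finprod_closed)
  finally show ?case .
qed

lemma (in comm_monoid) finprod_bij:
  assumes "bij_betw h A B" "\<And>b. b \<in> B \<Longrightarrow> f b \<in> carrier G"
  shows "(\<Otimes>a\<in>A. f (h a)) = (\<Otimes>b\<in>B. f b)"
  using finprod_reindex[of f h A] assms by (auto simp: bij_betw_def)

lemma (in comm_monoid) finprod_hom:
  assumes "comm_monoid M" "\<And>x y. x \<in> carrier G \<Longrightarrow> y \<in> carrier G \<Longrightarrow> h (x \<otimes> y) = h x \<otimes>\<^sub>M h y"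
    "h \<one> = \<one>\<^sub>M" "\<And>x. x \<in> carrier G \<Longrightarrow> h x \<in> carrier M" "\<And>i. i \<in> A \<Longrightarrow> f i \<in> carrier G"
  shows "h (\<Otimes>i\<in>A. f i) = (\<Otimes>\<^sub>M i\<in>A. h (f i))"
proof -
  interpret M: comm_monoid M by fact
  show ?thesis
    using assms(5)
  proof (induction A rule: infinite_finite_induct)
    case (insert x F)
    have "h (\<Otimes>i\<in>insert x F. f i) = h (f x \<otimes> (\<Otimes>i\<in>F. f i))"
      using insert by (subst finprod_insert) auto
    also have "\<dots> = h (f x) \<otimes>\<^sub>M h (\<Otimes>i\<in>F. f i)"
      using insert by (intro assms(2)) (auto intro!: finprod_closed)
    also have "\<dots> = (\<Otimes>\<^sub>M i\<in>insert x F. h (f i))"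
      using insert by (subst M.finprod_insert) (auto intro!: assms(4))
    finally show ?case .
  qed (auto simp: assms(3))
qed

context abelian_monoid
begin

lemmas finsum_swap = add.finprod_swap
lemmas finsum_bij = add.finprod_bij

lemma finsum_hom:
  assumes "abelian_monoid M" "\<And>x y. x \<in> carrier G \<Longrightarrow> y \<in> carrier G \<Longrightarrow> h (x \<oplus> y) = h x \<oplus>\<^sub>M h y"
    "h \<zero> = \<zero>\<^sub>M" "\<And>x. x \<in> carrier G \<Longrightarrow> h x \<in> carrier M" "\<And>i. i \<in> A \<Longrightarrow> f i \<in> carrier G"
  shows "h (\<Oplus>i\<in>A. f i) = (\<Oplus>\<^sub>M i\<in>A. h (f i))"
  using add.finprod_hom[of "add_monoid M" h A f] assms abelian_monoid.a_comm_monoid[OF assms(1)]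
  by (simp add: finsum_def)

lemma finsum_single:
  assumes "finite A" "i \<in> A" "f i \<in> carrier G" "\<And>j. j \<in> A \<Longrightarrow> j \<noteq> i \<Longrightarrow> f j = \<zero>"
  shows "(\<Oplus>j\<in>A. f j) = f i"
proof -
  have "(\<Oplus>j\<in>A. f j) = (\<Oplus>j\<in>A. if j = i then f i else \<zero>)"
    using assms by (intro finsum_cong') auto
  also have "\<dots> = f i"
    using add.finprod_singleton_swap[of i A "\<lambda>_. f i"] assms by auto
  finally show ?thesis .
qed

end

lemma (in group)
  assumes "a \<in> carrier G"
  shows bij_mult_left: "bij_betw (\<lambda>g. a \<otimes> g) (carrier G) (carrier G)"
    and bij_mult_right: "bij_betw (\<lambda>g. g \<otimes> a) (carrier G) (carrier G)"
    and bij_inv: "bij_betw (\<lambda>g. inv g) (carrier G) (carrier G)"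
proof -
  show "bij_betw (\<lambda>g. a \<otimes> g) (carrier G) (carrier G)"
    by (rule bij_betwI[where g = "\<lambda>g. inv a \<otimes> g"]) (use assms in \<open>auto simp: m_assoc[symmetric]\<close>)
  show "bij_betw (\<lambda>g. g \<otimes> a) (carrier G) (carrier G)"
    by (rule bij_betwI[where g = "\<lambda>g. g \<otimes> inv a"]) (use assms in \<open>auto simp: m_assoc\<close>)
  show "bij_betw (\<lambda>g. inv g) (carrier G) (carrier G)"
    by (rule bij_betwI[where g = "\<lambda>g. inv g"]) auto
qed

section \<open>The tensor product\<close>

locale two_modules = A: module R A + C: module R C
  for R :: "('r, 'q) ring_scheme" and A :: "('r, 'a, 'm) module_scheme" and C :: "('r, 'c, 'n) module_scheme"
begin

abbreviation F where "F \<equiv> free_Abelian_group (carrier A \<times> carrier C)"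
abbreviation N where "N \<equiv> tensor_null R A C"
abbreviation T where "T \<equiv> tensor_group R A C"
abbreviation tn (infix \<open>\<Otimes>\<close> 75) where "a \<Otimes> c \<equiv> tens R A C a c"

sublocale F: comm_group F by (rule abelian_free_Abelian_group)

lemma rels_subset: "tensor_rels R A C \<subseteq> carrier F"
proof -
  have "f - g \<in> carrier F" if "f \<in> carrier F" "g \<in> carrier F" for f g :: "'a \<times> 'c \<Rightarrow>\<^sub>0 int"
    using that keys_diff[of f g] by auto
  moreover have "frag_of (a, c) \<in> carrier F" if "a \<in> carrier A" "c \<in> carrier C" for a c
    using that by simp
  ultimately show ?thesis
    unfolding tensor_rels_def by (auto simp del: carrier_free_Abelian_group_iff)
qed

lemma null_subgroup: "subgroup N F"
  unfolding tensor_null_def by (rule F.generate_is_subgroup[OF rels_subset])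

sublocale T: comm_group T
  unfolding tensor_group_def by (rule F.abelian_FactGroup[OF null_subgroup])

sublocale N: normal N F
  by (rule F.normal_iff_subgroup[THEN iffD2]) (rule null_subgroup)

lemma coset_hom: "(\<lambda>f. N #>\<^sub>F f) \<in> hom F T"
  unfolding tensor_group_def by (rule N.r_coset_hom_Mod)

lemma T_carrier: "carrier T = (\<lambda>f. N #>\<^sub>F f) ` carrier F"
  by (auto simp: tensor_group_def FactGroup_def RCOSETS_def)

lemma coset_null: "f \<in> N \<Longrightarrow> N #>\<^sub>F f = \<one>\<^sub>T"
  using F.coset_join2[OF subgroup.mem_carrier[OF null_subgroup] null_subgroup, of f]
  by (auto simp: tensor_group_def FactGroup_def)

lemma coset_add: "f \<in> carrier F \<Longrightarrow> g \<in> carrier F \<Longrightarrow> N #>\<^sub>F (f + g) = (N #>\<^sub>F f) \<otimes>\<^sub>T (N #>\<^sub>F g)"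
  using hom_mult[OF coset_hom, of f g] by simp

lemma coset_diff_eq:
  assumes "f \<in> carrier F" "g \<in> carrier F" "f - g \<in> N"
  shows "N #>\<^sub>F f = N #>\<^sub>F g"
  using coset_add[of "f - g" g] coset_null[OF assms(3)] assms keys_diff[of f g] T_carrier
    subgroup.mem_carrier[OF null_subgroup assms(3)]
  by auto

lemma tens_closed [simp, intro]: "a \<in> carrier A \<Longrightarrow> c \<in> carrier C \<Longrightarrow> a \<Otimes> c \<in> carrier T"
  by (auto simp: tens_def T_carrier)

lemma rel_in_null: "x \<in> tensor_rels R A C \<Longrightarrow> x \<in> N"
  unfolding tensor_null_def by (rule generate.incl)

lemma tens_add_left:
  assumes "a \<in> carrier A" "a' \<in> carrier A" "c \<in> carrier C"
  shows "(a \<oplus>\<^sub>A a') \<Otimes> c = (a \<Otimes> c) \<otimes>\<^sub>T (a' \<Otimes> c)"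
proof -
  have "frag_of (a \<oplus>\<^sub>A a', c) - (frag_of (a, c) + frag_of (a', c)) \<in> N"
    by (rule rel_in_null) (use assms in \<open>auto simp: tensor_rels_def algebra_simps\<close>)
  then show ?thesis
    unfolding tens_def using assms
    by (subst coset_add[symmetric], simp, simp, intro coset_diff_eq) (auto dest: subsetD[OF keys_add])
qed

lemma tens_add_right:
  assumes "a \<in> carrier A" "c \<in> carrier C" "c' \<in> carrier C"
  shows "a \<Otimes> (c \<oplus>\<^sub>C c') = (a \<Otimes> c) \<otimes>\<^sub>T (a \<Otimes> c')"
proof -
  have "frag_of (a, c \<oplus>\<^sub>C c') - (frag_of (a, c) + frag_of (a, c')) \<in> N"
    by (rule rel_in_null) (use assms in \<open>auto simp: tensor_rels_def algebra_simps\<close>)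
  then show ?thesis
    unfolding tens_def using assms
    by (subst coset_add[symmetric], simp, simp, intro coset_diff_eq) (auto dest: subsetD[OF keys_add])
qed

lemma tens_smult:
  assumes "r \<in> carrier R" "a \<in> carrier A" "c \<in> carrier C"
  shows "(r \<odot>\<^sub>A a) \<Otimes> c = a \<Otimes> (r \<odot>\<^sub>C c)"
proof -
  have "frag_of (r \<odot>\<^sub>A a, c) - frag_of (a, r \<odot>\<^sub>C c) \<in> N"
    by (rule rel_in_null) (use assms in \<open>auto simp: tensor_rels_def\<close>)
  then show ?thesis
    unfolding tens_def using assms by (intro coset_diff_eq) auto
qed

lemma tens_zero_left [simp]: "c \<in> carrier C \<Longrightarrow> \<zero>\<^sub>A \<Otimes> c = \<one>\<^sub>T"
  using tens_add_left[of "\<zero>\<^sub>A" "\<zero>\<^sub>A" c] by (simp add: T.l_cancel_one' T.r_cancel_one')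

lemma tens_zero_right [simp]: "a \<in> carrier A \<Longrightarrow> a \<Otimes> \<zero>\<^sub>C = \<one>\<^sub>T"
  using tens_add_right[of a "\<zero>\<^sub>C" "\<zero>\<^sub>C"] by (simp add: T.l_cancel_one' T.r_cancel_one')

lemma tens_inv: "a \<in> carrier A \<Longrightarrow> c \<in> carrier C \<Longrightarrow> inv\<^bsub>T\<^esub> (a \<Otimes> c) = (\<ominus>\<^sub>A a) \<Otimes> c"
  using tens_add_left[of "\<ominus>\<^sub>A a" a c] by (intro T.inv_equality) (auto simp: A.M.l_neg)

text \<open>
  Negatives need no case of their own: the inverse of a pure tensor \<open>a \<otimes> c\<close> is \<open>(- a) \<otimes> c\<close>.
\<close>

lemma tensor_induct [consumes 1, case_names tens mult]:
  assumes "t \<in> carrier T"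
    and t: "\<And>a c. a \<in> carrier A \<Longrightarrow> c \<in> carrier C \<Longrightarrow> P (a \<Otimes> c)"
    and m: "\<And>t u. t \<in> carrier T \<Longrightarrow> u \<in> carrier T \<Longrightarrow> P t \<Longrightarrow> P u \<Longrightarrow> P (t \<otimes>\<^sub>T u)"
  shows "P t"
proof -
  obtain f where f: "f \<in> carrier F" "t = N #>\<^sub>F f"
    using assms(1) T_carrier by auto
  have k: "Poly_Mapping.keys f \<subseteq> carrier A \<times> carrier C" using f by simp
  have "P (N #>\<^sub>F f) \<and> P (inv\<^bsub>T\<^esub> (N #>\<^sub>F f))"
    using k
  proof (induction f rule: free_Abelian_group_induct[consumes 1])
    case 1
    have "N #>\<^sub>F 0 = \<one>\<^sub>T" using coset_null[of 0] subgroup.one_closed[OF null_subgroup] by simp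
    moreover have "P \<one>\<^sub>T" using t[of "\<zero>\<^sub>A" "\<zero>\<^sub>C"] by simp
    ultimately show ?case by simp
  next
    case (2 x y)
    have xy: "x \<in> carrier F" "y \<in> carrier F" "- y \<in> carrier F" using 2 by auto
    have cT: "N #>\<^sub>F x \<in> carrier T" "N #>\<^sub>F y \<in> carrier T" using xy T_carrier by auto
    have iy: "N #>\<^sub>F (-y) = inv\<^bsub>T\<^esub> (N #>\<^sub>F y)"
      using group_hom.hom_inv[of F T "\<lambda>f. N #>\<^sub>F f" y] coset_hom xy
      by (auto simp: group_hom_def group_hom_axioms_def simp del: inv_free_Abelian_group)
        (use xy(2) in \<open>auto\<close>)
    have "N #>\<^sub>F (x - y) = (N #>\<^sub>F x) \<otimes>\<^sub>T inv\<^bsub>T\<^esub> (N #>\<^sub>F y)"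
      using coset_add[OF xy(1,3)] iy by simp
    then show ?case using 2 cT m by (auto simp: T.inv_mult)
  next
    case (3 a)
    then show ?case using t tens_inv by (auto simp: tens_def[symmetric])
  qed
  then show ?thesis using f by blast
qed

definition balanced where
  "balanced P \<Phi> \<longleftrightarrow> (\<forall>a\<in>carrier A. \<forall>c\<in>carrier C. \<Phi> a c \<in> carrier P) \<and>
    (\<forall>a\<in>carrier A. \<forall>a'\<in>carrier A. \<forall>c\<in>carrier C. \<Phi> (a \<oplus>\<^sub>A a') c = \<Phi> a c \<otimes>\<^sub>P \<Phi> a' c) \<and>
    (\<forall>a\<in>carrier A. \<forall>c\<in>carrier C. \<forall>c'\<in>carrier C. \<Phi> a (c \<oplus>\<^sub>C c') = \<Phi> a c \<otimes>\<^sub>P \<Phi> a c') \<and>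
    (\<forall>r\<in>carrier R. \<forall>a\<in>carrier A. \<forall>c\<in>carrier C. \<Phi> (r \<odot>\<^sub>A a) c = \<Phi> a (r \<odot>\<^sub>C c))"

text \<open>
  The map that a balanced function induces on the free abelian group kills the bilinearity relations.
  So it is constant on cosets, and \<open>tensor_lift\<close>, defined by the image of a coset, takes that value.
\<close>

lemma
  assumes "comm_group P" and bal: "balanced P \<Phi>"
  shows lift_hom: "tensor_lift P \<Phi> \<in> hom T P"
    and lift_tens: "a \<in> carrier A \<Longrightarrow> c \<in> carrier C \<Longrightarrow> tensor_lift P \<Phi> (a \<Otimes> c) = \<Phi> a c"
proof -
  interpret P: comm_group P by fact
  let ?S = "carrier A \<times> carrier C"
  define \<Psi> where "\<Psi> f = finprod P (\<lambda>(a, c). \<Phi> a c [^]\<^sub>P Poly_Mapping.lookup f (a, c)) (Poly_Mapping.keys f)"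
    for f :: "'a \<times> 'c \<Rightarrow>\<^sub>0 int"
  have cl: "\<Phi> a c \<in> carrier P" if "a \<in> carrier A" "c \<in> carrier C" for a c
    using bal that by (auto simp: balanced_def)
  have sup: "\<Psi> f = finprod P (\<lambda>(a, c). \<Phi> a c [^]\<^sub>P Poly_Mapping.lookup f (a, c)) Z"
    if "finite Z" "Poly_Mapping.keys f \<subseteq> Z" "Z \<subseteq> ?S" for f Z
    unfolding \<Psi>_def using that
    by (intro P.finprod_mono_neutral_cong_left) (auto intro!: cl P.int_pow_closed simp: in_keys_iff subset_iff)
  have hom: "\<Psi> \<in> hom F P"
  proof (rule homI)
    fix f assume "f \<in> carrier F" then show "\<Psi> f \<in> carrier P"
      unfolding \<Psi>_def by (intro P.finprod_closed) (auto intro!: cl P.int_pow_closed)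
  next
    fix f g assume fg: "f \<in> carrier F" "g \<in> carrier F"
    let ?Z = "Poly_Mapping.keys f \<union> Poly_Mapping.keys g"
    have Z: "finite ?Z" "?Z \<subseteq> ?S" "Poly_Mapping.keys (f + g) \<subseteq> ?Z" using fg keys_add[of f g] by auto
    have "\<Psi> (f + g) = finprod P (\<lambda>(a, c). \<Phi> a c [^]\<^sub>P Poly_Mapping.lookup (f + g) (a, c)) ?Z"
      using Z by (intro sup) auto
    also have "\<dots> = finprod P (\<lambda>x. (case x of (a, c) \<Rightarrow> \<Phi> a c [^]\<^sub>P Poly_Mapping.lookup f (a, c))
                      \<otimes>\<^sub>P (case x of (a, c) \<Rightarrow> \<Phi> a c [^]\<^sub>P Poly_Mapping.lookup g (a, c))) ?Z"
    proof (intro P.finprod_cong')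
      fix x assume "x \<in> ?Z"
      then obtain a c where "x = (a, c)" "a \<in> carrier A" "c \<in> carrier C" using Z(2) by auto
      then show "(case x of (a, c) \<Rightarrow> \<Phi> a c [^]\<^sub>P Poly_Mapping.lookup (f + g) (a, c)) =
          (case x of (a, c) \<Rightarrow> \<Phi> a c [^]\<^sub>P Poly_Mapping.lookup f (a, c))
          \<otimes>\<^sub>P (case x of (a, c) \<Rightarrow> \<Phi> a c [^]\<^sub>P Poly_Mapping.lookup g (a, c))"
        using P.int_pow_mult[OF cl] by (simp add: lookup_add)
    qed (use Z(2) in \<open>auto intro!: cl P.m_closed P.int_pow_closed\<close>)
    also have "\<dots> = finprod P (\<lambda>(a, c). \<Phi> a c [^]\<^sub>P Poly_Mapping.lookup f (a, c)) ?Z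
        \<otimes>\<^sub>P finprod P (\<lambda>(a, c). \<Phi> a c [^]\<^sub>P Poly_Mapping.lookup g (a, c)) ?Z"
      using Z(1,2) by (subst P.finprod_multf) (auto intro!: cl P.int_pow_closed)
    also have "\<dots> = \<Psi> f \<otimes>\<^sub>P \<Psi> g"
      using Z(1,2) sup[of ?Z f] sup[of ?Z g] by simp
    finally show "\<Psi> (f \<otimes>\<^sub>F g) = \<Psi> f \<otimes>\<^sub>P \<Psi> g" by simp
  qed
  interpret \<Psi>: group_hom F P \<Psi>
    using hom by unfold_locales
  have frag: "\<Psi> (frag_of (a, c)) = \<Phi> a c" if "a \<in> carrier A" "c \<in> carrier C" for a c
    using cl[OF that] by (simp add: \<Psi>_def)
  have diff: "\<Psi> (f - g) = \<Psi> f \<otimes>\<^sub>P inv\<^bsub>P\<^esub> \<Psi> g" if "f \<in> carrier F" "g \<in> carrier F" for f g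
  proof -
    have "\<Psi> (f \<otimes>\<^sub>F inv\<^bsub>F\<^esub> g) = \<Psi> f \<otimes>\<^sub>P inv\<^bsub>P\<^esub> \<Psi> g"
      using that by (simp only: \<Psi>.hom_mult \<Psi>.hom_inv F.inv_closed)
    then show ?thesis using that by simp
  qed
  have rels: "\<Psi> x = \<one>\<^sub>P" if "x \<in> tensor_rels R A C" for x
  proof -
    have B: "\<And>a a' c. a \<in> carrier A \<Longrightarrow> a' \<in> carrier A \<Longrightarrow> c \<in> carrier C \<Longrightarrow> \<Phi> (a \<oplus>\<^sub>A a') c = \<Phi> a c \<otimes>\<^sub>P \<Phi> a' c"
      "\<And>a c c'. a \<in> carrier A \<Longrightarrow> c \<in> carrier C \<Longrightarrow> c' \<in> carrier C \<Longrightarrow> \<Phi> a (c \<oplus>\<^sub>C c') = \<Phi> a c \<otimes>\<^sub>P \<Phi> a c'"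
      "\<And>r a c. r \<in> carrier R \<Longrightarrow> a \<in> carrier A \<Longrightarrow> c \<in> carrier C \<Longrightarrow> \<Phi> (r \<odot>\<^sub>A a) c = \<Phi> a (r \<odot>\<^sub>C c)"
      using bal by (auto simp: balanced_def)
    have E: "x \<otimes>\<^sub>P y \<otimes>\<^sub>P inv\<^bsub>P\<^esub> x \<otimes>\<^sub>P inv\<^bsub>P\<^esub> y = \<one>\<^sub>P" if "x \<in> carrier P" "y \<in> carrier P" for x y
      using that by (metis P.inv_closed P.m_assoc P.m_closed P.m_comm P.r_inv P.inv_mult)
    have D: "f - g \<in> carrier F" if "f \<in> carrier F" "g \<in> carrier F" for f g
      using that keys_diff[of f g] by auto
    have fr: "frag_of (a, c) \<in> carrier F" if "a \<in> carrier A" "c \<in> carrier C" for a c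
      using that by simp
    from that show ?thesis
      unfolding tensor_rels_def
      by (auto simp: diff frag B cl E D fr simp del: carrier_free_Abelian_group_iff)
  qed
  have null: "\<Psi> x = \<one>\<^sub>P" if "x \<in> N" for x
    using that unfolding tensor_null_def
  proof (induction rule: generate.induct)
    case one then show ?case using \<Psi>.hom_one by simp
  next
    case (incl h) then show ?case by (rule rels)
  next
    case (inv h) then show ?case using rels[of h] rels_subset \<Psi>.hom_inv[of h] by auto
  next
    case (eng h1 h2)
    have "h1 \<in> carrier F" "h2 \<in> carrier F"
      using eng(1,2) F.generate_in_carrier[OF rels_subset] by auto
    then show ?case using eng by (simp only: \<Psi>.hom_mult) simp
  qed
  have lift: "tensor_lift P \<Phi> (N #>\<^sub>F f) = \<Psi> f" if f: "f \<in> carrier F" for f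
  proof -
    have "\<Psi> ` (N #>\<^sub>F f) = {\<Psi> f}"
    proof -
      have "\<Psi> (n \<otimes>\<^sub>F f) = \<Psi> f" if "n \<in> N" for n
        using that f null[OF that] subgroup.mem_carrier[OF null_subgroup that] by (simp only: \<Psi>.hom_mult) (simp del: carrier_free_Abelian_group_iff)
      moreover have "\<exists>n. n \<in> N" using subgroup.one_closed[OF null_subgroup] by blast
      ultimately show ?thesis by (auto simp: r_coset_def image_iff)
    qed
    then show ?thesis unfolding tensor_lift_def \<Psi>_def[symmetric] by simp
  qed
  show "tensor_lift P \<Phi> \<in> hom T P"
  proof (rule homI)
    fix x assume "x \<in> carrier T" then show "tensor_lift P \<Phi> x \<in> carrier P"
      using lift \<Psi>.hom_closed by (auto simp: T_carrier simp del: carrier_free_Abelian_group_iff)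
  next
    fix x y assume "x \<in> carrier T" "y \<in> carrier T"
    then obtain f g where fg: "f \<in> carrier F" "g \<in> carrier F" "x = N #>\<^sub>F f" "y = N #>\<^sub>F g"
      by (auto simp: T_carrier)
    have "x \<otimes>\<^sub>T y = N #>\<^sub>F (f \<otimes>\<^sub>F g)" using fg coset_add by simp
    then show "tensor_lift P \<Phi> (x \<otimes>\<^sub>T y) = tensor_lift P \<Phi> x \<otimes>\<^sub>P tensor_lift P \<Phi> y"
      using fg lift \<Psi>.hom_mult F.m_closed by (simp del: carrier_free_Abelian_group_iff mult_free_Abelian_group)
  qed
  show "tensor_lift P \<Phi> (a \<Otimes> c) = \<Phi> a c" if "a \<in> carrier A" "c \<in> carrier C"
    unfolding tens_def using that by (subst lift) (auto simp: frag)
qed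

end

section \<open>Algebras with a group action and their base change\<close>

locale galg =
  fixes R :: "('r, 'q) ring_scheme" and G :: "('g, 'm) monoid_scheme" (structure) and A :: "('r, 'a, 'g) galg"
  assumes galg: "G_algebra R G A"
begin

sublocale G: group G using galg by (simp add: G_algebra_def)
sublocale A: ring A using galg by (simp add: G_algebra_def)
sublocale M: module R A using galg by (simp add: G_algebra_def)

lemma smult_mult_left: "r \<in> carrier R \<Longrightarrow> a \<in> carrier A \<Longrightarrow> b \<in> carrier A \<Longrightarrow>
    (r \<odot>\<^sub>A a) \<otimes>\<^sub>A b = r \<odot>\<^sub>A (a \<otimes>\<^sub>A b)"
  and smult_mult_right: "r \<in> carrier R \<Longrightarrow> a \<in> carrier A \<Longrightarrow> b \<in> carrier A \<Longrightarrow>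
    a \<otimes>\<^sub>A (r \<odot>\<^sub>A b) = r \<odot>\<^sub>A (a \<otimes>\<^sub>A b)"
  and act_smult: "r \<in> carrier R \<Longrightarrow> a \<in> carrier A \<Longrightarrow> g \<in> carrier G \<Longrightarrow>
    gact A (r \<odot>\<^sub>A a) g = r \<odot>\<^sub>A gact A a g"
  and act_hom: "g \<in> carrier G \<Longrightarrow> (\<lambda>a. gact A a g) \<in> ring_hom A A"
  and act_id [simp]: "a \<in> carrier A \<Longrightarrow> gact A a \<one> = a"
  and act_act: "a \<in> carrier A \<Longrightarrow> g \<in> carrier G \<Longrightarrow> h \<in> carrier G \<Longrightarrow>
    gact A (gact A a g) h = gact A a (g \<otimes> h)"
  using galg by (auto simp: G_algebra_def)

lemma act_closed [simp, intro]: "a \<in> carrier A \<Longrightarrow> g \<in> carrier G \<Longrightarrow> gact A a g \<in> carrier A"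
  and act_add: "a \<in> carrier A \<Longrightarrow> b \<in> carrier A \<Longrightarrow> g \<in> carrier G \<Longrightarrow>
    gact A (a \<oplus>\<^sub>A b) g = gact A a g \<oplus>\<^sub>A gact A b g"
  and act_mult: "a \<in> carrier A \<Longrightarrow> b \<in> carrier A \<Longrightarrow> g \<in> carrier G \<Longrightarrow>
    gact A (a \<otimes>\<^sub>A b) g = gact A a g \<otimes>\<^sub>A gact A b g"
  and act_one [simp]: "g \<in> carrier G \<Longrightarrow> gact A \<one>\<^sub>A g = \<one>\<^sub>A"
  using act_hom[of g] by (auto simp: ring_hom_def)

lemma act_zero [simp]: "g \<in> carrier G \<Longrightarrow> gact A \<zero>\<^sub>A g = \<zero>\<^sub>A"
  using act_add[of "\<zero>\<^sub>A" "\<zero>\<^sub>A" g] by (simp add: A.add.l_cancel_one' A.add.r_cancel_one')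

lemma act_finsum:
  "g \<in> carrier G \<Longrightarrow> (\<And>i. i \<in> I \<Longrightarrow> f i \<in> carrier A) \<Longrightarrow>
    gact A (\<Oplus>\<^sub>A i\<in>I. f i) g = (\<Oplus>\<^sub>A i\<in>I. gact A (f i) g)"
  by (rule A.finsum_hom) (auto simp: act_add A.abelian_monoid_axioms)

lemma smult_finsum:
  "r \<in> carrier R \<Longrightarrow> (\<And>i. i \<in> I \<Longrightarrow> f i \<in> carrier A) \<Longrightarrow>
    r \<odot>\<^sub>A (\<Oplus>\<^sub>A i\<in>I. f i) = (\<Oplus>\<^sub>A i\<in>I. r \<odot>\<^sub>A f i)"
  by (rule A.finsum_hom) (auto simp: M.smult_r_distr A.abelian_monoid_axioms)

lemma finsum_smult:
  "a \<in> carrier A \<Longrightarrow> (\<And>i. i \<in> I \<Longrightarrow> f i \<in> carrier R) \<Longrightarrow>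
    (\<Oplus>\<^sub>R i\<in>I. f i) \<odot>\<^sub>A a = (\<Oplus>\<^sub>A i\<in>I. f i \<odot>\<^sub>A a)"
  by (rule M.R.finsum_hom[where h = "\<lambda>r. r \<odot>\<^sub>A a"])
    (auto simp: M.smult_l_distr A.abelian_monoid_axioms)

lemma finsum_mult:
  "a \<in> carrier A \<Longrightarrow> (\<And>i. i \<in> I \<Longrightarrow> f i \<in> carrier A) \<Longrightarrow>
    (\<Oplus>\<^sub>A i\<in>I. f i) \<otimes>\<^sub>A a = (\<Oplus>\<^sub>A i\<in>I. f i \<otimes>\<^sub>A a)"
  by (rule A.finsum_hom[where h = "\<lambda>r. r \<otimes>\<^sub>A a"]) (auto simp: A.l_distr A.abelian_monoid_axioms)

lemma mult_finsum:
  "a \<in> carrier A \<Longrightarrow> (\<And>i. i \<in> I \<Longrightarrow> f i \<in> carrier A) \<Longrightarrow>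
    a \<otimes>\<^sub>A (\<Oplus>\<^sub>A i\<in>I. f i) = (\<Oplus>\<^sub>A i\<in>I. a \<otimes>\<^sub>A f i)"
  by (rule A.finsum_hom[where h = "\<lambda>r. a \<otimes>\<^sub>A r"]) (auto simp: A.r_distr A.abelian_monoid_axioms)

end

lemma galgI:
  assumes "group G" "cring R" "ring A"
    and "\<And>r a. r \<in> carrier R \<Longrightarrow> a \<in> carrier A \<Longrightarrow> r \<odot>\<^sub>A a \<in> carrier A"
    and "\<And>r r' a. r \<in> carrier R \<Longrightarrow> r' \<in> carrier R \<Longrightarrow> a \<in> carrier A \<Longrightarrow>
      (r \<oplus>\<^sub>R r') \<odot>\<^sub>A a = r \<odot>\<^sub>A a \<oplus>\<^sub>A r' \<odot>\<^sub>A a"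
    and "\<And>r a b. r \<in> carrier R \<Longrightarrow> a \<in> carrier A \<Longrightarrow> b \<in> carrier A \<Longrightarrow>
      r \<odot>\<^sub>A (a \<oplus>\<^sub>A b) = r \<odot>\<^sub>A a \<oplus>\<^sub>A r \<odot>\<^sub>A b"
    and "\<And>r r' a. r \<in> carrier R \<Longrightarrow> r' \<in> carrier R \<Longrightarrow> a \<in> carrier A \<Longrightarrow>
      (r \<otimes>\<^sub>R r') \<odot>\<^sub>A a = r \<odot>\<^sub>A (r' \<odot>\<^sub>A a)"
    and "\<And>a. a \<in> carrier A \<Longrightarrow> \<one>\<^sub>R \<odot>\<^sub>A a = a"
    and "\<And>r a b. r \<in> carrier R \<Longrightarrow> a \<in> carrier A \<Longrightarrow> b \<in> carrier A \<Longrightarrow>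
      (r \<odot>\<^sub>A a) \<otimes>\<^sub>A b = r \<odot>\<^sub>A (a \<otimes>\<^sub>A b)"
    and "\<And>r a b. r \<in> carrier R \<Longrightarrow> a \<in> carrier A \<Longrightarrow> b \<in> carrier A \<Longrightarrow>
      a \<otimes>\<^sub>A (r \<odot>\<^sub>A b) = r \<odot>\<^sub>A (a \<otimes>\<^sub>A b)"
    and "\<And>g a. g \<in> carrier G \<Longrightarrow> a \<in> carrier A \<Longrightarrow> gact A a g \<in> carrier A"
    and "\<And>g a b. g \<in> carrier G \<Longrightarrow> a \<in> carrier A \<Longrightarrow> b \<in> carrier A \<Longrightarrow>
      gact A (a \<oplus>\<^sub>A b) g = gact A a g \<oplus>\<^sub>A gact A b g"
    and "\<And>g a b. g \<in> carrier G \<Longrightarrow> a \<in> carrier A \<Longrightarrow> b \<in> carrier A \<Longrightarrow>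
      gact A (a \<otimes>\<^sub>A b) g = gact A a g \<otimes>\<^sub>A gact A b g"
    and "\<And>g. g \<in> carrier G \<Longrightarrow> gact A \<one>\<^sub>A g = \<one>\<^sub>A"
    and "\<And>r g a. r \<in> carrier R \<Longrightarrow> g \<in> carrier G \<Longrightarrow> a \<in> carrier A \<Longrightarrow>
      gact A (r \<odot>\<^sub>A a) g = r \<odot>\<^sub>A gact A a g"
    and "\<And>a. a \<in> carrier A \<Longrightarrow> gact A a \<one>\<^sub>G = a"
    and "\<And>g h a. g \<in> carrier G \<Longrightarrow> h \<in> carrier G \<Longrightarrow> a \<in> carrier A \<Longrightarrow>
      gact A a (g \<otimes>\<^sub>G h) = gact A (gact A a g) h"
  shows "galg R G A"
proof -
  have "module R A"
    by (rule moduleI) (use assms ring.is_abelian_group[OF assms(3)] in auto)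
  then show ?thesis
    unfolding galg_def G_algebra_def using assms by (auto intro!: ring_hom_memI)
qed

text \<open>
  Semilinearity covers the inclusion of \<open>A\<close> into \<open>A \<otimes> S\<close>, and maps from \<open>A\<close> to functions with values in an extension field.
\<close>

definition galg_semihom ::
    "('r, 'q) ring_scheme \<Rightarrow> ('r \<Rightarrow> 's) \<Rightarrow> ('g, 'm) monoid_scheme \<Rightarrow> ('r, 'a, 'g) galg \<Rightarrow>
     ('s, 'd, 'g) galg \<Rightarrow> ('a \<Rightarrow> 'd) \<Rightarrow> bool"
  where "galg_semihom R \<phi> G A D f \<longleftrightarrow> f \<in> ring_hom A D \<and>
    (\<forall>r\<in>carrier R. \<forall>a\<in>carrier A. f (r \<odot>\<^sub>A a) = \<phi> r \<odot>\<^sub>D f a) \<and>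
    (\<forall>g\<in>carrier G. \<forall>a\<in>carrier A. f (gact A a g) = gact D (f a) g)"

lemma galg_isomorphic_iff_semihom:
  "galg_isomorphic R G A C \<longleftrightarrow>
    (\<exists>h. galg_semihom R (\<lambda>r. r) G A C h \<and> bij_betw h (carrier A) (carrier C))"
  by (auto simp: galg_isomorphic_def galg_semihom_def ring_iso_def)

locale base_ext = galg R G A + S: cring S
  for R :: "('r, 'q) ring_scheme" and G :: "('g, 'm) monoid_scheme" and A :: "('r, 'a, 'g) galg"
    and S :: "('s, 'p) ring_scheme" +
  fixes \<phi> :: "'r \<Rightarrow> 's"
  assumes \<phi>: "\<phi> \<in> ring_hom R S"
begin

lemma phi_simps [simp]:
  "r \<in> carrier R \<Longrightarrow> \<phi> r \<in> carrier S"
  "r \<in> carrier R \<Longrightarrow> r' \<in> carrier R \<Longrightarrow> \<phi> (r \<oplus>\<^sub>R r') = \<phi> r \<oplus>\<^sub>S \<phi> r'"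
  "r \<in> carrier R \<Longrightarrow> r' \<in> carrier R \<Longrightarrow> \<phi> (r \<otimes>\<^sub>R r') = \<phi> r \<otimes>\<^sub>S \<phi> r'"
  "\<phi> \<one>\<^sub>R = \<one>\<^sub>S"
  using \<phi> by (auto simp: ring_hom_def)

lemma via_simps [simp]:
  "carrier (algebra_via \<phi> S) = carrier S" "\<zero>\<^bsub>algebra_via \<phi> S\<^esub> = \<zero>\<^sub>S"
  "x \<oplus>\<^bsub>algebra_via \<phi> S\<^esub> y = x \<oplus>\<^sub>S y" "r \<odot>\<^bsub>algebra_via \<phi> S\<^esub> x = \<phi> r \<otimes>\<^sub>S x"
  by (auto simp: algebra_via_def)

lemma via_module: "module R (algebra_via \<phi> S)"
proof (rule moduleI)
  show "abelian_group (algebra_via \<phi> S)"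
    by (rule abelian_groupI) (auto simp: S.a_ac intro!: bexI[where x = "\<ominus>\<^sub>S _"] S.l_neg)
qed (auto simp: M.R.cring_axioms S.l_distr S.r_distr S.m_assoc)

sublocale TP: two_modules R A "algebra_via \<phi> S"
  by (simp add: two_modules_def M.module_axioms via_module)

abbreviation E where "E \<equiv> base_change R \<phi> S A"
abbreviation TT where "TT \<equiv> tensor_group R A (algebra_via \<phi> S)"
abbreviation pure (infix \<open>\<boxtimes>\<close> 75) where "a \<boxtimes> x \<equiv> tens R A (algebra_via \<phi> S) a x"

lemma E_carrier: "carrier E = carrier TT" and E_zero: "\<zero>\<^sub>E = \<one>\<^sub>TT"
  and E_add: "t \<oplus>\<^sub>E u = t \<otimes>\<^sub>TT u" and E_one: "\<one>\<^sub>E = \<one>\<^sub>A \<boxtimes> \<one>\<^sub>S"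
  by (auto simp: base_change_def Let_def)

lemma E_abelian: "abelian_group E"
proof (rule abelian_groupI)
  fix x assume "x \<in> carrier E"
  then show "\<exists>y\<in>carrier E. y \<oplus>\<^sub>E x = \<zero>\<^sub>E"
    by (intro bexI[where x = "inv\<^bsub>TT\<^esub> x"]) (auto simp: E_carrier E_add E_zero)
qed (auto simp: E_carrier E_add E_zero TP.T.m_ac)

sublocale E: abelian_group E by (rule E_abelian)

lemma pure_closed [simp, intro]: "a \<in> carrier A \<Longrightarrow> x \<in> carrier S \<Longrightarrow> a \<boxtimes> x \<in> carrier E"
  by (simp add: E_carrier TP.tens_closed)

lemma pure_add_left: "a \<in> carrier A \<Longrightarrow> b \<in> carrier A \<Longrightarrow> x \<in> carrier S \<Longrightarrow>
    (a \<oplus>\<^sub>A b) \<boxtimes> x = a \<boxtimes> x \<oplus>\<^sub>E b \<boxtimes> x"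
  using TP.tens_add_left[of a b x] by (simp add: E_add)

lemma pure_add_right: "a \<in> carrier A \<Longrightarrow> x \<in> carrier S \<Longrightarrow> y \<in> carrier S \<Longrightarrow>
    a \<boxtimes> (x \<oplus>\<^sub>S y) = a \<boxtimes> x \<oplus>\<^sub>E a \<boxtimes> y"
  using TP.tens_add_right[of a x y] by (simp add: E_add)

lemma pure_smult: "r \<in> carrier R \<Longrightarrow> a \<in> carrier A \<Longrightarrow> x \<in> carrier S \<Longrightarrow>
    (r \<odot>\<^sub>A a) \<boxtimes> x = a \<boxtimes> (\<phi> r \<otimes>\<^sub>S x)"
  using TP.tens_smult[of r a x] by simp

lemma pure_zero_left [simp]: "x \<in> carrier S \<Longrightarrow> \<zero>\<^sub>A \<boxtimes> x = \<zero>\<^sub>E"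
  and pure_zero_right [simp]: "a \<in> carrier A \<Longrightarrow> a \<boxtimes> \<zero>\<^sub>S = \<zero>\<^sub>E"
  using TP.tens_zero_left[of x] TP.tens_zero_right[of a] by (auto simp: E_zero)

lemma E_induct [consumes 1, case_names pure add]:
  assumes "t \<in> carrier E"
    and "\<And>a x. a \<in> carrier A \<Longrightarrow> x \<in> carrier S \<Longrightarrow> P (a \<boxtimes> x)"
    and "\<And>t u. t \<in> carrier E \<Longrightarrow> u \<in> carrier E \<Longrightarrow> P t \<Longrightarrow> P u \<Longrightarrow> P (t \<oplus>\<^sub>E u)"
  shows "P t"
  using assms TP.tensor_induct[of t P] by (auto simp: E_carrier E_add)

lemma
  assumes "comm_group P"
    and c: "\<And>a x. a \<in> carrier A \<Longrightarrow> x \<in> carrier S \<Longrightarrow> \<Phi> a x \<in> carrier P"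
    and "\<And>a b x. a \<in> carrier A \<Longrightarrow> b \<in> carrier A \<Longrightarrow> x \<in> carrier S \<Longrightarrow>
      \<Phi> (a \<oplus>\<^sub>A b) x = \<Phi> a x \<otimes>\<^sub>P \<Phi> b x"
    and "\<And>a x y. a \<in> carrier A \<Longrightarrow> x \<in> carrier S \<Longrightarrow> y \<in> carrier S \<Longrightarrow>
      \<Phi> a (x \<oplus>\<^sub>S y) = \<Phi> a x \<otimes>\<^sub>P \<Phi> a y"
    and "\<And>r a x. r \<in> carrier R \<Longrightarrow> a \<in> carrier A \<Longrightarrow> x \<in> carrier S \<Longrightarrow>
      \<Phi> (r \<odot>\<^sub>A a) x = \<Phi> a (\<phi> r \<otimes>\<^sub>S x)"
  shows E_lift_pure: "a \<in> carrier A \<Longrightarrow> x \<in> carrier S \<Longrightarrow> tensor_lift P \<Phi> (a \<boxtimes> x) = \<Phi> a x"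
    and E_lift_add: "t \<in> carrier E \<Longrightarrow> u \<in> carrier E \<Longrightarrow>
      tensor_lift P \<Phi> (t \<oplus>\<^sub>E u) = tensor_lift P \<Phi> t \<otimes>\<^sub>P tensor_lift P \<Phi> u"
    and E_lift_closed: "t \<in> carrier E \<Longrightarrow> tensor_lift P \<Phi> t \<in> carrier P"
proof -
  have b: "TP.balanced P \<Phi>" using assms by (auto simp: TP.balanced_def)
  show "a \<in> carrier A \<Longrightarrow> x \<in> carrier S \<Longrightarrow> tensor_lift P \<Phi> (a \<boxtimes> x) = \<Phi> a x"
    using TP.lift_tens[OF assms(1) b] by simp
  show "t \<in> carrier E \<Longrightarrow> u \<in> carrier E \<Longrightarrow>
      tensor_lift P \<Phi> (t \<oplus>\<^sub>E u) = tensor_lift P \<Phi> t \<otimes>\<^sub>P tensor_lift P \<Phi> u"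
    "t \<in> carrier E \<Longrightarrow> tensor_lift P \<Phi> t \<in> carrier P"
    using TP.lift_hom[OF assms(1) b] by (auto simp: hom_def E_carrier E_add)
qed

lemmas E_lift_E = E_lift_pure[where P = TT, folded E_add E_carrier]
  E_lift_add[where P = TT, folded E_add E_carrier] E_lift_closed[where P = TT, folded E_add E_carrier]

lemma E_addcomm: "comm_group TT" by (rule TP.T.comm_group_axioms)

lemma
  assumes "y \<in> carrier S"
  shows E_smult_pure: "a \<in> carrier A \<Longrightarrow> x \<in> carrier S \<Longrightarrow> y \<odot>\<^sub>E (a \<boxtimes> x) = a \<boxtimes> (y \<otimes>\<^sub>S x)"
    and E_smult_add: "t \<in> carrier E \<Longrightarrow> u \<in> carrier E \<Longrightarrow> y \<odot>\<^sub>E (t \<oplus>\<^sub>E u) = y \<odot>\<^sub>E t \<oplus>\<^sub>E y \<odot>\<^sub>E u"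
    and E_smult_closed: "t \<in> carrier E \<Longrightarrow> y \<odot>\<^sub>E t \<in> carrier E"
proof -
  have d: "smult E y = tensor_lift TT (\<lambda>a x. a \<boxtimes> (y \<otimes>\<^sub>S x))"
    by (simp add: base_change_def Let_def)
  show "a \<in> carrier A \<Longrightarrow> x \<in> carrier S \<Longrightarrow> y \<odot>\<^sub>E (a \<boxtimes> x) = a \<boxtimes> (y \<otimes>\<^sub>S x)"
    unfolding d by (rule E_lift_E(1)[OF E_addcomm])
      (use assms in \<open>auto simp: pure_add_left pure_add_right pure_smult S.r_distr S.m_lcomm\<close>)
  show "t \<in> carrier E \<Longrightarrow> u \<in> carrier E \<Longrightarrow> y \<odot>\<^sub>E (t \<oplus>\<^sub>E u) = y \<odot>\<^sub>E t \<oplus>\<^sub>E y \<odot>\<^sub>E u"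
    unfolding d by (rule E_lift_E(2)[OF E_addcomm])
      (use assms in \<open>auto simp: pure_add_left pure_add_right pure_smult S.r_distr S.m_lcomm\<close>)
  show "t \<in> carrier E \<Longrightarrow> y \<odot>\<^sub>E t \<in> carrier E"
    unfolding d by (rule E_lift_E(3)[OF E_addcomm])
      (use assms in \<open>auto simp: pure_add_left pure_add_right pure_smult S.r_distr S.m_lcomm\<close>)
qed

lemma
  assumes "g \<in> carrier G"
  shows E_act_pure: "a \<in> carrier A \<Longrightarrow> x \<in> carrier S \<Longrightarrow> gact E (a \<boxtimes> x) g = gact A a g \<boxtimes> x"
    and E_act_add: "t \<in> carrier E \<Longrightarrow> u \<in> carrier E \<Longrightarrow> gact E (t \<oplus>\<^sub>E u) g = gact E t g \<oplus>\<^sub>E gact E u g"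
    and E_act_closed: "t \<in> carrier E \<Longrightarrow> gact E t g \<in> carrier E"
proof -
  have d: "gact E t g = tensor_lift TT (\<lambda>a x. gact A a g \<boxtimes> x) t" for t
    by (simp add: base_change_def Let_def)
  show "a \<in> carrier A \<Longrightarrow> x \<in> carrier S \<Longrightarrow> gact E (a \<boxtimes> x) g = gact A a g \<boxtimes> x"
    unfolding d by (rule E_lift_E(1)[OF E_addcomm])
      (use assms in \<open>auto simp: pure_add_left pure_add_right pure_smult act_add act_smult\<close>)
  show "t \<in> carrier E \<Longrightarrow> u \<in> carrier E \<Longrightarrow> gact E (t \<oplus>\<^sub>E u) g = gact E t g \<oplus>\<^sub>E gact E u g"
    unfolding d by (rule E_lift_E(2)[OF E_addcomm])
      (use assms in \<open>auto simp: pure_add_left pure_add_right pure_smult act_add act_smult\<close>)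
  show "t \<in> carrier E \<Longrightarrow> gact E t g \<in> carrier E"
    unfolding d by (rule E_lift_E(3)[OF E_addcomm])
      (use assms in \<open>auto simp: pure_add_left pure_add_right pure_smult act_add act_smult\<close>)
qed

lemma
  shows E_mult_pure: "a \<in> carrier A \<Longrightarrow> x \<in> carrier S \<Longrightarrow> b \<in> carrier A \<Longrightarrow> y \<in> carrier S \<Longrightarrow>
      (a \<boxtimes> x) \<otimes>\<^sub>E (b \<boxtimes> y) = (a \<otimes>\<^sub>A b) \<boxtimes> (x \<otimes>\<^sub>S y)"
    and E_r_distr: "t \<in> carrier E \<Longrightarrow> u \<in> carrier E \<Longrightarrow> v \<in> carrier E \<Longrightarrow>
      t \<otimes>\<^sub>E (u \<oplus>\<^sub>E v) = t \<otimes>\<^sub>E u \<oplus>\<^sub>E t \<otimes>\<^sub>E v"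
    and E_l_distr: "t \<in> carrier E \<Longrightarrow> u \<in> carrier E \<Longrightarrow> v \<in> carrier E \<Longrightarrow>
      (t \<oplus>\<^sub>E u) \<otimes>\<^sub>E v = t \<otimes>\<^sub>E v \<oplus>\<^sub>E u \<otimes>\<^sub>E v"
    and E_mult_closed: "t \<in> carrier E \<Longrightarrow> u \<in> carrier E \<Longrightarrow> t \<otimes>\<^sub>E u \<in> carrier E"
proof -
  define in' where "in' a x u = tensor_lift TT (\<lambda>b y. (a \<otimes>\<^sub>A b) \<boxtimes> (x \<otimes>\<^sub>S y)) u" for a x u
  have d: "t \<otimes>\<^sub>E u = tensor_lift TT (\<lambda>a x. in' a x u) t" for t u
    by (simp add: base_change_def Let_def in'_def)
  have i1: "in' a x (b \<boxtimes> y) = (a \<otimes>\<^sub>A b) \<boxtimes> (x \<otimes>\<^sub>S y)"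
    if "a \<in> carrier A" "x \<in> carrier S" "b \<in> carrier A" "y \<in> carrier S" for a x b y
    unfolding in'_def by (rule E_lift_E(1)[OF E_addcomm])
      (use that in \<open>auto simp: pure_add_left pure_add_right pure_smult S.r_distr A.r_distr smult_mult_right S.m_lcomm\<close>)
  have i2: "in' a x (u \<oplus>\<^sub>E v) = in' a x u \<oplus>\<^sub>E in' a x v"
    if "a \<in> carrier A" "x \<in> carrier S" "u \<in> carrier E" "v \<in> carrier E" for a x u v
    unfolding in'_def by (rule E_lift_E(2)[OF E_addcomm])
      (use that in \<open>auto simp: pure_add_left pure_add_right pure_smult S.r_distr A.r_distr smult_mult_right S.m_lcomm\<close>)
  have i3: "in' a x u \<in> carrier E"
    if "a \<in> carrier A" "x \<in> carrier S" "u \<in> carrier E" for a x u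
    unfolding in'_def by (rule E_lift_E(3)[OF E_addcomm])
      (use that in \<open>auto simp: pure_add_left pure_add_right pure_smult S.r_distr A.r_distr smult_mult_right S.m_lcomm\<close>)
  have j1: "in' (a \<oplus>\<^sub>A b) x u = in' a x u \<oplus>\<^sub>E in' b x u"
    if "u \<in> carrier E" "a \<in> carrier A" "b \<in> carrier A" "x \<in> carrier S" for a b x u
    using that by (induction u rule: E_induct) (auto simp: i1 i2 i3 A.l_distr pure_add_left E.a_ac)
  have j2: "in' a (x \<oplus>\<^sub>S y) u = in' a x u \<oplus>\<^sub>E in' a y u"
    if "u \<in> carrier E" "a \<in> carrier A" "x \<in> carrier S" "y \<in> carrier S" for a x y u
    using that by (induction u rule: E_induct) (auto simp: i1 i2 i3 S.l_distr pure_add_right E.a_ac)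
  have j3: "in' (r \<odot>\<^sub>A a) x u = in' a (\<phi> r \<otimes>\<^sub>S x) u"
    if "u \<in> carrier E" "r \<in> carrier R" "a \<in> carrier A" "x \<in> carrier S" for r a x u
    using that by (induction u rule: E_induct) (auto simp: i1 i2 i3 smult_mult_left pure_smult S.m_assoc)
  have k1: "(a \<boxtimes> x) \<otimes>\<^sub>E u = in' a x u" if "a \<in> carrier A" "x \<in> carrier S" "u \<in> carrier E" for a x u
    unfolding d by (rule E_lift_E(1)[OF E_addcomm]) (use that in \<open>auto simp: i3 j1 j2 j3\<close>)
  show c: "t \<otimes>\<^sub>E u \<in> carrier E" if "t \<in> carrier E" "u \<in> carrier E" for t u
    unfolding d by (rule E_lift_E(3)[OF E_addcomm]) (use that in \<open>auto simp: i3 j1 j2 j3\<close>)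
  show l: "(t \<oplus>\<^sub>E u) \<otimes>\<^sub>E v = t \<otimes>\<^sub>E v \<oplus>\<^sub>E u \<otimes>\<^sub>E v"
    if "t \<in> carrier E" "u \<in> carrier E" "v \<in> carrier E" for t u v
    unfolding d by (rule E_lift_E(2)[OF E_addcomm]) (use that in \<open>auto simp: i3 j1 j2 j3\<close>)
  show "(a \<boxtimes> x) \<otimes>\<^sub>E (b \<boxtimes> y) = (a \<otimes>\<^sub>A b) \<boxtimes> (x \<otimes>\<^sub>S y)"
    if "a \<in> carrier A" "x \<in> carrier S" "b \<in> carrier A" "y \<in> carrier S"
    using that by (simp add: k1 i1)
  show "t \<otimes>\<^sub>E (u \<oplus>\<^sub>E v) = t \<otimes>\<^sub>E u \<oplus>\<^sub>E t \<otimes>\<^sub>E v"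
    if "t \<in> carrier E" "u \<in> carrier E" "v \<in> carrier E"
    using that by (induction t rule: E_induct) (auto simp: k1 i2 l c E.a_ac)
qed

lemma E_ring: "ring E"
proof (rule ringI)
  show "abelian_group E" by (rule E_abelian)
  show "monoid E"
  proof (rule monoidI)
    show "x \<otimes>\<^sub>E y \<otimes>\<^sub>E z = x \<otimes>\<^sub>E (y \<otimes>\<^sub>E z)"
      if "x \<in> carrier E" "y \<in> carrier E" "z \<in> carrier E" for x y z
      using that
    proof (induction x rule: E_induct)
      case (pure a x)
      from pure(3,1,2,4) show ?case
      proof (induction y rule: E_induct)
        case (pure b y)
        from pure(5,1-4) pure.prems show ?case
          by (induction z rule: E_induct)
            (auto simp: E_mult_pure A.m_assoc S.m_assoc E_r_distr E_mult_closed)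
      qed (auto simp: E_l_distr E_r_distr E_mult_closed)
    qed (auto simp: E_l_distr E_r_distr E_mult_closed)
    show "\<one>\<^sub>E \<otimes>\<^sub>E x = x" "x \<otimes>\<^sub>E \<one>\<^sub>E = x" if "x \<in> carrier E" for x
      using that
      by (induction x rule: E_induct) (auto simp: E_one E_mult_pure E_l_distr E_r_distr)
  qed (auto simp: E_mult_closed E_one)
qed (auto simp: E_l_distr E_r_distr)

lemma E_galg: "galg S G E"
proof (rule galgI)
  show "(r \<oplus>\<^sub>S r') \<odot>\<^sub>E a = r \<odot>\<^sub>E a \<oplus>\<^sub>E r' \<odot>\<^sub>E a"
    if "r \<in> carrier S" "r' \<in> carrier S" "a \<in> carrier E" for r r' a
    using that(3,1,2)
    by (induction a rule: E_induct)
      (auto simp: E_smult_pure E_smult_add E_smult_closed S.l_distr pure_add_right E.a_ac)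
  show "(r \<otimes>\<^sub>S r') \<odot>\<^sub>E a = r \<odot>\<^sub>E (r' \<odot>\<^sub>E a)"
    if "r \<in> carrier S" "r' \<in> carrier S" "a \<in> carrier E" for r r' a
    using that(3,1,2)
    by (induction a rule: E_induct)
      (auto simp: E_smult_pure E_smult_add E_smult_closed S.m_assoc)
  show "\<one>\<^sub>S \<odot>\<^sub>E a = a" if "a \<in> carrier E" for a
    using that by (induction a rule: E_induct) (auto simp: E_smult_pure E_smult_add)
  show "(r \<odot>\<^sub>E a) \<otimes>\<^sub>E b = r \<odot>\<^sub>E (a \<otimes>\<^sub>E b)"
    if "r \<in> carrier S" "a \<in> carrier E" "b \<in> carrier E" for r a b
    using that(2,1,3)
  proof (induction a rule: E_induct)
    case (pure a x)
    from pure(4,1-3) show ?case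
      by (induction b rule: E_induct)
        (auto simp: E_smult_pure E_smult_add E_smult_closed E_mult_pure E_r_distr E_mult_closed S.m_assoc)
  qed (auto simp: E_smult_pure E_smult_add E_smult_closed E_l_distr E_mult_closed)
  show "a \<otimes>\<^sub>E (r \<odot>\<^sub>E b) = r \<odot>\<^sub>E (a \<otimes>\<^sub>E b)"
    if "r \<in> carrier S" "a \<in> carrier E" "b \<in> carrier E" for r a b
    using that(2,1,3)
  proof (induction a rule: E_induct)
    case (pure a x)
    from pure(4,1-3) show ?case
      by (induction b rule: E_induct)
        (auto simp: E_smult_pure E_smult_add E_smult_closed E_mult_pure E_r_distr E_mult_closed S.m_lcomm)
  qed (auto simp: E_smult_pure E_smult_add E_smult_closed E_l_distr E_mult_closed)
  show "gact E (a \<otimes>\<^sub>E b) g = gact E a g \<otimes>\<^sub>E gact E b g"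
    if "g \<in> carrier G" "a \<in> carrier E" "b \<in> carrier E" for g a b
    using that(2,1,3)
  proof (induction a rule: E_induct)
    case (pure a x)
    from pure(4,1-3) show ?case
      by (induction b rule: E_induct)
        (auto simp: E_act_pure E_act_add E_act_closed E_mult_pure E_r_distr E_mult_closed act_mult)
  qed (auto simp: E_act_pure E_act_add E_act_closed E_l_distr E_mult_closed)
  show "gact E (r \<odot>\<^sub>E a) g = r \<odot>\<^sub>E gact E a g"
    if "r \<in> carrier S" "g \<in> carrier G" "a \<in> carrier E" for r g a
    using that(3,1,2)
    by (induction a rule: E_induct)
      (auto simp: E_smult_pure E_smult_add E_smult_closed E_act_pure E_act_add E_act_closed)
  show "gact E a \<one>\<^sub>G = a" if "a \<in> carrier E" for a
    using that by (induction a rule: E_induct) (auto simp: E_act_pure E_act_add)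
  show "gact E a (g \<otimes>\<^sub>G h) = gact E (gact E a g) h"
    if "g \<in> carrier G" "h \<in> carrier G" "a \<in> carrier E" for g h a
    using that(3,1,2)
    by (induction a rule: E_induct) (auto simp: E_act_pure E_act_add E_act_closed act_act)
qed (auto simp: G.group_axioms S.cring_axioms E_ring E_smult_closed E_smult_add E_act_closed
    E_act_add E_one E_act_pure)

sublocale EA: galg S G E by (rule E_galg)

lemma E_inclusion: "galg_semihom R \<phi> G A E (\<lambda>a. a \<boxtimes> \<one>\<^sub>S)"
  unfolding galg_semihom_def
  by (auto intro!: ring_hom_memI simp: E_mult_pure pure_add_left E_one E_act_pure pure_smult E_smult_pure)

text \<open>The induced homomorphism \<open>a \<otimes> x \<mapsto> x f(a)\<close>.\<close>

definition ext :: "('s, 'd, 'g) galg \<Rightarrow> ('a \<Rightarrow> 'd) \<Rightarrow> ('a \<times> 's \<Rightarrow>\<^sub>0 int) set \<Rightarrow> 'd"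
  where "ext D f = tensor_lift (add_monoid D) (\<lambda>a x. x \<odot>\<^sub>D f a)"

lemma
  assumes "galg S G D" "galg_semihom R \<phi> G A D f"
  shows ext_pure: "a \<in> carrier A \<Longrightarrow> x \<in> carrier S \<Longrightarrow> ext D f (a \<boxtimes> x) = x \<odot>\<^sub>D f a"
    and ext_add: "t \<in> carrier E \<Longrightarrow> u \<in> carrier E \<Longrightarrow> ext D f (t \<oplus>\<^sub>E u) = ext D f t \<oplus>\<^sub>D ext D f u"
    and ext_closed: "t \<in> carrier E \<Longrightarrow> ext D f t \<in> carrier D"
    and ext_semihom: "galg_semihom S (\<lambda>x. x) G E D (ext D f)"
proof -
  interpret D: galg S G D by fact
  have f: "\<And>a. a \<in> carrier A \<Longrightarrow> f a \<in> carrier D"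
    "\<And>a b. a \<in> carrier A \<Longrightarrow> b \<in> carrier A \<Longrightarrow> f (a \<oplus>\<^sub>A b) = f a \<oplus>\<^sub>D f b"
    "\<And>a b. a \<in> carrier A \<Longrightarrow> b \<in> carrier A \<Longrightarrow> f (a \<otimes>\<^sub>A b) = f a \<otimes>\<^sub>D f b"
    "f \<one>\<^sub>A = \<one>\<^sub>D"
    "\<And>r a. r \<in> carrier R \<Longrightarrow> a \<in> carrier A \<Longrightarrow> f (r \<odot>\<^sub>A a) = \<phi> r \<odot>\<^sub>D f a"
    "\<And>g a. g \<in> carrier G \<Longrightarrow> a \<in> carrier A \<Longrightarrow> f (gact A a g) = gact D (f a) g"
    using assms(2) by (auto simp: galg_semihom_def ring_hom_def)
  have cg: "comm_group (add_monoid D)" by (rule D.A.a_comm_group)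
  show p: "ext D f (a \<boxtimes> x) = x \<odot>\<^sub>D f a" if "a \<in> carrier A" "x \<in> carrier S" for a x
    unfolding ext_def by (rule E_lift_pure[OF cg])
      (use that in \<open>auto simp: f D.M.smult_r_distr D.M.smult_l_distr D.M.smult_assoc1[symmetric] S.m_comm\<close>)
  show a: "ext D f (t \<oplus>\<^sub>E u) = ext D f t \<oplus>\<^sub>D ext D f u" if "t \<in> carrier E" "u \<in> carrier E" for t u
    unfolding ext_def using E_lift_add[OF cg, where \<Phi> = "\<lambda>a x. x \<odot>\<^sub>D f a"] that
    by (auto simp: f D.M.smult_r_distr D.M.smult_l_distr D.M.smult_assoc1[symmetric] S.m_comm)
  show c: "ext D f t \<in> carrier D" if "t \<in> carrier E" for t
    unfolding ext_def using E_lift_closed[OF cg, where \<Phi> = "\<lambda>a x. x \<odot>\<^sub>D f a"] that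
    by (auto simp: f D.M.smult_r_distr D.M.smult_l_distr D.M.smult_assoc1[symmetric] S.m_comm)
  have m: "ext D f (t \<otimes>\<^sub>E u) = ext D f t \<otimes>\<^sub>D ext D f u" if "t \<in> carrier E" "u \<in> carrier E" for t u
    using that
  proof (induction t rule: E_induct)
    case (pure b y)
    from pure(3,1,2) show ?case
      by (induction u rule: E_induct)
        (auto simp: E_mult_pure p a c f E_r_distr E_mult_closed D.A.r_distr D.smult_mult_left
          D.smult_mult_right D.M.smult_assoc1[symmetric] S.m_comm)
  qed (auto simp: a c E_l_distr E_mult_closed D.A.l_distr)
  have s: "ext D f (r \<odot>\<^sub>E t) = r \<odot>\<^sub>D ext D f t" if "t \<in> carrier E" "r \<in> carrier S" for t r
    using that by (induction t rule: E_induct)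
      (auto simp: E_smult_pure E_smult_add E_smult_closed p a c f D.M.smult_assoc1 D.M.smult_r_distr)
  have g: "ext D f (gact E t g) = gact D (ext D f t) g" if "t \<in> carrier E" "g \<in> carrier G" for t g
    using that by (induction t rule: E_induct)
      (auto simp: E_act_pure E_act_add E_act_closed p a c f D.act_smult D.act_add)
  show "galg_semihom S (\<lambda>x. x) G E D (ext D f)"
    unfolding galg_semihom_def using f(1)[of "\<one>\<^sub>A"]
    by (auto intro!: ring_hom_memI simp: m s g a c) (auto simp: E_one p f)
qed

end

lemma (in abelian_monoid) fsum_cong:
  "(\<And>i. i \<in> I \<Longrightarrow> f i = g i) \<Longrightarrow> (\<And>i. i \<in> I \<Longrightarrow> g i \<in> carrier G) \<Longrightarrow> finsum G f I = finsum G g I"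
  by (rule finsum_cong') auto

lemma (in abelian_monoid) fsum_closed:
  "(\<And>i. i \<in> I \<Longrightarrow> f i \<in> carrier G) \<Longrightarrow> finsum G f I \<in> carrier G"
  by (rule finsum_closed) auto

lemma (in abelian_monoid) finsum_prod:
  assumes "finite A" "finite B" "\<And>i j. i \<in> A \<Longrightarrow> j \<in> B \<Longrightarrow> f i j \<in> carrier G"
  shows "(\<Oplus>x\<in>A \<times> B. f (fst x) (snd x)) = (\<Oplus>i\<in>A. \<Oplus>j\<in>B. f i j)"
  using assms(1,3)
proof (induction A rule: finite_induct)
  case (insert a A)
  have e: "insert a A \<times> B = (\<lambda>j. (a, j)) ` B \<union> A \<times> B" by auto
  have "(\<Oplus>x\<in>insert a A \<times> B. f (fst x) (snd x))
      = (\<Oplus>x\<in>(\<lambda>j. (a, j)) ` B. f (fst x) (snd x)) \<oplus> (\<Oplus>x\<in>A \<times> B. f (fst x) (snd x))"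
    unfolding e using insert assms(2) by (intro finsum_Un_disjoint) auto
  also have "(\<Oplus>x\<in>(\<lambda>j. (a, j)) ` B. f (fst x) (snd x)) = (\<Oplus>j\<in>B. f a j)"
    using insert by (subst finsum_reindex) (auto simp: inj_on_def)
  finally show ?case using insert by (subst finsum_insert) (auto intro!: fsum_closed)
qed (simp add: finsum_empty)

lemma (in semiring)
  assumes "a \<in> carrier R" "\<And>i. i \<in> I \<Longrightarrow> f i \<in> carrier R"
  shows fsum_mult: "(\<Oplus>i\<in>I. f i) \<otimes> a = (\<Oplus>i\<in>I. f i \<otimes> a)"
    and mult_fsum: "a \<otimes> (\<Oplus>i\<in>I. f i) = (\<Oplus>i\<in>I. a \<otimes> f i)"
  using finsum_hom[OF abelian_monoid_axioms, where h = "\<lambda>r. r \<otimes> a" and f = f and A = I]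
    finsum_hom[OF abelian_monoid_axioms, where h = "\<lambda>r. a \<otimes> r" and f = f and A = I] assms
  by (auto simp: l_distr r_distr)

locale fin_group = group G for G :: "('g, 'm) monoid_scheme" (structure) +
  assumes fin [simp]: "finite (carrier G)"

locale cring_fin_group = R: cring R + G: fin_group G
  for R :: "('r, 'q) ring_scheme" and G :: "('g, 'm) monoid_scheme" (structure)
begin

lemma sum_left: assumes "a \<in> carrier G" "\<And>g. g \<in> carrier G \<Longrightarrow> f g \<in> carrier R"
  shows "(\<Oplus>\<^sub>R g\<in>carrier G. f (a \<otimes> g)) = (\<Oplus>\<^sub>R g\<in>carrier G. f g)"
  using assms by (intro R.finsum_bij G.bij_mult_left)

lemma sum_right: assumes "a \<in> carrier G" "\<And>g. g \<in> carrier G \<Longrightarrow> f g \<in> carrier R"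
  shows "(\<Oplus>\<^sub>R g\<in>carrier G. f (g \<otimes> a)) = (\<Oplus>\<^sub>R g\<in>carrier G. f g)"
  using assms by (intro R.finsum_bij G.bij_mult_right)

end

section \<open>Convolution and functions on a finite group\<close>

text \<open>
  On functions, convolution is the product of the group algebra. The action is trivial here, only so that
  the group algebra falls under the results on \<open>G\<close>-algebras.
\<close>

definition group_alg :: "('r, 'q) ring_scheme \<Rightarrow> ('g, 'm) monoid_scheme \<Rightarrow> ('r, 'g \<Rightarrow> 'r, 'g) galg"
  where "group_alg R G = (fun_alg R G)
    \<lparr>monoid.mult := (\<lambda>x y. \<lambda>p\<in>carrier G. \<Oplus>\<^sub>R a\<in>carrier G. x a \<otimes>\<^sub>R y (inv\<^bsub>G\<^esub> a \<otimes>\<^sub>G p)),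
     monoid.one := delta_fun R G \<one>\<^sub>G, gact := (\<lambda>x g. x)\<rparr>"

context cring_fin_group
begin

abbreviation H where "H \<equiv> fun_alg R G"
abbreviation \<Lambda> where "\<Lambda> \<equiv> group_alg R G"
abbreviation e where "e \<equiv> delta_fun R G"

lemma fun_alg_simps [simp]:
  "carrier H = carrier G \<rightarrow>\<^sub>E carrier R"
  "g \<in> carrier G \<Longrightarrow> (x \<otimes>\<^sub>H y) g = x g \<otimes>\<^sub>R y g"
  "g \<in> carrier G \<Longrightarrow> (x \<oplus>\<^sub>H y) g = x g \<oplus>\<^sub>R y g"
  "g \<in> carrier G \<Longrightarrow> (r \<odot>\<^sub>H y) g = r \<otimes>\<^sub>R y g"
  "g \<in> carrier G \<Longrightarrow> \<one>\<^sub>H g = \<one>\<^sub>R"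
  "g \<in> carrier G \<Longrightarrow> \<zero>\<^sub>H g = \<zero>\<^sub>R"
  "h \<in> carrier G \<Longrightarrow> (gact H x g) h = x (g \<otimes> h)"
  by (auto simp: fun_alg_def)

lemma fun_alg_galg: "galg R G H"
proof (rule galgI)
  have "abelian_group H"
  proof (rule abelian_groupI)
    fix x assume "x \<in> carrier H"
    then show "\<exists>y\<in>carrier H. y \<oplus>\<^sub>H x = \<zero>\<^sub>H"
      by (intro bexI[where x = "\<lambda>g\<in>carrier G. \<ominus>\<^sub>R x g"]) (auto simp: fun_alg_def fun_eq_iff R.l_neg PiE_iff extensional_def)
  qed (auto simp: fun_alg_def fun_eq_iff PiE_iff extensional_def R.a_ac)
  moreover have "monoid H"
    by (rule monoidI) (auto simp: fun_alg_def fun_eq_iff PiE_iff extensional_def R.m_assoc)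
  ultimately show "ring H"
    by (rule ringI) (auto simp: fun_alg_def fun_eq_iff PiE_iff R.l_distr R.r_distr)
qed (auto simp: fun_alg_def fun_eq_iff PiE_iff extensional_def R.l_distr R.r_distr R.m_assoc R.m_lcomm
    G.m_assoc R.cring_axioms G.group_axioms)

sublocale H: galg R G H by (rule fun_alg_galg)

lemma delta_simps [simp]: "h \<in> carrier G \<Longrightarrow> e g h = (if h = g then \<one>\<^sub>R else \<zero>\<^sub>R)"
  by (auto simp: delta_fun_def)

lemma delta_closed [simp, intro]: "e g \<in> carrier H"
  by (auto simp: delta_fun_def)

lemma delta_act: "a \<in> carrier G \<Longrightarrow> p \<in> carrier G \<Longrightarrow> gact H (e p) a = e (inv a \<otimes> p)"
  by (auto simp: fun_alg_def delta_fun_def fun_eq_iff G.inv_solve_left)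

lemma fun_eqI: "x \<in> carrier H \<Longrightarrow> y \<in> carrier H \<Longrightarrow> (\<And>g. g \<in> carrier G \<Longrightarrow> x g = y g) \<Longrightarrow> x = y"
  by (auto simp: PiE_def intro: extensionalityI)

lemma delta_mult: "p \<in> carrier G \<Longrightarrow> q \<in> carrier G \<Longrightarrow> e p \<otimes>\<^sub>H e q = (if p = q then e p else \<zero>\<^sub>H)"
  by (rule fun_eqI) (auto intro!: H.A.m_closed simp del: fun_alg_simps(1))

lemma fun_sum:
  assumes "g \<in> carrier G" "\<And>i. i \<in> I \<Longrightarrow> f i \<in> carrier H"
  shows "(\<Oplus>\<^sub>H i\<in>I. f i) g = (\<Oplus>\<^sub>R i\<in>I. f i g)"
  using H.A.finsum_hom[OF R.abelian_monoid_axioms, where h = "\<lambda>x. x g" and f = f and A = I] assms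
  by auto

lemma fun_expand:
  assumes "x \<in> carrier H"
  shows "x = (\<Oplus>\<^sub>H g\<in>carrier G. x g \<odot>\<^sub>H e g)"
proof (rule fun_eqI)
  have c: "x g \<odot>\<^sub>H e g \<in> carrier H" if "g \<in> carrier G" for g
    using assms that by (intro H.M.smult_closed delta_closed) auto
  show "(\<Oplus>\<^sub>H g\<in>carrier G. x g \<odot>\<^sub>H e g) \<in> carrier H"
    by (rule H.A.fsum_closed) (rule c)
  show "x h = (\<Oplus>\<^sub>H g\<in>carrier G. x g \<odot>\<^sub>H e g) h" if h: "h \<in> carrier G" for h
    using assms h PiE_mem[of x "carrier G" "\<lambda>_. carrier R"] by (subst fun_sum[OF h c]) (auto intro!: R.finsum_single[where i = h, THEN trans, symmetric])
qed (rule assms)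

lemma group_alg_simps [simp]:
  "carrier \<Lambda> = carrier G \<rightarrow>\<^sub>E carrier R" "\<zero>\<^sub>\<Lambda> = \<zero>\<^sub>H" "x \<oplus>\<^sub>\<Lambda> y = x \<oplus>\<^sub>H y" "r \<odot>\<^sub>\<Lambda> y = r \<odot>\<^sub>H y"
  "\<one>\<^sub>\<Lambda> = e \<one>" "gact \<Lambda> x g = x"
  by (auto simp: group_alg_def fun_alg_def)

lemma group_alg_mult: "p \<in> carrier G \<Longrightarrow>
    (x \<otimes>\<^sub>\<Lambda> y) p = (\<Oplus>\<^sub>R a\<in>carrier G. x a \<otimes>\<^sub>R y (inv a \<otimes> p))"
  by (simp add: group_alg_def)

lemma group_alg_mult_closed: "x \<in> carrier H \<Longrightarrow> y \<in> carrier H \<Longrightarrow> x \<otimes>\<^sub>\<Lambda> y \<in> carrier H"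
  by (auto simp: group_alg_def intro!: R.fsum_closed)

lemma group_alg_assoc:
  assumes "x \<in> carrier H" "y \<in> carrier H" "z \<in> carrier H"
  shows "x \<otimes>\<^sub>\<Lambda> y \<otimes>\<^sub>\<Lambda> z = x \<otimes>\<^sub>\<Lambda> (y \<otimes>\<^sub>\<Lambda> z)"
proof (rule fun_eqI)
  have cl [simp]: "x g \<in> carrier R" "y g \<in> carrier R" "z g \<in> carrier R" if "g \<in> carrier G" for g
    using assms that by auto
  fix p assume p: "p \<in> carrier G"
  let ?s = "\<lambda>f. (\<Oplus>\<^sub>R a\<in>carrier G. f a)"
  have "(x \<otimes>\<^sub>\<Lambda> y \<otimes>\<^sub>\<Lambda> z) p
      = ?s (\<lambda>b. ?s (\<lambda>a. x a \<otimes>\<^sub>R y (inv a \<otimes> b)) \<otimes>\<^sub>R z (inv b \<otimes> p))"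
    using p by (simp add: group_alg_mult) (intro R.fsum_cong, auto simp: group_alg_mult intro!: R.fsum_closed)
  also have "\<dots> = ?s (\<lambda>b. ?s (\<lambda>a. x a \<otimes>\<^sub>R y (inv a \<otimes> b) \<otimes>\<^sub>R z (inv b \<otimes> p)))"
    using p by (intro R.fsum_cong R.fsum_mult) (auto intro!: R.fsum_closed)
  also have "\<dots> = ?s (\<lambda>a. ?s (\<lambda>b. x a \<otimes>\<^sub>R y (inv a \<otimes> b) \<otimes>\<^sub>R z (inv b \<otimes> p)))"
    using p by (intro R.finsum_swap) auto
  also have "\<dots> = ?s (\<lambda>a. x a \<otimes>\<^sub>R ?s (\<lambda>c. y c \<otimes>\<^sub>R z (inv c \<otimes> (inv a \<otimes> p))))"
  proof (rule R.fsum_cong)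
    fix a assume a: "a \<in> carrier G"
    have "?s (\<lambda>b. x a \<otimes>\<^sub>R y (inv a \<otimes> b) \<otimes>\<^sub>R z (inv b \<otimes> p))
        = ?s (\<lambda>c. x a \<otimes>\<^sub>R y (inv a \<otimes> (a \<otimes> c)) \<otimes>\<^sub>R z (inv (a \<otimes> c) \<otimes> p))"
      using a p by (intro sum_left[symmetric]) auto
    also have "\<dots> = x a \<otimes>\<^sub>R ?s (\<lambda>c. y c \<otimes>\<^sub>R z (inv c \<otimes> (inv a \<otimes> p)))"
      using a p by (subst R.mult_fsum) (auto intro!: R.fsum_cong simp: G.m_assoc[symmetric] G.inv_mult_group R.m_assoc)
    finally show "?s (\<lambda>b. x a \<otimes>\<^sub>R y (inv a \<otimes> b) \<otimes>\<^sub>R z (inv b \<otimes> p)) = \<dots>" .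
  qed (use p in \<open>auto intro!: R.fsum_closed\<close>)
  also have "\<dots> = (x \<otimes>\<^sub>\<Lambda> (y \<otimes>\<^sub>\<Lambda> z)) p"
    using p by (simp add: group_alg_mult) (intro R.fsum_cong, auto simp: group_alg_mult intro!: R.fsum_closed)
  finally show "(x \<otimes>\<^sub>\<Lambda> y \<otimes>\<^sub>\<Lambda> z) p = (x \<otimes>\<^sub>\<Lambda> (y \<otimes>\<^sub>\<Lambda> z)) p" .
qed (use assms in \<open>auto intro!: group_alg_mult_closed simp del: fun_alg_simps\<close>)

lemma group_alg_one:
  assumes "x \<in> carrier H"
  shows "e \<one> \<otimes>\<^sub>\<Lambda> x = x" "x \<otimes>\<^sub>\<Lambda> e \<one> = x"
proof -
  have cl [simp]: "x g \<in> carrier R" if "g \<in> carrier G" for g using assms that by auto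
  show "e \<one> \<otimes>\<^sub>\<Lambda> x = x"
  proof (rule fun_eqI)
    fix p assume p: "p \<in> carrier G"
    show "(e \<one> \<otimes>\<^sub>\<Lambda> x) p = x p"
      using p by (simp only: group_alg_mult) (subst R.finsum_single[where i = "\<one>"], auto)
  qed (use assms in \<open>auto intro!: group_alg_mult_closed simp del: fun_alg_simps\<close>)
  show "x \<otimes>\<^sub>\<Lambda> e \<one> = x"
  proof (rule fun_eqI)
    fix p assume p: "p \<in> carrier G"
    have "inv a \<otimes> p = \<one> \<longleftrightarrow> a = p" if "a \<in> carrier G" for a
      using p that by (metis G.inv_closed G.inv_equality G.inv_inv G.l_inv)
    then show "(x \<otimes>\<^sub>\<Lambda> e \<one>) p = x p"
      using p by (simp only: group_alg_mult) (subst R.finsum_single[where i = p], auto)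
  qed (use assms in \<open>auto intro!: group_alg_mult_closed simp del: fun_alg_simps\<close>)
qed

lemma group_alg_galg: "galg R G \<Lambda>"
proof (rule galgI)
  have ab: "abelian_group \<Lambda>"
  proof (rule abelian_groupI)
    fix x assume "x \<in> carrier \<Lambda>"
    then show "\<exists>y\<in>carrier \<Lambda>. y \<oplus>\<^sub>\<Lambda> x = \<zero>\<^sub>\<Lambda>"
      using H.A.l_neg[of x] H.A.a_inv_closed[of x] by auto
  qed (use H.A.a_closed H.A.a_assoc H.A.a_comm H.A.zero_closed H.A.l_zero in \<open>simp_all\<close>)
  show "ring \<Lambda>"
  proof (rule ringI[OF ab])
    show "monoid \<Lambda>"
      by (rule monoidI) (use group_alg_mult_closed group_alg_assoc group_alg_one delta_closed in simp_all)
    fix x y z assume xyz: "x \<in> carrier \<Lambda>" "y \<in> carrier \<Lambda>" "z \<in> carrier \<Lambda>"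
    then have cl [simp]: "x g \<in> carrier R" "y g \<in> carrier R" "z g \<in> carrier R" if "g \<in> carrier G" for g
      using that by auto
    show "(x \<oplus>\<^sub>\<Lambda> y) \<otimes>\<^sub>\<Lambda> z = x \<otimes>\<^sub>\<Lambda> z \<oplus>\<^sub>\<Lambda> y \<otimes>\<^sub>\<Lambda> z"
    proof (rule fun_eqI)
      fix p assume p: "p \<in> carrier G"
      have "((x \<oplus>\<^sub>\<Lambda> y) \<otimes>\<^sub>\<Lambda> z) p = (\<Oplus>\<^sub>R a\<in>carrier G. x a \<otimes>\<^sub>R z (inv a \<otimes> p) \<oplus>\<^sub>R y a \<otimes>\<^sub>R z (inv a \<otimes> p))"
        using p unfolding group_alg_mult[OF p] by (intro R.fsum_cong) (auto simp: R.l_distr)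
      then show "((x \<oplus>\<^sub>\<Lambda> y) \<otimes>\<^sub>\<Lambda> z) p = (x \<otimes>\<^sub>\<Lambda> z \<oplus>\<^sub>\<Lambda> y \<otimes>\<^sub>\<Lambda> z) p"
        using p by (simp only:) (simp add: group_alg_mult[OF p] R.finsum_addf)
    qed (use xyz in \<open>auto intro!: group_alg_mult_closed H.A.a_closed simp del: fun_alg_simps simp flip: fun_alg_simps(1)\<close>)
    show "z \<otimes>\<^sub>\<Lambda> (x \<oplus>\<^sub>\<Lambda> y) = z \<otimes>\<^sub>\<Lambda> x \<oplus>\<^sub>\<Lambda> z \<otimes>\<^sub>\<Lambda> y"
    proof (rule fun_eqI)
      fix p assume p: "p \<in> carrier G"
      have "(z \<otimes>\<^sub>\<Lambda> (x \<oplus>\<^sub>\<Lambda> y)) p = (\<Oplus>\<^sub>R a\<in>carrier G. z a \<otimes>\<^sub>R x (inv a \<otimes> p) \<oplus>\<^sub>R z a \<otimes>\<^sub>R y (inv a \<otimes> p))"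
        using p unfolding group_alg_mult[OF p] by (intro R.fsum_cong) (auto simp: R.r_distr)
      then show "(z \<otimes>\<^sub>\<Lambda> (x \<oplus>\<^sub>\<Lambda> y)) p = (z \<otimes>\<^sub>\<Lambda> x \<oplus>\<^sub>\<Lambda> z \<otimes>\<^sub>\<Lambda> y) p"
        using p by (simp only:) (simp add: group_alg_mult[OF p] R.finsum_addf)
    qed (use xyz in \<open>auto intro!: group_alg_mult_closed H.A.a_closed simp del: fun_alg_simps simp flip: fun_alg_simps(1)\<close>)
  qed
  fix r x y assume xy: "r \<in> carrier R" "x \<in> carrier \<Lambda>" "y \<in> carrier \<Lambda>"
  then have cl [simp]: "x g \<in> carrier R" "y g \<in> carrier R" if "g \<in> carrier G" for g
    using that by auto
  show "(r \<odot>\<^sub>\<Lambda> x) \<otimes>\<^sub>\<Lambda> y = r \<odot>\<^sub>\<Lambda> (x \<otimes>\<^sub>\<Lambda> y)"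
  proof (rule fun_eqI)
    fix p assume p: "p \<in> carrier G"
    show "((r \<odot>\<^sub>\<Lambda> x) \<otimes>\<^sub>\<Lambda> y) p = (r \<odot>\<^sub>\<Lambda> (x \<otimes>\<^sub>\<Lambda> y)) p"
      using p xy(1) by (simp add: group_alg_mult R.mult_fsum) (intro R.fsum_cong, auto simp: R.m_assoc)
  qed (use xy in \<open>auto intro!: group_alg_mult_closed H.M.smult_closed simp del: fun_alg_simps simp flip: fun_alg_simps(1)\<close>)
  show "x \<otimes>\<^sub>\<Lambda> (r \<odot>\<^sub>\<Lambda> y) = r \<odot>\<^sub>\<Lambda> (x \<otimes>\<^sub>\<Lambda> y)"
  proof (rule fun_eqI)
    fix p assume p: "p \<in> carrier G"
    show "(x \<otimes>\<^sub>\<Lambda> (r \<odot>\<^sub>\<Lambda> y)) p = (r \<odot>\<^sub>\<Lambda> (x \<otimes>\<^sub>\<Lambda> y)) p"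
      using p xy(1) by (simp add: group_alg_mult R.mult_fsum) (intro R.fsum_cong, auto simp: R.m_lcomm)
  qed (use xy in \<open>auto intro!: group_alg_mult_closed H.M.smult_closed simp del: fun_alg_simps simp flip: fun_alg_simps(1)\<close>)
qed (use H.M.smult_closed H.M.smult_l_distr H.M.smult_r_distr H.M.smult_assoc1 H.M.smult_one
  R.cring_axioms G.group_axioms in \<open>simp_all\<close>)

end

section \<open>Lazy cocycles in coordinates\<close>

text \<open>
  The values \<open>c(g,h) = s(e_g, e_h)\<close> describe a bilinear form \<open>s\<close> as an element of the group algebra of \<open>G \<times> G\<close>, in
  which the convolution of forms is the product. Invariance under conjugation is laziness, and \<open>sum_first\<close>,
  \<open>sum_second\<close> express \<open>s(1,x) = s(x,1) = s(1,1) \<epsilon>(x)\<close>.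
\<close>

locale lazy_coeffs = cring_fin_group R G
  for R :: "('r, 'q) ring_scheme" and G :: "('g, 'm) monoid_scheme" (structure) +
  fixes c d :: "'g \<Rightarrow> 'g \<Rightarrow> 'r"
  assumes c_closed [simp, intro]: "g \<in> carrier G \<Longrightarrow> h \<in> carrier G \<Longrightarrow> c g h \<in> carrier R"
    and d_closed [simp, intro]: "g \<in> carrier G \<Longrightarrow> h \<in> carrier G \<Longrightarrow> d g h \<in> carrier R"
    and c_conj: "x \<in> carrier G \<Longrightarrow> g \<in> carrier G \<Longrightarrow> h \<in> carrier G \<Longrightarrow>
      c (x \<otimes> g \<otimes> inv x) (x \<otimes> h \<otimes> inv x) = c g h"
    and d_conj: "x \<in> carrier G \<Longrightarrow> g \<in> carrier G \<Longrightarrow> h \<in> carrier G \<Longrightarrow>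
      d (x \<otimes> g \<otimes> inv x) (x \<otimes> h \<otimes> inv x) = d g h"
    and cd: "p \<in> carrier G \<Longrightarrow> q \<in> carrier G \<Longrightarrow>
      (\<Oplus>\<^sub>R a\<in>carrier G. \<Oplus>\<^sub>R b\<in>carrier G. c a b \<otimes>\<^sub>R d (inv a \<otimes> p) (inv b \<otimes> q))
      = (if p = \<one> \<and> q = \<one> then \<one>\<^sub>R else \<zero>\<^sub>R)"
    and dc: "p \<in> carrier G \<Longrightarrow> q \<in> carrier G \<Longrightarrow>
      (\<Oplus>\<^sub>R a\<in>carrier G. \<Oplus>\<^sub>R b\<in>carrier G. d a b \<otimes>\<^sub>R c (inv a \<otimes> p) (inv b \<otimes> q))
      = (if p = \<one> \<and> q = \<one> then \<one>\<^sub>R else \<zero>\<^sub>R)"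
    and cocycle: "p \<in> carrier G \<Longrightarrow> q \<in> carrier G \<Longrightarrow> r \<in> carrier G \<Longrightarrow>
      (\<Oplus>\<^sub>R x\<in>carrier G. c (p \<otimes> inv x) (q \<otimes> inv x) \<otimes>\<^sub>R c x r)
      = (\<Oplus>\<^sub>R x\<in>carrier G. c (q \<otimes> inv x) (r \<otimes> inv x) \<otimes>\<^sub>R c p x)"
    and sum_first: "q \<in> carrier G \<Longrightarrow> (\<Oplus>\<^sub>R p\<in>carrier G. c p q)
      = (if q = \<one> then (\<Oplus>\<^sub>R p\<in>carrier G. \<Oplus>\<^sub>R q\<in>carrier G. c p q) else \<zero>\<^sub>R)"
    and sum_second: "p \<in> carrier G \<Longrightarrow> (\<Oplus>\<^sub>R q\<in>carrier G. c p q)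
      = (if p = \<one> then (\<Oplus>\<^sub>R p\<in>carrier G. \<Oplus>\<^sub>R q\<in>carrier G. c p q) else \<zero>\<^sub>R)"
    and unit: "(\<Oplus>\<^sub>R p\<in>carrier G. \<Oplus>\<^sub>R q\<in>carrier G. c p q) \<in> Units R"

context cring_fin_group
begin

text \<open>
  Cancel \<open>f\<close> in \<open>f * f = u f\<close>. This is how the cocycle identity determines \<open>s(1,x)\<close> and \<open>s(x,1)\<close>.
\<close>

lemma group_alg_quasi_idem:
  assumes "f \<in> carrier H" "g \<in> carrier H" "u \<in> carrier R" "f \<otimes>\<^sub>\<Lambda> g = e \<one>" "f \<otimes>\<^sub>\<Lambda> f = u \<odot>\<^sub>H f"
  shows "f = u \<odot>\<^sub>H e \<one>"
proof -
  interpret L: galg R G \<Lambda> by (rule group_alg_galg)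
  have "f = f \<otimes>\<^sub>\<Lambda> (f \<otimes>\<^sub>\<Lambda> g)"
    using assms group_alg_one by simp
  also have "\<dots> = (u \<odot>\<^sub>\<Lambda> f) \<otimes>\<^sub>\<Lambda> g"
    using assms by (subst group_alg_assoc[symmetric]) auto
  also have "\<dots> = u \<odot>\<^sub>\<Lambda> e \<one>"
    using assms(1-4) by (subst L.smult_mult_left) (auto simp del: group_alg_simps(4))
  finally show ?thesis by simp
qed

lemma sum_inv: assumes "\<And>g. g \<in> carrier G \<Longrightarrow> f g \<in> carrier R"
  shows "(\<Oplus>\<^sub>R g\<in>carrier G. f (inv g)) = (\<Oplus>\<^sub>R g\<in>carrier G. f g)"
  using assms by (intro R.finsum_bij G.bij_inv[OF G.one_closed])

lemma bij_conj: assumes "x \<in> carrier G"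
  shows "bij_betw (\<lambda>a. x \<otimes> a \<otimes> inv x) (carrier G) (carrier G)"
  using bij_betw_trans[OF G.bij_mult_left[OF assms] G.bij_mult_right[of "inv x"]] assms
  by (simp add: o_def)

lemma conj_eq_one: "x \<in> carrier G \<Longrightarrow> p \<in> carrier G \<Longrightarrow>
    x \<otimes> p \<otimes> inv x = \<one> \<longleftrightarrow> p = \<one>"
  using G.inv_solve_right'[of "\<one>" "x \<otimes> p" x] by auto

text \<open>
  The inverse \<open>d\<close> is invariant under conjugation because inverses in the group algebra are unique. The partial sums of
  \<open>c\<close> satisfy the hypotheses of \<open>group_alg_quasi_idem\<close>: sum the cocycle identity over one variable.
\<close>

lemma lazy_coeffsI:
  fixes c d :: "'g \<Rightarrow> 'g \<Rightarrow> 'r"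
  assumes c [simp, intro]: "\<And>g h. g \<in> carrier G \<Longrightarrow> h \<in> carrier G \<Longrightarrow> c g h \<in> carrier R"
    and d [simp, intro]: "\<And>g h. g \<in> carrier G \<Longrightarrow> h \<in> carrier G \<Longrightarrow> d g h \<in> carrier R"
    and c_conj: "\<And>x g h. x \<in> carrier G \<Longrightarrow> g \<in> carrier G \<Longrightarrow> h \<in> carrier G \<Longrightarrow>
      c (x \<otimes> g \<otimes> inv x) (x \<otimes> h \<otimes> inv x) = c g h"
    and cd: "\<And>p q. p \<in> carrier G \<Longrightarrow> q \<in> carrier G \<Longrightarrow>
      (\<Oplus>\<^sub>R a\<in>carrier G. \<Oplus>\<^sub>R b\<in>carrier G. c a b \<otimes>\<^sub>R d (inv a \<otimes> p) (inv b \<otimes> q))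
      = (if p = \<one> \<and> q = \<one> then \<one>\<^sub>R else \<zero>\<^sub>R)"
    and dc: "\<And>p q. p \<in> carrier G \<Longrightarrow> q \<in> carrier G \<Longrightarrow>
      (\<Oplus>\<^sub>R a\<in>carrier G. \<Oplus>\<^sub>R b\<in>carrier G. d a b \<otimes>\<^sub>R c (inv a \<otimes> p) (inv b \<otimes> q))
      = (if p = \<one> \<and> q = \<one> then \<one>\<^sub>R else \<zero>\<^sub>R)"
    and cocycle: "\<And>p q r. p \<in> carrier G \<Longrightarrow> q \<in> carrier G \<Longrightarrow> r \<in> carrier G \<Longrightarrow>
      (\<Oplus>\<^sub>R x\<in>carrier G. c (p \<otimes> inv x) (q \<otimes> inv x) \<otimes>\<^sub>R c x r)
      = (\<Oplus>\<^sub>R x\<in>carrier G. c (q \<otimes> inv x) (r \<otimes> inv x) \<otimes>\<^sub>R c p x)"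
  shows "lazy_coeffs R G c d"
proof -
  let ?s = "\<lambda>f. (\<Oplus>\<^sub>R a\<in>carrier G. f a)"
  note cl = R.fsum_closed
  define u where "u = ?s (\<lambda>p. ?s (\<lambda>q. c p q))"
  define v where "v = ?s (\<lambda>p. ?s (\<lambda>q. d p q))"
  have uv_cl: "u \<in> carrier R" "v \<in> carrier R" by (auto simp: u_def v_def intro!: cl)
  have u_swap: "u = ?s (\<lambda>q. ?s (\<lambda>p. c p q))" unfolding u_def by (rule R.finsum_swap) auto
  define f where "f = (\<lambda>q\<in>carrier G. ?s (\<lambda>p. c p q))"
  define g where "g = (\<lambda>q\<in>carrier G. ?s (\<lambda>p. d p q))"
  define f' where "f' = (\<lambda>p\<in>carrier G. ?s (\<lambda>q. c p q))"
  define g' where "g' = (\<lambda>p\<in>carrier G. ?s (\<lambda>q. d p q))"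
  have H: "f \<in> carrier H" "g \<in> carrier H" "f' \<in> carrier H" "g' \<in> carrier H"
    by (auto simp: f_def g_def f'_def g'_def intro!: cl)
  have fg: "f \<otimes>\<^sub>\<Lambda> g = e \<one>"
  proof (rule fun_eqI)
    fix q assume q: "q \<in> carrier G"
    have "(f \<otimes>\<^sub>\<Lambda> g) q = ?s (\<lambda>b. ?s (\<lambda>a. c a b) \<otimes>\<^sub>R ?s (\<lambda>p. d p (inv b \<otimes> q)))"
      using q by (simp add: group_alg_mult f_def g_def) (intro R.fsum_cong, auto intro!: cl)
    also have "\<dots> = ?s (\<lambda>b. ?s (\<lambda>a. ?s (\<lambda>p. c a b \<otimes>\<^sub>R d (inv a \<otimes> p) (inv b \<otimes> q))))"
    proof (intro R.fsum_cong)
      fix b assume b: "b \<in> carrier G"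
      have "?s (\<lambda>a. c a b) \<otimes>\<^sub>R ?s (\<lambda>p. d p (inv b \<otimes> q))
          = ?s (\<lambda>a. c a b \<otimes>\<^sub>R ?s (\<lambda>p. d p (inv b \<otimes> q)))"
        using q b by (intro R.fsum_mult cl) auto
      also have "\<dots> = ?s (\<lambda>a. ?s (\<lambda>p. c a b \<otimes>\<^sub>R d (inv a \<otimes> p) (inv b \<otimes> q)))"
      proof (intro R.fsum_cong)
        fix a assume a: "a \<in> carrier G"
        have "?s (\<lambda>p. d p (inv b \<otimes> q)) = ?s (\<lambda>p. d (inv a \<otimes> p) (inv b \<otimes> q))"
          using a b q by (intro sum_left[symmetric]) auto
        then show "c a b \<otimes>\<^sub>R ?s (\<lambda>p. d p (inv b \<otimes> q))
            = ?s (\<lambda>p. c a b \<otimes>\<^sub>R d (inv a \<otimes> p) (inv b \<otimes> q))"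
          using a b q by (simp add: R.mult_fsum)
      qed (use q b in \<open>auto intro!: cl\<close>)
      finally show "?s (\<lambda>a. c a b) \<otimes>\<^sub>R ?s (\<lambda>p. d p (inv b \<otimes> q)) = \<dots>" .
    qed (use q in \<open>auto intro!: cl\<close>)
    also have "\<dots> = ?s (\<lambda>b. ?s (\<lambda>p. ?s (\<lambda>a. c a b \<otimes>\<^sub>R d (inv a \<otimes> p) (inv b \<otimes> q))))"
      using q by (intro R.fsum_cong R.finsum_swap cl) auto
    also have "\<dots> = ?s (\<lambda>p. ?s (\<lambda>b. ?s (\<lambda>a. c a b \<otimes>\<^sub>R d (inv a \<otimes> p) (inv b \<otimes> q))))"
      using q by (intro R.finsum_swap cl) auto
    also have "\<dots> = ?s (\<lambda>p. if p = \<one> \<and> q = \<one> then \<one>\<^sub>R else \<zero>\<^sub>R)"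
    proof (intro R.fsum_cong)
      fix p assume p: "p \<in> carrier G"
      show "?s (\<lambda>b. ?s (\<lambda>a. c a b \<otimes>\<^sub>R d (inv a \<otimes> p) (inv b \<otimes> q)))
          = (if p = \<one> \<and> q = \<one> then \<one>\<^sub>R else \<zero>\<^sub>R)"
        using p q by (subst R.finsum_swap) (auto simp: cd)
    qed auto
    also have "\<dots> = e \<one> q"
      using q by (subst R.finsum_single[where i = "\<one>"]) auto
    finally show "(f \<otimes>\<^sub>\<Lambda> g) q = e \<one> q" .
  qed (use H in \<open>auto intro!: group_alg_mult_closed simp del: fun_alg_simps\<close>)
  have fg': "f' \<otimes>\<^sub>\<Lambda> g' = e \<one>"
  proof (rule fun_eqI)
    fix p assume p: "p \<in> carrier G"
    have "(f' \<otimes>\<^sub>\<Lambda> g') p = ?s (\<lambda>a. ?s (\<lambda>b. c a b) \<otimes>\<^sub>R ?s (\<lambda>q. d (inv a \<otimes> p) q))"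
      using p by (simp add: group_alg_mult f'_def g'_def) (intro R.fsum_cong, auto intro!: cl)
    also have "\<dots> = ?s (\<lambda>a. ?s (\<lambda>b. ?s (\<lambda>q. c a b \<otimes>\<^sub>R d (inv a \<otimes> p) (inv b \<otimes> q))))"
    proof (intro R.fsum_cong)
      fix a assume a: "a \<in> carrier G"
      have "?s (\<lambda>b. c a b) \<otimes>\<^sub>R ?s (\<lambda>q. d (inv a \<otimes> p) q)
          = ?s (\<lambda>b. c a b \<otimes>\<^sub>R ?s (\<lambda>q. d (inv a \<otimes> p) q))"
        using p a by (intro R.fsum_mult cl) auto
      also have "\<dots> = ?s (\<lambda>b. ?s (\<lambda>q. c a b \<otimes>\<^sub>R d (inv a \<otimes> p) (inv b \<otimes> q)))"
      proof (intro R.fsum_cong)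
        fix b assume b: "b \<in> carrier G"
        have "?s (\<lambda>q. d (inv a \<otimes> p) q) = ?s (\<lambda>q. d (inv a \<otimes> p) (inv b \<otimes> q))"
          using a b p by (intro sum_left[symmetric]) auto
        then show "c a b \<otimes>\<^sub>R ?s (\<lambda>q. d (inv a \<otimes> p) q)
            = ?s (\<lambda>q. c a b \<otimes>\<^sub>R d (inv a \<otimes> p) (inv b \<otimes> q))"
          using a b p by (simp add: R.mult_fsum)
      qed (use p a in \<open>auto intro!: cl\<close>)
      finally show "?s (\<lambda>b. c a b) \<otimes>\<^sub>R ?s (\<lambda>q. d (inv a \<otimes> p) q) = \<dots>" .
    qed (use p in \<open>auto intro!: cl\<close>)
    also have "\<dots> = ?s (\<lambda>a. ?s (\<lambda>q. ?s (\<lambda>b. c a b \<otimes>\<^sub>R d (inv a \<otimes> p) (inv b \<otimes> q))))"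
      using p by (intro R.fsum_cong R.finsum_swap cl) auto
    also have "\<dots> = ?s (\<lambda>q. ?s (\<lambda>a. ?s (\<lambda>b. c a b \<otimes>\<^sub>R d (inv a \<otimes> p) (inv b \<otimes> q))))"
      using p by (intro R.finsum_swap cl) auto
    also have "\<dots> = ?s (\<lambda>q. if p = \<one> \<and> q = \<one> then \<one>\<^sub>R else \<zero>\<^sub>R)"
      using p by (intro R.fsum_cong) (auto simp: cd)
    also have "\<dots> = e \<one> p"
      using p by (subst R.finsum_single[where i = "\<one>"]) auto
    finally show "(f' \<otimes>\<^sub>\<Lambda> g') p = e \<one> p" .
  qed (use H in \<open>auto intro!: group_alg_mult_closed simp del: fun_alg_simps\<close>)
  have shift: "?s (\<lambda>p. F (p \<otimes> inv x)) = ?s F" if "x \<in> carrier G" "\<And>g. g \<in> carrier G \<Longrightarrow> F g \<in> carrier R" for F x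
    using that by (intro sum_right) auto
  have conv: "?s (\<lambda>x. F (r \<otimes> inv x) \<otimes>\<^sub>R F x) = (F \<otimes>\<^sub>\<Lambda> F) r" if r: "r \<in> carrier G" and F: "F \<in> carrier H" for F r
  proof -
    have "?s (\<lambda>x. F (r \<otimes> inv x) \<otimes>\<^sub>R F x) = ?s (\<lambda>x. F (r \<otimes> x) \<otimes>\<^sub>R F (inv x))"
      using sum_inv[of "\<lambda>x. F (r \<otimes> x) \<otimes>\<^sub>R F (inv x)"] r F by (auto simp: PiE_iff cong: R.finsum_cong)
    also have "\<dots> = ?s (\<lambda>a. F a \<otimes>\<^sub>R F (inv (inv r \<otimes> a)))"
      using sum_left[of r "\<lambda>a. F a \<otimes>\<^sub>R F (inv (inv r \<otimes> a))"] r F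
      by (auto simp: PiE_iff G.m_assoc[symmetric] cong: R.finsum_cong)
    also have "\<dots> = (F \<otimes>\<^sub>\<Lambda> F) r"
      using r F by (auto simp: group_alg_mult PiE_iff G.inv_mult_group intro!: R.fsum_cong)
    finally show ?thesis .
  qed
  have ff: "f \<otimes>\<^sub>\<Lambda> f = u \<odot>\<^sub>H f"
  proof (rule fun_eqI)
    fix r assume r: "r \<in> carrier G"
    have f [simp]: "?s (\<lambda>p. c p q) = f q" "f q \<in> carrier R" if "q \<in> carrier G" for q
      using that H by (auto simp: f_def intro!: cl)
    have "(f \<otimes>\<^sub>\<Lambda> f) r = ?s (\<lambda>x. f (r \<otimes> inv x) \<otimes>\<^sub>R f x)"
      using conv[OF r H(1)] by simp
    also have "\<dots> = ?s (\<lambda>x. ?s (\<lambda>q. ?s (\<lambda>p. c (q \<otimes> inv x) (r \<otimes> inv x) \<otimes>\<^sub>R c p x)))"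
    proof (rule R.fsum_cong)
      fix x assume x: "x \<in> carrier G"
      have "f (r \<otimes> inv x) = ?s (\<lambda>q. c (q \<otimes> inv x) (r \<otimes> inv x))"
        using x r shift[of x "\<lambda>q. c q (r \<otimes> inv x)"] by simp
      also have "\<dots> \<otimes>\<^sub>R f x = ?s (\<lambda>q. c (q \<otimes> inv x) (r \<otimes> inv x) \<otimes>\<^sub>R f x)"
        using x r by (intro R.fsum_mult) auto
      also have "\<dots> = ?s (\<lambda>q. ?s (\<lambda>p. c (q \<otimes> inv x) (r \<otimes> inv x) \<otimes>\<^sub>R c p x))"
        using x r by (intro R.fsum_cong) (auto simp: R.mult_fsum[symmetric] intro!: cl)
      finally show "f (r \<otimes> inv x) \<otimes>\<^sub>R f x = \<dots>" .
    qed (use r in \<open>auto intro!: cl\<close>)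
    also have "\<dots> = ?s (\<lambda>q. ?s (\<lambda>x. ?s (\<lambda>p. c (q \<otimes> inv x) (r \<otimes> inv x) \<otimes>\<^sub>R c p x)))"
      using r by (intro R.finsum_swap cl) auto
    also have "\<dots> = ?s (\<lambda>q. ?s (\<lambda>p. ?s (\<lambda>x. c (q \<otimes> inv x) (r \<otimes> inv x) \<otimes>\<^sub>R c p x)))"
      using r by (intro R.fsum_cong R.finsum_swap cl) auto
    also have "\<dots> = ?s (\<lambda>q. ?s (\<lambda>p. ?s (\<lambda>x. c (p \<otimes> inv x) (q \<otimes> inv x) \<otimes>\<^sub>R c x r)))"
      using r by (intro R.fsum_cong cocycle[symmetric] cl) auto
    also have "\<dots> = ?s (\<lambda>q. ?s (\<lambda>x. ?s (\<lambda>p. c (p \<otimes> inv x) (q \<otimes> inv x) \<otimes>\<^sub>R c x r)))"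
      using r by (intro R.fsum_cong R.finsum_swap cl) auto
    also have "\<dots> = ?s (\<lambda>x. ?s (\<lambda>q. ?s (\<lambda>p. c (p \<otimes> inv x) (q \<otimes> inv x) \<otimes>\<^sub>R c x r)))"
      using r by (intro R.finsum_swap cl) auto
    also have "\<dots> = ?s (\<lambda>x. u \<otimes>\<^sub>R c x r)"
    proof (rule R.fsum_cong)
      fix x assume x: "x \<in> carrier G"
      have "?s (\<lambda>q. ?s (\<lambda>p. c (p \<otimes> inv x) (q \<otimes> inv x) \<otimes>\<^sub>R c x r))
          = ?s (\<lambda>q. ?s (\<lambda>p. c (p \<otimes> inv x) (q \<otimes> inv x)) \<otimes>\<^sub>R c x r)"
        using x r by (intro R.fsum_cong R.fsum_mult[symmetric]) (auto intro!: cl)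
      also have "\<dots> = ?s (\<lambda>q. ?s (\<lambda>p. c (p \<otimes> inv x) (q \<otimes> inv x))) \<otimes>\<^sub>R c x r"
        using x r by (intro R.fsum_mult[symmetric]) (auto intro!: cl)
      also have "?s (\<lambda>q. ?s (\<lambda>p. c (p \<otimes> inv x) (q \<otimes> inv x))) = ?s (\<lambda>q. f (q \<otimes> inv x))"
      proof (rule R.fsum_cong)
        fix q assume q: "q \<in> carrier G"
        show "?s (\<lambda>p. c (p \<otimes> inv x) (q \<otimes> inv x)) = f (q \<otimes> inv x)"
          using x q shift[of x "\<lambda>p. c p (q \<otimes> inv x)"] by simp
      qed (use x in auto)
      also have "\<dots> = ?s f" using x by (intro shift) auto
      also have "\<dots> = u" unfolding u_swap by (intro R.fsum_cong) auto
      finally show "?s (\<lambda>q. ?s (\<lambda>p. c (p \<otimes> inv x) (q \<otimes> inv x) \<otimes>\<^sub>R c x r)) = u \<otimes>\<^sub>R c x r" .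
    qed (use r uv_cl in auto)
    also have "\<dots> = u \<otimes>\<^sub>R f r"
      using r uv_cl by (subst R.mult_fsum[symmetric]) auto
    finally show "(f \<otimes>\<^sub>\<Lambda> f) r = (u \<odot>\<^sub>H f) r" using r by simp
  qed (use H uv_cl in \<open>auto intro!: group_alg_mult_closed H.M.smult_closed simp del: fun_alg_simps\<close>)
  have ff': "f' \<otimes>\<^sub>\<Lambda> f' = u \<odot>\<^sub>H f'"
  proof (rule fun_eqI)
    fix p assume p: "p \<in> carrier G"
    have f [simp]: "?s (\<lambda>q. c p q) = f' p" "f' p \<in> carrier R" if "p \<in> carrier G" for p
      using that H by (auto simp: f'_def intro!: cl)
    have "(f' \<otimes>\<^sub>\<Lambda> f') p = ?s (\<lambda>x. f' (p \<otimes> inv x) \<otimes>\<^sub>R f' x)"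
      using conv[OF p H(3)] by simp
    also have "\<dots> = ?s (\<lambda>x. ?s (\<lambda>q. ?s (\<lambda>r. c (p \<otimes> inv x) (q \<otimes> inv x) \<otimes>\<^sub>R c x r)))"
    proof (rule R.fsum_cong)
      fix x assume x: "x \<in> carrier G"
      have "f' (p \<otimes> inv x) = ?s (\<lambda>q. c (p \<otimes> inv x) (q \<otimes> inv x))"
        using x p shift[of x "\<lambda>q. c (p \<otimes> inv x) q"] by simp
      also have "\<dots> \<otimes>\<^sub>R f' x = ?s (\<lambda>q. c (p \<otimes> inv x) (q \<otimes> inv x) \<otimes>\<^sub>R f' x)"
        using x p by (intro R.fsum_mult) auto
      also have "\<dots> = ?s (\<lambda>q. ?s (\<lambda>r. c (p \<otimes> inv x) (q \<otimes> inv x) \<otimes>\<^sub>R c x r))"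
        using x p by (intro R.fsum_cong) (auto simp: R.mult_fsum[symmetric] intro!: cl)
      finally show "f' (p \<otimes> inv x) \<otimes>\<^sub>R f' x = \<dots>" .
    qed (use p in \<open>auto intro!: cl\<close>)
    also have "\<dots> = ?s (\<lambda>q. ?s (\<lambda>x. ?s (\<lambda>r. c (p \<otimes> inv x) (q \<otimes> inv x) \<otimes>\<^sub>R c x r)))"
      using p by (intro R.finsum_swap cl) auto
    also have "\<dots> = ?s (\<lambda>q. ?s (\<lambda>r. ?s (\<lambda>x. c (p \<otimes> inv x) (q \<otimes> inv x) \<otimes>\<^sub>R c x r)))"
      using p by (intro R.fsum_cong R.finsum_swap cl) auto
    also have "\<dots> = ?s (\<lambda>q. ?s (\<lambda>r. ?s (\<lambda>x. c (q \<otimes> inv x) (r \<otimes> inv x) \<otimes>\<^sub>R c p x)))"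
      using p by (intro R.fsum_cong cocycle cl) auto
    also have "\<dots> = ?s (\<lambda>q. ?s (\<lambda>x. ?s (\<lambda>r. c (q \<otimes> inv x) (r \<otimes> inv x) \<otimes>\<^sub>R c p x)))"
      using p by (intro R.fsum_cong R.finsum_swap cl) auto
    also have "\<dots> = ?s (\<lambda>x. ?s (\<lambda>q. ?s (\<lambda>r. c (q \<otimes> inv x) (r \<otimes> inv x) \<otimes>\<^sub>R c p x)))"
      using p by (intro R.finsum_swap cl) auto
    also have "\<dots> = ?s (\<lambda>x. u \<otimes>\<^sub>R c p x)"
    proof (rule R.fsum_cong)
      fix x assume x: "x \<in> carrier G"
      have "?s (\<lambda>q. ?s (\<lambda>r. c (q \<otimes> inv x) (r \<otimes> inv x) \<otimes>\<^sub>R c p x))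
          = ?s (\<lambda>q. ?s (\<lambda>r. c (q \<otimes> inv x) (r \<otimes> inv x)) \<otimes>\<^sub>R c p x)"
        using x p by (intro R.fsum_cong R.fsum_mult[symmetric]) (auto intro!: cl)
      also have "\<dots> = ?s (\<lambda>q. ?s (\<lambda>r. c (q \<otimes> inv x) (r \<otimes> inv x))) \<otimes>\<^sub>R c p x"
        using x p by (intro R.fsum_mult[symmetric]) (auto intro!: cl)
      also have "?s (\<lambda>q. ?s (\<lambda>r. c (q \<otimes> inv x) (r \<otimes> inv x))) = ?s (\<lambda>q. f' (q \<otimes> inv x))"
      proof (rule R.fsum_cong)
        fix q assume q: "q \<in> carrier G"
        show "?s (\<lambda>r. c (q \<otimes> inv x) (r \<otimes> inv x)) = f' (q \<otimes> inv x)"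
          using x q shift[of x "\<lambda>r. c (q \<otimes> inv x) r"] by simp
      qed (use x in auto)
      also have "\<dots> = ?s f'" using x by (intro shift) auto
      also have "\<dots> = u" unfolding u_def by (intro R.fsum_cong) auto
      finally show "?s (\<lambda>q. ?s (\<lambda>r. c (q \<otimes> inv x) (r \<otimes> inv x) \<otimes>\<^sub>R c p x)) = u \<otimes>\<^sub>R c p x" .
    qed (use p uv_cl in auto)
    also have "\<dots> = u \<otimes>\<^sub>R f' p"
      using p uv_cl by (subst R.mult_fsum[symmetric]) auto
    finally show "(f' \<otimes>\<^sub>\<Lambda> f') p = (u \<odot>\<^sub>H f') p" using p by simp
  qed (use H uv_cl in \<open>auto intro!: group_alg_mult_closed H.M.smult_closed simp del: fun_alg_simps\<close>)
  have f_eq: "f = u \<odot>\<^sub>H e \<one>" "f' = u \<odot>\<^sub>H e \<one>"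
    using group_alg_quasi_idem[OF H(1,2) uv_cl(1) fg ff] group_alg_quasi_idem[OF H(3,4) uv_cl(1) fg' ff'] by auto
  have unit: "u \<in> Units R"
  proof -
    have "\<one>\<^sub>R = (f \<otimes>\<^sub>\<Lambda> g) \<one>" using fg by simp
    also have "\<dots> = ?s (\<lambda>a. f a \<otimes>\<^sub>R g (inv a \<otimes> \<one>))" by (simp only: group_alg_mult G.one_closed)
    also have "\<dots> = u \<otimes>\<^sub>R g \<one>"
      using H(2) uv_cl PiE_mem[of g "carrier G" "\<lambda>_. carrier R"]
      by (subst R.finsum_single[where i = "\<one>"]) (auto simp: f_eq)
    finally show ?thesis
      using uv_cl H(2) PiE_mem[of g "carrier G" "\<lambda>_. carrier R" "\<one>"] R.m_comm[of u "g \<one>"]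
      by (auto simp: Units_def intro!: bexI[where x = "g \<one>"])
  qed
  have d_conj: "d (x \<otimes> g \<otimes> inv x) (x \<otimes> h \<otimes> inv x) = d g h"
    if x: "x \<in> carrier G" and gh: "g \<in> carrier G" "h \<in> carrier G" for x g h
  proof -
    interpret GG: group "G \<times>\<times> G" by (intro DirProd_group G.group_axioms)
    interpret P: cring_fin_group R "G \<times>\<times> G"
      by unfold_locales (auto simp: DirProd_def)
    let ?cj = "\<lambda>a. x \<otimes> a \<otimes> inv x"
    define ct where "ct = (\<lambda>y\<in>carrier (G \<times>\<times> G). c (fst y) (snd y))"
    define dt where "dt = (\<lambda>y\<in>carrier (G \<times>\<times> G). d (fst y) (snd y))"
    define dx where "dx = (\<lambda>y\<in>carrier (G \<times>\<times> G). d (?cj (fst y)) (?cj (snd y)))"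
    have Ht: "ct \<in> carrier P.H" "dt \<in> carrier P.H" "dx \<in> carrier P.H"
      using x by (auto simp: ct_def dt_def dx_def)
    have mul: "(F \<otimes>\<^sub>P.\<Lambda> F') y = ?s (\<lambda>a. ?s (\<lambda>b. F (a, b) \<otimes>\<^sub>R F' (inv a \<otimes> fst y, inv b \<otimes> snd y)))"
      if F: "F \<in> carrier P.H" "F' \<in> carrier P.H" and y: "y \<in> carrier (G \<times>\<times> G)" for F F' y
    proof -
      have cl': "F (a, b) \<in> carrier R" "F' (a, b) \<in> carrier R" if "a \<in> carrier G" "b \<in> carrier G" for a b
        using F that by (auto simp: PiE_iff)
      obtain p q where pq: "y = (p, q)" "p \<in> carrier G" "q \<in> carrier G" using y by auto
      have "(F \<otimes>\<^sub>P.\<Lambda> F') y = (\<Oplus>\<^sub>R z\<in>carrier G \<times> carrier G.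
          F (fst z, snd z) \<otimes>\<^sub>R F' (inv (fst z) \<otimes> p, inv (snd z) \<otimes> q))"
        using y pq cl'
        by (simp add: P.group_alg_mult) (intro R.fsum_cong, auto simp: inv_DirProd[OF G.group_axioms G.group_axioms])
      then show ?thesis
        using pq cl' by (subst (asm) R.finsum_prod) auto
    qed
    have "dt \<otimes>\<^sub>P.\<Lambda> ct = P.e \<one>\<^bsub>G \<times>\<times> G\<^esub>"
    proof (rule P.fun_eqI)
      fix y assume y: "y \<in> carrier (G \<times>\<times> G)"
      then have "(dt \<otimes>\<^sub>P.\<Lambda> ct) y = ?s (\<lambda>a. ?s (\<lambda>b. d a b \<otimes>\<^sub>R c (inv a \<otimes> fst y) (inv b \<otimes> snd y)))"
        using Ht by (subst mul) (auto simp: ct_def dt_def intro!: R.fsum_cong cl)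
      then show "(dt \<otimes>\<^sub>P.\<Lambda> ct) y = P.e \<one>\<^bsub>G \<times>\<times> G\<^esub> y"
        using y by (auto simp: dc split: if_splits)
    qed (use Ht in \<open>auto intro!: P.group_alg_mult_closed simp del: P.fun_alg_simps\<close>)
    moreover have "ct \<otimes>\<^sub>P.\<Lambda> dx = P.e \<one>\<^bsub>G \<times>\<times> G\<^esub>"
    proof (rule P.fun_eqI)
      fix y assume y: "y \<in> carrier (G \<times>\<times> G)"
      then obtain p q where pq: "y = (p, q)" "p \<in> carrier G" "q \<in> carrier G" by auto
      have cj: "?cj (inv a \<otimes> p) = inv (?cj a) \<otimes> ?cj p" if "a \<in> carrier G" "p \<in> carrier G" for a p
      proof -
        have "inv x \<otimes> (x \<otimes> z) = z" if "z \<in> carrier G" for z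
          using that x by (simp add: G.m_assoc[symmetric])
        then show ?thesis using x that by (simp add: G.inv_mult_group G.m_assoc)
      qed
      have "(ct \<otimes>\<^sub>P.\<Lambda> dx) y = ?s (\<lambda>a. ?s (\<lambda>b. c (?cj a) (?cj b) \<otimes>\<^sub>R
          d (inv (?cj a) \<otimes> ?cj p) (inv (?cj b) \<otimes> ?cj q)))"
        using Ht y pq x
        by (subst mul) (auto simp: ct_def dx_def c_conj cj intro!: R.fsum_cong cl)
      also have "\<dots> = ?s (\<lambda>a. ?s (\<lambda>b. c (?cj a) b \<otimes>\<^sub>R
          d (inv (?cj a) \<otimes> ?cj p) (inv b \<otimes> ?cj q)))"
        using x pq by (intro R.fsum_cong R.finsum_bij bij_conj cl) auto
      also have "\<dots> = ?s (\<lambda>a. ?s (\<lambda>b. c a b \<otimes>\<^sub>R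
          d (inv a \<otimes> ?cj p) (inv b \<otimes> ?cj q)))"
        using x pq by (intro R.finsum_bij[where f = "\<lambda>a. ?s (\<lambda>b. c a b \<otimes>\<^sub>R
          d (inv a \<otimes> ?cj p) (inv b \<otimes> ?cj q))"] bij_conj cl) auto
      also have "\<dots> = P.e \<one>\<^bsub>G \<times>\<times> G\<^esub> y"
        using x pq y by (subst cd) (auto simp: conj_eq_one split: if_splits)
      finally show "(ct \<otimes>\<^sub>P.\<Lambda> dx) y = P.e \<one>\<^bsub>G \<times>\<times> G\<^esub> y" .
    qed (use Ht in \<open>auto intro!: P.group_alg_mult_closed simp del: P.fun_alg_simps\<close>)
    ultimately have "dx = dt"
      using P.group_alg_assoc[OF Ht(2,1,3)] P.group_alg_one[OF Ht(3)] P.group_alg_one[OF Ht(2)] by simp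
    then have "dx (g, h) = dt (g, h)" by simp
    then show ?thesis using gh by (simp add: dx_def dt_def)
  qed
  have sf: "?s (\<lambda>p. c p q) = (if q = \<one> then u else \<zero>\<^sub>R)"
    "?s (\<lambda>p. c q p) = (if q = \<one> then u else \<zero>\<^sub>R)" if "q \<in> carrier G" for q
  proof -
    have "f q = (u \<odot>\<^sub>H e \<one>) q" "f' q = (u \<odot>\<^sub>H e \<one>) q" using f_eq by auto
    then show "?s (\<lambda>p. c p q) = (if q = \<one> then u else \<zero>\<^sub>R)"
      "?s (\<lambda>p. c q p) = (if q = \<one> then u else \<zero>\<^sub>R)"
      using that uv_cl by (auto simp: f_def f'_def)
  qed
  show ?thesis
    by unfold_locales (use c_conj cd dc cocycle d_conj sf unit in \<open>auto simp: u_def\<close>)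
qed

end

lemma (in lazy_coeffs) lazy_coeffs_hom:
  assumes "cring S" and h: "h \<in> ring_hom R S"
  shows "lazy_coeffs S G (\<lambda>a b. h (c a b)) (\<lambda>a b. h (d a b))"
proof -
  interpret S: cring S by fact
  interpret S: cring_fin_group S G by unfold_locales
  have hs [simp]: "r \<in> carrier R \<Longrightarrow> h r \<in> carrier S"
    "r \<in> carrier R \<Longrightarrow> r' \<in> carrier R \<Longrightarrow> h (r \<oplus>\<^sub>R r') = h r \<oplus>\<^sub>S h r'"
    "r \<in> carrier R \<Longrightarrow> r' \<in> carrier R \<Longrightarrow> h (r \<otimes>\<^sub>R r') = h r \<otimes>\<^sub>S h r'"
    "h \<one>\<^sub>R = \<one>\<^sub>S" for r r'
    using h by (auto simp: ring_hom_def)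
  have h0 [simp]: "h \<zero>\<^sub>R = \<zero>\<^sub>S" by (rule ring_hom_zero[OF h R.ring_axioms S.ring_axioms])
  have sum: "h (\<Oplus>\<^sub>R i\<in>I. f i) = (\<Oplus>\<^sub>S i\<in>I. h (f i))" if "\<And>i. i \<in> I \<Longrightarrow> f i \<in> carrier R" for f and I :: "'g set"
    using that by (intro R.finsum_hom S.abelian_monoid_axioms) auto
  show ?thesis
  proof (rule S.lazy_coeffsI)
    fix p q assume pq: "p \<in> carrier G" "q \<in> carrier G"
    have "(\<Oplus>\<^sub>S a\<in>carrier G. \<Oplus>\<^sub>S b\<in>carrier G. h (c a b) \<otimes>\<^sub>S h (d (inv a \<otimes> p) (inv b \<otimes> q)))
        = h (\<Oplus>\<^sub>R a\<in>carrier G. \<Oplus>\<^sub>R b\<in>carrier G. c a b \<otimes>\<^sub>R d (inv a \<otimes> p) (inv b \<otimes> q))"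
      using pq by (subst sum, auto intro!: R.fsum_closed) (subst S.fsum_cong[OF sum], auto intro!: S.fsum_closed S.fsum_cong)
    then show "(\<Oplus>\<^sub>S a\<in>carrier G. \<Oplus>\<^sub>S b\<in>carrier G. h (c a b) \<otimes>\<^sub>S h (d (inv a \<otimes> p) (inv b \<otimes> q)))
        = (if p = \<one> \<and> q = \<one> then \<one>\<^sub>S else \<zero>\<^sub>S)"
      using pq by (simp add: cd)
    have "(\<Oplus>\<^sub>S a\<in>carrier G. \<Oplus>\<^sub>S b\<in>carrier G. h (d a b) \<otimes>\<^sub>S h (c (inv a \<otimes> p) (inv b \<otimes> q)))
        = h (\<Oplus>\<^sub>R a\<in>carrier G. \<Oplus>\<^sub>R b\<in>carrier G. d a b \<otimes>\<^sub>R c (inv a \<otimes> p) (inv b \<otimes> q))"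
      using pq by (subst sum, auto intro!: R.fsum_closed) (subst S.fsum_cong[OF sum], auto intro!: S.fsum_closed S.fsum_cong)
    then show "(\<Oplus>\<^sub>S a\<in>carrier G. \<Oplus>\<^sub>S b\<in>carrier G. h (d a b) \<otimes>\<^sub>S h (c (inv a \<otimes> p) (inv b \<otimes> q)))
        = (if p = \<one> \<and> q = \<one> then \<one>\<^sub>S else \<zero>\<^sub>S)"
      using pq by (simp add: dc)
    fix r assume r: "r \<in> carrier G"
    have "(\<Oplus>\<^sub>S x\<in>carrier G. h (c (p \<otimes> inv x) (q \<otimes> inv x)) \<otimes>\<^sub>S h (c x r))
        = h (\<Oplus>\<^sub>R x\<in>carrier G. c (p \<otimes> inv x) (q \<otimes> inv x) \<otimes>\<^sub>R c x r)"
      using pq r by (subst sum) (auto intro!: S.fsum_cong)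
    also have "\<dots> = (\<Oplus>\<^sub>S x\<in>carrier G. h (c (q \<otimes> inv x) (r \<otimes> inv x)) \<otimes>\<^sub>S h (c p x))"
      using pq r by (subst cocycle, auto) (subst sum, auto intro!: S.fsum_cong)
    finally show "(\<Oplus>\<^sub>S x\<in>carrier G. h (c (p \<otimes> inv x) (q \<otimes> inv x)) \<otimes>\<^sub>S h (c x r))
        = (\<Oplus>\<^sub>S x\<in>carrier G. h (c (q \<otimes> inv x) (r \<otimes> inv x)) \<otimes>\<^sub>S h (c p x))" .
  qed (auto simp: c_conj)
qed

context cring_fin_group
begin

definition coeff :: "(('g \<Rightarrow> 'r) \<Rightarrow> ('g \<Rightarrow> 'r) \<Rightarrow> 'r) \<Rightarrow> 'g \<Rightarrow> 'g \<Rightarrow> 'r"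
  where "coeff s g h = s (e g) (e h)"

lemma bilinear_closed: "bilinear_form R G s \<Longrightarrow> x \<in> carrier H \<Longrightarrow> y \<in> carrier H \<Longrightarrow> s x y \<in> carrier R"
  by (auto simp: bilinear_form_def Let_def)

lemma bilinear_zero:
  assumes "bilinear_form R G s" "x \<in> carrier H"
  shows "s \<zero>\<^sub>H x = \<zero>\<^sub>R" "s x \<zero>\<^sub>H = \<zero>\<^sub>R"
proof -
  have "s (\<zero>\<^sub>R \<odot>\<^sub>H x) x = \<zero>\<^sub>R \<otimes>\<^sub>R s x x" "s x (\<zero>\<^sub>R \<odot>\<^sub>H x) = \<zero>\<^sub>R \<otimes>\<^sub>R s x x"
    using assms R.zero_closed unfolding bilinear_form_def Let_def by blast+
  then show "s \<zero>\<^sub>H x = \<zero>\<^sub>R" "s x \<zero>\<^sub>H = \<zero>\<^sub>R"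
    using assms bilinear_closed[OF assms(1)] H.M.smult_l_null[OF assms(2)] by (auto simp del: fun_alg_simps)
qed

lemma sweedler_delta:
  "p \<in> carrier G \<Longrightarrow> abelian_monoid M \<Longrightarrow> (\<And>a. a \<in> carrier G \<Longrightarrow> F (e a) (e (inv a \<otimes> p)) \<in> carrier M) \<Longrightarrow>
    sweedler R G H M F (e p) = (\<Oplus>\<^sub>M a\<in>carrier G. F (e a) (e (inv a \<otimes> p)))"
  unfolding sweedler_def by (rule abelian_monoid.fsum_cong) (auto simp: delta_act)

lemma sweedler_delta2:
  assumes "p \<in> carrier G" "q \<in> carrier G" "abelian_monoid M"
    "\<And>a b. a \<in> carrier G \<Longrightarrow> b \<in> carrier G \<Longrightarrow>
      F (e a) (e (inv a \<otimes> p)) (e b) (e (inv b \<otimes> q)) \<in> carrier M"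
  shows "sweedler R G H M (\<lambda>x1 x2. sweedler R G H M (\<lambda>y1 y2. F x1 x2 y1 y2) (e q)) (e p) =
    (\<Oplus>\<^sub>M a\<in>carrier G. \<Oplus>\<^sub>M b\<in>carrier G.
      F (e a) (e (inv a \<otimes> p)) (e b) (e (inv b \<otimes> q)))"
proof -
  interpret M: abelian_monoid M by fact
  have i: "sweedler R G H M (\<lambda>y1 y2. F (e a) (e (inv a \<otimes> p)) y1 y2) (e q)
      = (\<Oplus>\<^sub>M b\<in>carrier G. F (e a) (e (inv a \<otimes> p)) (e b) (e (inv b \<otimes> q)))"
    if "a \<in> carrier G" for a
    using assms that by (intro sweedler_delta) auto
  show ?thesis
    using assms by (subst sweedler_delta) (auto simp: i intro!: M.fsum_cong M.fsum_closed)
qed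

theorem lazy_coeffs_of_cocycle:
  assumes "lazy_two_cocycle R G s"
  obtains d where "lazy_coeffs R G (coeff s) d"
proof -
  have bs: "bilinear_form R G s"
    using assms by (auto simp: lazy_two_cocycle_def two_cocycle_def Let_def)
  obtain t where bt: "bilinear_form R G t" and inv: "convolution_inverse_forms R G s t"
    using assms by (auto simp: lazy_two_cocycle_def two_cocycle_def Let_def)
  have co: "sweedler R G H R (\<lambda>x1 x2. sweedler R G H R (\<lambda>y1 y2. s x1 y1 \<otimes>\<^sub>R s (x2 \<otimes>\<^sub>H y2) z) y) x =
      sweedler R G H R (\<lambda>y1 y2. sweedler R G H R (\<lambda>z1 z2. s y1 z1 \<otimes>\<^sub>R s x (y2 \<otimes>\<^sub>H z2)) z) y"
    if "x \<in> carrier H" "y \<in> carrier H" "z \<in> carrier H" for x y z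
    using assms that by (auto simp: lazy_two_cocycle_def two_cocycle_def Let_def simp del: fun_alg_simps)
  have lz: "sweedler R G H H (\<lambda>x1 x2. sweedler R G H H (\<lambda>y1 y2. s x1 y1 \<odot>\<^sub>H (x2 \<otimes>\<^sub>H y2)) y) x =
      sweedler R G H H (\<lambda>x1 x2. sweedler R G H H (\<lambda>y1 y2. s x2 y2 \<odot>\<^sub>H (x1 \<otimes>\<^sub>H y1)) y) x"
    if "x \<in> carrier H" "y \<in> carrier H" for x y
    using assms that by (auto simp: lazy_two_cocycle_def Let_def simp del: fun_alg_simps)
  have iv: "sweedler R G H R (\<lambda>x1 x2. sweedler R G H R (\<lambda>y1 y2. s x1 y1 \<otimes>\<^sub>R t x2 y2) y) x
        = counit G x \<otimes>\<^sub>R counit G y"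
      "sweedler R G H R (\<lambda>x1 x2. sweedler R G H R (\<lambda>y1 y2. t x1 y1 \<otimes>\<^sub>R s x2 y2) y) x
        = counit G x \<otimes>\<^sub>R counit G y"
    if "x \<in> carrier H" "y \<in> carrier H" for x y
    using inv that by (auto simp: convolution_inverse_forms_def Let_def simp del: fun_alg_simps)
  note [simp] = bilinear_closed[OF bs delta_closed delta_closed] bilinear_closed[OF bt delta_closed delta_closed]
  have hcl: "s (e a) (e b) \<odot>\<^sub>H (e p \<otimes>\<^sub>H e q) \<in> carrier H" for a b p q
    by (intro H.M.smult_closed H.A.m_closed delta_closed) simp
  have cnt: "counit G (e p) \<otimes>\<^sub>R counit G (e q) = (if p = \<one> \<and> q = \<one> then \<one>\<^sub>R else \<zero>\<^sub>R)" for p q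
    by (auto simp: counit_def)
  have shift: "c (p \<otimes> inv h) (q \<otimes> inv h) = c (inv h \<otimes> p) (inv h \<otimes> q)"
    if c: "c = coeff s" and pqh: "p \<in> carrier G" "q \<in> carrier G" "h \<in> carrier G" for c p q h
  proof -
    have eqv: "h = inv a \<otimes> p \<longleftrightarrow> a = p \<otimes> inv h" if "a \<in> carrier G" "p \<in> carrier G" for a p
      using that pqh by (metis G.inv_closed G.inv_solve_left G.inv_solve_right G.m_closed)
    have "c (p \<otimes> inv h) (q \<otimes> inv h) = (\<Oplus>\<^sub>R a\<in>carrier G. \<Oplus>\<^sub>R b\<in>carrier G.
        (s (e a) (e b) \<odot>\<^sub>H (e (inv a \<otimes> p) \<otimes>\<^sub>H e (inv b \<otimes> q))) h)"
      using pqh by (subst R.finsum_single[where i = "p \<otimes> inv h"])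
        (auto simp: eqv R.finsum_zero c coeff_def intro!: R.finsum_single[where i = "q \<otimes> inv h", THEN trans, symmetric] R.fsum_closed)
    also have "\<dots> = (sweedler R G H H (\<lambda>x1 x2. sweedler R G H H (\<lambda>y1 y2. s x1 y1 \<odot>\<^sub>H (x2 \<otimes>\<^sub>H y2)) (e q)) (e p)) h"
      using pqh by (subst sweedler_delta2) (auto simp: fun_sum hcl H.A.abelian_monoid_axioms
          intro!: R.fsum_cong[OF fun_sum[symmetric]] R.fsum_closed H.A.fsum_closed PiE_mem[OF hcl[simplified fun_alg_simps(1)]]
          simp del: fun_alg_simps)
    also have "\<dots> = (sweedler R G H H (\<lambda>x1 x2. sweedler R G H H (\<lambda>y1 y2. s x2 y2 \<odot>\<^sub>H (x1 \<otimes>\<^sub>H y1)) (e q)) (e p)) h"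
      by (simp only: lz[OF delta_closed delta_closed])
    also have "\<dots> = (\<Oplus>\<^sub>R a\<in>carrier G. \<Oplus>\<^sub>R b\<in>carrier G.
        (s (e (inv a \<otimes> p)) (e (inv b \<otimes> q)) \<odot>\<^sub>H (e a \<otimes>\<^sub>H e b)) h)"
      using pqh by (subst sweedler_delta2) (auto simp: fun_sum hcl H.A.abelian_monoid_axioms
          intro!: R.fsum_cong[OF fun_sum] R.fsum_closed H.A.fsum_closed PiE_mem[OF hcl[simplified fun_alg_simps(1)]]
          simp del: fun_alg_simps)
    also have "\<dots> = c (inv h \<otimes> p) (inv h \<otimes> q)"
      using pqh by (subst R.finsum_single[where i = h])
        (auto simp: R.finsum_zero c coeff_def intro!: R.finsum_single[where i = h, THEN trans] R.fsum_closed)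
    finally show ?thesis .
  qed
  have "lazy_coeffs R G (coeff s) (coeff t)"
  proof (rule lazy_coeffsI)
    fix x g h assume xgh: "x \<in> carrier G" "g \<in> carrier G" "h \<in> carrier G"
    have "inv x \<otimes> (x \<otimes> z) = z" if "z \<in> carrier G" for z
      using that xgh by (simp add: G.m_assoc[symmetric])
    then show "coeff s (x \<otimes> g \<otimes> inv x) (x \<otimes> h \<otimes> inv x) = coeff s g h"
      using xgh shift[OF refl, of "x \<otimes> g" "x \<otimes> h" x] by simp
  next
    fix p q assume pq: "p \<in> carrier G" "q \<in> carrier G"
    show "(\<Oplus>\<^sub>R a\<in>carrier G. \<Oplus>\<^sub>R b\<in>carrier G. coeff s a b \<otimes>\<^sub>R coeff t (inv a \<otimes> p) (inv b \<otimes> q))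
      = (if p = \<one> \<and> q = \<one> then \<one>\<^sub>R else \<zero>\<^sub>R)"
      using iv(1)[OF delta_closed delta_closed, of q p] pq
      by (subst (asm) sweedler_delta2) (auto simp: coeff_def cnt R.abelian_monoid_axioms)
    show "(\<Oplus>\<^sub>R a\<in>carrier G. \<Oplus>\<^sub>R b\<in>carrier G. coeff t a b \<otimes>\<^sub>R coeff s (inv a \<otimes> p) (inv b \<otimes> q))
      = (if p = \<one> \<and> q = \<one> then \<one>\<^sub>R else \<zero>\<^sub>R)"
      using iv(2)[OF delta_closed delta_closed, of q p] pq
      by (subst (asm) sweedler_delta2) (auto simp: coeff_def cnt R.abelian_monoid_axioms)
    fix r assume r: "r \<in> carrier G"
    have z: "s \<zero>\<^sub>H (e r) = \<zero>\<^sub>R" "s (e p) \<zero>\<^sub>H = \<zero>\<^sub>R" for r p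
      by (auto intro!: bilinear_zero[OF bs] simp del: fun_alg_simps)
    have eqv: "inv a \<otimes> p = d \<longleftrightarrow> a = p \<otimes> inv d" "d = inv a \<otimes> p \<longleftrightarrow> a = p \<otimes> inv d"
      if "a \<in> carrier G" "p \<in> carrier G" "d \<in> carrier G" for a p d
      using that by (metis G.inv_closed G.inv_solve_left G.inv_solve_right G.m_closed)+
    have bb: "bij_betw (\<lambda>x. p \<otimes> inv x) (carrier G) (carrier G)" if "p \<in> carrier G" for p
      using bij_betw_trans[OF G.bij_inv[OF G.one_closed] G.bij_mult_left[OF that]] by (simp add: o_def)
    have ii: "inv (p \<otimes> inv x) \<otimes> p = x" if "p \<in> carrier G" "x \<in> carrier G" for p x
      using that by (simp add: G.inv_mult_group G.m_assoc)
    have red: "(\<Oplus>\<^sub>R a\<in>carrier G. \<Oplus>\<^sub>R b\<in>carrier G. s (e a) (e b) \<otimes>\<^sub>R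
          K (e (inv a \<otimes> p) \<otimes>\<^sub>H e (inv b \<otimes> q)))
        = (\<Oplus>\<^sub>R x\<in>carrier G. coeff s (p \<otimes> inv x) (q \<otimes> inv x) \<otimes>\<^sub>R K (e x))"
      if K: "K \<zero>\<^sub>H = \<zero>\<^sub>R" "\<And>x. K (e x) \<in> carrier R" and pq: "p \<in> carrier G" "q \<in> carrier G" for K p q
    proof -
      have "(\<Oplus>\<^sub>R a\<in>carrier G. \<Oplus>\<^sub>R b\<in>carrier G. s (e a) (e b) \<otimes>\<^sub>R
            K (e (inv a \<otimes> p) \<otimes>\<^sub>H e (inv b \<otimes> q)))
          = (\<Oplus>\<^sub>R a\<in>carrier G. s (e a) (e (q \<otimes> inv (inv a \<otimes> p))) \<otimes>\<^sub>R K (e (inv a \<otimes> p)))"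
      proof (rule R.fsum_cong)
        fix a assume a: "a \<in> carrier G"
        let ?x = "inv a \<otimes> p"
        have x: "?x \<in> carrier G" using a pq by simp
        show "(\<Oplus>\<^sub>R b\<in>carrier G. s (e a) (e b) \<otimes>\<^sub>R K (e ?x \<otimes>\<^sub>H e (inv b \<otimes> q)))
            = s (e a) (e (q \<otimes> inv ?x)) \<otimes>\<^sub>R K (e ?x)"
          using x a pq K ii[of q ?x] eqv(2)[of _ q ?x]
          by (subst R.finsum_single[where i = "q \<otimes> inv ?x"]) (auto simp: delta_mult)
      qed (use pq K in auto)
      also have "\<dots> = (\<Oplus>\<^sub>R x\<in>carrier G. s (e (p \<otimes> inv x))
          (e (q \<otimes> inv (inv (p \<otimes> inv x) \<otimes> p))) \<otimes>\<^sub>R K (e (inv (p \<otimes> inv x) \<otimes> p)))"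
        using pq K by (intro R.finsum_bij[symmetric] bb) auto
      also have "\<dots> = (\<Oplus>\<^sub>R x\<in>carrier G. coeff s (p \<otimes> inv x) (q \<otimes> inv x) \<otimes>\<^sub>R K (e x))"
        using pq K by (intro R.fsum_cong) (auto simp: ii coeff_def)
      finally show ?thesis .
    qed
    have scl: "s (e a \<otimes>\<^sub>H e b) (e r) \<in> carrier R" "s (e r) (e a \<otimes>\<^sub>H e b) \<in> carrier R" for a b r
      by (rule bilinear_closed[OF bs], auto intro!: H.A.m_closed simp del: fun_alg_simps)+
    show "(\<Oplus>\<^sub>R x\<in>carrier G. coeff s (p \<otimes> inv x) (q \<otimes> inv x) \<otimes>\<^sub>R coeff s x r)
        = (\<Oplus>\<^sub>R x\<in>carrier G. coeff s (q \<otimes> inv x) (r \<otimes> inv x) \<otimes>\<^sub>R coeff s p x)"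
      using co[OF delta_closed delta_closed delta_closed, of r q p] pq r z
        red[of "\<lambda>w. s w (e r)" p q] red[of "\<lambda>w. s (e p) w" q r]
      by (subst (asm) sweedler_delta2, (auto simp: scl R.abelian_monoid_axioms)[4],
          subst (asm) sweedler_delta2, (auto simp: scl R.abelian_monoid_axioms)[4]) (simp add: coeff_def)
  qed (auto simp: coeff_def)
  then show ?thesis by (rule that)
qed

lemma twist_unit_coeff:
  assumes "bilinear_form R G s"
  shows "twist_unit R G s = inv\<^bsub>R\<^esub> (\<Oplus>\<^sub>R p\<in>carrier G. \<Oplus>\<^sub>R q\<in>carrier G. coeff s p q)"
proof -
  have one: "\<one>\<^sub>H = (\<Oplus>\<^sub>H g\<in>carrier G. e g)"
    by (rule fun_eqI) (auto simp: fun_sum H.A.fsum_closed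
      intro!: R.finsum_single[THEN trans, symmetric] H.A.one_closed simp del: fun_alg_simps(1) simp flip: fun_alg_simps(1))
  have add: "s (x \<oplus>\<^sub>H y) z = s x z \<oplus>\<^sub>R s y z" "s z (x \<oplus>\<^sub>H y) = s z x \<oplus>\<^sub>R s z y"
    if "x \<in> carrier H" "y \<in> carrier H" "z \<in> carrier H" for x y z
    using assms that by (auto simp: bilinear_form_def Let_def simp del: fun_alg_simps)
  have l: "s (\<Oplus>\<^sub>H g\<in>carrier G. e g) z = (\<Oplus>\<^sub>R g\<in>carrier G. s (e g) z)" if "z \<in> carrier H" for z
    using that assms add by (intro H.A.finsum_hom[where h = "\<lambda>x. s x z"] R.abelian_monoid_axioms)
      (auto simp: bilinear_zero bilinear_closed simp del: fun_alg_simps)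
  have r: "s z (\<Oplus>\<^sub>H g\<in>carrier G. e g) = (\<Oplus>\<^sub>R g\<in>carrier G. s z (e g))" if "z \<in> carrier H" for z
    using that assms add by (intro H.A.finsum_hom[where h = "\<lambda>x. s z x"] R.abelian_monoid_axioms)
      (auto simp: bilinear_zero bilinear_closed simp del: fun_alg_simps)
  have "s \<one>\<^sub>H \<one>\<^sub>H = (\<Oplus>\<^sub>R p\<in>carrier G. \<Oplus>\<^sub>R q\<in>carrier G. coeff s p q)"
    unfolding one coeff_def using H.A.fsum_closed[where f = e and I = "carrier G", OF delta_closed]
    by (subst l) (auto simp: r bilinear_closed[OF assms] simp del: fun_alg_simps intro!: R.fsum_cong R.fsum_closed)
  then show ?thesis by (simp add: twist_unit_def)
qed

end

section \<open>Twisting\<close>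

definition twist_sum ::
    "('r, 'q) ring_scheme \<Rightarrow> ('g, 'm) monoid_scheme \<Rightarrow> ('g \<Rightarrow> 'g \<Rightarrow> 'r) \<Rightarrow> 'r"
  where "twist_sum R G c = (\<Oplus>\<^sub>R p\<in>carrier G. \<Oplus>\<^sub>R q\<in>carrier G. c p q)"

definition twist_mult ::
    "('g, 'm) monoid_scheme \<Rightarrow> ('g \<Rightarrow> 'g \<Rightarrow> 'r) \<Rightarrow> ('r, 'a, 'g) galg \<Rightarrow> 'a \<Rightarrow> 'a \<Rightarrow> 'a"
  where "twist_mult G c A a b =
    (\<Oplus>\<^sub>A g\<in>carrier G. \<Oplus>\<^sub>A h\<in>carrier G. c g h \<odot>\<^sub>A (gact A a g \<otimes>\<^sub>A gact A b h))"

text \<open>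
  A relation instead of an equation with \<open>twist\<close>: constructions such as base change commute with twisting only up to the values
  of the operations outside of the carrier.
\<close>

definition twisted ::
    "('r, 'q) ring_scheme \<Rightarrow> ('g, 'm) monoid_scheme \<Rightarrow> ('g \<Rightarrow> 'g \<Rightarrow> 'r) \<Rightarrow> ('r, 'a, 'g) galg \<Rightarrow>
     ('r, 'a, 'g) galg \<Rightarrow> bool"
  where "twisted R G c A C \<longleftrightarrow>
    carrier C = carrier A \<and> \<zero>\<^sub>C = \<zero>\<^sub>A \<and>
    (\<forall>a\<in>carrier A. \<forall>b\<in>carrier A. a \<oplus>\<^sub>C b = a \<oplus>\<^sub>A b) \<and>
    (\<forall>r\<in>carrier R. \<forall>a\<in>carrier A. r \<odot>\<^sub>C a = r \<odot>\<^sub>A a) \<and>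
    (\<forall>a\<in>carrier A. \<forall>g\<in>carrier G. gact C a g = gact A a g) \<and>
    (\<forall>a\<in>carrier A. \<forall>b\<in>carrier A. a \<otimes>\<^sub>C b = twist_mult G c A a b) \<and>
    \<one>\<^sub>C = inv\<^bsub>R\<^esub> (twist_sum R G c) \<odot>\<^sub>A \<one>\<^sub>A"

lemma twistedD:
  assumes "twisted R G c A C"
  shows "carrier C = carrier A" "\<zero>\<^sub>C = \<zero>\<^sub>A"
    "a \<in> carrier A \<Longrightarrow> b \<in> carrier A \<Longrightarrow> a \<oplus>\<^sub>C b = a \<oplus>\<^sub>A b"
    "r \<in> carrier R \<Longrightarrow> a \<in> carrier A \<Longrightarrow> r \<odot>\<^sub>C a = r \<odot>\<^sub>A a"
    "a \<in> carrier A \<Longrightarrow> g \<in> carrier G \<Longrightarrow> gact C a g = gact A a g"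
    "a \<in> carrier A \<Longrightarrow> b \<in> carrier A \<Longrightarrow> a \<otimes>\<^sub>C b = twist_mult G c A a b"
    "\<one>\<^sub>C = inv\<^bsub>R\<^esub> (twist_sum R G c) \<odot>\<^sub>A \<one>\<^sub>A"
  using assms by (auto simp: twisted_def)

definition twist_by ::
    "('r, 'q) ring_scheme \<Rightarrow> ('g, 'm) monoid_scheme \<Rightarrow> ('g \<Rightarrow> 'g \<Rightarrow> 'r) \<Rightarrow> ('r, 'a, 'g) galg \<Rightarrow> ('r, 'a, 'g) galg"
  where "twist_by R G c A = A\<lparr>monoid.mult := twist_mult G c A,
    monoid.one := inv\<^bsub>R\<^esub> (twist_sum R G c) \<odot>\<^sub>A \<one>\<^sub>A \<rparr>"

lemma twisted_twist_by: "twisted R G c A (twist_by R G c A)"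
  by (simp add: twisted_def twist_by_def)

lemma abelian_group_cong:
  assumes "abelian_group A" and c: "carrier C = carrier A" and z: "\<zero>\<^sub>C = \<zero>\<^sub>A"
    and a: "\<And>a b. a \<in> carrier A \<Longrightarrow> b \<in> carrier A \<Longrightarrow> a \<oplus>\<^sub>C b = a \<oplus>\<^sub>A b"
  shows "abelian_group C"
proof -
  interpret A: abelian_group A by fact
  show ?thesis
  proof (rule abelian_groupI, unfold c z)
    show "x \<oplus>\<^sub>C y \<in> carrier A" if "x \<in> carrier A" "y \<in> carrier A" for x y
      using that by (simp add: a)
    show "\<zero>\<^sub>A \<in> carrier A" by simp
    show "x \<oplus>\<^sub>C y \<oplus>\<^sub>C z = x \<oplus>\<^sub>C (y \<oplus>\<^sub>C z)" if "x \<in> carrier A" "y \<in> carrier A" "z \<in> carrier A" for x y z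
      using that A.a_assoc by (simp add: a)
    show "x \<oplus>\<^sub>C y = y \<oplus>\<^sub>C x" if "x \<in> carrier A" "y \<in> carrier A" for x y
      using that A.a_comm[of x y] by (simp add: a)
    show "\<zero>\<^sub>A \<oplus>\<^sub>C x = x" if "x \<in> carrier A" for x using that by (simp add: a)
    show "\<exists>y\<in>carrier A. y \<oplus>\<^sub>C x = \<zero>\<^sub>A" if "x \<in> carrier A" for x
      using that a A.l_neg[of x] A.a_inv_closed[of x] by auto
  qed
qed

lemma finsum_struct_cong:
  assumes "abelian_group A" "carrier C = carrier A" "\<zero>\<^sub>C = \<zero>\<^sub>A"
    "\<And>a b. a \<in> carrier A \<Longrightarrow> b \<in> carrier A \<Longrightarrow> a \<oplus>\<^sub>C b = a \<oplus>\<^sub>A b"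
    "\<And>i. i \<in> I \<Longrightarrow> f i \<in> carrier A"
  shows "(\<Oplus>\<^sub>C i\<in>I. f i) = (\<Oplus>\<^sub>A i\<in>I. f i)"
proof -
  interpret A: abelian_group A by fact
  interpret C: abelian_group C by (rule abelian_group_cong[OF assms(1-4)])
  show ?thesis using A.finsum_hom[OF C.abelian_monoid_axioms, where h = "\<lambda>x. x" and f = f and A = I] assms by simp
qed

lemma tensor_group_cong:
  assumes "carrier C = carrier A"
    "\<And>a b. a \<in> carrier A \<Longrightarrow> b \<in> carrier A \<Longrightarrow> a \<oplus>\<^sub>C b = a \<oplus>\<^sub>A b"
    "\<And>r a. r \<in> carrier R \<Longrightarrow> a \<in> carrier A \<Longrightarrow> r \<odot>\<^sub>C a = r \<odot>\<^sub>A a"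
    "carrier C' = carrier A'"
    "\<And>a b. a \<in> carrier A' \<Longrightarrow> b \<in> carrier A' \<Longrightarrow> a \<oplus>\<^sub>C' b = a \<oplus>\<^sub>A' b"
    "\<And>r a. r \<in> carrier R \<Longrightarrow> a \<in> carrier A' \<Longrightarrow> r \<odot>\<^sub>C' a = r \<odot>\<^sub>A' a"
  shows "tensor_null R C C' = tensor_null R A A'"
    and "tensor_group R C C' = tensor_group R A A'"
    and "tens R C C' = tens R A A'"
proof -
  have "tensor_rels R C C' = tensor_rels R A A'"
    unfolding tensor_rels_def assms(1,4)
    by (intro arg_cong2[where f = "(\<union>)"] Collect_cong iff_exI; auto simp only: assms(2,3,5,6))
  then show n: "tensor_null R C C' = tensor_null R A A'"
    by (simp add: tensor_null_def assms(1,4))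
  show "tensor_group R C C' = tensor_group R A A'"
    by (simp add: tensor_group_def n assms(1,4))
  show "tens R C C' = tens R A A'"
    by (intro ext) (simp add: tens_def n assms(1,4))
qed

locale galg_fin = cring_fin_group R G + A: galg R G A
  for R :: "('r, 'q) ring_scheme" and G :: "('g, 'm) monoid_scheme" (structure) and A :: "('r, 'a, 'g) galg"
begin

abbreviation act (infixl \<open>\<cdot>\<close> 72) where "a \<cdot> g \<equiv> gact A a g"
abbreviation asum where "asum f \<equiv> (\<Oplus>\<^sub>A g\<in>carrier G. f g)"

lemma asum_left: assumes "a \<in> carrier G" "\<And>g. g \<in> carrier G \<Longrightarrow> f g \<in> carrier A"
  shows "asum (\<lambda>g. f (a \<otimes> g)) = asum f"
  using assms by (intro A.A.finsum_bij G.bij_mult_left)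

lemma asum_right: assumes "a \<in> carrier G" "\<And>g. g \<in> carrier G \<Longrightarrow> f g \<in> carrier A"
  shows "asum (\<lambda>g. f (g \<otimes> a)) = asum f"
  using assms by (intro A.A.finsum_bij G.bij_mult_right)

lemma asum_inv: assumes "\<And>g. g \<in> carrier G \<Longrightarrow> f g \<in> carrier A"
  shows "asum (\<lambda>g. f (inv g)) = asum f"
  using assms by (intro A.A.finsum_bij G.bij_inv[OF G.one_closed])

lemma asum_conj: assumes "x \<in> carrier G" "\<And>g. g \<in> carrier G \<Longrightarrow> f g \<in> carrier A"
  shows "asum (\<lambda>g. f (x \<otimes> g \<otimes> inv x)) = asum f"
  using assms by (intro A.A.finsum_bij bij_conj)

lemmas asum_cong = A.A.fsum_cong and asum_closed = A.A.fsum_closed and asum_swap = A.A.finsum_swap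

text \<open>
  Composition of the operators \<open>F \<mapsto> \<Sum> c(p,q) F(p,q)\<close> is convolution on \<open>G \<times> G\<close>.
\<close>

lemma double_convolution:
  assumes c: "\<And>g h. g \<in> carrier G \<Longrightarrow> h \<in> carrier G \<Longrightarrow> c g h \<in> carrier R"
    and d: "\<And>g h. g \<in> carrier G \<Longrightarrow> h \<in> carrier G \<Longrightarrow> d g h \<in> carrier R"
    and dc: "\<And>p q. p \<in> carrier G \<Longrightarrow> q \<in> carrier G \<Longrightarrow>
      (\<Oplus>\<^sub>R a\<in>carrier G. \<Oplus>\<^sub>R b\<in>carrier G. d a b \<otimes>\<^sub>R c (inv a \<otimes> p) (inv b \<otimes> q))
      = (if p = \<one> \<and> q = \<one> then \<one>\<^sub>R else \<zero>\<^sub>R)"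
    and F: "\<And>p q. p \<in> carrier G \<Longrightarrow> q \<in> carrier G \<Longrightarrow> F p q \<in> carrier A"
  shows "asum (\<lambda>g. asum (\<lambda>h. d g h \<odot>\<^sub>A asum (\<lambda>x. asum (\<lambda>y. c x y \<odot>\<^sub>A F (g \<otimes> x) (h \<otimes> y)))))
    = F \<one> \<one>"
proof -
  note [simp] = c d F
  have "asum (\<lambda>g. asum (\<lambda>h. d g h \<odot>\<^sub>A asum (\<lambda>x. asum (\<lambda>y. c x y \<odot>\<^sub>A F (g \<otimes> x) (h \<otimes> y)))))
    = asum (\<lambda>g. asum (\<lambda>h. asum (\<lambda>p. asum (\<lambda>q. (d g h \<otimes>\<^sub>R c (inv g \<otimes> p) (inv h \<otimes> q)) \<odot>\<^sub>A F p q))))"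
  proof (intro asum_cong)
    fix g h assume gh: "g \<in> carrier G" "h \<in> carrier G"
    have ii: "inv x \<otimes> (x \<otimes> z) = z" if "x \<in> carrier G" "z \<in> carrier G" for x z
      using that by (simp add: G.m_assoc[symmetric])
    have "asum (\<lambda>x. asum (\<lambda>y. c x y \<odot>\<^sub>A F (g \<otimes> x) (h \<otimes> y)))
      = asum (\<lambda>x. asum (\<lambda>y. c (inv g \<otimes> (g \<otimes> x)) (inv h \<otimes> (h \<otimes> y)) \<odot>\<^sub>A F (g \<otimes> x) (h \<otimes> y)))"
      using gh by (intro asum_cong asum_closed) (auto simp: ii)
    also have "\<dots> = asum (\<lambda>x. asum (\<lambda>q. c (inv g \<otimes> (g \<otimes> x)) (inv h \<otimes> q) \<odot>\<^sub>A F (g \<otimes> x) q))"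
      using gh by (intro asum_cong asum_left asum_closed) auto
    also have "\<dots> = asum (\<lambda>p. asum (\<lambda>q. c (inv g \<otimes> p) (inv h \<otimes> q) \<odot>\<^sub>A F p q))"
      using gh by (intro asum_left asum_closed) auto
    finally show "d g h \<odot>\<^sub>A asum (\<lambda>x. asum (\<lambda>y. c x y \<odot>\<^sub>A F (g \<otimes> x) (h \<otimes> y)))
      = asum (\<lambda>p. asum (\<lambda>q. (d g h \<otimes>\<^sub>R c (inv g \<otimes> p) (inv h \<otimes> q)) \<odot>\<^sub>A F p q))"
      using gh by (simp add: A.smult_finsum asum_closed A.M.smult_assoc1 cong: A.A.finsum_cong)
  qed (auto intro!: asum_closed)
  also have "\<dots> = asum (\<lambda>g. asum (\<lambda>p. asum (\<lambda>h. asum (\<lambda>q. (d g h \<otimes>\<^sub>R c (inv g \<otimes> p) (inv h \<otimes> q)) \<odot>\<^sub>A F p q))))"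
    by (intro asum_cong asum_swap asum_closed) auto
  also have "\<dots> = asum (\<lambda>p. asum (\<lambda>g. asum (\<lambda>h. asum (\<lambda>q. (d g h \<otimes>\<^sub>R c (inv g \<otimes> p) (inv h \<otimes> q)) \<odot>\<^sub>A F p q))))"
    by (intro asum_swap asum_closed) auto
  also have "\<dots> = asum (\<lambda>p. asum (\<lambda>g. asum (\<lambda>q. asum (\<lambda>h. (d g h \<otimes>\<^sub>R c (inv g \<otimes> p) (inv h \<otimes> q)) \<odot>\<^sub>A F p q))))"
    by (intro asum_cong asum_swap asum_closed) auto
  also have "\<dots> = asum (\<lambda>p. asum (\<lambda>q. asum (\<lambda>g. asum (\<lambda>h. (d g h \<otimes>\<^sub>R c (inv g \<otimes> p) (inv h \<otimes> q)) \<odot>\<^sub>A F p q))))"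
    by (intro asum_cong asum_swap asum_closed) auto
  also have "\<dots> = asum (\<lambda>p. asum (\<lambda>q. (if p = \<one> \<and> q = \<one> then \<one>\<^sub>R else \<zero>\<^sub>R) \<odot>\<^sub>A F p q))"
  proof (intro asum_cong)
    fix p q assume pq: "p \<in> carrier G" "q \<in> carrier G"
    have "asum (\<lambda>g. asum (\<lambda>h. (d g h \<otimes>\<^sub>R c (inv g \<otimes> p) (inv h \<otimes> q)) \<odot>\<^sub>A F p q))
      = (\<Oplus>\<^sub>R g\<in>carrier G. \<Oplus>\<^sub>R h\<in>carrier G. d g h \<otimes>\<^sub>R c (inv g \<otimes> p) (inv h \<otimes> q)) \<odot>\<^sub>A F p q"
      using pq by (simp add: A.finsum_smult R.fsum_closed cong: A.A.finsum_cong)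
    then show "asum (\<lambda>g. asum (\<lambda>h. (d g h \<otimes>\<^sub>R c (inv g \<otimes> p) (inv h \<otimes> q)) \<odot>\<^sub>A F p q))
      = (if p = \<one> \<and> q = \<one> then \<one>\<^sub>R else \<zero>\<^sub>R) \<odot>\<^sub>A F p q" by (simp only: dc[OF pq])
  qed (auto intro!: asum_closed)
  also have "\<dots> = F \<one> \<one>"
    by (subst A.A.finsum_single[where i = "\<one>"])
      (auto simp: A.A.finsum_zero intro!: asum_closed A.A.finsum_single[where i = "\<one>", THEN trans])
  finally show ?thesis .
qed

lemma twist_mult_closed:
  assumes c: "\<And>g h. g \<in> carrier G \<Longrightarrow> h \<in> carrier G \<Longrightarrow> c g h \<in> carrier R"
  shows "a \<in> carrier A \<Longrightarrow> b \<in> carrier A \<Longrightarrow> twist_mult G c A a b \<in> carrier A"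
  unfolding twist_mult_def by (intro asum_closed) (auto simp: c)

end

lemma (in lazy_coeffs) sum_cd: "twist_sum R G c \<otimes>\<^sub>R twist_sum R G d = \<one>\<^sub>R"
proof -
  let ?s = "\<lambda>f. (\<Oplus>\<^sub>R a\<in>carrier G. f a)"
  note cl = R.fsum_closed
  have v: "twist_sum R G d \<in> carrier R" by (auto simp: twist_sum_def intro!: cl)
  have "twist_sum R G c \<otimes>\<^sub>R twist_sum R G d = ?s (\<lambda>a. ?s (\<lambda>b. c a b)) \<otimes>\<^sub>R twist_sum R G d"
    by (simp add: twist_sum_def)
  also have "\<dots> = ?s (\<lambda>a. ?s (\<lambda>b. c a b) \<otimes>\<^sub>R twist_sum R G d)"
    using v by (intro R.fsum_mult cl) auto
  also have "\<dots> = ?s (\<lambda>a. ?s (\<lambda>b. c a b \<otimes>\<^sub>R twist_sum R G d))"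
    using v by (intro R.fsum_cong R.fsum_mult cl) auto
  also have "\<dots> = ?s (\<lambda>a. ?s (\<lambda>b. ?s (\<lambda>p. ?s (\<lambda>q. c a b \<otimes>\<^sub>R d (inv a \<otimes> p) (inv b \<otimes> q)))))"
  proof (intro R.fsum_cong)
    fix a b assume ab: "a \<in> carrier G" "b \<in> carrier G"
    have "twist_sum R G d = ?s (\<lambda>p. ?s (\<lambda>q. d (inv a \<otimes> p) q))"
      unfolding twist_sum_def using ab by (intro sum_left[symmetric] cl) auto
    also have "\<dots> = ?s (\<lambda>p. ?s (\<lambda>q. d (inv a \<otimes> p) (inv b \<otimes> q)))"
      using ab by (intro R.fsum_cong sum_left[symmetric] cl) auto
    finally have e: "twist_sum R G d = \<dots>" .
    show "c a b \<otimes>\<^sub>R twist_sum R G d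
        = ?s (\<lambda>p. ?s (\<lambda>q. c a b \<otimes>\<^sub>R d (inv a \<otimes> p) (inv b \<otimes> q)))"
      unfolding e using ab by (simp add: R.mult_fsum cl cong: R.finsum_cong)
  qed (auto intro!: cl)
  also have "\<dots> = ?s (\<lambda>a. ?s (\<lambda>p. ?s (\<lambda>b. ?s (\<lambda>q. c a b \<otimes>\<^sub>R d (inv a \<otimes> p) (inv b \<otimes> q)))))"
    by (intro R.fsum_cong R.finsum_swap cl) auto
  also have "\<dots> = ?s (\<lambda>p. ?s (\<lambda>a. ?s (\<lambda>b. ?s (\<lambda>q. c a b \<otimes>\<^sub>R d (inv a \<otimes> p) (inv b \<otimes> q)))))"
    by (intro R.finsum_swap cl) auto
  also have "\<dots> = ?s (\<lambda>p. ?s (\<lambda>a. ?s (\<lambda>q. ?s (\<lambda>b. c a b \<otimes>\<^sub>R d (inv a \<otimes> p) (inv b \<otimes> q)))))"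
    by (intro R.fsum_cong R.finsum_swap cl) auto
  also have "\<dots> = ?s (\<lambda>p. ?s (\<lambda>q. ?s (\<lambda>a. ?s (\<lambda>b. c a b \<otimes>\<^sub>R d (inv a \<otimes> p) (inv b \<otimes> q)))))"
    by (intro R.fsum_cong R.finsum_swap cl) auto
  also have "\<dots> = ?s (\<lambda>p. ?s (\<lambda>q. if p = \<one> \<and> q = \<one> then \<one>\<^sub>R else \<zero>\<^sub>R))"
    by (intro R.fsum_cong cl cd) auto
  also have "\<dots> = \<one>\<^sub>R"
    by (subst R.finsum_single[where i = "\<one>"])
      (auto simp: R.finsum_zero intro!: cl R.finsum_single[where i = "\<one>", THEN trans])
  finally show ?thesis .
qed

lemma (in lazy_coeffs) sum_units:
  "twist_sum R G c \<in> Units R" "twist_sum R G d \<in> Units R" "inv\<^bsub>R\<^esub> (twist_sum R G d) = twist_sum R G c"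
  "inv\<^bsub>R\<^esub> (twist_sum R G c) = twist_sum R G d"
proof -
  have cl: "twist_sum R G c \<in> carrier R" "twist_sum R G d \<in> carrier R"
    by (auto simp: twist_sum_def intro!: R.fsum_closed)
  show "twist_sum R G c \<in> Units R" "twist_sum R G d \<in> Units R"
    using sum_cd cl R.m_comm[OF cl] by (auto simp: Units_def)
  show "inv\<^bsub>R\<^esub> (twist_sum R G d) = twist_sum R G c" "inv\<^bsub>R\<^esub> (twist_sum R G c) = twist_sum R G d"
    using R.comm_inv_char[OF cl sum_cd] R.comm_inv_char[OF cl(2,1)] sum_cd R.m_comm[OF cl] by auto
qed

text \<open>
  Composing two twists convolves their coefficients. Here \<open>c\<close> and \<open>d\<close> are bare functions, so that
  twists can be undone in both directions: it is not necessary to verify that \<open>d\<close> is a cocycle, too.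
\<close>

lemma (in galg_fin) twisted_sym:
  assumes c [simp]: "\<And>g h. g \<in> carrier G \<Longrightarrow> h \<in> carrier G \<Longrightarrow> c g h \<in> carrier R"
    and d [simp]: "\<And>g h. g \<in> carrier G \<Longrightarrow> h \<in> carrier G \<Longrightarrow> d g h \<in> carrier R"
    and dc: "\<And>p q. p \<in> carrier G \<Longrightarrow> q \<in> carrier G \<Longrightarrow>
      (\<Oplus>\<^sub>R a\<in>carrier G. \<Oplus>\<^sub>R b\<in>carrier G. d a b \<otimes>\<^sub>R c (inv a \<otimes> p) (inv b \<otimes> q))
      = (if p = \<one> \<and> q = \<one> then \<one>\<^sub>R else \<zero>\<^sub>R)"
    and u: "twist_sum R G c \<in> Units R" "inv\<^bsub>R\<^esub> (twist_sum R G d) = twist_sum R G c"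
    and tw: "twisted R G c A C"
  shows "twisted R G d C A"
proof -
  note t = twistedD[OF tw]
  have tm: "twist_mult G d C a b = a \<otimes>\<^sub>A b" if ab: "a \<in> carrier A" "b \<in> carrier A" for a b
  proof -
    have cl: "d g h \<odot>\<^sub>A twist_mult G c A (a \<cdot> g) (b \<cdot> h) \<in> carrier A" if "g \<in> carrier G" "h \<in> carrier G" for g h
      using ab that by (auto intro!: twist_mult_closed)
    have e: "d g h \<odot>\<^sub>C (gact C a g \<otimes>\<^sub>C gact C b h) = d g h \<odot>\<^sub>A twist_mult G c A (a \<cdot> g) (b \<cdot> h)"
      if "g \<in> carrier G" "h \<in> carrier G" for g h
      using ab that by (auto simp: t twist_mult_closed)
    note fc = finsum_struct_cong[OF A.A.is_abelian_group t(1-3)]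
    have "twist_mult G d C a b = asum (\<lambda>g. asum (\<lambda>h. d g h \<odot>\<^sub>A twist_mult G c A (a \<cdot> g) (b \<cdot> h)))"
    proof -
      interpret C: abelian_group C by (rule abelian_group_cong[OF A.A.is_abelian_group t(1-3)])
      have i: "(\<Oplus>\<^sub>C h\<in>carrier G. d g h \<odot>\<^sub>C (gact C a g \<otimes>\<^sub>C gact C b h))
          = asum (\<lambda>h. d g h \<odot>\<^sub>A twist_mult G c A (a \<cdot> g) (b \<cdot> h))" if g: "g \<in> carrier G" for g
      proof -
        have "(\<Oplus>\<^sub>C h\<in>carrier G. d g h \<odot>\<^sub>C (gact C a g \<otimes>\<^sub>C gact C b h))
            = (\<Oplus>\<^sub>C h\<in>carrier G. d g h \<odot>\<^sub>A twist_mult G c A (a \<cdot> g) (b \<cdot> h))"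
          using g cl by (intro C.fsum_cong e) (auto simp: t(1))
        also have "\<dots> = asum (\<lambda>h. d g h \<odot>\<^sub>A twist_mult G c A (a \<cdot> g) (b \<cdot> h))"
          using g cl by (intro fc) auto
        finally show ?thesis .
      qed
      have "twist_mult G d C a b = (\<Oplus>\<^sub>C g\<in>carrier G. asum (\<lambda>h. d g h \<odot>\<^sub>A twist_mult G c A (a \<cdot> g) (b \<cdot> h)))"
        unfolding twist_mult_def[of G d C] using cl by (intro C.fsum_cong i) (auto simp: t(1) intro!: asum_closed)
      also have "\<dots> = asum (\<lambda>g. asum (\<lambda>h. d g h \<odot>\<^sub>A twist_mult G c A (a \<cdot> g) (b \<cdot> h)))"
        using cl by (intro fc asum_closed) auto
      finally show ?thesis .
    qed
    also have "\<dots> = asum (\<lambda>g. asum (\<lambda>h. d g h \<odot>\<^sub>A asum (\<lambda>x. asum (\<lambda>y. c x y \<odot>\<^sub>A (a \<cdot> (g \<otimes> x) \<otimes>\<^sub>A b \<cdot> (h \<otimes> y))))))"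
      unfolding twist_mult_def using ab by (simp add: A.act_act asum_closed cong: A.A.finsum_cong)
    also have "\<dots> = a \<cdot> \<one> \<otimes>\<^sub>A b \<cdot> \<one>"
      using ab by (intro double_convolution[where F = "\<lambda>p q. a \<cdot> p \<otimes>\<^sub>A b \<cdot> q"] dc) auto
    finally show ?thesis using ab by simp
  qed
  have "\<one>\<^sub>A = inv\<^bsub>R\<^esub> (twist_sum R G d) \<odot>\<^sub>C \<one>\<^sub>C"
    using u by (simp add: t R.Units_closed R.Units_inv_closed A.M.smult_assoc1[symmetric] R.Units_r_inv)
  with tm show ?thesis
    by (auto simp: twisted_def t)
qed

locale twist_pair = lazy_coeffs R G c d + galg_fin R G A
  for R :: "('r, 'q) ring_scheme" and G :: "('g, 'm) monoid_scheme" (structure) and c d and A :: "('r, 'a, 'g) galg" +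
  fixes C :: "('r, 'a, 'g) galg"
  assumes tw: "twisted R G c A C"
begin

lemmas twC = twistedD[OF tw]

abbreviation tmult (infixl \<open>\<star>\<close> 70) where "a \<star> b \<equiv> twist_mult G c A a b"

lemma tmult_closed [simp, intro]: "a \<in> carrier A \<Longrightarrow> b \<in> carrier A \<Longrightarrow> a \<star> b \<in> carrier A"
  by (rule twist_mult_closed) auto

lemma tmult_bilinear:
  assumes "a \<in> carrier A" "b \<in> carrier A" "b' \<in> carrier A"
  shows "(b \<oplus>\<^sub>A b') \<star> a = b \<star> a \<oplus>\<^sub>A b' \<star> a" "a \<star> (b \<oplus>\<^sub>A b') = a \<star> b \<oplus>\<^sub>A a \<star> b'"
    "r \<in> carrier R \<Longrightarrow> (r \<odot>\<^sub>A b) \<star> a = r \<odot>\<^sub>A (b \<star> a)"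
    "r \<in> carrier R \<Longrightarrow> a \<star> (r \<odot>\<^sub>A b) = r \<odot>\<^sub>A (a \<star> b)"
  using assms unfolding twist_mult_def
  by (auto simp: A.act_add A.act_smult A.A.l_distr A.A.r_distr A.M.smult_r_distr A.smult_mult_left A.smult_mult_right
      A.smult_finsum asum_closed A.M.smult_assoc1[symmetric] R.m_comm
      intro!: asum_cong simp flip: A.A.finsum_addf cong: A.A.finsum_cong)

text \<open>
  Laziness is what keeps the action multiplicative: substitute \<open>g \<mapsto> x g x\<inverse>\<close> in the sum.
\<close>

lemma tmult_act:
  assumes "a \<in> carrier A" "b \<in> carrier A" "x \<in> carrier G"
  shows "(a \<star> b) \<cdot> x = (a \<cdot> x) \<star> (b \<cdot> x)"
proof -
  have xx: "x \<otimes> (inv x \<otimes> h \<otimes> inv (inv x)) = h \<otimes> x" if "h \<in> carrier G" for h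
    using that assms(3) by (simp add: G.m_assoc[symmetric])
  have "(a \<cdot> x) \<star> (b \<cdot> x) = asum (\<lambda>g. asum (\<lambda>h. c g h \<odot>\<^sub>A (a \<cdot> (x \<otimes> g) \<otimes>\<^sub>A b \<cdot> (x \<otimes> h))))"
    unfolding twist_mult_def using assms by (simp add: A.act_act cong: A.A.finsum_cong)
  also have "\<dots> = asum (\<lambda>g. asum (\<lambda>h. c g (inv x \<otimes> h \<otimes> inv (inv x)) \<odot>\<^sub>A
      (a \<cdot> (x \<otimes> g) \<otimes>\<^sub>A b \<cdot> (x \<otimes> (inv x \<otimes> h \<otimes> inv (inv x))))))"
    using assms by (intro asum_cong asum_conj[symmetric] asum_closed) auto
  also have "\<dots> = asum (\<lambda>g. asum (\<lambda>h. c (inv x \<otimes> g \<otimes> inv (inv x)) (inv x \<otimes> h \<otimes> inv (inv x)) \<odot>\<^sub>A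
      (a \<cdot> (x \<otimes> (inv x \<otimes> g \<otimes> inv (inv x))) \<otimes>\<^sub>A b \<cdot> (x \<otimes> (inv x \<otimes> h \<otimes> inv (inv x))))))"
    using assms by (intro asum_conj[symmetric, where f = "\<lambda>g. asum (\<lambda>h. c g (inv x \<otimes> h \<otimes> inv (inv x)) \<odot>\<^sub>A
      (a \<cdot> (x \<otimes> g) \<otimes>\<^sub>A b \<cdot> (x \<otimes> (inv x \<otimes> h \<otimes> inv (inv x)))))"] asum_closed) auto
  also have "\<dots> = asum (\<lambda>g. asum (\<lambda>h. c g h \<odot>\<^sub>A (a \<cdot> (g \<otimes> x) \<otimes>\<^sub>A b \<cdot> (h \<otimes> x))))"
  proof (intro asum_cong)
    fix g h assume gh: "g \<in> carrier G" "h \<in> carrier G"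
    show "c (inv x \<otimes> g \<otimes> inv (inv x)) (inv x \<otimes> h \<otimes> inv (inv x)) \<odot>\<^sub>A
        (a \<cdot> (x \<otimes> (inv x \<otimes> g \<otimes> inv (inv x))) \<otimes>\<^sub>A b \<cdot> (x \<otimes> (inv x \<otimes> h \<otimes> inv (inv x))))
      = c g h \<odot>\<^sub>A (a \<cdot> (g \<otimes> x) \<otimes>\<^sub>A b \<cdot> (h \<otimes> x))"
      unfolding xx[OF gh(1)] xx[OF gh(2)] using c_conj[of "inv x"] gh assms(3) by simp
  qed (use assms in \<open>auto intro!: asum_closed\<close>)
  also have "\<dots> = (a \<star> b) \<cdot> x"
    unfolding twist_mult_def using assms
    by (simp add: A.act_finsum asum_closed A.act_smult A.act_mult A.act_act cong: A.A.finsum_cong)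
  finally show ?thesis by simp
qed

text \<open>
  Comparing the coefficients of \<open>(a \<cdot> p) (b \<cdot> q) (f \<cdot> r)\<close> on both sides gives exactly the cocycle identity.
\<close>

lemma tmult_assoc:
  assumes [simp]: "a \<in> carrier A" "b \<in> carrier A" "f \<in> carrier A"
  shows "a \<star> b \<star> f = a \<star> (b \<star> f)"
proof -
  let ?t = "\<lambda>p q r. a \<cdot> p \<otimes>\<^sub>A b \<cdot> q \<otimes>\<^sub>A f \<cdot> r"
  have bk: "z \<otimes> x \<otimes> inv x = z" if "z \<in> carrier G" "x \<in> carrier G" for z x
    using that by (simp add: G.m_assoc)
  have shift2: "asum (\<lambda>g. asum (\<lambda>h. F g h (g \<otimes> x) (h \<otimes> x)))
      = asum (\<lambda>p. asum (\<lambda>q. F (p \<otimes> inv x) (q \<otimes> inv x) p q))"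
    if x: "x \<in> carrier G"
      and F: "\<And>g h p q. g \<in> carrier G \<Longrightarrow> h \<in> carrier G \<Longrightarrow> p \<in> carrier G \<Longrightarrow> q \<in> carrier G \<Longrightarrow> F g h p q \<in> carrier A"
    for x F
  proof -
    have "asum (\<lambda>g. asum (\<lambda>h. F g h (g \<otimes> x) (h \<otimes> x)))
        = asum (\<lambda>g. asum (\<lambda>h. F (g \<otimes> x \<otimes> inv x) (h \<otimes> x \<otimes> inv x) (g \<otimes> x) (h \<otimes> x)))"
      using x F by (intro asum_cong asum_closed) (auto simp: bk)
    also have "\<dots> = asum (\<lambda>g. asum (\<lambda>q. F (g \<otimes> x \<otimes> inv x) (q \<otimes> inv x) (g \<otimes> x) q))"
      using x F by (intro asum_cong asum_closed
          asum_right[where f = "\<lambda>q. F (_ \<otimes> x \<otimes> inv x) (q \<otimes> inv x) (_ \<otimes> x) q"]) auto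
    also have "\<dots> = asum (\<lambda>p. asum (\<lambda>q. F (p \<otimes> inv x) (q \<otimes> inv x) p q))"
      using x F by (intro asum_closed
          asum_right[where f = "\<lambda>p. asum (\<lambda>q. F (p \<otimes> inv x) (q \<otimes> inv x) p q)"]) auto
    finally show ?thesis .
  qed
  have inner: "(u \<star> v) \<cdot> x = asum (\<lambda>p. asum (\<lambda>q. c (p \<otimes> inv x) (q \<otimes> inv x) \<odot>\<^sub>A (u \<cdot> p \<otimes>\<^sub>A v \<cdot> q)))"
    if "u \<in> carrier A" "v \<in> carrier A" "x \<in> carrier G" for u v x
  proof -
    have "(u \<star> v) \<cdot> x = asum (\<lambda>g. asum (\<lambda>h. c g h \<odot>\<^sub>A (u \<cdot> (g \<otimes> x) \<otimes>\<^sub>A v \<cdot> (h \<otimes> x))))"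
      unfolding twist_mult_def using that
      by (simp add: A.act_finsum asum_closed A.act_smult A.act_mult A.act_act cong: A.A.finsum_cong)
    also have "\<dots> = asum (\<lambda>p. asum (\<lambda>q. c (p \<otimes> inv x) (q \<otimes> inv x) \<odot>\<^sub>A (u \<cdot> p \<otimes>\<^sub>A v \<cdot> q)))"
      using that by (intro shift2) auto
    finally show ?thesis .
  qed
  have "a \<star> b \<star> f = asum (\<lambda>x. asum (\<lambda>r. c x r \<odot>\<^sub>A ((a \<star> b) \<cdot> x \<otimes>\<^sub>A f \<cdot> r)))"
    by (simp add: twist_mult_def[of _ _ _ "a \<star> b"])
  also have "\<dots> = asum (\<lambda>x. asum (\<lambda>r. asum (\<lambda>p. asum (\<lambda>q. (c (p \<otimes> inv x) (q \<otimes> inv x) \<otimes>\<^sub>R c x r) \<odot>\<^sub>A ?t p q r))))"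
    by (intro asum_cong asum_closed)
      (auto simp: inner A.finsum_mult asum_closed A.smult_finsum A.smult_mult_left A.M.smult_assoc1[symmetric] R.m_comm
        cong: A.A.finsum_cong)
  also have "\<dots> = asum (\<lambda>x. asum (\<lambda>p. asum (\<lambda>r. asum (\<lambda>q. (c (p \<otimes> inv x) (q \<otimes> inv x) \<otimes>\<^sub>R c x r) \<odot>\<^sub>A ?t p q r))))"
    by (intro asum_cong asum_swap asum_closed) auto
  also have "\<dots> = asum (\<lambda>x. asum (\<lambda>p. asum (\<lambda>q. asum (\<lambda>r. (c (p \<otimes> inv x) (q \<otimes> inv x) \<otimes>\<^sub>R c x r) \<odot>\<^sub>A ?t p q r))))"
    by (intro asum_cong asum_swap asum_closed) auto
  also have "\<dots> = asum (\<lambda>p. asum (\<lambda>x. asum (\<lambda>q. asum (\<lambda>r. (c (p \<otimes> inv x) (q \<otimes> inv x) \<otimes>\<^sub>R c x r) \<odot>\<^sub>A ?t p q r))))"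
    by (intro asum_swap asum_closed) auto
  also have "\<dots> = asum (\<lambda>p. asum (\<lambda>q. asum (\<lambda>x. asum (\<lambda>r. (c (p \<otimes> inv x) (q \<otimes> inv x) \<otimes>\<^sub>R c x r) \<odot>\<^sub>A ?t p q r))))"
    by (intro asum_cong asum_swap asum_closed) auto
  also have "\<dots> = asum (\<lambda>p. asum (\<lambda>q. asum (\<lambda>r. asum (\<lambda>x. (c (p \<otimes> inv x) (q \<otimes> inv x) \<otimes>\<^sub>R c x r) \<odot>\<^sub>A ?t p q r))))"
    by (intro asum_cong asum_swap asum_closed) auto
  also have "\<dots> = asum (\<lambda>p. asum (\<lambda>q. asum (\<lambda>r. asum (\<lambda>x. (c (q \<otimes> inv x) (r \<otimes> inv x) \<otimes>\<^sub>R c p x) \<odot>\<^sub>A ?t p q r))))"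
  proof (rule asum_cong, rule asum_cong, rule asum_cong)
    fix p q r assume "p \<in> carrier G" "q \<in> carrier G" "r \<in> carrier G"
    then show "asum (\<lambda>x. (c (p \<otimes> inv x) (q \<otimes> inv x) \<otimes>\<^sub>R c x r) \<odot>\<^sub>A ?t p q r)
        = asum (\<lambda>x. (c (q \<otimes> inv x) (r \<otimes> inv x) \<otimes>\<^sub>R c p x) \<odot>\<^sub>A ?t p q r)"
      by (simp add: A.finsum_smult[symmetric] cocycle)
  qed (auto intro!: asum_closed)
  also have "\<dots> = asum (\<lambda>p. asum (\<lambda>q. asum (\<lambda>x. asum (\<lambda>r. (c (q \<otimes> inv x) (r \<otimes> inv x) \<otimes>\<^sub>R c p x) \<odot>\<^sub>A ?t p q r))))"
    by (intro asum_cong asum_swap asum_closed) auto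
  also have "\<dots> = asum (\<lambda>p. asum (\<lambda>x. asum (\<lambda>q. asum (\<lambda>r. (c (q \<otimes> inv x) (r \<otimes> inv x) \<otimes>\<^sub>R c p x) \<odot>\<^sub>A ?t p q r))))"
    by (intro asum_cong asum_swap asum_closed) auto
  also have "\<dots> = asum (\<lambda>p. asum (\<lambda>x. c p x \<odot>\<^sub>A (a \<cdot> p \<otimes>\<^sub>A (b \<star> f) \<cdot> x)))"
    by (intro asum_cong asum_closed)
      (auto simp: inner A.mult_finsum asum_closed A.smult_finsum A.smult_mult_right A.M.smult_assoc1[symmetric] R.m_comm
        A.A.m_assoc cong: A.A.finsum_cong)
  also have "\<dots> = a \<star> (b \<star> f)"
    by (simp add: twist_mult_def[of _ _ _ a "b \<star> f"])
  finally show ?thesis .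
qed

lemma tmult_one:
  assumes [simp]: "a \<in> carrier A"
  shows "\<one>\<^sub>A \<star> a = twist_sum R G c \<odot>\<^sub>A a" "a \<star> \<one>\<^sub>A = twist_sum R G c \<odot>\<^sub>A a"
proof -
  have u [simp]: "twist_sum R G c \<in> carrier R" using sum_units by auto
  have "\<one>\<^sub>A \<star> a = asum (\<lambda>g. asum (\<lambda>h. c g h \<odot>\<^sub>A a \<cdot> h))"
    unfolding twist_mult_def by (simp cong: A.A.finsum_cong)
  also have "\<dots> = asum (\<lambda>h. asum (\<lambda>g. c g h \<odot>\<^sub>A a \<cdot> h))"
    by (intro asum_swap) auto
  also have "\<dots> = asum (\<lambda>h. (if h = \<one> then twist_sum R G c else \<zero>\<^sub>R) \<odot>\<^sub>A a \<cdot> h)"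
    by (intro asum_cong) (auto simp: A.finsum_smult[symmetric] sum_first twist_sum_def[symmetric])
  also have "\<dots> = twist_sum R G c \<odot>\<^sub>A a"
    by (subst A.A.finsum_single[where i = "\<one>"]) auto
  finally show "\<one>\<^sub>A \<star> a = twist_sum R G c \<odot>\<^sub>A a" .
  have "a \<star> \<one>\<^sub>A = asum (\<lambda>g. asum (\<lambda>h. c g h \<odot>\<^sub>A a \<cdot> g))"
    unfolding twist_mult_def by (simp cong: A.A.finsum_cong)
  also have "\<dots> = asum (\<lambda>h. (if h = \<one> then twist_sum R G c else \<zero>\<^sub>R) \<odot>\<^sub>A a \<cdot> h)"
    by (intro asum_cong) (auto simp: A.finsum_smult[symmetric] sum_second twist_sum_def[symmetric])
  also have "\<dots> = twist_sum R G c \<odot>\<^sub>A a"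
    by (subst A.A.finsum_single[where i = "\<one>"]) auto
  finally show "a \<star> \<one>\<^sub>A = twist_sum R G c \<odot>\<^sub>A a" .
qed

theorem twisted_galg: "galg R G C"
proof -
  have ab: "abelian_group C" by (rule abelian_group_cong[OF A.A.is_abelian_group twC(1-3)])
  have u: "inv\<^bsub>R\<^esub> (twist_sum R G c) \<in> carrier R" "inv\<^bsub>R\<^esub> (twist_sum R G c) \<otimes>\<^sub>R twist_sum R G c = \<one>\<^sub>R"
     "twist_sum R G c \<in> carrier R"
    using sum_units R.Units_l_inv[of "twist_sum R G c"] by auto
  have "monoid C"
    by (rule monoidI)
      (auto simp: twC tmult_assoc tmult_bilinear tmult_one u A.M.smult_assoc1[symmetric])
  then have "ring C"
    by (rule ringI[OF ab]) (auto simp: twC tmult_bilinear)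
  then show ?thesis
    by (intro galgI) (auto simp: twC tmult_bilinear tmult_act A.act_add A.act_smult A.act_act u
        A.M.smult_l_distr A.M.smult_r_distr A.M.smult_assoc1 G.group_axioms R.cring_axioms)
qed

lemma twisted_invariants:
  "carrier (invariants G C) = carrier (invariants G A)"
  "{x \<odot>\<^sub>C \<one>\<^sub>C | x. x \<in> carrier R} = {x \<odot>\<^sub>A \<one>\<^sub>A | x. x \<in> carrier R}"
proof -
  show "carrier (invariants G C) = carrier (invariants G A)"
    by (auto simp: invariants_def twC)
  have u: "twist_sum R G c \<in> carrier R" "inv\<^bsub>R\<^esub> (twist_sum R G c) \<in> carrier R"
    "twist_sum R G c \<otimes>\<^sub>R inv\<^bsub>R\<^esub> (twist_sum R G c) = \<one>\<^sub>R"
    using sum_units R.Units_r_inv[of "twist_sum R G c"] by auto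
  have "x \<odot>\<^sub>A \<one>\<^sub>A = (x \<otimes>\<^sub>R twist_sum R G c) \<odot>\<^sub>C \<one>\<^sub>C" if "x \<in> carrier R" for x
    using that u by (simp add: twC A.M.smult_assoc1[symmetric] R.m_assoc)
  moreover have "x \<odot>\<^sub>C \<one>\<^sub>C = (x \<otimes>\<^sub>R inv\<^bsub>R\<^esub> (twist_sum R G c)) \<odot>\<^sub>A \<one>\<^sub>A" if "x \<in> carrier R" for x
    using that u by (simp add: twC A.M.smult_assoc1)
  ultimately show "{x \<odot>\<^sub>C \<one>\<^sub>C | x. x \<in> carrier R} = {x \<odot>\<^sub>A \<one>\<^sub>A | x. x \<in> carrier R}"
    using u by (auto intro: R.m_closed) (metis R.m_closed)+
qed

end

section \<open>The canonical map\<close>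

context galg_fin
begin

lemma self_modules: "two_modules R A A"
  by (simp add: two_modules_def A.M.module_axioms)

lemma
  shows canonical_tens: "a \<in> carrier A \<Longrightarrow> b \<in> carrier A \<Longrightarrow>
      canonical_map G A (tens R A A a b) = (\<lambda>g\<in>carrier G. a \<cdot> g \<otimes>\<^sub>A b)"
    and canonical_mult: "t \<in> carrier (tensor_group R A A) \<Longrightarrow> t' \<in> carrier (tensor_group R A A) \<Longrightarrow>
      canonical_map G A (t \<otimes>\<^bsub>tensor_group R A A\<^esub> t') =
        (\<lambda>g\<in>carrier G. canonical_map G A t g \<oplus>\<^sub>A canonical_map G A t' g)"
    and canonical_closed: "t \<in> carrier (tensor_group R A A) \<Longrightarrow> canonical_map G A t \<in> carrier G \<rightarrow>\<^sub>E carrier A"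
proof -
  interpret T: two_modules R A A by (rule self_modules)
  have cg: "comm_group (add_monoid A)" by (rule A.A.a_comm_group)
  have b: "T.balanced (add_monoid A) (\<lambda>a b. a \<cdot> g \<otimes>\<^sub>A b)" if "g \<in> carrier G" for g
    using that by (auto simp: T.balanced_def A.act_add A.act_smult A.A.l_distr A.A.r_distr A.smult_mult_left A.smult_mult_right)
  show "a \<in> carrier A \<Longrightarrow> b \<in> carrier A \<Longrightarrow>
      canonical_map G A (tens R A A a b) = (\<lambda>g\<in>carrier G. a \<cdot> g \<otimes>\<^sub>A b)"
    unfolding canonical_map_def using T.lift_tens[OF cg b] by auto
  show "t \<in> carrier (tensor_group R A A) \<Longrightarrow> t' \<in> carrier (tensor_group R A A) \<Longrightarrow>
      canonical_map G A (t \<otimes>\<^bsub>tensor_group R A A\<^esub> t') =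
        (\<lambda>g\<in>carrier G. canonical_map G A t g \<oplus>\<^sub>A canonical_map G A t' g)"
    unfolding canonical_map_def using hom_mult[OF T.lift_hom[OF cg b]] by auto
  show "t \<in> carrier (tensor_group R A A) \<Longrightarrow> canonical_map G A t \<in> carrier G \<rightarrow>\<^sub>E carrier A"
    unfolding canonical_map_def using T.lift_hom[OF cg b] by (auto simp: hom_def)
qed

text \<open>
  The operator that relates the canonical maps of an algebra and of its twist: in \<open>(a \<cdot> g) * b = \<Sum> c(p,q) (a \<cdot> g p) (b \<cdot> q)\<close>
  the product \<open>(a \<cdot> g p) (b \<cdot> q)\<close> is \<open>((a \<cdot> g p q\<inverse>) b) \<cdot> q\<close>. It is inverted by the operator of \<open>d\<close>.
\<close>

definition canonical_twist :: "('g \<Rightarrow> 'g \<Rightarrow> 'r) \<Rightarrow> ('g \<Rightarrow> 'a) \<Rightarrow> 'g \<Rightarrow> 'a"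
  where "canonical_twist c f = (\<lambda>g\<in>carrier G. asum (\<lambda>p. asum (\<lambda>q.
    c p q \<odot>\<^sub>A f (g \<otimes> p \<otimes> inv q) \<cdot> q)))"

lemma canonical_twist_inverse:
  assumes c [simp]: "\<And>g h. g \<in> carrier G \<Longrightarrow> h \<in> carrier G \<Longrightarrow> c g h \<in> carrier R"
    and d [simp]: "\<And>g h. g \<in> carrier G \<Longrightarrow> h \<in> carrier G \<Longrightarrow> d g h \<in> carrier R"
    and c_conj: "\<And>x g h. x \<in> carrier G \<Longrightarrow> g \<in> carrier G \<Longrightarrow> h \<in> carrier G \<Longrightarrow>
      c (x \<otimes> g \<otimes> inv x) (x \<otimes> h \<otimes> inv x) = c g h"
    and dc: "\<And>p q. p \<in> carrier G \<Longrightarrow> q \<in> carrier G \<Longrightarrow>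
      (\<Oplus>\<^sub>R a\<in>carrier G. \<Oplus>\<^sub>R b\<in>carrier G. d a b \<otimes>\<^sub>R c (inv a \<otimes> p) (inv b \<otimes> q))
      = (if p = \<one> \<and> q = \<one> then \<one>\<^sub>R else \<zero>\<^sub>R)"
    and f: "f \<in> carrier G \<rightarrow>\<^sub>E carrier A"
  shows "canonical_twist c f \<in> carrier G \<rightarrow>\<^sub>E carrier A" "canonical_twist d (canonical_twist c f) = f"
proof -
  have f' [simp]: "f g \<in> carrier A" if "g \<in> carrier G" for g using f that by auto
  show cl: "canonical_twist c f \<in> carrier G \<rightarrow>\<^sub>E carrier A"
    unfolding canonical_twist_def by (auto intro!: asum_closed)
  show "canonical_twist d (canonical_twist c f) = f"
  proof (rule extensionalityI[of _ "carrier G"])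
    fix g assume g [simp]: "g \<in> carrier G"
    let ?F = "\<lambda>P Q. f (g \<otimes> P \<otimes> inv Q) \<cdot> Q"
    have "canonical_twist d (canonical_twist c f) g
        = asum (\<lambda>p. asum (\<lambda>q. d p q \<odot>\<^sub>A asum (\<lambda>x. asum (\<lambda>y. c x y \<odot>\<^sub>A ?F (p \<otimes> x) (q \<otimes> y)))))"
    proof -
      have "asum (\<lambda>x. asum (\<lambda>y. c x y \<odot>\<^sub>A ?F (p \<otimes> x) (q \<otimes> y)))
          = canonical_twist c f (g \<otimes> p \<otimes> inv q) \<cdot> q"
        if pq [simp]: "p \<in> carrier G" "q \<in> carrier G" for p q
      proof -
        have qq: "q \<otimes> (inv q \<otimes> h \<otimes> inv (inv q)) = h \<otimes> q" if "h \<in> carrier G" for h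
          using that by (simp add: G.m_assoc[symmetric])
        have "asum (\<lambda>x. asum (\<lambda>y. c x y \<odot>\<^sub>A ?F (p \<otimes> x) (q \<otimes> y)))
            = asum (\<lambda>x. asum (\<lambda>y. c x (inv q \<otimes> y \<otimes> inv (inv q)) \<odot>\<^sub>A
                ?F (p \<otimes> x) (q \<otimes> (inv q \<otimes> y \<otimes> inv (inv q)))))"
          by (intro asum_cong asum_closed asum_conj[symmetric, where f = "\<lambda>y. c _ y \<odot>\<^sub>A ?F (p \<otimes> _) (q \<otimes> y)"]) auto
        also have "\<dots> = asum (\<lambda>x. asum (\<lambda>y. c (inv q \<otimes> x \<otimes> inv (inv q)) (inv q \<otimes> y \<otimes> inv (inv q)) \<odot>\<^sub>A
                ?F (p \<otimes> (inv q \<otimes> x \<otimes> inv (inv q))) (q \<otimes> (inv q \<otimes> y \<otimes> inv (inv q)))))"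
          by (intro asum_closed asum_conj[symmetric, where f = "\<lambda>x. asum (\<lambda>y. c x (inv q \<otimes> y \<otimes> inv (inv q)) \<odot>\<^sub>A
                ?F (p \<otimes> x) (q \<otimes> (inv q \<otimes> y \<otimes> inv (inv q))))"]) auto
        also have "\<dots> = asum (\<lambda>x. asum (\<lambda>y. c x y \<odot>\<^sub>A (f (g \<otimes> p \<otimes> inv q \<otimes> x \<otimes> inv y) \<cdot> y \<cdot> q)))"
        proof (intro asum_cong)
          fix x y assume xy [simp]: "x \<in> carrier G" "y \<in> carrier G"
          have c': "c (inv q \<otimes> x \<otimes> inv (inv q)) (inv q \<otimes> y \<otimes> inv (inv q)) = c x y"
            by (rule c_conj) auto
          have "inv (inv q) \<otimes> inv (y \<otimes> q) = inv y"
            by (simp add: G.inv_mult_group G.m_assoc[symmetric])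
          then have g': "g \<otimes> (p \<otimes> (inv q \<otimes> x \<otimes> inv (inv q))) \<otimes> inv (y \<otimes> q)
              = g \<otimes> p \<otimes> inv q \<otimes> x \<otimes> inv y"
            by (simp add: G.m_assoc)
          show "c (inv q \<otimes> x \<otimes> inv (inv q)) (inv q \<otimes> y \<otimes> inv (inv q)) \<odot>\<^sub>A
                ?F (p \<otimes> (inv q \<otimes> x \<otimes> inv (inv q))) (q \<otimes> (inv q \<otimes> y \<otimes> inv (inv q)))
              = c x y \<odot>\<^sub>A (f (g \<otimes> p \<otimes> inv q \<otimes> x \<otimes> inv y) \<cdot> y \<cdot> q)"
            unfolding c' qq[OF xy(2)] g' by (simp add: A.act_act)
        qed (auto intro!: asum_closed)
        also have "\<dots> = canonical_twist c f (g \<otimes> p \<otimes> inv q) \<cdot> q"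
          by (simp add: canonical_twist_def A.act_finsum asum_closed A.act_smult cong: A.A.finsum_cong)
        finally show ?thesis .
      qed
      then show ?thesis
        using cl by (auto simp: canonical_twist_def[of d] intro!: asum_cong asum_closed)
    qed
    also have "\<dots> = ?F \<one> \<one>"
      by (intro double_convolution[where F = ?F] dc) auto
    also have "\<dots> = f g" by simp
    finally show "canonical_twist d (canonical_twist c f) g = f g" .
  qed (use f in \<open>auto simp: canonical_twist_def PiE_def\<close>)
qed

end

context twist_pair
begin

lemma canonical_map_twisted:
  assumes "t \<in> carrier (tensor_group R A A)"
  shows "canonical_map G C t = canonical_twist c (canonical_map G A t)"
proof -
  interpret T: two_modules R A A by (rule self_modules)
  interpret C: galg R G C by (rule twisted_galg)
  interpret C: galg_fin R G C by unfold_locales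
  note tc = tensor_group_cong[OF twC(1,3,4) twC(1,3,4)]
  from assms show ?thesis
  proof (induction t rule: T.tensor_induct)
    case (tens a b)
    have "canonical_map G C (tens R A A a b) = (\<lambda>g\<in>carrier G. (a \<cdot> g) \<star> b)"
      using C.canonical_tens[of a b] tens by (auto simp: tc twC)
    also have "\<dots> = canonical_twist c (\<lambda>g\<in>carrier G. a \<cdot> g \<otimes>\<^sub>A b)"
    proof (rule extensionalityI[of _ "carrier G"])
      fix g assume g: "g \<in> carrier G"
      then show "(\<lambda>g\<in>carrier G. (a \<cdot> g) \<star> b) g = canonical_twist c (\<lambda>g\<in>carrier G. a \<cdot> g \<otimes>\<^sub>A b) g"
        using tens by (auto simp: twist_mult_def canonical_twist_def A.act_mult A.act_act G.m_assoc intro!: asum_cong asum_closed)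
    qed (auto simp: canonical_twist_def)
    finally show ?case using tens by (simp only: canonical_tens)
  next
    case (mult t u)
    have cl: "canonical_map G A t g \<in> carrier A" "canonical_map G A u g \<in> carrier A" if "g \<in> carrier G" for g
      using canonical_closed[OF mult(1)] canonical_closed[OF mult(2)] that by auto
    have "canonical_map G C (t \<otimes>\<^sub>T.T u) = (\<lambda>g\<in>carrier G. canonical_map G C t g \<oplus>\<^sub>C canonical_map G C u g)"
      using C.canonical_mult[of t u] mult by (simp add: tc)
    also have "\<dots> = canonical_twist c (\<lambda>g\<in>carrier G. canonical_map G A t g \<oplus>\<^sub>A canonical_map G A u g)"
    proof (rule extensionalityI[of _ "carrier G"])
      fix g assume g: "g \<in> carrier G"
      have "canonical_twist c (canonical_map G A t) g \<in> carrier A" "canonical_twist c (canonical_map G A u) g \<in> carrier A"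
        using g cl by (auto simp: canonical_twist_def intro!: asum_closed)
      then show "(\<lambda>g\<in>carrier G. canonical_map G C t g \<oplus>\<^sub>C canonical_map G C u g) g
          = canonical_twist c (\<lambda>g\<in>carrier G. canonical_map G A t g \<oplus>\<^sub>A canonical_map G A u g) g"
        using g cl mult by (simp add: twC)
          (simp add: canonical_twist_def A.act_add A.M.smult_r_distr A.A.finsum_addf asum_closed cong: A.A.finsum_cong)
    qed (auto simp: canonical_twist_def)
    finally show ?case using mult by (simp only: canonical_mult)
  qed
qed

theorem canonical_map_bijective_twisted:
  "canonical_map_bijective R G C \<longleftrightarrow> canonical_map_bijective R G A"
proof -
  have tg: "tensor_group R C C = tensor_group R A A" by (rule tensor_group_cong) (auto simp: twC)
  let ?X = "carrier G \<rightarrow>\<^sub>E carrier A" and ?T = "carrier (tensor_group R A A)"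
  note cdi = canonical_twist_inverse[OF c_closed d_closed c_conj dc]
    and dci = canonical_twist_inverse[OF d_closed c_closed d_conj cd]
  have bij: "bij_betw (canonical_twist c) ?X ?X"
    by (rule bij_betwI[where g = "canonical_twist d"]) (use cdi dci in auto)
  have "canonical_map_bijective R G C \<longleftrightarrow> bij_betw (canonical_twist c \<circ> canonical_map G A) ?T ?X"
    unfolding canonical_map_bijective_def tg twC(1)
    by (subst bij_betw_cong[where g = "canonical_twist c \<circ> canonical_map G A"]) (simp_all add: canonical_map_twisted)
  also have "\<dots> \<longleftrightarrow> canonical_map_bijective R G A"
    unfolding canonical_map_bijective_def
  proof
    assume "bij_betw (canonical_map G A) ?T ?X"
    then show "bij_betw (canonical_twist c \<circ> canonical_map G A) ?T ?X" using bij by (rule bij_betw_trans)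
  next
    assume "bij_betw (canonical_twist c \<circ> canonical_map G A) ?T ?X"
    moreover have "canonical_map G A ` ?T \<subseteq> ?X" using canonical_closed by auto
    ultimately show "bij_betw (canonical_map G A) ?T ?X"
      using bij_betw_comp_iff2[OF bij] by blast
  qed
  finally show ?thesis .
qed

end

section \<open>Twisting and change of scalars\<close>

lemma (in lazy_coeffs) twist_sum_hom:
  assumes "cring S" and h: "h \<in> ring_hom R S"
  shows "h (twist_sum R G c) = twist_sum S G (\<lambda>a b. h (c a b))"
    and "h (twist_sum R G d) = twist_sum S G (\<lambda>a b. h (d a b))"
proof -
  interpret S: cring S by fact
  have sum: "h (\<Oplus>\<^sub>R i\<in>carrier G. f i) = (\<Oplus>\<^sub>S i\<in>carrier G. h (f i))" if "\<And>i. i \<in> carrier G \<Longrightarrow> f i \<in> carrier R" for f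
    using that h ring_hom_zero[OF h R.ring_axioms S.ring_axioms]
    by (intro R.finsum_hom S.abelian_monoid_axioms) (auto simp: ring_hom_def)
  have cl: "r \<in> carrier R \<Longrightarrow> h r \<in> carrier S" for r using h by (auto simp: ring_hom_def)
  show "h (twist_sum R G c) = twist_sum S G (\<lambda>a b. h (c a b))"
    "h (twist_sum R G d) = twist_sum S G (\<lambda>a b. h (d a b))"
    unfolding twist_sum_def
    by (subst sum, (auto intro!: R.fsum_closed)[1], intro S.fsum_cong sum S.fsum_closed cl, auto)+
qed

context twist_pair
begin

lemma twisted_semihom:
  assumes "galg S G D" and \<phi>: "\<phi> \<in> ring_hom R S" and f: "galg_semihom R \<phi> G A D f"
    and tw': "twisted S G (\<lambda>a b. \<phi> (c a b)) D D'"
  shows "galg_semihom R \<phi> G C D' f"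
proof -
  interpret D: galg S G D by fact
  interpret S: lazy_coeffs S G "\<lambda>a b. \<phi> (c a b)" "\<lambda>a b. \<phi> (d a b)"
    by (rule lazy_coeffs_hom[OF D.M.R.cring_axioms \<phi>])
  interpret D: twist_pair S G "\<lambda>a b. \<phi> (c a b)" "\<lambda>a b. \<phi> (d a b)" D D'
    using tw' by unfold_locales
  have f': "\<And>a. a \<in> carrier A \<Longrightarrow> f a \<in> carrier D"
    "\<And>a b. a \<in> carrier A \<Longrightarrow> b \<in> carrier A \<Longrightarrow> f (a \<oplus>\<^sub>A b) = f a \<oplus>\<^sub>D f b"
    "\<And>a b. a \<in> carrier A \<Longrightarrow> b \<in> carrier A \<Longrightarrow> f (a \<otimes>\<^sub>A b) = f a \<otimes>\<^sub>D f b"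
    "f \<one>\<^sub>A = \<one>\<^sub>D"
    "\<And>r a. r \<in> carrier R \<Longrightarrow> a \<in> carrier A \<Longrightarrow> f (r \<odot>\<^sub>A a) = \<phi> r \<odot>\<^sub>D f a"
    "\<And>g a. g \<in> carrier G \<Longrightarrow> a \<in> carrier A \<Longrightarrow> f (gact A a g) = gact D (f a) g"
    using f by (auto simp: galg_semihom_def ring_hom_def)
  have f0: "f \<zero>\<^sub>A = \<zero>\<^sub>D"
    using f by (auto simp: galg_semihom_def intro: ring_hom_zero A.A.ring_axioms D.A.ring_axioms)
  have sum: "f (asum F) = (\<Oplus>\<^sub>D g\<in>carrier G. f (F g))" if "\<And>g. g \<in> carrier G \<Longrightarrow> F g \<in> carrier A" for F
    using that f' f0 by (intro A.A.finsum_hom D.A.abelian_monoid_axioms) auto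
  have mult: "f (twist_mult G c A a b) = twist_mult G (\<lambda>a b. \<phi> (c a b)) D (f a) (f b)"
    if "a \<in> carrier A" "b \<in> carrier A" for a b
  proof -
    have "f (twist_mult G c A a b) = (\<Oplus>\<^sub>D g\<in>carrier G. f (asum (\<lambda>h. c g h \<odot>\<^sub>A (a \<cdot> g \<otimes>\<^sub>A b \<cdot> h))))"
      unfolding twist_mult_def using that by (intro sum asum_closed) auto
    also have "\<dots> = (\<Oplus>\<^sub>D g\<in>carrier G. \<Oplus>\<^sub>D h\<in>carrier G. f (c g h \<odot>\<^sub>A (a \<cdot> g \<otimes>\<^sub>A b \<cdot> h)))"
      using that by (intro D.A.fsum_cong sum D.A.fsum_closed f') auto
    also have "\<dots> = twist_mult G (\<lambda>a b. \<phi> (c a b)) D (f a) (f b)"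
      unfolding twist_mult_def using that by (intro D.A.fsum_cong D.A.fsum_closed) (auto simp: f')
    finally show ?thesis .
  qed
  have s: "\<phi> (inv\<^bsub>R\<^esub> twist_sum R G c) = inv\<^bsub>S\<^esub> twist_sum S G (\<lambda>a b. \<phi> (c a b))"
    using sum_units S.sum_units twist_sum_hom[OF D.M.R.cring_axioms \<phi>] by simp
  have u: "inv\<^bsub>R\<^esub> twist_sum R G c \<in> carrier R" using sum_units by auto
  have one: "f \<one>\<^sub>C = \<one>\<^sub>D'"
    using u by (simp add: twC D.twC f' s)
  show ?thesis
    unfolding galg_semihom_def
    using ring_hom_closed[OF \<phi>]
    by (auto intro!: ring_hom_memI simp: twC D.twC f' mult one[unfolded twC D.twC])
qed

text \<open>
  Pure tensors generate, so it suffices to compare the two products of \<open>a \<otimes> x\<close> and \<open>b \<otimes> y\<close>.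
\<close>

lemma base_change_twisted:
  assumes S: "cring S" and \<phi>: "\<phi> \<in> ring_hom R S"
  shows "twisted S G (\<lambda>a b. \<phi> (c a b)) (base_change R \<phi> S A) (base_change R \<phi> S C)"
proof -
  interpret C: galg R G C by (rule twisted_galg)
  interpret S: cring S by fact
  interpret EA: base_ext R G A S \<phi> by unfold_locales (rule \<phi>)
  interpret EC: base_ext R G C S \<phi> by unfold_locales (rule \<phi>)
  interpret SL: lazy_coeffs S G "\<lambda>a b. \<phi> (c a b)" "\<lambda>a b. \<phi> (d a b)"
    by (rule lazy_coeffs_hom[OF S \<phi>])
  let ?c = "\<lambda>a b. \<phi> (c a b)"
  interpret TE: twist_pair S G ?c "\<lambda>a b. \<phi> (d a b)" EA.E "twist_by S G ?c EA.E"
    by unfold_locales (rule twisted_twist_by)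
  have tg: "EC.TT = EA.TT" and tt: "tens R C (algebra_via \<phi> S) = tens R A (algebra_via \<phi> S)"
    by (rule tensor_group_cong(2,3); simp add: twC)+
  have car: "carrier EC.E = carrier EA.E" and zero: "\<zero>\<^sub>EC.E = \<zero>\<^sub>EA.E" and add: "t \<oplus>\<^sub>EC.E u = t \<oplus>\<^sub>EA.E u" for t u
    by (simp_all add: EC.E_carrier EA.E_carrier EC.E_zero EA.E_zero EC.E_add EA.E_add tg)
  have sm: "r \<odot>\<^sub>EC.E t = r \<odot>\<^sub>EA.E t" for r t
    by (simp add: base_change_def Let_def tg tt)
  have act: "gact EC.E t g = gact EA.E t g" if "t \<in> carrier EA.E" "g \<in> carrier G" for t g
    using that
  proof (induction t rule: EA.E_induct)
    case (pure a x)
    then show ?case using EC.E_act_pure[of g a x] EA.E_act_pure[of g a x] by (simp add: tt twC)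
  next
    case (add t u)
    then show ?case using EC.E_act_add[of g t u] EA.E_act_add[of g t u] by (simp add: \<open>\<And>t u. t \<oplus>\<^sub>EC.E u = t \<oplus>\<^sub>EA.E u\<close> car)
  qed
  have psum: "EA.pure (asum F) x = (\<Oplus>\<^sub>EA.E g\<in>carrier G. EA.pure (F g) x)"
    if "\<And>g. g \<in> carrier G \<Longrightarrow> F g \<in> carrier A" "x \<in> carrier S" for F x
    using that by (intro A.A.finsum_hom[where h = "\<lambda>a. EA.pure a x"] EA.E.abelian_monoid_axioms) (auto simp: EA.pure_add_left EA.E_zero)
  have pm: "EA.pure (a \<star> b) (x \<otimes>\<^sub>S y) = twist_mult G ?c EA.E (EA.pure a x) (EA.pure b y)"
    if "a \<in> carrier A" "b \<in> carrier A" "x \<in> carrier S" "y \<in> carrier S" for a b x y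
  proof -
    have "EA.pure (a \<star> b) (x \<otimes>\<^sub>S y) = (\<Oplus>\<^sub>EA.E g\<in>carrier G. EA.pure (asum (\<lambda>h. c g h \<odot>\<^sub>A (a \<cdot> g \<otimes>\<^sub>A b \<cdot> h))) (x \<otimes>\<^sub>S y))"
      unfolding twist_mult_def using that by (intro psum asum_closed) auto
    also have "\<dots> = (\<Oplus>\<^sub>EA.E g\<in>carrier G. \<Oplus>\<^sub>EA.E h\<in>carrier G. EA.pure (c g h \<odot>\<^sub>A (a \<cdot> g \<otimes>\<^sub>A b \<cdot> h)) (x \<otimes>\<^sub>S y))"
      using that by (intro EA.E.fsum_cong psum EA.E.fsum_closed EA.pure_closed) auto
    also have "\<dots> = twist_mult G ?c EA.E (EA.pure a x) (EA.pure b y)"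
      unfolding twist_mult_def using that
      by (intro EA.E.fsum_cong EA.E.fsum_closed) (auto simp: EA.E_act_pure EA.E_mult_pure EA.pure_smult EA.E_smult_pure)
    finally show ?thesis .
  qed
  have mult: "t \<otimes>\<^sub>EC.E u = twist_mult G ?c EA.E t u" if "t \<in> carrier EA.E" "u \<in> carrier EA.E" for t u
    using that
  proof (induction t rule: EA.E_induct)
    case (pure a x)
    from pure(3,1,2) show ?case
    proof (induction u rule: EA.E_induct)
      case (pure b y)
      then show ?case using EC.E_mult_pure[of a x b y] by (simp add: tt twC pm)
    next
      case (add t u)
      then show ?case using EC.E_r_distr[of "EA.pure a x" t u] TE.tmult_bilinear(2)[of "EA.pure a x" t u]
        by (simp add: \<open>\<And>t u. t \<oplus>\<^sub>EC.E u = t \<oplus>\<^sub>EA.E u\<close> car)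
    qed
  next
    case (add t v)
    then show ?case using EC.E_l_distr[of t v u] TE.tmult_bilinear(1)[of u t v]
      by (simp add: \<open>\<And>t u. t \<oplus>\<^sub>EC.E u = t \<oplus>\<^sub>EA.E u\<close> car)
  qed
  have s: "\<phi> (inv\<^bsub>R\<^esub> twist_sum R G c) = inv\<^bsub>S\<^esub> twist_sum S G ?c"
    using sum_units SL.sum_units twist_sum_hom[OF S \<phi>] by simp
  have u: "inv\<^bsub>R\<^esub> twist_sum R G c \<in> carrier R" "inv\<^bsub>S\<^esub> twist_sum S G ?c \<in> carrier S"
    using sum_units SL.sum_units by auto
  have one: "\<one>\<^sub>EC.E = inv\<^bsub>S\<^esub> twist_sum S G ?c \<odot>\<^sub>EA.E \<one>\<^sub>EA.E"
    using u by (simp add: EC.E_one EA.E_one tt twC EA.pure_smult s EA.E_smult_pure)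
  show ?thesis
    unfolding twisted_def by (simp add: car zero add sm act mult one)
qed

end

section \<open>Linear algebra over a field\<close>

locale vspace = K: field K + M: module K M
  for K :: "('r, 'q) ring_scheme" and M :: "('r, 'a, 'm) module_scheme"
begin

definition subsp :: "'a set \<Rightarrow> bool"
  where "subsp V \<longleftrightarrow> V \<subseteq> carrier M \<and> \<zero>\<^sub>M \<in> V \<and> (\<forall>x\<in>V. \<forall>y\<in>V. x \<oplus>\<^sub>M y \<in> V) \<and>
    (\<forall>r\<in>carrier K. \<forall>x\<in>V. r \<odot>\<^sub>M x \<in> V)"

lemma subspI: "V \<subseteq> carrier M \<Longrightarrow> \<zero>\<^sub>M \<in> V \<Longrightarrow> (\<And>x y. x \<in> V \<Longrightarrow> y \<in> V \<Longrightarrow> x \<oplus>\<^sub>M y \<in> V) \<Longrightarrow>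
    (\<And>r x. r \<in> carrier K \<Longrightarrow> x \<in> V \<Longrightarrow> r \<odot>\<^sub>M x \<in> V) \<Longrightarrow> subsp V"
  by (auto simp: subsp_def)

lemma subspD: "subsp V \<Longrightarrow> V \<subseteq> carrier M" "subsp V \<Longrightarrow> \<zero>\<^sub>M \<in> V"
  "subsp V \<Longrightarrow> x \<in> V \<Longrightarrow> y \<in> V \<Longrightarrow> x \<oplus>\<^sub>M y \<in> V"
  "subsp V \<Longrightarrow> r \<in> carrier K \<Longrightarrow> x \<in> V \<Longrightarrow> r \<odot>\<^sub>M x \<in> V"
  by (auto simp: subsp_def)

lemma subsp_minus: "subsp V \<Longrightarrow> x \<in> V \<Longrightarrow> \<ominus>\<^sub>M x \<in> V"
  using subspD(4)[of V "\<ominus>\<^sub>K \<one>\<^sub>K" x] subspD(1)[of V] M.smult_l_minus[of "\<one>\<^sub>K" x] by auto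

lemma subsp_zero: "subsp {\<zero>\<^sub>M }"
  by (auto intro!: subspI)

definition functional :: "('a \<Rightarrow> 'r) \<Rightarrow> bool"
  where "functional f \<longleftrightarrow> (\<forall>x\<in>carrier M. f x \<in> carrier K) \<and>
    (\<forall>x\<in>carrier M. \<forall>y\<in>carrier M. f (x \<oplus>\<^sub>M y) = f x \<oplus>\<^sub>K f y) \<and>
    (\<forall>r\<in>carrier K. \<forall>x\<in>carrier M. f (r \<odot>\<^sub>M x) = r \<otimes>\<^sub>K f x)"

lemma functionalD:
  assumes "functional f"
  shows "x \<in> carrier M \<Longrightarrow> f x \<in> carrier K"
    "x \<in> carrier M \<Longrightarrow> y \<in> carrier M \<Longrightarrow> f (x \<oplus>\<^sub>M y) = f x \<oplus>\<^sub>K f y"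
    "r \<in> carrier K \<Longrightarrow> x \<in> carrier M \<Longrightarrow> f (r \<odot>\<^sub>M x) = r \<otimes>\<^sub>K f x"
  using assms by (simp_all add: functional_def)

text \<open>
  By Zorn's lemma there is a maximal subspace \<open>V\<close> that contains \<open>W\<close> but not \<open>u\<close>. Then each vector is congruent modulo \<open>V\<close>
  to exactly one multiple of \<open>u\<close>.
\<close>

lemma separating_functional:
  assumes W: "subsp W" and u: "u \<in> carrier M" "u \<notin> W"
  obtains f where "functional f" "\<forall>x\<in>W. f x = \<zero>\<^sub>K" "f u = \<one>\<^sub>K"
proof -
  let ?S = "{V. subsp V \<and> W \<subseteq> V \<and> u \<notin> V}"
  have "\<exists>V\<in>?S. \<forall>V'\<in>?S. V \<subseteq> V' \<longrightarrow> V' = V"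
  proof (rule subset_Zorn_nonempty)
    show "?S \<noteq> {}" using W u by auto
    fix \<C> assume ne: "\<C> \<noteq> {}" and ch: "subset.chain ?S \<C>"
    have sub: "subsp V" "W \<subseteq> V" "u \<notin> V" if "V \<in> \<C>" for V
      using that ch by (auto simp: subset.chain_def)
    have tot: "V \<subseteq> V' \<or> V' \<subseteq> V" if "V \<in> \<C>" "V' \<in> \<C>" for V V'
      using that ch by (auto simp: subset.chain_def)
    have "subsp (\<Union>\<C>)"
    proof (rule subspI)
      fix x y assume "x \<in> \<Union>\<C>" "y \<in> \<Union>\<C>"
      then obtain V V' where V: "V \<in> \<C>" "x \<in> V" "V' \<in> \<C>" "y \<in> V'" by auto
      then consider "x \<in> V'" | "y \<in> V" using tot[of V V'] by auto
      then show "x \<oplus>\<^sub>M y \<in> \<Union>\<C>"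
        using V subspD(3)[OF sub(1)[OF V(1)], of x y] subspD(3)[OF sub(1)[OF V(3)], of x y] by cases auto
    next
      fix r x assume "r \<in> carrier K" "x \<in> \<Union>\<C>"
      then show "r \<odot>\<^sub>M x \<in> \<Union>\<C>" using subspD(4)[OF sub(1)] by auto
    next
      show "\<Union>\<C> \<subseteq> carrier M" using subspD(1)[OF sub(1)] by auto
      show "\<zero>\<^sub>M \<in> \<Union>\<C>" using subspD(2)[OF sub(1)] ne by auto
    qed
    moreover have "W \<subseteq> \<Union>\<C>" "u \<notin> \<Union>\<C>" using ne sub(2,3) by blast+
    ultimately show "\<Union>\<C> \<in> ?S" by simp
  qed
  then obtain V where V0: "V \<in> ?S" and max0: "\<forall>V'\<in>?S. V \<subseteq> V' \<longrightarrow> V' = V"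
    by (rule bexE)
  have V: "subsp V" "W \<subseteq> V" "u \<notin> V" using V0 by auto
  have max: "V' = V" if "subsp V'" "W \<subseteq> V'" "u \<notin> V'" "V \<subseteq> V'" for V'
    using max0 that by simp
  note Vc = subspD(1)[OF V(1)]
  have M0: "\<ominus>\<^sub>M \<zero>\<^sub>M = \<zero>\<^sub>M" using M.M.l_neg[of "\<zero>\<^sub>M"] by simp
  have Vm: "x \<ominus>\<^sub>M y \<in> V" if "x \<in> V" "y \<in> V" for x y
    using that subspD(3)[OF V(1)] subsp_minus[OF V(1)] by (auto simp: a_minus_def)
  have ex: "\<exists>x\<in>carrier K. a \<ominus>\<^sub>M x \<odot>\<^sub>M u \<in> V" if a: "a \<in> carrier M" for a
  proof (cases "a \<in> V")
    case True
    then show ?thesis using u a by (intro bexI[where x = "\<zero>\<^sub>K"]) (auto simp: a_minus_def M0)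
  next
    case False
    let ?V' = "{v \<oplus>\<^sub>M r \<odot>\<^sub>M a | v r. v \<in> V \<and> r \<in> carrier K}"
    have sV': "subsp ?V'"
    proof (rule subspI)
      show "?V' \<subseteq> carrier M" using Vc a by auto
      show "\<zero>\<^sub>M \<in> ?V'" using subspD(2)[OF V(1)] a by (auto intro!: exI[where x = "\<zero>\<^sub>M"] exI[where x = "\<zero>\<^sub>K"])
      fix x y assume "x \<in> ?V'" "y \<in> ?V'"
      then obtain v r v' r' where xy: "x = v \<oplus>\<^sub>M r \<odot>\<^sub>M a" "y = v' \<oplus>\<^sub>M r' \<odot>\<^sub>M a" "v \<in> V" "v' \<in> V" "r \<in> carrier K" "r' \<in> carrier K"
        by auto
      then have c: "v \<in> carrier M" "v' \<in> carrier M" using Vc by auto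
      have "x \<oplus>\<^sub>M y = (v \<oplus>\<^sub>M v') \<oplus>\<^sub>M (r \<oplus>\<^sub>K r') \<odot>\<^sub>M a"
        using xy c a by (simp add: M.smult_l_distr M.M.a_ac)
      then show "x \<oplus>\<^sub>M y \<in> ?V'" using xy subspD(3)[OF V(1)] by blast
    next
      fix s x assume s: "s \<in> carrier K" and "x \<in> ?V'"
      then obtain v r where x: "x = v \<oplus>\<^sub>M r \<odot>\<^sub>M a" "v \<in> V" "r \<in> carrier K" by auto
      then have "s \<odot>\<^sub>M x = s \<odot>\<^sub>M v \<oplus>\<^sub>M (s \<otimes>\<^sub>K r) \<odot>\<^sub>M a"
        using s Vc a by (auto simp: M.smult_r_distr M.smult_assoc1 subset_iff)
      then show "s \<odot>\<^sub>M x \<in> ?V'" using x s subspD(4)[OF V(1)] by blast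
    qed
    have VV': "V \<subseteq> ?V'"
    proof
      fix v assume "v \<in> V"
      then show "v \<in> ?V'" using Vc a by (auto intro!: exI[where x = v] exI[where x = "\<zero>\<^sub>K"])
    qed
    have "a \<in> ?V'" using subspD(2)[OF V(1)] a by (auto intro!: exI[where x = "\<zero>\<^sub>M"] exI[where x = "\<one>\<^sub>K"])
    then have "u \<in> ?V'" using max[OF sV' _ _ VV'] V(2) VV' False by blast
    then obtain v r where vr: "u = v \<oplus>\<^sub>M r \<odot>\<^sub>M a" "v \<in> V" "r \<in> carrier K" by auto
    have v: "v \<in> carrier M" using vr Vc by auto
    have r0: "r \<noteq> \<zero>\<^sub>K" using vr V(3) a v by auto
    then have i: "inv\<^bsub>K\<^esub> r \<in> carrier K" "inv\<^bsub>K\<^esub> r \<otimes>\<^sub>K r = \<one>\<^sub>K" using vr K.field_Units by auto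
    have "inv\<^bsub>K\<^esub> r \<odot>\<^sub>M u = inv\<^bsub>K\<^esub> r \<odot>\<^sub>M v \<oplus>\<^sub>M a"
      using vr v a i by (simp add: M.smult_r_distr M.smult_assoc1[symmetric])
    then have "a \<ominus>\<^sub>M inv\<^bsub>K\<^esub> r \<odot>\<^sub>M u = \<ominus>\<^sub>M (inv\<^bsub>K\<^esub> r \<odot>\<^sub>M v)"
      using v a i by (simp add: a_minus_def M.M.minus_add M.M.a_ac M.M.r_neg1 M.M.r_neg2)
    also have "\<dots> \<in> V" using vr i by (intro subsp_minus[OF V(1)] subspD(4)[OF V(1)])
    finally show ?thesis using i by auto
  qed
  have un: "x = y" if "x \<in> carrier K" "y \<in> carrier K" "a \<in> carrier M" "a \<ominus>\<^sub>M x \<odot>\<^sub>M u \<in> V" "a \<ominus>\<^sub>M y \<odot>\<^sub>M u \<in> V" for a x y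
  proof (rule ccontr)
    assume ne: "x \<noteq> y"
    let ?z = "x \<ominus>\<^sub>K y"
    have z: "?z \<in> carrier K" "?z \<noteq> \<zero>\<^sub>K" using that ne K.r_right_minus_eq[of x y] by auto
    have d: "(a \<ominus>\<^sub>M y \<odot>\<^sub>M u) \<ominus>\<^sub>M (a \<ominus>\<^sub>M x \<odot>\<^sub>M u) = ?z \<odot>\<^sub>M u"
      using that(1-3) u by (simp add: a_minus_def M.smult_l_distr M.smult_l_minus M.M.minus_add M.M.a_ac M.M.r_neg1 M.M.r_neg2)
    have zU: "?z \<in> Units K" using z K.field_Units by simp
    have "?z \<odot>\<^sub>M u \<in> V" using Vm[OF that(5,4)] by (simp only: d)
    then have "inv\<^bsub>K\<^esub> ?z \<odot>\<^sub>M (?z \<odot>\<^sub>M u) \<in> V"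
      by (rule subspD(4)[OF V(1) K.Units_inv_closed[OF zU]])
    moreover have "inv\<^bsub>K\<^esub> ?z \<odot>\<^sub>M (?z \<odot>\<^sub>M u) = u"
      using zU z(1) u by (simp add: M.smult_assoc1[symmetric])
    ultimately show False using V by simp
  qed
  define f where "f a = (THE x. x \<in> carrier K \<and> a \<ominus>\<^sub>M x \<odot>\<^sub>M u \<in> V)" for a
  have f: "f a \<in> carrier K \<and> a \<ominus>\<^sub>M f a \<odot>\<^sub>M u \<in> V" if aM: "a \<in> carrier M" for a
  proof -
    obtain x where x: "x \<in> carrier K" "a \<ominus>\<^sub>M x \<odot>\<^sub>M u \<in> V" using ex[OF aM] by (rule bexE)
    have "f a = x"
      unfolding f_def
    proof (rule the_equality)
      show "x \<in> carrier K \<and> a \<ominus>\<^sub>M x \<odot>\<^sub>M u \<in> V" using x by simp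
      fix y assume y: "y \<in> carrier K \<and> a \<ominus>\<^sub>M y \<odot>\<^sub>M u \<in> V"
      show "y = x" by (rule un[OF conjunct1[OF y] x(1) aM conjunct2[OF y] x(2)])
    qed
    with x show ?thesis by simp
  qed
  have feq: "f a = x" if "a \<in> carrier M" "x \<in> carrier K" "a \<ominus>\<^sub>M x \<odot>\<^sub>M u \<in> V" for a x
    by (rule un[OF conjunct1[OF f[OF that(1)]] that(2,1) conjunct2[OF f[OF that(1)]] that(3)])
  show ?thesis
  proof (rule that[of f])
    show "functional f"
      unfolding functional_def
    proof (intro conjI ballI)
    show "f x \<in> carrier K" if "x \<in> carrier M" for x using f[OF that] by simp
    show "f (x \<oplus>\<^sub>M y) = f x \<oplus>\<^sub>K f y" if xy: "x \<in> carrier M" "y \<in> carrier M" for x y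
    proof (rule feq)
      have "(x \<oplus>\<^sub>M y) \<ominus>\<^sub>M (f x \<oplus>\<^sub>K f y) \<odot>\<^sub>M u = (x \<ominus>\<^sub>M f x \<odot>\<^sub>M u) \<oplus>\<^sub>M (y \<ominus>\<^sub>M f y \<odot>\<^sub>M u)"
        using xy f u by (simp add: a_minus_def M.smult_l_distr M.M.minus_add M.M.a_ac)
      then show "(x \<oplus>\<^sub>M y) \<ominus>\<^sub>M (f x \<oplus>\<^sub>K f y) \<odot>\<^sub>M u \<in> V" using f xy subspD(3)[OF V(1)] by simp
    qed (use xy f in auto)
    show "f (r \<odot>\<^sub>M x) = r \<otimes>\<^sub>K f x" if xy: "r \<in> carrier K" "x \<in> carrier M" for r x
    proof (rule feq)
      have "r \<odot>\<^sub>M x \<ominus>\<^sub>M (r \<otimes>\<^sub>K f x) \<odot>\<^sub>M u = r \<odot>\<^sub>M (x \<ominus>\<^sub>M f x \<odot>\<^sub>M u)"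
        using xy f u by (simp add: a_minus_def M.smult_r_distr M.smult_r_minus M.smult_assoc1)
      then show "r \<odot>\<^sub>M x \<ominus>\<^sub>M (r \<otimes>\<^sub>K f x) \<odot>\<^sub>M u \<in> V" using f xy subspD(4)[OF V(1)] by simp
    qed (use xy f in auto)
    qed
    show "\<forall>x\<in>W. f x = \<zero>\<^sub>K"
    proof
      fix x assume x: "x \<in> W"
      show "f x = \<zero>\<^sub>K"
        using subsetD[OF V(2) x] subsetD[OF Vc subsetD[OF V(2) x]] u
        by (intro feq) (auto simp: a_minus_def M0)
    qed
    show "f u = \<one>\<^sub>K"
      using u subspD(2)[OF V(1)] by (intro feq) (auto simp: a_minus_def M.M.r_neg)
  qed
qed

end

lemma (in field) homogeneous_system:
  fixes m :: "'i \<Rightarrow> 'j \<Rightarrow> 'a"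
  assumes "finite I" "finite J" "card I < card J" "\<And>i j. i \<in> I \<Longrightarrow> j \<in> J \<Longrightarrow> m i j \<in> carrier R"
  shows "\<exists>c. (\<forall>j\<in>J. c j \<in> carrier R) \<and> (\<exists>j\<in>J. c j \<noteq> \<zero>) \<and> (\<forall>i\<in>I. (\<Oplus>j\<in>J. c j \<otimes> m i j) = \<zero>)"
  using assms
proof (induction I arbitrary: J m rule: finite_induct)
  case empty
  then show ?case by (intro exI[where x = "\<lambda>_. \<one>"]) (auto simp: card_gt_0_iff)
next
  case (insert i I)
  show ?case
  proof (cases "\<forall>j\<in>J. m i j = \<zero>")
    case True
    obtain j0 where j0: "j0 \<in> J" using insert.prems(2) by (metis card.empty equals0I less_nat_zero_code)
    have "card I < card J" using insert by (simp add: less_Suc_eq_le Suc_le_eq)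
    then obtain c where c: "\<forall>j\<in>J. c j \<in> carrier R" "\<exists>j\<in>J. c j \<noteq> \<zero>" "\<forall>i\<in>I. (\<Oplus>j\<in>J. c j \<otimes> m i j) = \<zero>"
      using insert.IH[of J m] insert.prems by auto
    have "(\<Oplus>j\<in>J. c j \<otimes> m i j) = (\<Oplus>j\<in>J. \<zero>)" using True c by (intro fsum_cong) auto
    then show ?thesis using c by (intro exI[where x = c]) (auto simp: finsum_zero)
  next
    case False
    then obtain j0 where j0: "j0 \<in> J" "m i j0 \<noteq> \<zero>" by auto
    let ?J = "J - {j0}"
    have J: "J = Set.insert j0 ?J" using j0 by auto
    have fJ: "finite ?J" using insert by auto
    have mc [simp]: "m a b \<in> carrier R" if "a \<in> Set.insert i I" "b \<in> J" for a b using insert that by auto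
    let ?v = "inv (m i j0)"
    have v: "?v \<in> carrier R" "?v \<otimes> m i j0 = \<one>" using j0 field_Units mc[of i j0] by auto
    define m' where "m' a j = m a j \<ominus> (m a j0 \<otimes> ?v) \<otimes> m i j" for a j
    have "card I < card ?J" using insert j0 by simp
    moreover have mc': "m' a j \<in> carrier R" if "a \<in> I" "j \<in> ?J" for a j using that v j0 by (auto simp: m'_def)
    ultimately have "\<exists>c. (\<forall>j\<in>?J. c j \<in> carrier R) \<and> (\<exists>j\<in>?J. c j \<noteq> \<zero>) \<and> (\<forall>i\<in>I. (\<Oplus>j\<in>?J. c j \<otimes> m' i j) = \<zero>)"
      using fJ by (intro insert.IH)
    then obtain c where c: "\<And>j. j \<in> ?J \<Longrightarrow> c j \<in> carrier R" "\<exists>j\<in>?J. c j \<noteq> \<zero>" "\<And>i. i \<in> I \<Longrightarrow> (\<Oplus>j\<in>?J. c j \<otimes> m' i j) = \<zero>"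
      by blast
    define s where "s = (\<Oplus>j\<in>?J. c j \<otimes> m i j)"
    have s: "s \<in> carrier R" unfolding s_def using c by (intro fsum_closed) auto
    define c' where "c' = c(j0 := \<ominus> (?v \<otimes> s))"
    have c'c: "c' j \<in> carrier R" if "j \<in> J" for j using that c v s by (auto simp: c'_def)
    have sp: "(\<Oplus>j\<in>J. c' j \<otimes> m a j) = \<ominus> (?v \<otimes> s) \<otimes> m a j0 \<oplus> (\<Oplus>j\<in>?J. c j \<otimes> m a j)" if a: "a \<in> Set.insert i I" for a
    proof -
      have "(\<Oplus>j\<in>J. c' j \<otimes> m a j) = (\<Oplus>j\<in>Set.insert j0 ?J. c' j \<otimes> m a j)" using J by simp
      also have "\<dots> = c' j0 \<otimes> m a j0 \<oplus> (\<Oplus>j\<in>?J. c' j \<otimes> m a j)"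
        using fJ a c'c j0 by (intro finsum_insert) (auto simp del: mc intro!: m_closed mc)
      also have "(\<Oplus>j\<in>?J. c' j \<otimes> m a j) = (\<Oplus>j\<in>?J. c j \<otimes> m a j)"
        using a c by (intro fsum_cong) (auto simp: c'_def)
      finally show ?thesis by (simp add: c'_def)
    qed
    have "(\<Oplus>j\<in>J. c' j \<otimes> m i j) = \<zero>"
    proof -
      have "(?v \<otimes> s) \<otimes> m i j0 = (?v \<otimes> m i j0) \<otimes> s"
        using v(1) s mc[OF insertI1 j0(1)] by (simp only: m_ac m_closed)
      then have "\<ominus> (?v \<otimes> s) \<otimes> m i j0 = \<ominus> s"
        using v s mc[OF insertI1 j0(1)] by (simp add: l_minus)
      with sp[OF insertI1] s show ?thesis by (simp add: s_def[symmetric] l_neg)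
    qed
    moreover have "(\<Oplus>j\<in>J. c' j \<otimes> m a j) = \<zero>" if a: "a \<in> I" for a
    proof -
      have "\<zero> = (\<Oplus>j\<in>?J. c j \<otimes> m' a j)" using c a by simp
      also have "\<dots> = (\<Oplus>j\<in>?J. c j \<otimes> m a j \<oplus> \<ominus> (m a j0 \<otimes> ?v) \<otimes> (c j \<otimes> m i j))"
        using a c v j0 by (intro fsum_cong) (auto simp: m'_def a_minus_def r_distr l_minus r_minus m_ac)
      also have "\<dots> = (\<Oplus>j\<in>?J. c j \<otimes> m a j) \<oplus> (\<Oplus>j\<in>?J. \<ominus> (m a j0 \<otimes> ?v) \<otimes> (c j \<otimes> m i j))"
        using a c v j0 by (intro finsum_addf) auto
      also have "(\<Oplus>j\<in>?J. \<ominus> (m a j0 \<otimes> ?v) \<otimes> (c j \<otimes> m i j)) = \<ominus> (m a j0 \<otimes> ?v) \<otimes> s"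
        unfolding s_def using a c v j0 by (intro mult_fsum[symmetric]) auto
      finally have "\<zero> = (\<Oplus>j\<in>?J. c j \<otimes> m a j) \<oplus> \<ominus> (m a j0 \<otimes> ?v) \<otimes> s" .
      moreover have "\<ominus> (m a j0 \<otimes> ?v) \<otimes> s = \<ominus> (?v \<otimes> s) \<otimes> m a j0"
        using a v s j0 by (simp add: l_minus r_minus m_ac)
      moreover have "(\<Oplus>j\<in>?J. c j \<otimes> m a j) \<in> carrier R" using a c by (intro fsum_closed) auto
      ultimately show ?thesis using sp[of a] a v s j0 by (simp add: a_comm)
    qed
    moreover have "\<exists>j\<in>J. c' j \<noteq> \<zero>" using c(2) by (auto simp: c'_def)
    ultimately show ?thesis using c'c by (intro exI[where x = c']) auto
  qed
qed

section \<open>Algebras over an algebraically closed field\<close>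

locale closed_galg = L: algebraically_closed L + W: galg L G W
  for L :: "('l, 'q) ring_scheme" and G :: "('g, 'm) monoid_scheme" (structure) and W :: "('l, 'w, 'g) galg"
begin

fun poly_val :: "'l list \<Rightarrow> 'w \<Rightarrow> 'w"
  where "poly_val [] w = \<zero>\<^sub>W"
  | "poly_val (c # cs) w = c \<odot>\<^sub>W \<one>\<^sub>W \<oplus>\<^sub>W w \<otimes>\<^sub>W poly_val cs w"

definition shift :: "'w \<Rightarrow> 'l \<Rightarrow> 'w"
  where "shift w l = w \<ominus>\<^sub>W l \<odot>\<^sub>W \<one>\<^sub>W"

text \<open>
  The value at \<open>w\<close> of the polynomial with the roots \<open>ls\<close>, applied to a vector: for \<open>1\<close> it says that \<open>w\<close> is
  algebraic, for other vectors it leads to eigenvectors.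
\<close>

definition split_val :: "'l list \<Rightarrow> 'w \<Rightarrow> 'w \<Rightarrow> 'w"
  where "split_val ls w = foldr (\<lambda>l x. shift w l \<otimes>\<^sub>W x) ls"

lemma split_val_simps [simp]:
  "split_val [] w x = x" "split_val (l # ls) w x = shift w l \<otimes>\<^sub>W split_val ls w x"
  by (simp_all add: split_val_def)

lemma shift_closed [simp, intro]: "w \<in> carrier W \<Longrightarrow> l \<in> carrier L \<Longrightarrow> shift w l \<in> carrier W"
  by (simp add: shift_def)

lemma poly_val_closed [simp, intro]: "w \<in> carrier W \<Longrightarrow> set cs \<subseteq> carrier L \<Longrightarrow> poly_val cs w \<in> carrier W"
  by (induction cs) auto

lemma split_val_closed [simp, intro]:
  "w \<in> carrier W \<Longrightarrow> set ls \<subseteq> carrier L \<Longrightarrow> x \<in> carrier W \<Longrightarrow> split_val ls w x \<in> carrier W"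
  by (induction ls) auto

lemma split_val_mult:
  "w \<in> carrier W \<Longrightarrow> set ls \<subseteq> carrier L \<Longrightarrow> x \<in> carrier W \<Longrightarrow>
    split_val ls w x = split_val ls w \<one>\<^sub>W \<otimes>\<^sub>W x"
proof (induction ls)
  case (Cons l ls)
  then show ?case using W.A.m_assoc[of "shift w l" "split_val ls w \<one>\<^sub>W" x] by auto
qed auto

lemma poly_val_snoc:
  "w \<in> carrier W \<Longrightarrow> set cs \<subseteq> carrier L \<Longrightarrow> c \<in> carrier L \<Longrightarrow>
    poly_val (cs @ [c]) w = poly_val cs w \<oplus>\<^sub>W c \<odot>\<^sub>W w [^]\<^sub>W length cs"
proof (induction cs)
  case (Cons b cs)
  have "w \<otimes>\<^sub>W w [^]\<^sub>W length cs = w [^]\<^sub>W Suc (length cs)"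
    using Cons.prems W.A.nat_pow_Suc2 by simp
  then show ?case
    using Cons by (simp add: W.A.r_distr W.smult_mult_right W.A.a_assoc del: W.A.nat_pow_Suc)
qed auto

lemma poly_val_sum:
  assumes "w \<in> carrier W" "\<And>j. c j \<in> carrier L"
  shows "poly_val (map c [0..<n]) w = (\<Oplus>\<^sub>W j\<in>{..<n}. c j \<odot>\<^sub>W w [^]\<^sub>W j)"
proof (induction n)
  case (Suc n)
  then show ?case using assms
    by (simp add: poly_val_snoc lessThan_Suc W.A.a_comm image_subset_iff W.A.finsum_closed)
qed (simp add: W.A.finsum_empty)

text \<open>Division of a polynomial by \<open>X - x\<close>; the remainder is the value at \<open>x\<close>.\<close>

lemma synthetic_division:
  assumes "w \<in> carrier W" "x \<in> carrier L" "set cs \<subseteq> carrier L" "cs \<noteq> []"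
  shows "\<exists>bs. set bs \<subseteq> carrier L \<and> length cs = Suc (length bs) \<and> (bs \<noteq> [] \<longrightarrow> last bs = last cs) \<and>
    poly_val cs w = shift w x \<otimes>\<^sub>W poly_val bs w \<oplus>\<^sub>W L.eval (rev cs) x \<odot>\<^sub>W \<one>\<^sub>W"
  using assms(3,4)
proof (induction cs)
  case (Cons c cs)
  show ?case
  proof (cases "cs = []")
    case True
    then show ?thesis using Cons.prems assms by (intro exI[where x = "[]"]) auto
  next
    case False
    then obtain bs where bs: "set bs \<subseteq> carrier L" "length cs = Suc (length bs)" "bs \<noteq> [] \<longrightarrow> last bs = last cs"
      "poly_val cs w = shift w x \<otimes>\<^sub>W poly_val bs w \<oplus>\<^sub>W L.eval (rev cs) x \<odot>\<^sub>W \<one>\<^sub>W"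
      using Cons by auto
    let ?v = "L.eval (rev cs) x"
    have v: "?v \<in> carrier L" using Cons.prems assms by (intro L.eval_in_carrier) auto
    have ev: "L.eval (rev (c # cs)) x = ?v \<otimes>\<^sub>L x \<oplus>\<^sub>L c"
      using Cons.prems assms by (simp add: L.eval_append_aux)
    let ?b = "poly_val bs w"
    have b: "?b \<in> carrier W" using bs assms by auto
    have comm: "w \<otimes>\<^sub>W shift w x = shift w x \<otimes>\<^sub>W w"
      using assms by (simp add: shift_def a_minus_def W.A.r_distr W.A.l_distr W.A.r_minus W.A.l_minus
          W.smult_mult_left W.smult_mult_right)
    have e1: "w \<otimes>\<^sub>W (shift w x \<otimes>\<^sub>W ?b) = shift w x \<otimes>\<^sub>W (w \<otimes>\<^sub>W ?b)"
      using comm assms b by (simp add: W.A.m_assoc[symmetric])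
    have e2: "w \<otimes>\<^sub>W (?v \<odot>\<^sub>W \<one>\<^sub>W) = shift w x \<otimes>\<^sub>W (?v \<odot>\<^sub>W \<one>\<^sub>W) \<oplus>\<^sub>W (?v \<otimes>\<^sub>L x) \<odot>\<^sub>W \<one>\<^sub>W"
    proof -
      have "shift w x \<oplus>\<^sub>W x \<odot>\<^sub>W \<one>\<^sub>W = w"
        using assms by (simp add: shift_def a_minus_def W.A.a_assoc W.A.l_neg)
      then have "w \<otimes>\<^sub>W (?v \<odot>\<^sub>W \<one>\<^sub>W) = (shift w x \<oplus>\<^sub>W x \<odot>\<^sub>W \<one>\<^sub>W) \<otimes>\<^sub>W (?v \<odot>\<^sub>W \<one>\<^sub>W)" by simp
      also have "\<dots> = shift w x \<otimes>\<^sub>W (?v \<odot>\<^sub>W \<one>\<^sub>W) \<oplus>\<^sub>W (?v \<otimes>\<^sub>L x) \<odot>\<^sub>W \<one>\<^sub>W"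
        using assms v by (simp add: W.A.l_distr W.smult_mult_left W.smult_mult_right W.M.smult_assoc1 W.M.smult_r_distr)
      finally show ?thesis .
    qed
    have "poly_val (c # cs) w = c \<odot>\<^sub>W \<one>\<^sub>W \<oplus>\<^sub>W (shift w x \<otimes>\<^sub>W (w \<otimes>\<^sub>W ?b) \<oplus>\<^sub>W w \<otimes>\<^sub>W (?v \<odot>\<^sub>W \<one>\<^sub>W))"
      using assms b v by (simp add: bs(4) W.A.r_distr e1)
    also have "\<dots> = shift w x \<otimes>\<^sub>W poly_val (?v # bs) w \<oplus>\<^sub>W L.eval (rev (c # cs)) x \<odot>\<^sub>W \<one>\<^sub>W"
      unfolding e2 ev using Cons.prems assms b v by (simp add: W.A.r_distr W.M.smult_l_distr W.A.a_ac)
    finally have "poly_val (c # cs) w = \<dots>" .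
    moreover have "last (?v # bs) = last (c # cs)"
    proof (cases "bs = []")
      case True
      then obtain c' where "cs = [c']" using bs(2) by (cases cs) auto
      then show ?thesis using True Cons.prems assms by simp
    qed (use bs False in auto)
    ultimately show ?thesis using bs v False by (intro exI[where x = "?v # bs"]) auto
  qed
qed simp

lemma poly_val_split:
  assumes "w \<in> carrier W"
  shows "set cs \<subseteq> carrier L \<Longrightarrow> cs \<noteq> [] \<Longrightarrow> last cs \<noteq> \<zero>\<^sub>L \<Longrightarrow>
    \<exists>ls. set ls \<subseteq> carrier L \<and> poly_val cs w = last cs \<odot>\<^sub>W split_val ls w \<one>\<^sub>W"
proof (induction "length cs" arbitrary: cs rule: less_induct)
  case less
  show ?case
  proof (cases "length cs = 1")
    case True
    then obtain c where "cs = [c]" by (cases cs) auto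
    then show ?thesis using less assms by (intro exI[where x = "[]"]) auto
  next
    case False
    have p: "rev cs \<in> carrier (poly_ring L)"
      using less.prems by (auto simp: univ_poly_carrier[symmetric] polynomial_def hd_rev)
    have "L.splitted (rev cs)" by (rule L.roots_over_carrier[OF p])
    then have "size (L.roots (rev cs)) > 0"
      using False less.prems(2) by (cases cs) (auto simp: L.splitted_def)
    then obtain x where "x \<in># L.roots (rev cs)" by (metis multiset_nonemptyE size_empty less_irrefl)
    then have "L.is_root (rev cs) x" using L.roots_mem_iff_is_root[OF p] by simp
    then have x: "x \<in> carrier L" "L.eval (rev cs) x = \<zero>\<^sub>L" by (auto simp: L.is_root_def)
    obtain bs where bs: "set bs \<subseteq> carrier L" "length cs = Suc (length bs)" "bs \<noteq> [] \<longrightarrow> last bs = last cs"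
      "poly_val cs w = shift w x \<otimes>\<^sub>W poly_val bs w \<oplus>\<^sub>W L.eval (rev cs) x \<odot>\<^sub>W \<one>\<^sub>W"
      using synthetic_division[OF assms x(1) less.prems(1,2)] by auto
    have bs0: "bs \<noteq> []" using bs(2) False by auto
    then obtain ls where ls: "set ls \<subseteq> carrier L" "poly_val bs w = last bs \<odot>\<^sub>W split_val ls w \<one>\<^sub>W"
      using less.hyps[of bs] bs less.prems by auto
    have "last cs \<in> carrier L" using less.prems by auto
    then show ?thesis
      using ls x bs bs0 assms by (intro exI[where x = "x # ls"]) (simp add: W.smult_mult_right)
  qed
qed

lemma poly_val_strip:
  "w \<in> carrier W \<Longrightarrow> set cs \<subseteq> carrier L \<Longrightarrow> poly_val cs w = \<zero>\<^sub>W \<Longrightarrow> \<exists>c\<in>set cs. c \<noteq> \<zero>\<^sub>L \<Longrightarrow>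
    \<exists>bs. set bs \<subseteq> carrier L \<and> bs \<noteq> [] \<and> last bs \<noteq> \<zero>\<^sub>L \<and> poly_val bs w = \<zero>\<^sub>W"
proof (induction cs rule: rev_induct)
  case (snoc c cs)
  show ?case
  proof (cases "c = \<zero>\<^sub>L")
    case True
    then show ?thesis using snoc by (auto simp: poly_val_snoc)
  next
    case False
    then show ?thesis using snoc.prems by (intro exI[where x = "cs @ [c]"]) auto
  qed
qed simp

text \<open>
  In a finite-dimensional algebra the powers of an element are dependent, so every element is a
  root of a polynomial that splits.
\<close>

lemma algebraic_split:
  assumes Y: "finite Y" "Y \<subseteq> carrier W"
    and span: "\<And>a. a \<in> carrier W \<Longrightarrow> \<exists>x\<in>Y \<rightarrow> carrier L. a = (\<Oplus>\<^sub>W y\<in>Y. x y \<odot>\<^sub>W y)"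
    and w: "w \<in> carrier W"
  obtains ls where "set ls \<subseteq> carrier L" "split_val ls w \<one>\<^sub>W = \<zero>\<^sub>W"
proof -
  let ?J = "{..<Suc (card Y)}"
  have "\<forall>j::nat. \<exists>x. x \<in> Y \<rightarrow> carrier L \<and> w [^]\<^sub>W j = (\<Oplus>\<^sub>W y\<in>Y. x y \<odot>\<^sub>W y)"
    using span[OF W.A.nat_pow_closed[OF w]] by (simp add: Bex_def)
  from choice[OF this] obtain m
    where m: "\<And>j::nat. m j \<in> Y \<rightarrow> carrier L \<and> w [^]\<^sub>W j = (\<Oplus>\<^sub>W y\<in>Y. m j y \<odot>\<^sub>W y)"
    by blast
  have mc: "m j y \<in> carrier L" if "y \<in> Y" for j y using m that by auto
  have Yc: "y \<in> carrier W" if "y \<in> Y" for y using Y that by auto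
  obtain c where c: "\<forall>j\<in>?J. c j \<in> carrier L" "\<exists>j\<in>?J. c j \<noteq> \<zero>\<^sub>L" "\<forall>y\<in>Y. (\<Oplus>\<^sub>L j\<in>?J. c j \<otimes>\<^sub>L m j y) = \<zero>\<^sub>L"
    using L.homogeneous_system[of Y ?J "\<lambda>y j. m j y"] Y mc by auto
  define c' where "c' j = (if j \<in> ?J then c j else \<zero>\<^sub>L)" for j
  have c': "c' j \<in> carrier L" for j using c by (auto simp: c'_def)
  have "poly_val (map c' [0..<Suc (card Y)]) w = (\<Oplus>\<^sub>W j\<in>?J. c' j \<odot>\<^sub>W w [^]\<^sub>W j)"
    using poly_val_sum[OF w c', where n = "Suc (card Y)"] by (simp del: upt_Suc)
  also have "\<dots> = (\<Oplus>\<^sub>W j\<in>?J. \<Oplus>\<^sub>W y\<in>Y. (c j \<otimes>\<^sub>L m j y) \<odot>\<^sub>W y)"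
  proof (rule W.A.fsum_cong)
    fix j assume j: "j \<in> ?J"
    have "c' j \<odot>\<^sub>W w [^]\<^sub>W j = c j \<odot>\<^sub>W (\<Oplus>\<^sub>W y\<in>Y. m j y \<odot>\<^sub>W y)"
      using m[of j] j by (simp add: c'_def)
    also have "\<dots> = (\<Oplus>\<^sub>W y\<in>Y. c j \<odot>\<^sub>W (m j y \<odot>\<^sub>W y))"
      using c j mc Yc by (intro W.smult_finsum) auto
    also have "\<dots> = (\<Oplus>\<^sub>W y\<in>Y. (c j \<otimes>\<^sub>L m j y) \<odot>\<^sub>W y)"
      using c j mc Yc by (intro W.A.fsum_cong) (auto simp: W.M.smult_assoc1)
    finally show "c' j \<odot>\<^sub>W w [^]\<^sub>W j = \<dots>" .
  qed (use c mc Yc in \<open>auto intro!: W.A.fsum_closed\<close>)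
  also have "\<dots> = (\<Oplus>\<^sub>W y\<in>Y. \<Oplus>\<^sub>W j\<in>?J. (c j \<otimes>\<^sub>L m j y) \<odot>\<^sub>W y)"
    using c mc Yc Y by (intro W.A.finsum_swap) auto
  also have "\<dots> = (\<Oplus>\<^sub>W y\<in>Y. \<zero>\<^sub>W)"
  proof (rule W.A.fsum_cong)
    fix y assume y: "y \<in> Y"
    have "(\<Oplus>\<^sub>W j\<in>?J. (c j \<otimes>\<^sub>L m j y) \<odot>\<^sub>W y) = (\<Oplus>\<^sub>L j\<in>?J. c j \<otimes>\<^sub>L m j y) \<odot>\<^sub>W y"
      using c mc[OF y] Yc[OF y] by (intro W.finsum_smult[symmetric]) auto
    then show "(\<Oplus>\<^sub>W j\<in>?J. (c j \<otimes>\<^sub>L m j y) \<odot>\<^sub>W y) = \<zero>\<^sub>W" using c(3) y Yc[OF y] by simp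
  qed auto
  also have "\<dots> = \<zero>\<^sub>W" by (simp add: W.A.finsum_zero)
  finally have z: "poly_val (map c' [0..<Suc (card Y)]) w = \<zero>\<^sub>W" .
  obtain j where j: "j \<in> ?J" "c j \<noteq> \<zero>\<^sub>L" using c(2) by blast
  have "c' j \<in> set (map c' [0..<Suc (card Y)])" using j by (simp del: upt_Suc)
  then have "\<exists>c\<in>set (map c' [0..<Suc (card Y)]). c \<noteq> \<zero>\<^sub>L" using j by (auto simp: c'_def simp del: upt_Suc)
  from poly_val_strip[OF w _ z this] obtain bs where
    bs: "set bs \<subseteq> carrier L" "bs \<noteq> []" "last bs \<noteq> \<zero>\<^sub>L" "poly_val bs w = \<zero>\<^sub>W"
    using c' by auto
  obtain ls where ls: "set ls \<subseteq> carrier L" "poly_val bs w = last bs \<odot>\<^sub>W split_val ls w \<one>\<^sub>W"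
    using poly_val_split[OF w bs(1-3)] by auto
  have b: "last bs \<in> Units L" using bs L.field_Units by auto
  have "split_val ls w \<one>\<^sub>W = inv\<^bsub>L\<^esub> (last bs) \<odot>\<^sub>W (last bs \<odot>\<^sub>W split_val ls w \<one>\<^sub>W)"
    using b w ls L.Units_closed[OF b] by (simp add: W.M.smult_assoc1[symmetric])
  also have "\<dots> = \<zero>\<^sub>W" using b bs(4) ls by simp
  finally show ?thesis using that ls by blast
qed

text \<open>
  Division of \<open>\<Prod> (X - a)\<close> by \<open>X - l\<close> leaves a nonzero constant \<open>\<mu>\<close>, hence \<open>(w - l) q = - \<mu>\<close> for the quotient \<open>q\<close> at \<open>w\<close>.
\<close>

lemma shift_unit:
  assumes w: "w \<in> carrier W" and ls: "set ls \<subseteq> carrier L" "split_val ls w \<one>\<^sub>W = \<zero>\<^sub>W"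
    and l: "l \<in> carrier L" "l \<notin> set ls"
  shows "shift w l \<in> Units W"
proof -
  have sc: "shift w a \<otimes>\<^sub>W shift w b = shift w b \<otimes>\<^sub>W shift w a" if "a \<in> carrier L" "b \<in> carrier L" for a b
    using w that by (simp add: shift_def a_minus_def W.A.r_distr W.A.l_distr W.A.r_minus W.A.l_minus
          W.smult_mult_left W.smult_mult_right W.A.a_ac W.A.minus_add W.M.smult_r_distr W.M.smult_r_minus
          W.M.smult_assoc1[symmetric] L.m_comm)
  let ?s = "shift w l"
  have "set ls \<subseteq> carrier L \<Longrightarrow> l \<notin> set ls \<Longrightarrow> \<exists>q\<in>carrier W. \<exists>\<mu>\<in>carrier L. \<mu> \<noteq> \<zero>\<^sub>L \<and> ?s \<otimes>\<^sub>W q = q \<otimes>\<^sub>W ?s \<and>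
      split_val ls w \<one>\<^sub>W = ?s \<otimes>\<^sub>W q \<oplus>\<^sub>W \<mu> \<odot>\<^sub>W \<one>\<^sub>W"
  proof (induction ls)
    case Nil
    show ?case by (rule bexI[where x = "\<zero>\<^sub>W"], rule bexI[where x = "\<one>\<^sub>L"]) (use w l in auto)
  next
    case (Cons a ls)
    then obtain q \<mu> where q: "q \<in> carrier W" "\<mu> \<in> carrier L" "\<mu> \<noteq> \<zero>\<^sub>L" "?s \<otimes>\<^sub>W q = q \<otimes>\<^sub>W ?s"
      "split_val ls w \<one>\<^sub>W = ?s \<otimes>\<^sub>W q \<oplus>\<^sub>W \<mu> \<odot>\<^sub>W \<one>\<^sub>W"
      by auto
    have a: "a \<in> carrier L" "a \<noteq> l" using Cons.prems by auto
    let ?q = "shift w a \<otimes>\<^sub>W q \<oplus>\<^sub>W \<mu> \<odot>\<^sub>W \<one>\<^sub>W" and ?\<mu> = "\<mu> \<otimes>\<^sub>L (l \<ominus>\<^sub>L a)"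
    have sl: "?s \<in> carrier W" "shift w a \<in> carrier W" using w l a by auto
    have d: "l \<ominus>\<^sub>L a \<in> carrier L" "l \<ominus>\<^sub>L a \<noteq> \<zero>\<^sub>L" using a l L.r_right_minus_eq[of l a] by auto
    have sa: "shift w a = ?s \<oplus>\<^sub>W (l \<ominus>\<^sub>L a) \<odot>\<^sub>W \<one>\<^sub>W"
      using w a l by (simp add: shift_def a_minus_def W.M.smult_l_distr W.M.smult_l_minus W.A.a_assoc W.A.r_neg1 W.A.r_neg2)
    have m1: "shift w a \<otimes>\<^sub>W (?s \<otimes>\<^sub>W q) = ?s \<otimes>\<^sub>W (shift w a \<otimes>\<^sub>W q)"
      using sc[OF a(1) l(1)] sl q(1) by (simp add: W.A.m_assoc[symmetric])
    have m2: "shift w a \<otimes>\<^sub>W (\<mu> \<odot>\<^sub>W \<one>\<^sub>W) = ?s \<otimes>\<^sub>W (\<mu> \<odot>\<^sub>W \<one>\<^sub>W) \<oplus>\<^sub>W ?\<mu> \<odot>\<^sub>W \<one>\<^sub>W"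
    proof -
      have "shift w a \<otimes>\<^sub>W (\<mu> \<odot>\<^sub>W \<one>\<^sub>W) = (?s \<oplus>\<^sub>W (l \<ominus>\<^sub>L a) \<odot>\<^sub>W \<one>\<^sub>W) \<otimes>\<^sub>W (\<mu> \<odot>\<^sub>W \<one>\<^sub>W)" using sa by simp
      also have "\<dots> = ?s \<otimes>\<^sub>W (\<mu> \<odot>\<^sub>W \<one>\<^sub>W) \<oplus>\<^sub>W ?\<mu> \<odot>\<^sub>W \<one>\<^sub>W"
        using sl d q by (simp add: W.A.l_distr W.smult_mult_left W.smult_mult_right W.M.smult_assoc1 W.M.smult_r_distr)
      finally show ?thesis .
    qed
    have "split_val (a # ls) w \<one>\<^sub>W = shift w a \<otimes>\<^sub>W (?s \<otimes>\<^sub>W q) \<oplus>\<^sub>W shift w a \<otimes>\<^sub>W (\<mu> \<odot>\<^sub>W \<one>\<^sub>W)"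
      using sl q by (simp add: W.A.r_distr)
    also have "\<dots> = ?s \<otimes>\<^sub>W ?q \<oplus>\<^sub>W ?\<mu> \<odot>\<^sub>W \<one>\<^sub>W"
      unfolding m1 m2 using sl q d by (simp add: W.A.r_distr W.A.a_assoc)
    finally have "split_val (a # ls) w \<one>\<^sub>W = \<dots>" .
    moreover have "?s \<otimes>\<^sub>W ?q = ?q \<otimes>\<^sub>W ?s"
    proof -
      have "?s \<otimes>\<^sub>W (shift w a \<otimes>\<^sub>W q) = shift w a \<otimes>\<^sub>W q \<otimes>\<^sub>W ?s"
        using sl q m1 by (simp add: W.A.m_assoc)
      then show ?thesis using sl q by (simp add: W.A.r_distr W.A.l_distr W.smult_mult_left W.smult_mult_right)
    qed
    moreover have "?\<mu> \<noteq> \<zero>\<^sub>L" using d q L.integral by blast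
    ultimately show ?case
      using sl q d by (intro bexI[where x = ?q] bexI[where x = ?\<mu>]) auto
  qed
  then obtain q \<mu> where q: "q \<in> carrier W" "\<mu> \<in> carrier L" "\<mu> \<noteq> \<zero>\<^sub>L" "?s \<otimes>\<^sub>W q = q \<otimes>\<^sub>W ?s"
    "\<zero>\<^sub>W = ?s \<otimes>\<^sub>W q \<oplus>\<^sub>W \<mu> \<odot>\<^sub>W \<one>\<^sub>W"
    using ls l by auto
  have s: "?s \<in> carrier W" using w l by auto
  have mu: "\<mu> \<in> Units L" using q L.field_Units by auto
  have sq: "?s \<otimes>\<^sub>W q = \<ominus>\<^sub>W (\<mu> \<odot>\<^sub>W \<one>\<^sub>W)"
    using q s by (intro W.A.minus_equality[symmetric]) auto
  let ?r = "\<ominus>\<^sub>L (inv\<^bsub>L\<^esub> \<mu>)"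
  have r: "?r \<in> carrier L" "inv\<^bsub>L\<^esub> \<mu> \<in> carrier L" using mu by auto
  have "?r \<odot>\<^sub>W (?s \<otimes>\<^sub>W q) = \<one>\<^sub>W"
    unfolding sq using r mu q(2)
    by (simp add: L.l_minus W.M.smult_l_minus W.M.smult_r_minus W.M.smult_assoc1[symmetric])
  then have "?s \<otimes>\<^sub>W (?r \<odot>\<^sub>W q) = \<one>\<^sub>W" "(?r \<odot>\<^sub>W q) \<otimes>\<^sub>W ?s = \<one>\<^sub>W"
    using r s q by (simp_all add: W.smult_mult_left W.smult_mult_right)
  then show ?thesis using s q r by (auto simp: Units_def intro!: bexI[where x = "?r \<odot>\<^sub>W q"])
qed

text \<open>
  A commutative finite-dimensional algebra has a common eigenvector, and its eigenvalues form a
  homomorphism to the base field.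
\<close>

lemma eigenvector_step:
  assumes w: "w \<in> carrier W"
  shows "set ls \<subseteq> carrier L \<Longrightarrow> z \<in> carrier W \<Longrightarrow> z \<noteq> \<zero>\<^sub>W \<Longrightarrow> split_val ls w z = \<zero>\<^sub>W \<Longrightarrow>
    \<exists>q\<in>carrier W. \<exists>l\<in>carrier L. q \<otimes>\<^sub>W z \<noteq> \<zero>\<^sub>W \<and> w \<otimes>\<^sub>W (q \<otimes>\<^sub>W z) = l \<odot>\<^sub>W (q \<otimes>\<^sub>W z)"
proof (induction ls)
  case (Cons l ls)
  show ?case
  proof (cases "split_val ls w z = \<zero>\<^sub>W")
    case True
    then show ?thesis using Cons by auto
  next
    case False
    let ?q = "split_val ls w \<one>\<^sub>W"
    have q: "?q \<in> carrier W" using Cons.prems w by auto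
    have e: "split_val ls w z = ?q \<otimes>\<^sub>W z" using Cons.prems w by (intro split_val_mult) auto
    have qz: "?q \<otimes>\<^sub>W z \<in> carrier W" using q Cons.prems by auto
    have "w \<otimes>\<^sub>W (?q \<otimes>\<^sub>W z) \<ominus>\<^sub>W l \<odot>\<^sub>W (?q \<otimes>\<^sub>W z) = \<zero>\<^sub>W"
      using Cons.prems(4) Cons.prems(1) w qz
      by (simp add: e shift_def a_minus_def W.A.l_distr W.A.l_minus W.smult_mult_left)
    then have "w \<otimes>\<^sub>W (?q \<otimes>\<^sub>W z) = l \<odot>\<^sub>W (?q \<otimes>\<^sub>W z)"
      using w qz Cons.prems(1) by simp
    then show ?thesis using False e q Cons.prems(1) by (intro bexI[where x = ?q] bexI[where x = l]) auto
  qed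
qed simp

lemma character:
  assumes comm: "cring W" and nz: "\<one>\<^sub>W \<noteq> \<zero>\<^sub>W"
    and Y: "finite Y" "Y \<subseteq> carrier W"
    and span: "\<And>a. a \<in> carrier W \<Longrightarrow> \<exists>x\<in>Y \<rightarrow> carrier L. a = (\<Oplus>\<^sub>W y\<in>Y. x y \<odot>\<^sub>W y)"
  shows "\<exists>p\<in>ring_hom W L. \<forall>l\<in>carrier L. \<forall>w\<in>carrier W. p (l \<odot>\<^sub>W w) = l \<otimes>\<^sub>L p w"
proof -
  interpret C: cring W by fact
  have "\<exists>z\<in>carrier W. z \<noteq> \<zero>\<^sub>W \<and> (\<forall>y\<in>Y. \<exists>l\<in>carrier L. y \<otimes>\<^sub>W z = l \<odot>\<^sub>W z)"
    using Y
  proof (induction Y rule: finite_induct)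
    case empty
    then show ?case using nz by auto
  next
    case (insert y Y)
    then obtain z where z: "z \<in> carrier W" "z \<noteq> \<zero>\<^sub>W" "\<forall>y\<in>Y. \<exists>l\<in>carrier L. y \<otimes>\<^sub>W z = l \<odot>\<^sub>W z" by auto
    have y: "y \<in> carrier W" using insert by auto
    obtain ls where ls: "set ls \<subseteq> carrier L" "split_val ls y \<one>\<^sub>W = \<zero>\<^sub>W"
      using algebraic_split[OF assms(3,4) span y] by blast
    have "split_val ls y z = \<zero>\<^sub>W" using split_val_mult[OF y ls(1) z(1)] ls z by simp
    then obtain q l where q: "q \<in> carrier W" "l \<in> carrier L" "q \<otimes>\<^sub>W z \<noteq> \<zero>\<^sub>W" "y \<otimes>\<^sub>W (q \<otimes>\<^sub>W z) = l \<odot>\<^sub>W (q \<otimes>\<^sub>W z)"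
      using eigenvector_step[OF y ls(1) z(1,2)] by blast
    have "\<exists>l\<in>carrier L. y' \<otimes>\<^sub>W (q \<otimes>\<^sub>W z) = l \<odot>\<^sub>W (q \<otimes>\<^sub>W z)" if y': "y' \<in> Y" for y'
    proof -
      obtain l where l: "l \<in> carrier L" "y' \<otimes>\<^sub>W z = l \<odot>\<^sub>W z" using z y' by blast
      have "y' \<in> carrier W" using insert y' by auto
      then have "y' \<otimes>\<^sub>W (q \<otimes>\<^sub>W z) = q \<otimes>\<^sub>W (y' \<otimes>\<^sub>W z)" using q z by (simp add: C.m_lcomm)
      then show ?thesis using l q z by (intro bexI[where x = l]) (auto simp: W.smult_mult_right)
    qed
    then show ?case using q z by (intro bexI[where x = "q \<otimes>\<^sub>W z"]) auto
  qed
  then obtain z where z: "z \<in> carrier W" "z \<noteq> \<zero>\<^sub>W" "\<And>y. y \<in> Y \<Longrightarrow> \<exists>l\<in>carrier L. y \<otimes>\<^sub>W z = l \<odot>\<^sub>W z" by auto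
  define e where "e y = (SOME l. l \<in> carrier L \<and> y \<otimes>\<^sub>W z = l \<odot>\<^sub>W z)" for y
  have e: "e y \<in> carrier L \<and> y \<otimes>\<^sub>W z = e y \<odot>\<^sub>W z" if "y \<in> Y" for y
    unfolding e_def by (rule someI_ex) (use z(3)[OF that] in blast)
  have ex: "\<exists>l\<in>carrier L. w \<otimes>\<^sub>W z = l \<odot>\<^sub>W z" if w: "w \<in> carrier W" for w
  proof -
    obtain x where x: "x \<in> Y \<rightarrow> carrier L" "w = (\<Oplus>\<^sub>W y\<in>Y. x y \<odot>\<^sub>W y)" using span[OF w] by blast
    have xc: "x y \<in> carrier L" "y \<in> carrier W" if "y \<in> Y" for y using x Y that by auto
    have "w \<otimes>\<^sub>W z = (\<Oplus>\<^sub>W y\<in>Y. x y \<odot>\<^sub>W y \<otimes>\<^sub>W z)"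
      unfolding x(2) using z xc by (intro W.finsum_mult) auto
    also have "\<dots> = (\<Oplus>\<^sub>W y\<in>Y. (x y \<otimes>\<^sub>L e y) \<odot>\<^sub>W z)"
      using z xc e by (intro W.A.fsum_cong) (auto simp: W.smult_mult_left W.M.smult_assoc1)
    also have "\<dots> = (\<Oplus>\<^sub>L y\<in>Y. x y \<otimes>\<^sub>L e y) \<odot>\<^sub>W z"
      using z xc e by (intro W.finsum_smult[symmetric]) auto
    finally show ?thesis using xc e by (intro bexI[where x = "(\<Oplus>\<^sub>L y\<in>Y. x y \<otimes>\<^sub>L e y)"]) (auto intro!: L.fsum_closed)
  qed
  define p where "p w = (SOME l. l \<in> carrier L \<and> w \<otimes>\<^sub>W z = l \<odot>\<^sub>W z)" for w
  have p: "p w \<in> carrier L \<and> w \<otimes>\<^sub>W z = p w \<odot>\<^sub>W z" if "w \<in> carrier W" for w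
    unfolding p_def by (rule someI_ex) (use ex[OF that] in blast)
  have un: "a = b" if "a \<in> carrier L" "b \<in> carrier L" "a \<odot>\<^sub>W z = b \<odot>\<^sub>W z" for a b
  proof (rule ccontr)
    assume "a \<noteq> b"
    then have "a \<ominus>\<^sub>L b \<noteq> \<zero>\<^sub>L" using that L.r_right_minus_eq[of a b] by simp
    then have u: "a \<ominus>\<^sub>L b \<in> Units L" using that L.field_Units by simp
    have "(a \<ominus>\<^sub>L b) \<odot>\<^sub>W z = \<zero>\<^sub>W"
      using that z by (simp add: a_minus_def W.M.smult_l_distr W.M.smult_l_minus W.A.r_neg)
    then have "inv\<^bsub>L\<^esub> (a \<ominus>\<^sub>L b) \<odot>\<^sub>W ((a \<ominus>\<^sub>L b) \<odot>\<^sub>W z) = \<zero>\<^sub>W" using u by simp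
    then have "z = \<zero>\<^sub>W" using u z that L.Units_closed[OF u] L.Units_inv_closed[OF u]
      by (simp add: W.M.smult_assoc1[symmetric])
    then show False using z by simp
  qed
  have peq: "p w = l" if "w \<in> carrier W" "l \<in> carrier L" "w \<otimes>\<^sub>W z = l \<odot>\<^sub>W z" for w l
    using un[of "p w" l] p[OF that(1)] that by simp
  have "p \<in> ring_hom W L"
  proof (rule ring_hom_memI)
    fix a b assume ab: "a \<in> carrier W" "b \<in> carrier W"
    note pa = p[OF ab(1)] and pb = p[OF ab(2)]
    show "p a \<in> carrier L" using pa by simp
    show "p (a \<otimes>\<^sub>W b) = p a \<otimes>\<^sub>L p b"
    proof (rule peq)
      have "a \<otimes>\<^sub>W b \<otimes>\<^sub>W z = a \<otimes>\<^sub>W (p b \<odot>\<^sub>W z)" using ab z pb by (simp add: W.A.m_assoc)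
      also have "\<dots> = p b \<odot>\<^sub>W (p a \<odot>\<^sub>W z)" using ab z pa pb by (simp add: W.smult_mult_right)
      finally show "a \<otimes>\<^sub>W b \<otimes>\<^sub>W z = (p a \<otimes>\<^sub>L p b) \<odot>\<^sub>W z"
        using z pa pb by (simp add: W.M.smult_assoc1[symmetric] L.m_comm)
    qed (use ab pa pb in auto)
    show "p (a \<oplus>\<^sub>W b) = p a \<oplus>\<^sub>L p b"
      using ab z pa pb by (intro peq) (auto simp: W.A.l_distr W.M.smult_l_distr)
  qed (use z in \<open>auto intro!: peq\<close>)
  moreover have "p (l \<odot>\<^sub>W w) = l \<otimes>\<^sub>L p w" if "l \<in> carrier L" "w \<in> carrier W" for l w
    using that z p[OF that(2)] by (intro peq) (auto simp: W.smult_mult_left W.M.smult_assoc1)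
  ultimately show ?thesis by blast
qed

end

lemma (in two_modules) tensor_sum_rep:
  assumes "t \<in> carrier T"
  shows "\<exists>(n::nat) a c. (\<forall>i<n. a i \<in> carrier A \<and> c i \<in> carrier C) \<and> t = finprod T (\<lambda>i. a i \<Otimes> c i) {..<n}"
  using assms
proof (induction t rule: tensor_induct)
    case (tens a c)
    then show ?case
      by (intro exI[where x = "1::nat"] exI[where x = "\<lambda>_. a"] exI[where x = "\<lambda>_. c"]) (auto simp: lessThan_Suc)
  next
    case (mult t u)
    obtain n :: nat and a c where t: "\<forall>i<n. a i \<in> carrier A \<and> c i \<in> carrier C" "t = finprod T (\<lambda>i. a i \<Otimes> c i) {..<n}"
      using mult by blast
    obtain m :: nat and b d where u: "\<forall>i<m. b i \<in> carrier A \<and> d i \<in> carrier C" "u = finprod T (\<lambda>i. b i \<Otimes> d i) {..<m}"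
      using mult by blast
    let ?a = "\<lambda>i. if i < n then a i else b (i - n)" and ?c = "\<lambda>i. if i < n then c i else d (i - n)"
    have "i \<in> (\<lambda>i. i + n) ` {..<m}" if "i < n + m" "\<not> i < n" for i
      by (rule image_eqI[where x = "i - n"]) (use that in auto)
    then have U: "{..<n + m} = {..<n} \<union> (\<lambda>i. i + n) ` {..<m}" by auto
    have ac: "?a i \<in> carrier A \<and> ?c i \<in> carrier C" if "i < n + m" for i
      using t(1) u(1) that by auto
    have "finprod T (\<lambda>i. ?a i \<Otimes> ?c i) {..<n + m}
        = finprod T (\<lambda>i. ?a i \<Otimes> ?c i) {..<n} \<otimes>\<^sub>T finprod T (\<lambda>i. ?a i \<Otimes> ?c i) ((\<lambda>i. i + n) ` {..<m})"
      unfolding U using t(1) u(1) by (intro T.finprod_Un_disjoint) auto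
    also have "finprod T (\<lambda>i. ?a i \<Otimes> ?c i) ((\<lambda>i. i + n) ` {..<m}) = finprod T (\<lambda>i. b i \<Otimes> d i) {..<m}"
      using u(1) by (subst T.finprod_reindex) (auto simp: inj_on_def)
    also have "finprod T (\<lambda>i. ?a i \<Otimes> ?c i) {..<n} = finprod T (\<lambda>i. a i \<Otimes> c i) {..<n}"
      using t(1) by (intro T.finprod_cong') auto
    finally show ?case
      unfolding t(2) u(2) using ac by (intro exI[where x = "n + m"] exI[where x = ?a] exI[where x = ?c]) auto
qed

context vspace
begin

lemma subsp_finsum: "subsp V \<Longrightarrow> (\<And>i. i \<in> I \<Longrightarrow> f i \<in> V) \<Longrightarrow> (\<Oplus>\<^sub>M i\<in>I. f i) \<in> V"
proof (induction I rule: infinite_finite_induct)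
  case (insert i I)
  have c: "f j \<in> carrier M" if "j \<in> Set.insert i I" for j using insert.prems(2)[OF that] subspD(1)[OF insert.prems(1)] by auto
  have "(\<Oplus>\<^sub>M i\<in>Set.insert i I. f i) = f i \<oplus>\<^sub>M (\<Oplus>\<^sub>M i\<in>I. f i)"
    using insert(1,2) c by (intro M.M.finsum_insert) auto
  moreover have "(\<Oplus>\<^sub>M i\<in>I. f i) \<in> V" using insert by auto
  ultimately show ?case using subspD(3)[OF insert.prems(1)] insert.prems(2) by simp
qed (auto simp: subspD(2) M.M.finsum_infinite M.M.finsum_empty)

lemma span_subsp:
  assumes "finite I" "\<And>i. i \<in> I \<Longrightarrow> y i \<in> carrier M"
  shows "subsp {\<Oplus>\<^sub>M i\<in>I. x i \<odot>\<^sub>M y i | x. x \<in> I \<rightarrow> carrier K}"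
proof (rule subspI)
  let ?V = "{\<Oplus>\<^sub>M i\<in>I. x i \<odot>\<^sub>M y i | x. x \<in> I \<rightarrow> carrier K}"
  have c: "x i \<odot>\<^sub>M y i \<in> carrier M" if "x \<in> I \<rightarrow> carrier K" "i \<in> I" for x i using assms that by auto
  show "?V \<subseteq> carrier M" using c by (auto intro!: M.M.fsum_closed)
  have "(\<Oplus>\<^sub>M i\<in>I. \<zero>\<^sub>K \<odot>\<^sub>M y i) = (\<Oplus>\<^sub>M i\<in>I. \<zero>\<^sub>M)" using assms by (intro M.M.fsum_cong) auto
  then have z: "\<zero>\<^sub>M = (\<Oplus>\<^sub>M i\<in>I. (\<lambda>_. \<zero>\<^sub>K) i \<odot>\<^sub>M y i)" by (simp add: M.M.finsum_zero)
  show "\<zero>\<^sub>M \<in> ?V" by (rule CollectI, rule exI, rule conjI[OF z]) simp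
  fix v w assume "v \<in> ?V" "w \<in> ?V"
  then obtain x x' where x: "x \<in> I \<rightarrow> carrier K" "v = (\<Oplus>\<^sub>M i\<in>I. x i \<odot>\<^sub>M y i)"
    and x': "x' \<in> I \<rightarrow> carrier K" "w = (\<Oplus>\<^sub>M i\<in>I. x' i \<odot>\<^sub>M y i)" by auto
  have "v \<oplus>\<^sub>M w = (\<Oplus>\<^sub>M i\<in>I. x i \<odot>\<^sub>M y i \<oplus>\<^sub>M x' i \<odot>\<^sub>M y i)"
    unfolding x(2) x'(2) using c[OF x(1)] c[OF x'(1)] by (intro M.M.finsum_addf[symmetric]) auto
  also have "\<dots> = (\<Oplus>\<^sub>M i\<in>I. (\<lambda>i. x i \<oplus>\<^sub>K x' i) i \<odot>\<^sub>M y i)"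
    using x(1) x'(1) assms by (intro M.M.fsum_cong) (auto simp: M.smult_l_distr Pi_iff)
  finally have "v \<oplus>\<^sub>M w = \<dots>" .
  then show "v \<oplus>\<^sub>M w \<in> ?V" using x(1) x'(1) by (intro CollectI exI[where x = "\<lambda>i. x i \<oplus>\<^sub>K x' i"]) auto
next
  let ?V = "{\<Oplus>\<^sub>M i\<in>I. x i \<odot>\<^sub>M y i | x. x \<in> I \<rightarrow> carrier K}"
  fix r v assume r: "r \<in> carrier K" and "v \<in> ?V"
  then obtain x where x: "x \<in> I \<rightarrow> carrier K" "v = (\<Oplus>\<^sub>M i\<in>I. x i \<odot>\<^sub>M y i)" by auto
  have "r \<odot>\<^sub>M v = (\<Oplus>\<^sub>M i\<in>I. r \<odot>\<^sub>M (x i \<odot>\<^sub>M y i))"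
    unfolding x(2) using x(1) assms r
    by (intro M.M.finsum_hom[where h = "\<lambda>v. r \<odot>\<^sub>M v"] M.M.abelian_monoid_axioms) (auto simp: M.smult_r_distr)
  also have "\<dots> = (\<Oplus>\<^sub>M i\<in>I. (\<lambda>i. r \<otimes>\<^sub>K x i) i \<odot>\<^sub>M y i)"
    using x(1) assms r by (intro M.M.fsum_cong) (auto simp: M.smult_assoc1 Pi_iff)
  finally have "r \<odot>\<^sub>M v = \<dots>" .
  then show "r \<odot>\<^sub>M v \<in> ?V" using x(1) r by (intro CollectI exI[where x = "\<lambda>i. r \<otimes>\<^sub>K x i"]) auto
qed

lemma span_contains:
  assumes "finite I" "\<And>i. i \<in> I \<Longrightarrow> y i \<in> carrier M" "j \<in> I"
  shows "y j \<in> {\<Oplus>\<^sub>M i\<in>I. x i \<odot>\<^sub>M y i | x. x \<in> I \<rightarrow> carrier K}"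
proof -
  have "(\<Oplus>\<^sub>M i\<in>I. (\<lambda>i. if i = j then \<one>\<^sub>K else \<zero>\<^sub>K) i \<odot>\<^sub>M y i) = y j"
    using assms by (subst M.M.finsum_single[where i = j]) auto
  then show ?thesis by (intro CollectI exI[where x = "\<lambda>i. if i = j then \<one>\<^sub>K else \<zero>\<^sub>K"]) auto
qed

end

text \<open>
  A functional on \<open>A\<close> extends to \<open>A \<otimes> S\<close>. Over a field these extensions separate the elements \<open>a \<otimes> 1\<close>.
\<close>

lemma (in base_ext) functional_lift:
  assumes f: "\<And>x. x \<in> carrier A \<Longrightarrow> f x \<in> carrier R"
    "\<And>x y. x \<in> carrier A \<Longrightarrow> y \<in> carrier A \<Longrightarrow> f (x \<oplus>\<^sub>A y) = f x \<oplus>\<^sub>R f y"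
    "\<And>r x. r \<in> carrier R \<Longrightarrow> x \<in> carrier A \<Longrightarrow> f (r \<odot>\<^sub>A x) = r \<otimes>\<^sub>R f x"
  shows "a \<in> carrier A \<Longrightarrow> x \<in> carrier S \<Longrightarrow>
      tensor_lift (add_monoid S) (\<lambda>a x. \<phi> (f a) \<otimes>\<^sub>S x) (a \<boxtimes> x) = \<phi> (f a) \<otimes>\<^sub>S x"
    "t \<in> carrier E \<Longrightarrow> u \<in> carrier E \<Longrightarrow>
      tensor_lift (add_monoid S) (\<lambda>a x. \<phi> (f a) \<otimes>\<^sub>S x) (t \<oplus>\<^sub>E u) =
      tensor_lift (add_monoid S) (\<lambda>a x. \<phi> (f a) \<otimes>\<^sub>S x) t \<oplus>\<^sub>S
      tensor_lift (add_monoid S) (\<lambda>a x. \<phi> (f a) \<otimes>\<^sub>S x) u"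
    "t \<in> carrier E \<Longrightarrow> tensor_lift (add_monoid S) (\<lambda>a x. \<phi> (f a) \<otimes>\<^sub>S x) t \<in> carrier S"
proof -
  have cg: "comm_group (add_monoid S)" by (rule S.a_comm_group)
  let ?F = "tensor_lift (add_monoid S) (\<lambda>a x. \<phi> (f a) \<otimes>\<^sub>S x)"
  show "?F (a \<boxtimes> x) = \<phi> (f a) \<otimes>\<^sub>S x" if "a \<in> carrier A" "x \<in> carrier S" for a x
    by (rule E_lift_pure[OF cg]) (use that in \<open>auto simp: f S.l_distr S.r_distr S.m_ac\<close>)
  show "?F (t \<oplus>\<^sub>E u) = ?F t \<oplus>\<^sub>S ?F u" if "t \<in> carrier E" "u \<in> carrier E" for t u
    using E_lift_add[OF cg, where \<Phi> = "\<lambda>a x. \<phi> (f a) \<otimes>\<^sub>S x"] that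
    by (auto simp: f S.l_distr S.r_distr S.m_ac)
  show "?F t \<in> carrier S" if "t \<in> carrier E" for t
    using E_lift_closed[OF cg, where \<Phi> = "\<lambda>a x. \<phi> (f a) \<otimes>\<^sub>S x"] that
    by (auto simp: f S.l_distr S.r_distr S.m_ac)
qed

lemma (in base_ext) pure_inject:
  assumes K: "field R" and S: "\<one>\<^sub>S \<noteq> \<zero>\<^sub>S" and ab: "a \<in> carrier A" "b \<in> carrier A" "a \<boxtimes> \<one>\<^sub>S = b \<boxtimes> \<one>\<^sub>S"
  shows "a = b"
proof (rule ccontr)
  assume "a \<noteq> b"
  interpret K: field R by fact
  interpret V: vspace R A by unfold_locales
  let ?u = "a \<ominus>\<^sub>A b"
  have u: "?u \<in> carrier A" "?u \<notin> {\<zero>\<^sub>A }" using ab \<open>a \<noteq> b\<close> A.r_right_minus_eq[of a b] by auto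
  obtain f where fn: "V.functional f" and fu: "f ?u = \<one>\<^sub>R"
    by (rule V.separating_functional[OF V.subsp_zero u])
  note f = V.functionalD[OF fn]
  define F where "F = tensor_lift (add_monoid S) (\<lambda>a x. \<phi> (f a) \<otimes>\<^sub>S x)"
  have F: "F (a \<boxtimes> x) = \<phi> (f a) \<otimes>\<^sub>S x" if "a \<in> carrier A" "x \<in> carrier S" for a x
    unfolding F_def by (rule functional_lift(1)) (use f that in auto)
  have "\<phi> (f a) = \<phi> (f b)" using F[of a "\<one>\<^sub>S"] F[of b "\<one>\<^sub>S"] ab f(1) by simp
  moreover have "f a = f ?u \<oplus>\<^sub>R f b"
    using f(2)[of ?u b] ab u by (simp add: a_minus_def A.a_assoc A.l_neg)
  ultimately have "\<one>\<^sub>S \<oplus>\<^sub>S \<phi> (f b) = \<phi> (f b)" using f(1) fu ab by simp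
  then show False using S f(1)[OF ab(2)] by (simp add: S.add.r_cancel_one)
qed

section \<open>Torsors\<close>

locale galois_galg = galg_fin K G T + K: field K
  for K :: "('r, 'q) ring_scheme" and G :: "('g, 'm) monoid_scheme" (structure) and T :: "('r, 'a, 'g) galg" +
  assumes nonzero: "carrier T \<noteq> {\<zero>\<^sub>T }" and can: "canonical_map_bijective K G T"
begin

sublocale V: vspace K T by unfold_locales

sublocale TT: two_modules K T T by (rule self_modules)

abbreviation tact (infixl \<open>\<cdot>\<close> 72) where "a \<cdot> g \<equiv> gact T a g"
abbreviation TxT where "TxT \<equiv> tensor_group K T T"
abbreviation tt (infix \<open>\<otimes>\<otimes>\<close> 75) where "a \<otimes>\<otimes> b \<equiv> tens K T T a b"

lemma one_not_zero: "\<one>\<^sub>T \<noteq> \<zero>\<^sub>T"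
proof
  assume "\<one>\<^sub>T = \<zero>\<^sub>T"
  then have "carrier T = {\<zero>\<^sub>T }" by (rule A.A.one_zeroD)
  with nonzero show False ..
qed

lemma can_inj: "t \<in> carrier TxT \<Longrightarrow> u \<in> carrier TxT \<Longrightarrow>
    (\<And>g. g \<in> carrier G \<Longrightarrow> canonical_map G T t g = canonical_map G T u g) \<Longrightarrow> t = u"
proof -
  assume t: "t \<in> carrier TxT" "u \<in> carrier TxT"
    and e: "\<And>g. g \<in> carrier G \<Longrightarrow> canonical_map G T t g = canonical_map G T u g"
  have "canonical_map G T t = canonical_map G T u"
    by (rule PiE_ext[OF canonical_closed[OF t(1)] canonical_closed[OF t(2)] e])
  moreover have "inj_on (canonical_map G T) (carrier TxT)"
    using can by (simp add: canonical_map_bijective_def bij_betw_def)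
  ultimately show "t = u" using t by (simp add: inj_on_eq_iff)
qed

lemma can_surj: assumes "f \<in> carrier G \<rightarrow>\<^sub>E carrier T"
  obtains t where "t \<in> carrier TxT" "canonical_map G T t = f"
proof -
  have "canonical_map G T ` carrier TxT = carrier G \<rightarrow>\<^sub>E carrier T"
    using can by (simp add: canonical_map_bijective_def bij_betw_def)
  with assms have "f \<in> canonical_map G T ` carrier TxT" by simp
  then show ?thesis using that by (auto elim!: imageE)
qed

lemma can_finprod:
  assumes "\<And>i. i \<in> I \<Longrightarrow> t i \<in> carrier TxT" "g \<in> carrier G"
  shows "canonical_map G T (finprod TxT t I) g = (\<Oplus>\<^sub>T i\<in>I. canonical_map G T (t i) g)"
proof -
  have 1: "canonical_map G T \<one>\<^sub>TxT g = \<zero>\<^sub>T"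
    using canonical_tens[of "\<zero>\<^sub>T" "\<zero>\<^sub>T"] assms(2) by simp
  have "canonical_map G T (finprod TxT t I) g = finprod (add_monoid T) (\<lambda>i. canonical_map G T (t i) g) I"
    using assms 1 canonical_closed canonical_mult
    by (intro TT.T.finprod_hom[where h = "\<lambda>t. canonical_map G T t g"]) (auto intro: A.A.a_comm_monoid simp: PiE_iff)
  then show ?thesis by (simp add: finsum_def)
qed

text \<open>
  An invariant \<open>u\<close> has \<open>u \<otimes> 1 = 1 \<otimes> u\<close>, because both sides have the same image under the
  canonical map. Over a field this makes \<open>u\<close> a scalar.
\<close>

lemma coinvariants:
  assumes u: "u \<in> carrier T" and inv: "\<And>g. g \<in> carrier G \<Longrightarrow> u \<cdot> g = u"
  obtains x where "x \<in> carrier K" "u = x \<odot>\<^sub>T \<one>\<^sub>T"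
proof (cases "u \<in> {x \<odot>\<^sub>T \<one>\<^sub>T | x. x \<in> carrier K}")
  case True
  then show ?thesis using that by blast
next
  case False
  let ?W = "{x \<odot>\<^sub>T \<one>\<^sub>T | x. x \<in> carrier K}"
  have W: "V.subsp ?W"
  proof (rule V.subspI)
    show "?W \<subseteq> carrier T" by auto
    have "\<zero>\<^sub>K \<odot>\<^sub>T \<one>\<^sub>T \<in> ?W" by (rule CollectI, intro exI conjI, rule refl) simp
    then show "\<zero>\<^sub>T \<in> ?W" by simp
  next
    fix v w assume "v \<in> ?W" "w \<in> ?W"
    then obtain x y where xy: "v = x \<odot>\<^sub>T \<one>\<^sub>T" "w = y \<odot>\<^sub>T \<one>\<^sub>T" "x \<in> carrier K" "y \<in> carrier K" by auto
    have "v \<oplus>\<^sub>T w = (x \<oplus>\<^sub>K y) \<odot>\<^sub>T \<one>\<^sub>T" using xy by (simp add: A.M.smult_l_distr)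
    then show "v \<oplus>\<^sub>T w \<in> ?W" using xy R.a_closed by (intro CollectI exI[where x = "x \<oplus>\<^sub>K y"]) simp
  next
    fix r v assume r: "r \<in> carrier K" and "v \<in> ?W"
    then obtain x where x: "v = x \<odot>\<^sub>T \<one>\<^sub>T" "x \<in> carrier K" by auto
    have "r \<odot>\<^sub>T v = (r \<otimes>\<^sub>K x) \<odot>\<^sub>T \<one>\<^sub>T" using x r by (simp add: A.M.smult_assoc1)
    then show "r \<odot>\<^sub>T v \<in> ?W" using x r R.m_closed by (intro CollectI exI[where x = "r \<otimes>\<^sub>K x"]) simp
  qed
  obtain f where fn: "V.functional f" and fW: "\<forall>x\<in>?W. f x = \<zero>\<^sub>K" and fu: "f u = \<one>\<^sub>K"
    by (rule V.separating_functional[OF W u False])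
  note f = V.functionalD[OF fn]
  have f1: "f \<one>\<^sub>T = \<zero>\<^sub>K" proof (rule bspec[OF fW])
    have "\<one>\<^sub>K \<odot>\<^sub>T \<one>\<^sub>T \<in> ?W" by (rule CollectI, intro exI conjI, rule refl) simp
    then show "\<one>\<^sub>T \<in> ?W" by simp
  qed
  have bal: "TT.balanced (add_monoid T) (\<lambda>a b. f a \<odot>\<^sub>T b)"
    by (auto simp: TT.balanced_def f A.M.smult_l_distr A.M.smult_r_distr A.M.smult_assoc1[symmetric] R.m_comm)
  have "u \<otimes>\<otimes> \<one>\<^sub>T = \<one>\<^sub>T \<otimes>\<otimes> u"
    using u inv by (intro can_inj) (auto simp: canonical_tens)
  then have "f u \<odot>\<^sub>T \<one>\<^sub>T = f \<one>\<^sub>T \<odot>\<^sub>T u"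
    using TT.lift_tens[OF A.A.a_comm_group bal, of u "\<one>\<^sub>T"] TT.lift_tens[OF A.A.a_comm_group bal, of "\<one>\<^sub>T" u] u by simp
  then have False using fu f1 u one_not_zero by simp
  then show ?thesis ..
qed

text \<open>Galois coordinates: the preimage of the function supported at \<open>1\<close> under the canonical map.\<close>

lemma galois_coordinates:
  obtains n :: nat and x y where "\<And>i. i < n \<Longrightarrow> x i \<in> carrier T" "\<And>i. i < n \<Longrightarrow> y i \<in> carrier T"
    "\<And>g. g \<in> carrier G \<Longrightarrow> (\<Oplus>\<^sub>T i\<in>{..<n}. x i \<cdot> g \<otimes>\<^sub>T y i) = (if g = \<one> then \<one>\<^sub>T else \<zero>\<^sub>T)"
proof -
  obtain t where t: "t \<in> carrier TxT" "canonical_map G T t = (\<lambda>g\<in>carrier G. if g = \<one> then \<one>\<^sub>T else \<zero>\<^sub>T)"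
    by (rule can_surj[of "\<lambda>g\<in>carrier G. if g = \<one> then \<one>\<^sub>T else \<zero>\<^sub>T"]) auto
  obtain n :: nat and x y where xy0: "\<forall>i<n. x i \<in> carrier T \<and> y i \<in> carrier T"
    and t_eq: "t = finprod TxT (\<lambda>i. x i \<otimes>\<otimes> y i) {..<n}"
    using TT.tensor_sum_rep[OF t(1)] by blast
  have xy: "x i \<in> carrier T" "y i \<in> carrier T" if "i < n" for i using xy0 that by auto
  have "(\<Oplus>\<^sub>T i\<in>{..<n}. x i \<cdot> g \<otimes>\<^sub>T y i) = (if g = \<one> then \<one>\<^sub>T else \<zero>\<^sub>T)" if g: "g \<in> carrier G" for g
  proof -
    have "canonical_map G T t g = (\<Oplus>\<^sub>T i\<in>{..<n}. canonical_map G T (x i \<otimes>\<otimes> y i) g)"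
      unfolding t_eq using xy g by (intro can_finprod) auto
    also have "\<dots> = (\<Oplus>\<^sub>T i\<in>{..<n}. x i \<cdot> g \<otimes>\<^sub>T y i)"
      using xy g by (intro A.A.fsum_cong) (auto simp: canonical_tens)
    finally show ?thesis using t(2) g by simp
  qed
  then show ?thesis by (intro that[of n x y] xy)
qed

end

locale torsor_galg = galois_galg K G T
  for K :: "('r, 'q) ring_scheme" and G :: "('g, 'm) monoid_scheme" (structure) and T :: "('r, 'a, 'g) galg" +
  assumes comm: "cring T"
begin

sublocale C: cring T by (rule comm)

text \<open>One has \<open>a = \<Sum>\<^sub>i tr(x\<^sub>i a) y\<^sub>i\<close>, and traces are invariant, hence scalars.\<close>

lemma coordinates_span:
  assumes xy: "\<And>i. i < n \<Longrightarrow> x i \<in> carrier T" "\<And>i. i < n \<Longrightarrow> y i \<in> carrier T"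
    "\<And>g. g \<in> carrier G \<Longrightarrow> (\<Oplus>\<^sub>T i\<in>{..<n::nat}. x i \<cdot> g \<otimes>\<^sub>T y i) = (if g = \<one> then \<one>\<^sub>T else \<zero>\<^sub>T)"
    and a: "a \<in> carrier T"
  shows "\<exists>r. (\<forall>i<n. r i \<in> carrier K) \<and> a = (\<Oplus>\<^sub>T i\<in>{..<n}. r i \<odot>\<^sub>T y i)"
proof -
  define tr where "tr b = asum (\<lambda>g. b \<cdot> g)" for b
  have trc: "tr b \<in> carrier T" if "b \<in> carrier T" for b unfolding tr_def using that by (intro asum_closed) auto
  have "\<exists>r\<in>carrier K. tr b = r \<odot>\<^sub>T \<one>\<^sub>T" if b: "b \<in> carrier T" for b
  proof (rule coinvariants[OF trc[OF b]])
    fix h assume h: "h \<in> carrier G"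
    have "tr b \<cdot> h = asum (\<lambda>g. b \<cdot> (g \<otimes> h))"
      unfolding tr_def using b h by (subst A.act_finsum) (auto simp: A.act_act intro!: asum_cong)
    also have "\<dots> = tr b" unfolding tr_def using b h by (intro asum_right) auto
    finally show "tr b \<cdot> h = tr b" .
  qed blast
  then have "\<forall>b\<in>carrier T. \<exists>r. r \<in> carrier K \<and> tr b = r \<odot>\<^sub>T \<one>\<^sub>T" by blast
  from bchoice[OF this] obtain r where r: "\<And>b. b \<in> carrier T \<Longrightarrow> r b \<in> carrier K \<and> tr b = r b \<odot>\<^sub>T \<one>\<^sub>T"
    by blast
  have c: "x i \<otimes>\<^sub>T a \<in> carrier T" if "i < n" for i using that xy a by auto
  have "(\<Oplus>\<^sub>T i\<in>{..<n}. r (x i \<otimes>\<^sub>T a) \<odot>\<^sub>T y i) = (\<Oplus>\<^sub>T i\<in>{..<n}. asum (\<lambda>g. (x i \<cdot> g \<otimes>\<^sub>T y i) \<otimes>\<^sub>T a \<cdot> g))"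
  proof (rule A.A.fsum_cong)
    fix i assume "i \<in> {..<n}"
    then have i: "x i \<in> carrier T" "y i \<in> carrier T" "x i \<otimes>\<^sub>T a \<in> carrier T" using xy c by auto
    have "r (x i \<otimes>\<^sub>T a) \<odot>\<^sub>T y i = tr (x i \<otimes>\<^sub>T a) \<otimes>\<^sub>T y i"
      using r[OF i(3)] i by (simp add: A.smult_mult_left)
    also have "\<dots> = asum (\<lambda>g. (x i \<otimes>\<^sub>T a) \<cdot> g \<otimes>\<^sub>T y i)"
      unfolding tr_def using i by (intro A.finsum_mult) auto
    also have "\<dots> = asum (\<lambda>g. (x i \<cdot> g \<otimes>\<^sub>T y i) \<otimes>\<^sub>T a \<cdot> g)"
      using i a by (intro asum_cong) (auto simp: A.act_mult C.m_ac)
    finally show "r (x i \<otimes>\<^sub>T a) \<odot>\<^sub>T y i = asum (\<lambda>g. (x i \<cdot> g \<otimes>\<^sub>T y i) \<otimes>\<^sub>T a \<cdot> g)" .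
  qed (use xy a in \<open>auto intro!: asum_closed\<close>)
  also have "\<dots> = asum (\<lambda>g. (\<Oplus>\<^sub>T i\<in>{..<n}. (x i \<cdot> g \<otimes>\<^sub>T y i) \<otimes>\<^sub>T a \<cdot> g))"
    using xy a by (intro asum_swap) auto
  also have "\<dots> = asum (\<lambda>g. (if g = \<one> then \<one>\<^sub>T else \<zero>\<^sub>T) \<otimes>\<^sub>T a \<cdot> g)"
  proof (rule asum_cong)
    fix g assume g: "g \<in> carrier G"
    have "(\<Oplus>\<^sub>T i\<in>{..<n}. (x i \<cdot> g \<otimes>\<^sub>T y i) \<otimes>\<^sub>T a \<cdot> g) = (\<Oplus>\<^sub>T i\<in>{..<n}. x i \<cdot> g \<otimes>\<^sub>T y i) \<otimes>\<^sub>T a \<cdot> g"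
      using xy a g by (intro A.finsum_mult[symmetric]) auto
    then show "(\<Oplus>\<^sub>T i\<in>{..<n}. (x i \<cdot> g \<otimes>\<^sub>T y i) \<otimes>\<^sub>T a \<cdot> g) = (if g = \<one> then \<one>\<^sub>T else \<zero>\<^sub>T) \<otimes>\<^sub>T a \<cdot> g"
      using xy(3)[OF g] by simp
  qed (use a in auto)
  also have "\<dots> = a" using a by (subst A.A.finsum_single[where i = "\<one>"]) auto
  finally have "(\<Oplus>\<^sub>T i\<in>{..<n}. r (x i \<otimes>\<^sub>T a) \<odot>\<^sub>T y i) = a" .
  then show ?thesis using r c by (intro exI[where x = "\<lambda>i. r (x i \<otimes>\<^sub>T a)"]) auto
qed

end

section \<open>Splitting a torsor over an algebraically closed field\<close>

locale torsor_split = torsor_galg K G T + L: algebraically_closed L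
  for K :: "('r, 'q) ring_scheme" and G :: "('g, 'm) monoid_scheme" (structure) and T :: "('r, 'a, 'g) galg"
    and L :: "('l, 'p) ring_scheme" +
  fixes \<phi> :: "'r \<Rightarrow> 'l"
  assumes \<phi>: "\<phi> \<in> ring_hom K L"
begin

sublocale B: base_ext K G T L \<phi>
  by unfold_locales (rule \<phi>)

abbreviation W where "W \<equiv> base_change K \<phi> L T"
abbreviation bpure (infix \<open>\<boxtimes>\<close> 75) where "a \<boxtimes> x \<equiv> tens K T (algebra_via \<phi> L) a x"

sublocale LG: cring_fin_group L G by unfold_locales

sublocale WL: vspace L W by (intro vspace.intro B.EA.M.module_axioms L.field_axioms)

lemma W_cring: "cring W"
proof (rule cring.intro)
  show "ring W" by (rule B.E_ring)
  show "comm_monoid W"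
  proof (rule B.EA.A.monoid_comm_monoidI)
    show "t \<otimes>\<^sub>W u = u \<otimes>\<^sub>W t" if "t \<in> carrier W" "u \<in> carrier W" for t u
      using that
    proof (induction t rule: B.E_induct)
      case (pure a x)
      from pure(3,1,2) show ?case
        by (induction u rule: B.E_induct) (auto simp: B.E_mult_pure C.m_comm L.m_comm B.E_r_distr B.E_l_distr)
    qed (auto simp: B.E_r_distr B.E_l_distr)
  qed
qed

lemma W_one: "\<one>\<^sub>W \<noteq> \<zero>\<^sub>W"
proof
  assume "\<one>\<^sub>W = \<zero>\<^sub>W"
  then have "\<one>\<^sub>T \<boxtimes> \<one>\<^sub>L = \<zero>\<^sub>T \<boxtimes> \<one>\<^sub>L" using B.pure_zero_left[of "\<one>\<^sub>L"] by (simp add: B.E_one)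
  then have "\<one>\<^sub>T = \<zero>\<^sub>T"
    by (intro B.pure_inject[OF K.field_axioms L.one_not_zero]) auto
  then show False using one_not_zero by simp
qed

text \<open>
  The algebra \<open>T \<otimes> L\<close> is commutative, nonzero and, by Galois coordinates, spanned by finitely many elements. Hence it has
  a character.
\<close>

lemma point:
  obtains p where "p \<in> ring_hom T L" "\<forall>x\<in>carrier K. \<forall>a\<in>carrier T. p (x \<odot>\<^sub>T a) = \<phi> x \<otimes>\<^sub>L p a"
proof -
  interpret W: closed_galg L G W by (intro closed_galg.intro L.algebraically_closed_axioms B.E_galg)
  obtain n :: nat and x y where xy: "\<And>i. i < n \<Longrightarrow> x i \<in> carrier T" "\<And>i. i < n \<Longrightarrow> y i \<in> carrier T"
    "\<And>g. g \<in> carrier G \<Longrightarrow> (\<Oplus>\<^sub>T i\<in>{..<n}. x i \<cdot> g \<otimes>\<^sub>T y i) = (if g = \<one> then \<one>\<^sub>T else \<zero>\<^sub>T)"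
    by (rule galois_coordinates) (rule that)
  define Y where "Y = (\<lambda>i. y i \<boxtimes> \<one>\<^sub>L) ` {..<n}"
  have Y: "finite Y" "Y \<subseteq> carrier W" using xy by (auto simp: Y_def)
  let ?V = "{\<Oplus>\<^sub>W w\<in>Y. c w \<odot>\<^sub>W w | c. c \<in> Y \<rightarrow> carrier L}"
  have V: "WL.subsp ?V" using Y by (intro WL.span_subsp) auto
  have inV: "t \<in> ?V" if "t \<in> carrier W" for t
    using that
  proof (induction t rule: B.E_induct)
    case (pure a l)
    obtain r where r: "\<forall>i<n. r i \<in> carrier K" "a = (\<Oplus>\<^sub>T i\<in>{..<n}. r i \<odot>\<^sub>T y i)"
      using coordinates_span[OF xy pure(1)] by auto
    have "a \<boxtimes> l = (\<Oplus>\<^sub>W i\<in>{..<n}. (r i \<odot>\<^sub>T y i) \<boxtimes> l)"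
      unfolding r(2) using r(1) xy pure
      by (intro A.A.finsum_hom[where h = "\<lambda>a. a \<boxtimes> l"] B.E.abelian_monoid_axioms) (auto simp: B.pure_add_left B.E_zero)
    also have "\<dots> = (\<Oplus>\<^sub>W i\<in>{..<n}. (\<phi> (r i) \<otimes>\<^sub>L l) \<odot>\<^sub>W (y i \<boxtimes> \<one>\<^sub>L))"
      using r(1) xy pure by (intro B.E.fsum_cong) (auto simp: B.pure_smult B.E_smult_pure)
    also have "\<dots> \<in> ?V"
    proof (rule WL.subsp_finsum[OF V], rule WL.subspD(4)[OF V])
      fix i assume i: "i \<in> {..<n}"
      then show "\<phi> (r i) \<otimes>\<^sub>L l \<in> carrier L" using r pure by auto
      have "y i \<boxtimes> \<one>\<^sub>L \<in> Y" using i by (auto simp: Y_def)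
      then show "y i \<boxtimes> \<one>\<^sub>L \<in> ?V" using Y by (intro WL.span_contains[where y = "\<lambda>w. w"]) auto
    qed
    finally show ?case .
  next
    case (add t u)
    then show ?case by (intro WL.subspD(3)[OF V])
  qed
  have span: "\<exists>c\<in>Y \<rightarrow> carrier L. t = (\<Oplus>\<^sub>W w\<in>Y. c w \<odot>\<^sub>W w)" if "t \<in> carrier W" for t
    using inV[OF that] by auto
  have "\<exists>P\<in>ring_hom W L. \<forall>l\<in>carrier L. \<forall>w\<in>carrier W. P (l \<odot>\<^sub>W w) = l \<otimes>\<^sub>L P w"
    by (rule W.character[OF W_cring W_one Y]) (rule span)
  then obtain P where P: "P \<in> ring_hom W L" and Pl: "\<forall>l\<in>carrier L. \<forall>w\<in>carrier W. P (l \<odot>\<^sub>W w) = l \<otimes>\<^sub>L P w"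
    by (rule bexE)
  show ?thesis
  proof (rule that[of "\<lambda>a. P (a \<boxtimes> \<one>\<^sub>L)"])
    show "(\<lambda>a. P (a \<boxtimes> \<one>\<^sub>L)) \<in> ring_hom T L"
      using ring_hom_closed[OF P] ring_hom_mult[OF P] ring_hom_add[OF P] ring_hom_one[OF P]
        ring_hom_mult[OF P, of "_ \<boxtimes> \<one>\<^sub>L" "_ \<boxtimes> \<one>\<^sub>L"]
      by (intro ring_hom_memI) (auto simp: B.E_one B.pure_add_left B.E_mult_pure[of _ "\<one>\<^sub>L" _ "\<one>\<^sub>L", simplified, symmetric])
    have "P ((x \<odot>\<^sub>T a) \<boxtimes> \<one>\<^sub>L) = \<phi> x \<otimes>\<^sub>L P (a \<boxtimes> \<one>\<^sub>L)" if "x \<in> carrier K" "a \<in> carrier T" for x a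
      using that bspec[OF bspec[OF Pl], of "\<phi> x" "a \<boxtimes> \<one>\<^sub>L"] by (simp add: B.pure_smult B.E_smult_pure)
    then show "\<forall>x\<in>carrier K. \<forall>a\<in>carrier T. P ((x \<odot>\<^sub>T a) \<boxtimes> \<one>\<^sub>L) = \<phi> x \<otimes>\<^sub>L P (a \<boxtimes> \<one>\<^sub>L)" by blast
  qed
qed

end

locale torsor_point = torsor_split K G T L \<phi>
  for K :: "('r, 'q) ring_scheme" and G :: "('g, 'm) monoid_scheme" (structure) and T :: "('r, 'a, 'g) galg"
    and L :: "('l, 'p) ring_scheme" and \<phi> :: "'r \<Rightarrow> 'l" +
  fixes p :: "'a \<Rightarrow> 'l"
  assumes p: "p \<in> ring_hom T L"
    and p_smult: "\<And>x a. x \<in> carrier K \<Longrightarrow> a \<in> carrier T \<Longrightarrow> p (x \<odot>\<^sub>T a) = \<phi> x \<otimes>\<^sub>L p a"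
begin

lemma p_simps [simp]:
  "a \<in> carrier T \<Longrightarrow> p a \<in> carrier L"
  "a \<in> carrier T \<Longrightarrow> b \<in> carrier T \<Longrightarrow> p (a \<oplus>\<^sub>T b) = p a \<oplus>\<^sub>L p b"
  "a \<in> carrier T \<Longrightarrow> b \<in> carrier T \<Longrightarrow> p (a \<otimes>\<^sub>T b) = p a \<otimes>\<^sub>L p b"
  "p \<one>\<^sub>T = \<one>\<^sub>L" "p \<zero>\<^sub>T = \<zero>\<^sub>L"
  using p ring_hom_zero[OF p A.A.ring_axioms L.ring_axioms] by (auto simp: ring_hom_def)

lemma p_finsum: "(\<And>i. i \<in> I \<Longrightarrow> f i \<in> carrier T) \<Longrightarrow> p (\<Oplus>\<^sub>T i\<in>I. f i) = (\<Oplus>\<^sub>L i\<in>I. p (f i))"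
  by (intro A.A.finsum_hom L.abelian_monoid_axioms) auto

definition orbit :: "'a \<Rightarrow> 'g \<Rightarrow> 'l"
  where "orbit a = (\<lambda>g\<in>carrier G. p (a \<cdot> g))"

lemma orbit_closed [simp, intro]: "a \<in> carrier T \<Longrightarrow> orbit a \<in> carrier G \<rightarrow>\<^sub>E carrier L"
  by (auto simp: orbit_def)

lemma orbit_semihom: "galg_semihom K \<phi> G T LG.H orbit"
proof -
  have "orbit \<in> ring_hom T LG.H"
    by (rule ring_hom_memI) (auto simp: orbit_def fun_alg_def fun_eq_iff A.act_mult A.act_add)
  moreover have "orbit (r \<odot>\<^sub>T a) = \<phi> r \<odot>\<^sub>LG.H orbit a" if "r \<in> carrier K" "a \<in> carrier T" for r a
    using that by (auto simp: orbit_def fun_alg_def A.act_smult p_smult)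
  moreover have "orbit (a \<cdot> g) = gact LG.H (orbit a) g" if "g \<in> carrier G" "a \<in> carrier T" for g a
    using that by (auto simp: orbit_def fun_alg_def A.act_act)
  ultimately show ?thesis by (simp add: galg_semihom_def)
qed

text \<open>
  The inverse of \<open>a \<otimes> x \<mapsto> (g \<mapsto> x p(a g))\<close> in Galois coordinates. It comes from
  \<open>\<Sum>\<^sub>g\<Sum>\<^sub>i x\<^sub>i g\<inverse> \<otimes> y\<^sub>i (a g) = a \<otimes> 1\<close> in \<open>T \<otimes> T\<close>, which holds because both sides have the same image
  under the canonical map.
\<close>

theorem torsor_splits: "bij_betw (B.ext LG.H orbit) (carrier W) (carrier LG.H)"
proof -
  obtain n :: nat and x y where xy: "\<And>i. i < n \<Longrightarrow> x i \<in> carrier T" "\<And>i. i < n \<Longrightarrow> y i \<in> carrier T"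
    "\<And>g. g \<in> carrier G \<Longrightarrow> (\<Oplus>\<^sub>T i\<in>{..<n}. x i \<cdot> g \<otimes>\<^sub>T y i) = (if g = \<one> then \<one>\<^sub>T else \<zero>\<^sub>T)"
    by (rule galois_coordinates) (rule that)
  note [simp] = xy(1,2)
  let ?\<Psi> = "B.ext LG.H orbit"
  note ep = B.ext_pure[OF LG.fun_alg_galg orbit_semihom] and ea = B.ext_add[OF LG.fun_alg_galg orbit_semihom]
    and ec = B.ext_closed[OF LG.fun_alg_galg orbit_semihom]
  define J where "J f = (\<Oplus>\<^sub>W g\<in>carrier G. \<Oplus>\<^sub>W i\<in>{..<n}. (x i \<cdot> inv g) \<boxtimes> (p (y i) \<otimes>\<^sub>L f g))" for f
  have fc: "f g \<in> carrier L" if "f \<in> carrier LG.H" "g \<in> carrier G" for f g using that by auto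
  have Jc: "J f \<in> carrier W" if "f \<in> carrier LG.H" for f
    unfolding J_def using fc[OF that] by (intro B.E.fsum_closed B.pure_closed) auto
  have Jadd: "J (f \<oplus>\<^sub>LG.H f') = J f \<oplus>\<^sub>W J f'" if f: "f \<in> carrier LG.H" "f' \<in> carrier LG.H" for f f'
  proof -
    have "J (f \<oplus>\<^sub>LG.H f') = (\<Oplus>\<^sub>W g\<in>carrier G. (\<Oplus>\<^sub>W i\<in>{..<n}. (x i \<cdot> inv g) \<boxtimes> (p (y i) \<otimes>\<^sub>L f g))
        \<oplus>\<^sub>W (\<Oplus>\<^sub>W i\<in>{..<n}. (x i \<cdot> inv g) \<boxtimes> (p (y i) \<otimes>\<^sub>L f' g)))"
      unfolding J_def
    proof (rule B.E.fsum_cong)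
      fix g assume g: "g \<in> carrier G"
      have "(\<Oplus>\<^sub>W i\<in>{..<n}. (x i \<cdot> inv g) \<boxtimes> (p (y i) \<otimes>\<^sub>L (f \<oplus>\<^sub>LG.H f') g))
          = (\<Oplus>\<^sub>W i\<in>{..<n}. (x i \<cdot> inv g) \<boxtimes> (p (y i) \<otimes>\<^sub>L f g) \<oplus>\<^sub>W (x i \<cdot> inv g) \<boxtimes> (p (y i) \<otimes>\<^sub>L f' g))"
        using g fc[OF f(1) g] fc[OF f(2) g]
        by (intro B.E.fsum_cong) (auto simp: L.r_distr B.pure_add_right intro!: B.E.a_closed B.pure_closed)
      also have "\<dots> = (\<Oplus>\<^sub>W i\<in>{..<n}. (x i \<cdot> inv g) \<boxtimes> (p (y i) \<otimes>\<^sub>L f g))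
        \<oplus>\<^sub>W (\<Oplus>\<^sub>W i\<in>{..<n}. (x i \<cdot> inv g) \<boxtimes> (p (y i) \<otimes>\<^sub>L f' g))"
        using g fc[OF f(1) g] fc[OF f(2) g] by (intro B.E.finsum_addf) (auto intro!: B.pure_closed)
      finally show "(\<Oplus>\<^sub>W i\<in>{..<n}. (x i \<cdot> inv g) \<boxtimes> (p (y i) \<otimes>\<^sub>L (f \<oplus>\<^sub>LG.H f') g)) = \<dots>" .
    qed (use fc[OF f(1)] fc[OF f(2)] in \<open>auto intro!: B.E.a_closed B.E.fsum_closed B.pure_closed\<close>)
    also have "\<dots> = J f \<oplus>\<^sub>W J f'"
      unfolding J_def using fc[OF f(1)] fc[OF f(2)]
      by (intro B.E.finsum_addf) (auto intro!: B.E.fsum_closed B.pure_closed)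
    finally show ?thesis .
  qed
  have sumfact: "(\<Oplus>\<^sub>T i\<in>{..<n}. x i \<cdot> g \<otimes>\<^sub>T (y i \<otimes>\<^sub>T b)) = (if g = \<one> then b else \<zero>\<^sub>T)"
    if "g \<in> carrier G" "b \<in> carrier T" for g b
  proof -
    have "(\<Oplus>\<^sub>T i\<in>{..<n}. x i \<cdot> g \<otimes>\<^sub>T (y i \<otimes>\<^sub>T b)) = (\<Oplus>\<^sub>T i\<in>{..<n}. (x i \<cdot> g \<otimes>\<^sub>T y i) \<otimes>\<^sub>T b)"
      using that by (intro A.A.fsum_cong) (auto simp: A.A.m_assoc)
    also have "\<dots> = (\<Oplus>\<^sub>T i\<in>{..<n}. x i \<cdot> g \<otimes>\<^sub>T y i) \<otimes>\<^sub>T b"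
      using that by (intro A.finsum_mult[symmetric]) auto
    finally show ?thesis using that xy(3) by simp
  qed
  have g1: "inv g \<otimes> h = \<one> \<longleftrightarrow> g = h" if "g \<in> carrier G" "h \<in> carrier G" for g h
    using that by (metis G.inv_closed G.inv_equality G.inv_inv G.l_inv)
  have key: "finprod TxT (\<lambda>g. finprod TxT (\<lambda>i. (x i \<cdot> inv g) \<otimes>\<otimes> (y i \<otimes>\<^sub>T a \<cdot> g)) {..<n}) (carrier G) = a \<otimes>\<otimes> \<one>\<^sub>T"
    if a: "a \<in> carrier T" for a
  proof (rule can_inj)
    fix h assume h: "h \<in> carrier G"
    have "canonical_map G T (finprod TxT (\<lambda>g. finprod TxT (\<lambda>i. (x i \<cdot> inv g) \<otimes>\<otimes> (y i \<otimes>\<^sub>T a \<cdot> g)) {..<n}) (carrier G)) h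
        = (\<Oplus>\<^sub>T g\<in>carrier G. canonical_map G T (finprod TxT (\<lambda>i. (x i \<cdot> inv g) \<otimes>\<otimes> (y i \<otimes>\<^sub>T a \<cdot> g)) {..<n}) h)"
      using a h by (intro can_finprod TT.T.finprod_closed) auto
    also have "\<dots> = (\<Oplus>\<^sub>T g\<in>carrier G. \<Oplus>\<^sub>T i\<in>{..<n}. x i \<cdot> (inv g \<otimes> h) \<otimes>\<^sub>T (y i \<otimes>\<^sub>T a \<cdot> g))"
    proof (rule A.A.fsum_cong)
      fix g assume g: "g \<in> carrier G"
      have "canonical_map G T (finprod TxT (\<lambda>i. (x i \<cdot> inv g) \<otimes>\<otimes> (y i \<otimes>\<^sub>T a \<cdot> g)) {..<n}) h
          = (\<Oplus>\<^sub>T i\<in>{..<n}. canonical_map G T ((x i \<cdot> inv g) \<otimes>\<otimes> (y i \<otimes>\<^sub>T a \<cdot> g)) h)"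
        using a g h by (intro can_finprod) auto
      also have "\<dots> = (\<Oplus>\<^sub>T i\<in>{..<n}. x i \<cdot> (inv g \<otimes> h) \<otimes>\<^sub>T (y i \<otimes>\<^sub>T a \<cdot> g))"
        using a g h by (intro A.A.fsum_cong) (auto simp: canonical_tens A.act_act)
      finally show "canonical_map G T (finprod TxT (\<lambda>i. (x i \<cdot> inv g) \<otimes>\<otimes> (y i \<otimes>\<^sub>T a \<cdot> g)) {..<n}) h = \<dots>" .
    qed (use a h in \<open>auto intro!: A.A.fsum_closed\<close>)
    also have "\<dots> = (\<Oplus>\<^sub>T g\<in>carrier G. if inv g \<otimes> h = \<one> then a \<cdot> g else \<zero>\<^sub>T)"
      using a h by (intro A.A.fsum_cong sumfact) auto
    also have "\<dots> = a \<cdot> h"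
      using a h by (subst A.A.finsum_single[where i = h]) (auto simp: g1)
    finally show "canonical_map G T (finprod TxT (\<lambda>g. finprod TxT (\<lambda>i. (x i \<cdot> inv g) \<otimes>\<otimes> (y i \<otimes>\<^sub>T a \<cdot> g)) {..<n}) (carrier G)) h
        = canonical_map G T (a \<otimes>\<otimes> \<one>\<^sub>T) h" using a h by (simp add: canonical_tens)
  qed (use a in \<open>auto intro!: TT.T.finprod_closed\<close>)
  have Jpure: "J (?\<Psi> (a \<boxtimes> l)) = a \<boxtimes> l" if a: "a \<in> carrier T" and l: "l \<in> carrier L" for a l
  proof -
    let ?\<Phi> = "\<lambda>b c. b \<boxtimes> (p c \<otimes>\<^sub>L l)"
    have cg: "comm_group (add_monoid W)" by (rule B.E.a_comm_group)
    have bal: "TT.balanced (add_monoid W) ?\<Phi>"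
      using l by (auto simp: TT.balanced_def B.pure_add_left B.pure_add_right L.l_distr B.pure_smult p_smult L.m_assoc)
    let ?l = "tensor_lift (add_monoid W) ?\<Phi>"
    have lp: "?l (b \<otimes>\<otimes> c) = ?\<Phi> b c" if "b \<in> carrier T" "c \<in> carrier T" for b c
      using TT.lift_tens[OF cg bal that] .
    interpret lh: group_hom TxT "add_monoid W" ?l
      using TT.lift_hom[OF cg bal] cg by (auto simp: group_hom_def group_hom_axioms_def comm_group_def TT.T.is_group)
    have lfin: "?l (finprod TxT t I) = (\<Oplus>\<^sub>W i\<in>I. ?l (t i))" if "\<And>i. i \<in> I \<Longrightarrow> t i \<in> carrier TxT" for t and I :: "'z set"
      unfolding finsum_def using that lh.hom_closed lh.hom_mult lh.hom_one cg
      by (intro TT.T.finprod_hom) (auto simp: comm_group_def)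
    have "a \<boxtimes> l = ?l (a \<otimes>\<otimes> \<one>\<^sub>T)" using a l by (simp add: lp)
    also have "\<dots> = (\<Oplus>\<^sub>W g\<in>carrier G. ?l (finprod TxT (\<lambda>i. (x i \<cdot> inv g) \<otimes>\<otimes> (y i \<otimes>\<^sub>T a \<cdot> g)) {..<n}))"
      unfolding key[OF a, symmetric] using a by (intro lfin TT.T.finprod_closed) auto
    also have "\<dots> = (\<Oplus>\<^sub>W g\<in>carrier G. \<Oplus>\<^sub>W i\<in>{..<n}. ?l ((x i \<cdot> inv g) \<otimes>\<otimes> (y i \<otimes>\<^sub>T a \<cdot> g)))"
      using a l by (intro B.E.fsum_cong lfin B.E.fsum_closed) (auto simp: lp)
    also have "\<dots> = J (?\<Psi> (a \<boxtimes> l))"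
      unfolding J_def using a l
      by (intro B.E.fsum_cong B.E.fsum_closed) (auto simp: lp ep orbit_def L.m_ac intro!: B.pure_closed)
    finally show ?thesis by simp
  qed
  have JP: "J (?\<Psi> w) = w" if "w \<in> carrier W" for w
    using that by (induction w rule: B.E_induct) (auto simp: Jpure ea Jadd ec simp del: LG.fun_alg_simps(1))
  have PJ: "?\<Psi> (J f) = f" if f: "f \<in> carrier LG.H" for f
  proof (rule LG.fun_eqI)
    have \<Psi>0: "?\<Psi> \<zero>\<^sub>W = \<zero>\<^sub>LG.H"
      using ep[of "\<zero>\<^sub>T" "\<zero>\<^sub>L"] orbit_closed[of "\<zero>\<^sub>T"] B.pure_zero_left[of "\<zero>\<^sub>L"] LG.H.M.smult_l_null[of "orbit \<zero>\<^sub>T"] by simp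
    have sum: "?\<Psi> (\<Oplus>\<^sub>W i\<in>I. t i) = (\<Oplus>\<^sub>LG.H i\<in>I. ?\<Psi> (t i))" if "\<And>i. i \<in> I \<Longrightarrow> t i \<in> carrier W" for t and I :: "'z set"
      using that \<Psi>0 by (intro B.E.finsum_hom LG.H.A.abelian_monoid_axioms ea ec)
    fix h assume h: "h \<in> carrier G"
    have cl: "(x i \<cdot> inv g) \<boxtimes> (p (y i) \<otimes>\<^sub>L f g) \<in> carrier W" if "g \<in> carrier G" "i < n" for g i
      using that fc[OF f] by (intro B.pure_closed) auto
    have val: "?\<Psi> ((x i \<cdot> inv g) \<boxtimes> (p (y i) \<otimes>\<^sub>L f g)) h = p (x i \<cdot> (inv g \<otimes> h) \<otimes>\<^sub>T y i) \<otimes>\<^sub>L f g"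
      if "g \<in> carrier G" "i < n" for g i
      using that h fc[OF f that(1)] by (simp add: ep orbit_def A.act_act L.m_ac)
    have "?\<Psi> (J f) h = (\<Oplus>\<^sub>L g\<in>carrier G. \<Oplus>\<^sub>L i\<in>{..<n}. ?\<Psi> ((x i \<cdot> inv g) \<boxtimes> (p (y i) \<otimes>\<^sub>L f g)) h)"
    proof -
      have "?\<Psi> (J f) = (\<Oplus>\<^sub>LG.H g\<in>carrier G. ?\<Psi> (\<Oplus>\<^sub>W i\<in>{..<n}. (x i \<cdot> inv g) \<boxtimes> (p (y i) \<otimes>\<^sub>L f g)))"
        unfolding J_def using cl by (intro sum B.E.fsum_closed) auto
      also have "\<dots> = (\<Oplus>\<^sub>LG.H g\<in>carrier G. \<Oplus>\<^sub>LG.H i\<in>{..<n}. ?\<Psi> ((x i \<cdot> inv g) \<boxtimes> (p (y i) \<otimes>\<^sub>L f g)))"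
        using cl by (intro LG.H.A.fsum_cong sum LG.H.A.fsum_closed ec) auto
      finally have "?\<Psi> (J f) h = (\<Oplus>\<^sub>L g\<in>carrier G. (\<Oplus>\<^sub>LG.H i\<in>{..<n}. ?\<Psi> ((x i \<cdot> inv g) \<boxtimes> (p (y i) \<otimes>\<^sub>L f g))) h)"
        using cl by (simp only:) (intro LG.fun_sum[OF h] LG.H.A.fsum_closed ec, auto)
      also have "\<dots> = (\<Oplus>\<^sub>L g\<in>carrier G. \<Oplus>\<^sub>L i\<in>{..<n}. ?\<Psi> ((x i \<cdot> inv g) \<boxtimes> (p (y i) \<otimes>\<^sub>L f g)) h)"
      proof (rule L.fsum_cong)
        fix g assume g: "g \<in> carrier G"
        show "(\<Oplus>\<^sub>LG.H i\<in>{..<n}. ?\<Psi> ((x i \<cdot> inv g) \<boxtimes> (p (y i) \<otimes>\<^sub>L f g))) h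
            = (\<Oplus>\<^sub>L i\<in>{..<n}. ?\<Psi> ((x i \<cdot> inv g) \<boxtimes> (p (y i) \<otimes>\<^sub>L f g)) h)"
          by (rule LG.fun_sum[OF h]) (rule ec[OF cl[OF g]], simp)
      qed (use h fc[OF f] in \<open>auto simp: val intro!: L.fsum_closed\<close>)
      finally show ?thesis .
    qed
    also have "\<dots> = (\<Oplus>\<^sub>L g\<in>carrier G. (if inv g \<otimes> h = \<one> then \<one>\<^sub>L else \<zero>\<^sub>L) \<otimes>\<^sub>L f g)"
    proof (rule L.fsum_cong)
      fix g assume g: "g \<in> carrier G"
      have "(\<Oplus>\<^sub>L i\<in>{..<n}. ?\<Psi> ((x i \<cdot> inv g) \<boxtimes> (p (y i) \<otimes>\<^sub>L f g)) h)
          = (\<Oplus>\<^sub>L i\<in>{..<n}. p (x i \<cdot> (inv g \<otimes> h) \<otimes>\<^sub>T y i) \<otimes>\<^sub>L f g)"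
        using g h fc[OF f g] by (intro L.fsum_cong) (auto simp: val)
      also have "\<dots> = (\<Oplus>\<^sub>L i\<in>{..<n}. p (x i \<cdot> (inv g \<otimes> h) \<otimes>\<^sub>T y i)) \<otimes>\<^sub>L f g"
        using g h fc[OF f g] by (intro L.fsum_mult[symmetric]) auto
      also have "(\<Oplus>\<^sub>L i\<in>{..<n}. p (x i \<cdot> (inv g \<otimes> h) \<otimes>\<^sub>T y i)) = p (\<Oplus>\<^sub>T i\<in>{..<n}. x i \<cdot> (inv g \<otimes> h) \<otimes>\<^sub>T y i)"
        using g h by (intro p_finsum[symmetric]) auto
      also have "\<dots> = (if inv g \<otimes> h = \<one> then \<one>\<^sub>L else \<zero>\<^sub>L)"
        using g h by (subst xy(3)) auto
      finally show "(\<Oplus>\<^sub>L i\<in>{..<n}. ?\<Psi> ((x i \<cdot> inv g) \<boxtimes> (p (y i) \<otimes>\<^sub>L f g)) h)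
          = (if inv g \<otimes> h = \<one> then \<one>\<^sub>L else \<zero>\<^sub>L) \<otimes>\<^sub>L f g" .
    qed (use fc[OF f] in auto)
    also have "\<dots> = f h"
      using h fc[OF f] by (subst L.finsum_single[where i = h]) (auto simp: g1)
    finally show "?\<Psi> (J f) h = f h" .
  qed (use f ec[OF Jc[OF f]] in auto)
  show ?thesis
    by (rule bij_betwI[where g = J]) (use JP PJ Jc ec in \<open>auto simp del: LG.fun_alg_simps(1)\<close>)
qed

end

section \<open>Normal bases\<close>

definition (in galg_fin) normal_sum :: "'a \<Rightarrow> ('g \<Rightarrow> 'r) \<Rightarrow> 'a"
  where "normal_sum v c = asum (\<lambda>g. c g \<odot>\<^sub>A v \<cdot> g)"

definition (in galg_fin) normal_generator :: "'a \<Rightarrow> bool"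
  where "normal_generator v \<longleftrightarrow> v \<in> carrier A \<and> bij_betw (normal_sum v) (carrier G \<rightarrow>\<^sub>E carrier R) (carrier A)"

lemma (in galg_fin) normal_sum_closed: "v \<in> carrier A \<Longrightarrow> c \<in> carrier G \<rightarrow>\<^sub>E carrier R \<Longrightarrow> normal_sum v c \<in> carrier A"
  unfolding normal_sum_def by (intro asum_closed) (auto simp: PiE_iff)

lemma (in cring_fin_group) group_alg_finsum:
  "(\<And>i. i \<in> I \<Longrightarrow> f i \<in> carrier H) \<Longrightarrow> (\<Oplus>\<^sub>\<Lambda> i\<in>I. f i) = (\<Oplus>\<^sub>H i\<in>I. f i)"
  by (rule finsum_struct_cong[OF H.A.is_abelian_group]) auto

context closed_galg
begin

lemma smult_unit:
  assumes "r \<in> carrier L" "r \<noteq> \<zero>\<^sub>L" "a \<in> Units W"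
  shows "r \<odot>\<^sub>W a \<in> Units W"
proof -
  have r: "r \<in> Units L" using assms L.field_Units by simp
  note a = W.A.Units_closed[OF assms(3)] W.A.Units_inv_closed[OF assms(3)]
  have "(r \<odot>\<^sub>W a) \<otimes>\<^sub>W (inv\<^bsub>L\<^esub> r \<odot>\<^sub>W inv\<^bsub>W\<^esub> a) = \<one>\<^sub>W" "(inv\<^bsub>L\<^esub> r \<odot>\<^sub>W inv\<^bsub>W\<^esub> a) \<otimes>\<^sub>W (r \<odot>\<^sub>W a) = \<one>\<^sub>W"
    using r a assms by (simp_all add: W.smult_mult_left W.smult_mult_right W.M.smult_assoc1[symmetric])
  moreover have "r \<odot>\<^sub>W a \<in> carrier W" "inv\<^bsub>L\<^esub> r \<odot>\<^sub>W inv\<^bsub>W\<^esub> a \<in> carrier W"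
    using assms(1) a L.Units_inv_closed[OF r] by (blast intro: W.M.smult_closed)+
  ultimately show ?thesis unfolding Units_def[of W] by blast
qed

text \<open>
  On the line \<open>u + t q\<close> through a unit \<open>e\<close>, only finitely many points are not units: up to the factor
  \<open>e\<close> such a point is \<open>1 + \<tau> w\<close> with \<open>w = e\<inverse> q\<close>, which is invertible unless \<open>-1/\<tau>\<close> is a root
  of a polynomial that annihilates \<open>w\<close>.
\<close>

lemma unit_on_line:
  assumes Y: "finite Y" "Y \<subseteq> carrier W"
    and span: "\<And>a. a \<in> carrier W \<Longrightarrow> \<exists>x\<in>Y \<rightarrow> carrier L. a = (\<Oplus>\<^sub>W y\<in>Y. x y \<odot>\<^sub>W y)"
    and S: "infinite S" "S \<subseteq> carrier L"
    and u: "u \<in> carrier W" "q \<in> carrier W" "x \<in> carrier L" "u \<oplus>\<^sub>W x \<odot>\<^sub>W q \<in> Units W"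
  shows "\<exists>t\<in>S. u \<oplus>\<^sub>W t \<odot>\<^sub>W q \<in> Units W"
proof -
  let ?e = "u \<oplus>\<^sub>W x \<odot>\<^sub>W q"
  let ?w = "inv\<^bsub>W\<^esub> ?e \<otimes>\<^sub>W q"
  have e: "?e \<in> carrier W" "inv\<^bsub>W\<^esub> ?e \<in> carrier W" "?e \<otimes>\<^sub>W inv\<^bsub>W\<^esub> ?e = \<one>\<^sub>W"
    using W.A.Units_closed[OF u(4)] W.A.Units_inv_closed[OF u(4)] W.A.Units_r_inv[OF u(4)] by blast+
  have w: "?w \<in> carrier W" using e u by blast
  obtain ls where ls: "set ls \<subseteq> carrier L" "split_val ls ?w \<one>\<^sub>W = \<zero>\<^sub>W"
    using algebraic_split[OF Y span w] by blast
  have "finite (Set.insert x ((\<lambda>l. x \<ominus>\<^sub>L inv\<^bsub>L\<^esub> l) ` set ls))" by simp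
  then obtain t where t: "t \<in> S" "t \<noteq> x" "t \<notin> (\<lambda>l. x \<ominus>\<^sub>L inv\<^bsub>L\<^esub> l) ` set ls"
    using S(1) by (metis (no_types, lifting) finite_subset insertCI subsetI)
  let ?\<tau> = "t \<ominus>\<^sub>L x"
  have tc: "t \<in> carrier L" using t S by auto
  have \<tau>: "?\<tau> \<in> carrier L" "?\<tau> \<noteq> \<zero>\<^sub>L" using tc u t L.r_right_minus_eq[of t x] by auto
  then have \<tau>U: "?\<tau> \<in> Units L" using L.field_Units by simp
  let ?l = "\<ominus>\<^sub>L (inv\<^bsub>L\<^esub> ?\<tau>)"
  have l: "?l \<in> carrier L" using \<tau>U by simp
  have "?l \<notin> set ls"
  proof
    assume "?l \<in> set ls"
    have "inv\<^bsub>L\<^esub> ?l = \<ominus>\<^sub>L ?\<tau>"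
      using \<tau> \<tau>U l by (intro L.comm_inv_char) (auto simp: L.l_minus L.r_minus)
    then have "x \<ominus>\<^sub>L inv\<^bsub>L\<^esub> ?l = t"
      using u(3) tc by (simp add: a_minus_def L.minus_add L.a_ac L.r_neg1 L.r_neg2 L.r_neg)
    with t(3) \<open>?l \<in> set ls\<close> show False by (metis image_eqI)
  qed
  then have sU: "shift ?w ?l \<in> Units W" by (rule shift_unit[OF w ls l])
  have "?\<tau> \<odot>\<^sub>W shift ?w ?l = ?\<tau> \<odot>\<^sub>W ?w \<oplus>\<^sub>W \<one>\<^sub>W"
  proof -
    have "inv\<^bsub>L\<^esub> ?\<tau> \<in> carrier L" "?\<tau> \<otimes>\<^sub>L inv\<^bsub>L\<^esub> ?\<tau> = \<one>\<^sub>L" using \<tau>U by auto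
    then show ?thesis
      using \<tau>(1) w unfolding shift_def a_minus_def[of W] W.M.smult_r_distr[OF \<tau>(1) w W.A.a_inv_closed[OF W.M.smult_closed[OF l W.A.one_closed]]]
      by (simp add: W.M.smult_l_minus W.M.smult_r_minus W.M.smult_assoc1[symmetric])
  qed
  moreover have "?e \<otimes>\<^sub>W (?\<tau> \<odot>\<^sub>W ?w \<oplus>\<^sub>W \<one>\<^sub>W) = u \<oplus>\<^sub>W t \<odot>\<^sub>W q"
  proof -
    have "?e \<otimes>\<^sub>W ?w = q" using e u(2) by (simp only: W.A.m_assoc[symmetric] W.A.l_one)
    then have "?e \<otimes>\<^sub>W (?\<tau> \<odot>\<^sub>W ?w \<oplus>\<^sub>W \<one>\<^sub>W) = ?\<tau> \<odot>\<^sub>W q \<oplus>\<^sub>W ?e"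
      using e(1) w \<tau>(1) by (simp add: W.A.r_distr W.smult_mult_right)
    also have "\<dots> = u \<oplus>\<^sub>W (?\<tau> \<oplus>\<^sub>L x) \<odot>\<^sub>W q"
      using u \<tau>(1) by (simp add: W.M.smult_l_distr W.A.a_ac)
    also have "?\<tau> \<oplus>\<^sub>L x = t" using u(3) tc by (simp add: a_minus_def L.a_assoc L.l_neg)
    finally show ?thesis .
  qed
  ultimately have "u \<oplus>\<^sub>W t \<odot>\<^sub>W q = ?e \<otimes>\<^sub>W (?\<tau> \<odot>\<^sub>W shift ?w ?l)" by simp
  also have "\<dots> \<in> Units W" by (intro W.A.Units_m_closed u(4) smult_unit \<tau> sU)
  finally show ?thesis using t(1) by blast
qed

text \<open>
  The coefficients are moved into \<open>S\<close> one after the other, each by \<open>unit_on_line\<close>.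
\<close>

lemma unit_in_span:
  assumes Y: "finite Y" "Y \<subseteq> carrier W"
    and span: "\<And>a. a \<in> carrier W \<Longrightarrow> \<exists>x\<in>Y \<rightarrow> carrier L. a = (\<Oplus>\<^sub>W y\<in>Y. x y \<odot>\<^sub>W y)"
    and S: "infinite S" "S \<subseteq> carrier L" and q: "\<And>i. q i \<in> carrier W"
  shows "u \<in> carrier W \<Longrightarrow> (\<And>i. \<xi> i \<in> carrier L) \<Longrightarrow>
    u \<oplus>\<^sub>W (\<Oplus>\<^sub>W i\<in>{..<n::nat}. \<xi> i \<odot>\<^sub>W q i) \<in> Units W \<Longrightarrow>
    \<exists>t. (\<forall>i. t i \<in> S) \<and> u \<oplus>\<^sub>W (\<Oplus>\<^sub>W i\<in>{..<n}. t i \<odot>\<^sub>W q i) \<in> Units W"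
proof (induction n arbitrary: u)
  case 0
  obtain s where "s \<in> S" using S(1) by (metis finite.emptyI equals0I)
  then show ?case using 0 by (intro exI[where x = "\<lambda>_. s"]) (auto simp: W.A.finsum_empty)
next
  case (Suc n)
  have Sc: "s \<in> carrier L" if "s \<in> S" for s using that S by auto
  have fs: "(\<Oplus>\<^sub>W i\<in>{..<Suc n}. f i \<odot>\<^sub>W q i) = f n \<odot>\<^sub>W q n \<oplus>\<^sub>W (\<Oplus>\<^sub>W i\<in>{..<n}. f i \<odot>\<^sub>W q i)"
    if "\<And>i. f i \<in> carrier L" for f using that q by (simp add: lessThan_Suc W.A.finsum_insert)
  have cl: "(\<Oplus>\<^sub>W i\<in>{..<n}. f i \<odot>\<^sub>W q i) \<in> carrier W" if "\<And>i. f i \<in> carrier L" for f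
    using that q by (intro W.A.fsum_closed) auto
  note [simp] = q Suc.prems(1,2) cl[OF Suc.prems(2)]
  let ?u = "u \<oplus>\<^sub>W (\<Oplus>\<^sub>W i\<in>{..<n}. \<xi> i \<odot>\<^sub>W q i)"
  have "?u \<oplus>\<^sub>W \<xi> n \<odot>\<^sub>W q n \<in> Units W"
    using Suc.prems(3) unfolding fs[OF Suc.prems(2)] by (simp add: W.A.a_ac)
  then obtain s where s: "s \<in> S" "?u \<oplus>\<^sub>W s \<odot>\<^sub>W q n \<in> Units W"
    using unit_on_line[OF Y span S, of ?u "q n" "\<xi> n"] by auto
  have "(u \<oplus>\<^sub>W s \<odot>\<^sub>W q n) \<oplus>\<^sub>W (\<Oplus>\<^sub>W i\<in>{..<n}. \<xi> i \<odot>\<^sub>W q i) \<in> Units W"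
    using s Sc by (simp add: W.A.a_ac)
  then obtain t where t: "\<forall>i. t i \<in> S" "(u \<oplus>\<^sub>W s \<odot>\<^sub>W q n) \<oplus>\<^sub>W (\<Oplus>\<^sub>W i\<in>{..<n}. t i \<odot>\<^sub>W q i) \<in> Units W"
    using Suc.IH[of "u \<oplus>\<^sub>W s \<odot>\<^sub>W q n"] Suc.prems(2) Sc[OF s(1)] by auto
  have tc: "t i \<in> carrier L" "(t(n := s)) i \<in> carrier L" for i using t(1) Sc s(1) by auto
  have "(\<Oplus>\<^sub>W i\<in>{..<n}. (t(n := s)) i \<odot>\<^sub>W q i) = (\<Oplus>\<^sub>W i\<in>{..<n}. t i \<odot>\<^sub>W q i)"
    using tc by (intro W.A.fsum_cong) auto
  then have "u \<oplus>\<^sub>W (\<Oplus>\<^sub>W i\<in>{..<Suc n}. (t(n := s)) i \<odot>\<^sub>W q i)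
      = (u \<oplus>\<^sub>W s \<odot>\<^sub>W q n) \<oplus>\<^sub>W (\<Oplus>\<^sub>W i\<in>{..<n}. t i \<odot>\<^sub>W q i)"
    unfolding fs[OF tc(2)] using Sc[OF s(1)] cl[of t] tc(1) by (simp add: W.A.a_ac)
  then show ?case using t s by (intro exI[where x = "t(n := s)"]) auto
qed

end

context torsor_point
begin

sublocale LW: closed_galg L G LG.\<Lambda>
  by (intro closed_galg.intro L.algebraically_closed_axioms LG.group_alg_galg)

lemma group_alg_span:
  assumes "a \<in> carrier LG.\<Lambda>"
  shows "\<exists>x\<in>LG.e ` carrier G \<rightarrow> carrier L. a = (\<Oplus>\<^sub>LG.\<Lambda> y\<in>LG.e ` carrier G. x y \<odot>\<^sub>LG.\<Lambda> y)"
proof -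
  let ?Y = "LG.e ` carrier G"
  interpret VL: vspace L LG.\<Lambda> by (intro vspace.intro L.field_axioms LW.W.M.module_axioms)
  have Y: "finite ?Y" "?Y \<subseteq> carrier LG.\<Lambda>" using LG.delta_closed by auto
  let ?V = "{\<Oplus>\<^sub>LG.\<Lambda> y\<in>?Y. x y \<odot>\<^sub>LG.\<Lambda> y | x. x \<in> ?Y \<rightarrow> carrier L}"
  have V: "VL.subsp ?V" using Y by (intro VL.span_subsp) auto
  have ac: "a g \<in> carrier L" if "g \<in> carrier G" for g using assms that by auto
  have "a = (\<Oplus>\<^sub>LG.H g\<in>carrier G. a g \<odot>\<^sub>LG.H LG.e g)" using assms by (intro LG.fun_expand) auto
  also have "\<dots> = (\<Oplus>\<^sub>LG.\<Lambda> g\<in>carrier G. a g \<odot>\<^sub>LG.H LG.e g)"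
    using ac by (intro LG.group_alg_finsum[symmetric] LG.H.M.smult_closed LG.delta_closed) auto
  also have "\<dots> \<in> ?V"
  proof (rule VL.subsp_finsum[OF V])
    fix g assume g: "g \<in> carrier G"
    have "LG.e g \<in> ?V" using Y g by (intro VL.span_contains[where y = "\<lambda>w. w"]) auto
    from VL.subspD(4)[OF V ac[OF g] this] show "a g \<odot>\<^sub>LG.H LG.e g \<in> ?V" by simp
  qed
  finally show ?thesis by auto
qed

lemma orbit_mult:
  assumes "c \<in> carrier LG.H" "v \<in> carrier T" "h \<in> carrier G"
  shows "(c \<otimes>\<^sub>LG.\<Lambda> orbit v) h = (\<Oplus>\<^sub>L g\<in>carrier G. c g \<otimes>\<^sub>L p (v \<cdot> (inv g \<otimes> h)))"
  using assms by (simp add: LG.group_alg_mult) (intro L.fsum_cong, auto simp: orbit_def)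

lemma phi_inj: "inj_on \<phi> (carrier K)"
  by (rule non_trivial_field_hom_is_inj[OF \<phi> K.field_axioms L.field_axioms])

lemma phi_zero: "\<phi> \<zero>\<^sub>K = \<zero>\<^sub>L"
  by (rule ring_hom_zero[OF \<phi> R.ring_axioms L.ring_axioms])

text \<open>
  If the orbit of \<open>v\<close> is a unit of the group algebra over \<open>L\<close>, then the translates of \<open>v\<close> are
  independent. They span, because otherwise a functional on \<open>T\<close> that kills them would extend to \<open>L\<close>.
\<close>

lemma unit_orbit_normal:
  assumes v: "v \<in> carrier T" and U: "orbit v \<in> Units LG.\<Lambda>"
  shows "normal_generator v"
proof -
  let ?R = "carrier G \<rightarrow>\<^sub>E carrier K"
  have Ui: "inv\<^bsub>LG.\<Lambda>\<^esub> orbit v \<in> carrier LG.\<Lambda>" "orbit v \<otimes>\<^sub>LG.\<Lambda> inv\<^bsub>LG.\<Lambda>\<^esub> orbit v = \<one>\<^sub>LG.\<Lambda>"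
    "inv\<^bsub>LG.\<Lambda>\<^esub> orbit v \<otimes>\<^sub>LG.\<Lambda> orbit v = \<one>\<^sub>LG.\<Lambda>"
    using LW.W.A.Units_inv_closed[OF U] LW.W.A.Units_r_inv[OF U] LW.W.A.Units_l_inv[OF U] by blast+
  have oc: "orbit v \<in> carrier LG.\<Lambda>" using v by simp
  have inj: "inj_on (normal_sum v) ?R"
  proof (rule inj_onI)
    fix c c' assume c: "c \<in> ?R" "c' \<in> ?R" and eq: "normal_sum v c = normal_sum v c'"
    \<comment> \<open>In the group algebra over \<open>L\<close>, the product of \<open>?t c\<close> and \<open>orbit v\<close> is the orbit of \<open>normal_sum v c\<close>.\<close>
    let ?t = "\<lambda>c. \<lambda>g\<in>carrier G. \<phi> (c (inv g))"
    have tc: "?t c \<in> carrier LG.\<Lambda>" if "c \<in> ?R" for c using that by (auto simp: PiE_iff)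
    have val: "(?t c \<otimes>\<^sub>LG.\<Lambda> orbit v) h = p (normal_sum v c \<cdot> h)" if c: "c \<in> ?R" and h: "h \<in> carrier G" for c h
    proof -
      have cc: "c g \<in> carrier K" if "g \<in> carrier G" for g using c that by auto
      have "(?t c \<otimes>\<^sub>LG.\<Lambda> orbit v) h = (\<Oplus>\<^sub>L g\<in>carrier G. ?t c g \<otimes>\<^sub>L p (v \<cdot> (inv g \<otimes> h)))"
        using tc[OF c] v h by (intro orbit_mult) auto
      also have "\<dots> = (\<Oplus>\<^sub>L g\<in>carrier G. \<phi> (c (inv g)) \<otimes>\<^sub>L p (v \<cdot> (inv g \<otimes> h)))"
        using cc v h by (intro L.fsum_cong) auto
      also have "\<dots> = (\<Oplus>\<^sub>L g\<in>carrier G. \<phi> (c g) \<otimes>\<^sub>L p (v \<cdot> (g \<otimes> h)))"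
        using cc v h by (intro LG.sum_inv[where f = "\<lambda>g. \<phi> (c g) \<otimes>\<^sub>L p (v \<cdot> (g \<otimes> h))"]) auto
      also have "\<dots> = (\<Oplus>\<^sub>L g\<in>carrier G. p ((c g \<odot>\<^sub>T v \<cdot> g) \<cdot> h))"
        using cc v h by (intro L.fsum_cong) (auto simp: A.act_smult A.act_act p_smult)
      also have "\<dots> = p (asum (\<lambda>g. (c g \<odot>\<^sub>T v \<cdot> g) \<cdot> h))"
        using cc v h by (intro p_finsum[symmetric]) auto
      also have "\<dots> = p (normal_sum v c \<cdot> h)"
        unfolding normal_sum_def using cc v h by (subst A.act_finsum) auto
      finally show ?thesis .
    qed
    have "?t c \<otimes>\<^sub>LG.\<Lambda> orbit v = ?t c' \<otimes>\<^sub>LG.\<Lambda> orbit v"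
    proof (rule LG.fun_eqI)
      fix g assume g: "g \<in> carrier G"
      then show "(?t c \<otimes>\<^sub>LG.\<Lambda> orbit v) g = (?t c' \<otimes>\<^sub>LG.\<Lambda> orbit v) g"
        by (simp only: val[OF c(1) g] val[OF c(2) g] eq)
    qed (use LW.W.A.m_closed[OF tc[OF c(1)] oc] LW.W.A.m_closed[OF tc[OF c(2)] oc] in simp_all)
    then have "?t c \<otimes>\<^sub>LG.\<Lambda> orbit v \<otimes>\<^sub>LG.\<Lambda> inv\<^bsub>LG.\<Lambda>\<^esub> orbit v = ?t c' \<otimes>\<^sub>LG.\<Lambda> orbit v \<otimes>\<^sub>LG.\<Lambda> inv\<^bsub>LG.\<Lambda>\<^esub> orbit v" by simp
    then have tt: "?t c = ?t c'"
      using LW.W.A.m_assoc[OF tc[OF c(1)] oc Ui(1)] LW.W.A.m_assoc[OF tc[OF c(2)] oc Ui(1)]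
        LW.W.A.r_one[OF tc[OF c(1)]] LW.W.A.r_one[OF tc[OF c(2)]] unfolding Ui(2) by simp
    show "c = c'"
    proof (rule PiE_ext[OF c])
      fix g assume g: "g \<in> carrier G"
      have "\<phi> (c g) = \<phi> (c' g)" using fun_cong[OF tt, of "inv g"] g by simp
      then show "c g = c' g" using inj_onD[OF phi_inj] c g by (auto simp: PiE_iff)
    qed
  qed
  have surj: "a \<in> normal_sum v ` ?R" if a: "a \<in> carrier T" for a
  proof (rule ccontr)
    assume na: "a \<notin> normal_sum v ` ?R"
    let ?V = "{asum (\<lambda>g. c g \<odot>\<^sub>T v \<cdot> g) | c. c \<in> carrier G \<rightarrow> carrier K}"
    have vg: "v \<cdot> g \<in> carrier T" if "g \<in> carrier G" for g using v that by auto
    have aV: "a \<notin> ?V"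
    proof
      assume "a \<in> ?V"
      then obtain c where c: "c \<in> carrier G \<rightarrow> carrier K" "a = asum (\<lambda>g. c g \<odot>\<^sub>T v \<cdot> g)" by auto
      have "normal_sum v (restrict c (carrier G)) = a"
        unfolding normal_sum_def c(2) using c(1) vg by (intro asum_cong) auto
      then show False using na c(1) by (metis imageI restrict_PiE_iff Pi_iff)
    qed
    obtain f where fn: "V.functional f" and fV: "\<forall>x\<in>?V. f x = \<zero>\<^sub>K" and fa: "f a = \<one>\<^sub>K"
      by (rule V.separating_functional[OF V.span_subsp[OF G.fin vg] a aV])
    note f = V.functionalD[OF fn]
    have fvg: "f (v \<cdot> g) = \<zero>\<^sub>K" if "g \<in> carrier G" for g
      using bspec[OF fV V.span_contains[OF G.fin vg that]] .
    let ?F = "tensor_lift (add_monoid L) (\<lambda>a x. \<phi> (f a) \<otimes>\<^sub>L x)"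
    note F = B.functional_lift[OF f]
    let ?\<xi> = "orbit a \<otimes>\<^sub>LG.\<Lambda> inv\<^bsub>LG.\<Lambda>\<^esub> orbit v"
    have ac: "orbit a \<in> carrier LG.\<Lambda>" using a by simp
    have \<xi>: "?\<xi> \<in> carrier LG.\<Lambda>" by (rule LW.W.A.m_closed[OF ac Ui(1)])
    have \<xi>c: "?\<xi> g \<in> carrier L" if "g \<in> carrier G" for g using \<xi> that by (auto simp: PiE_iff)
    have \<xi>o: "?\<xi> \<otimes>\<^sub>LG.\<Lambda> orbit v = orbit a"
      using LW.W.A.m_assoc[OF ac Ui(1) oc] LW.W.A.r_one[OF ac] unfolding Ui(3) by simp
    let ?w = "(\<Oplus>\<^sub>W g\<in>carrier G. (v \<cdot> inv g) \<boxtimes> ?\<xi> g)"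
    have wc: "(v \<cdot> inv g) \<boxtimes> ?\<xi> g \<in> carrier W" if "g \<in> carrier G" for g
      using that \<xi>c vg by (intro B.pure_closed) auto
    have w: "?w \<in> carrier W" by (intro B.E.fsum_closed wc)
    let ?\<Psi> = "B.ext LG.H orbit"
    note ep = B.ext_pure[OF LG.fun_alg_galg orbit_semihom] and ea = B.ext_add[OF LG.fun_alg_galg orbit_semihom]
      and ec = B.ext_closed[OF LG.fun_alg_galg orbit_semihom]
    have \<Psi>0: "?\<Psi> \<zero>\<^sub>W = \<zero>\<^sub>LG.H"
      using ep[of "\<zero>\<^sub>T" "\<zero>\<^sub>L"] orbit_closed[of "\<zero>\<^sub>T"] B.pure_zero_left[of "\<zero>\<^sub>L"] LG.H.M.smult_l_null[of "orbit \<zero>\<^sub>T"] by simp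
    have \<Psi>w: "?\<Psi> ?w = (\<Oplus>\<^sub>LG.H g\<in>carrier G. ?\<Psi> ((v \<cdot> inv g) \<boxtimes> ?\<xi> g))"
      by (rule B.E.finsum_hom[OF LG.H.A.abelian_monoid_axioms ea \<Psi>0 ec wc])
    have "?\<Psi> ?w = ?\<Psi> (a \<boxtimes> \<one>\<^sub>L)"
    proof (rule LG.fun_eqI)
      fix h assume h: "h \<in> carrier G"
      have "?\<Psi> ?w h = (\<Oplus>\<^sub>L g\<in>carrier G. ?\<Psi> ((v \<cdot> inv g) \<boxtimes> ?\<xi> g) h)"
        unfolding \<Psi>w by (rule LG.fun_sum[OF h ec[OF wc]])
      also have "\<dots> = (\<Oplus>\<^sub>L g\<in>carrier G. ?\<xi> g \<otimes>\<^sub>L p (v \<cdot> (inv g \<otimes> h)))"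
        using h v \<xi>c by (intro L.fsum_cong) (auto simp: ep orbit_def A.act_act)
      also have "\<dots> = orbit a h"
        using orbit_mult[of ?\<xi> v h] \<xi> v h \<xi>o by simp
      also have "\<dots> = ?\<Psi> (a \<boxtimes> \<one>\<^sub>L) h" using a h by (simp add: ep orbit_def)
      finally show "?\<Psi> ?w h = ?\<Psi> (a \<boxtimes> \<one>\<^sub>L) h" .
    qed (use ec[OF w] ec[of "a \<boxtimes> \<one>\<^sub>L"] a in auto)
    then have "?w = a \<boxtimes> \<one>\<^sub>L"
      using torsor_splits w a by (auto simp: bij_betw_def inj_on_def)
    moreover have "?F ?w = \<zero>\<^sub>L"
    proof -
      have F0: "?F \<zero>\<^sub>W = \<zero>\<^sub>L" using F(1)[of "\<zero>\<^sub>T" "\<zero>\<^sub>L"] f(1)[of "\<zero>\<^sub>T"] B.pure_zero_left[of "\<zero>\<^sub>L"] by simp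
      have "?F ?w = (\<Oplus>\<^sub>L g\<in>carrier G. ?F ((v \<cdot> inv g) \<boxtimes> ?\<xi> g))"
        by (rule B.E.finsum_hom[OF L.abelian_monoid_axioms F(2) F0 F(3) wc])
      also have "\<dots> = (\<Oplus>\<^sub>L g\<in>carrier G. \<zero>\<^sub>L)"
        using vg \<xi>c fvg by (intro L.fsum_cong) (auto simp: F(1) phi_zero)
      finally show ?thesis by (simp add: L.finsum_zero)
    qed
    moreover have "?F (a \<boxtimes> \<one>\<^sub>L) = \<one>\<^sub>L" using F(1)[of a "\<one>\<^sub>L"] a fa by simp
    ultimately show False using L.one_not_zero by simp
  qed
  show ?thesis
    unfolding normal_generator_def bij_betw_def
    using inj surj v normal_sum_closed by (auto simp del: restrict_PiE_iff)
qed

text \<open>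
  Over \<open>L\<close> the orbits of the \<open>x_i\<close> have a combination with coefficients \<open>p(y_i)\<close> that is the unit of the group
  algebra, for Galois coordinates \<open>x_i, y_i\<close>. Since \<open>K\<close> is infinite, the coefficients can be moved to \<open>K\<close> without losing
  invertibility.
\<close>

theorem normal_basis_infinite:
  assumes "infinite (carrier K)"
  shows "\<exists>v. normal_generator v"
proof -
  obtain n :: nat and x y where xy: "\<And>i. i < n \<Longrightarrow> x i \<in> carrier T" "\<And>i. i < n \<Longrightarrow> y i \<in> carrier T"
    "\<And>g. g \<in> carrier G \<Longrightarrow> (\<Oplus>\<^sub>T i\<in>{..<n}. x i \<cdot> g \<otimes>\<^sub>T y i) = (if g = \<one> then \<one>\<^sub>T else \<zero>\<^sub>T)"
    by (rule galois_coordinates) (rule that)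
  let ?x = "\<lambda>i. if i < n then x i else \<zero>\<^sub>T" and ?y = "\<lambda>i. if i < n then y i else \<zero>\<^sub>T"
  have xc: "?x i \<in> carrier T" "?y i \<in> carrier T" for i using xy by auto
  let ?S = "\<phi> ` carrier K"
  have S: "infinite ?S" "?S \<subseteq> carrier L" using assms finite_imageD[OF _ phi_inj] by auto
  let ?q = "\<lambda>i. orbit (?x i)"
  have oc: "orbit (?x i) \<in> carrier LG.H" for i using orbit_closed[OF xc(1)] by simp
  have sm: "l \<odot>\<^sub>LG.H orbit (?x i) \<in> carrier LG.H" if "l \<in> carrier L" for l i
    using that oc by (rule LG.H.M.smult_closed)
  have comb: "(\<Oplus>\<^sub>LG.\<Lambda> i\<in>{..<n}. c i \<odot>\<^sub>LG.\<Lambda> orbit (?x i)) g = (\<Oplus>\<^sub>L i\<in>{..<n}. c i \<otimes>\<^sub>L p (x i \<cdot> g))"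
    if c: "\<And>i. c i \<in> carrier L" and g: "g \<in> carrier G" for c g
  proof -
    have "(\<Oplus>\<^sub>LG.\<Lambda> i\<in>{..<n}. c i \<odot>\<^sub>LG.\<Lambda> orbit (?x i)) = (\<Oplus>\<^sub>LG.H i\<in>{..<n}. c i \<odot>\<^sub>LG.H orbit (?x i))"
      unfolding LG.group_alg_simps(4) by (rule LG.group_alg_finsum[OF sm[OF c]])
    then have "(\<Oplus>\<^sub>LG.\<Lambda> i\<in>{..<n}. c i \<odot>\<^sub>LG.\<Lambda> orbit (?x i)) g = (\<Oplus>\<^sub>L i\<in>{..<n}. (c i \<odot>\<^sub>LG.H orbit (?x i)) g)"
      using LG.fun_sum[OF g sm[OF c]] by simp
    also have "\<dots> = (\<Oplus>\<^sub>L i\<in>{..<n}. c i \<otimes>\<^sub>L p (x i \<cdot> g))"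
      using g c xy(1) by (intro L.fsum_cong) (auto simp: orbit_def)
    finally show ?thesis .
  qed
  have csum: "(\<Oplus>\<^sub>LG.\<Lambda> i\<in>{..<n}. c i \<odot>\<^sub>LG.\<Lambda> orbit (?x i)) \<in> carrier LG.\<Lambda>" if "\<And>i. c i \<in> carrier L" for c
    using sm[OF that] by (intro LW.W.A.fsum_closed) (simp only: LG.group_alg_simps(1,4) LG.fun_alg_simps(1))
  have "(\<Oplus>\<^sub>LG.\<Lambda> i\<in>{..<n}. p (?y i) \<odot>\<^sub>LG.\<Lambda> orbit (?x i)) = \<one>\<^sub>LG.\<Lambda>"
  proof (rule LG.fun_eqI)
    fix g assume g: "g \<in> carrier G"
    have "(\<Oplus>\<^sub>LG.\<Lambda> i\<in>{..<n}. p (?y i) \<odot>\<^sub>LG.\<Lambda> orbit (?x i)) g = (\<Oplus>\<^sub>L i\<in>{..<n}. p (?y i) \<otimes>\<^sub>L p (x i \<cdot> g))"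
      using g xc(2) by (intro comb) auto
    also have "\<dots> = (\<Oplus>\<^sub>L i\<in>{..<n}. p (x i \<cdot> g \<otimes>\<^sub>T y i))"
      using g xy by (intro L.fsum_cong) (auto simp: L.m_comm)
    also have "\<dots> = p (\<Oplus>\<^sub>T i\<in>{..<n}. x i \<cdot> g \<otimes>\<^sub>T y i)"
      using g xy by (intro p_finsum[symmetric]) auto
    finally show "(\<Oplus>\<^sub>LG.\<Lambda> i\<in>{..<n}. p (?y i) \<odot>\<^sub>LG.\<Lambda> orbit (?x i)) g = \<one>\<^sub>LG.\<Lambda> g"
      using g xy(3)[OF g] by simp
  qed (use csum[of "\<lambda>i. p (?y i)"] xc(2) LW.W.A.one_closed in simp_all)
  then have U: "\<zero>\<^sub>LG.\<Lambda> \<oplus>\<^sub>LG.\<Lambda> (\<Oplus>\<^sub>LG.\<Lambda> i\<in>{..<n}. p (?y i) \<odot>\<^sub>LG.\<Lambda> orbit (?x i)) \<in> Units LG.\<Lambda>"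
    using LW.W.A.Units_one_closed LW.W.A.l_zero[OF LW.W.A.one_closed] by simp
  have Y: "finite (LG.e ` carrier G)" "LG.e ` carrier G \<subseteq> carrier LG.\<Lambda>" using LG.delta_closed by auto
  have "\<exists>t. (\<forall>i. t i \<in> ?S) \<and> \<zero>\<^sub>LG.\<Lambda> \<oplus>\<^sub>LG.\<Lambda> (\<Oplus>\<^sub>LG.\<Lambda> i\<in>{..<n}. t i \<odot>\<^sub>LG.\<Lambda> orbit (?x i)) \<in> Units LG.\<Lambda>"
  proof (rule LW.unit_in_span[OF Y _ S _ LW.W.A.zero_closed _ U])
    show "orbit (?x i) \<in> carrier LG.\<Lambda>" for i using oc by simp
    show "p (?y i) \<in> carrier L" for i using xc(2) by (rule p_simps(1))
  qed (rule group_alg_span)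
  then obtain t where t: "\<forall>i. t i \<in> ?S"
    and tU: "\<zero>\<^sub>LG.\<Lambda> \<oplus>\<^sub>LG.\<Lambda> (\<Oplus>\<^sub>LG.\<Lambda> i\<in>{..<n}. t i \<odot>\<^sub>LG.\<Lambda> orbit (?x i)) \<in> Units LG.\<Lambda>" by blast
  have "\<forall>i. \<exists>k. k \<in> carrier K \<and> t i = \<phi> k" using t by blast
  from choice[OF this] obtain k where k: "\<forall>i. k i \<in> carrier K \<and> t i = \<phi> (k i)" by blast
  have tc: "t i \<in> carrier L" for i using k by auto
  define v where "v = (\<Oplus>\<^sub>T i\<in>{..<n}. k i \<odot>\<^sub>T x i)"
  have v: "v \<in> carrier T" unfolding v_def using k xy by (intro A.A.fsum_closed) auto
  have "orbit v = (\<Oplus>\<^sub>LG.\<Lambda> i\<in>{..<n}. t i \<odot>\<^sub>LG.\<Lambda> orbit (?x i))"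
  proof (rule LG.fun_eqI)
    fix g assume g: "g \<in> carrier G"
    have "orbit v g = p (\<Oplus>\<^sub>T i\<in>{..<n}. (k i \<odot>\<^sub>T x i) \<cdot> g)"
      unfolding v_def using g k xy by (subst A.act_finsum[symmetric]) (auto simp: orbit_def)
    also have "\<dots> = (\<Oplus>\<^sub>L i\<in>{..<n}. p ((k i \<odot>\<^sub>T x i) \<cdot> g))"
      using g k xy by (intro p_finsum) auto
    also have "\<dots> = (\<Oplus>\<^sub>L i\<in>{..<n}. t i \<otimes>\<^sub>L p (x i \<cdot> g))"
      using g k xy by (intro L.fsum_cong) (auto simp: A.act_smult p_smult)
    also have "\<dots> = (\<Oplus>\<^sub>LG.\<Lambda> i\<in>{..<n}. t i \<odot>\<^sub>LG.\<Lambda> orbit (?x i)) g"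
      by (rule comb[OF tc g, symmetric])
    finally show "orbit v g = (\<Oplus>\<^sub>LG.\<Lambda> i\<in>{..<n}. t i \<odot>\<^sub>LG.\<Lambda> orbit (?x i)) g" .
  qed (use csum[OF tc] v in simp_all)
  then have "orbit v \<in> Units LG.\<Lambda>"
    using tU LW.W.A.l_zero[OF csum[OF tc]] by simp
  then show ?thesis using unit_orbit_normal[OF v] by blast
qed

end

context galg_fin
begin

lemma asum_smult_add:
  assumes "\<And>g. g \<in> carrier G \<Longrightarrow> a g \<in> carrier A" "\<And>g. g \<in> carrier G \<Longrightarrow> c g \<in> carrier R"
    "\<And>g. g \<in> carrier G \<Longrightarrow> c' g \<in> carrier R" "\<And>g. g \<in> carrier G \<Longrightarrow> x g = c g \<oplus>\<^sub>R c' g"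
  shows "asum (\<lambda>g. x g \<odot>\<^sub>A a g) = asum (\<lambda>g. c g \<odot>\<^sub>A a g) \<oplus>\<^sub>A asum (\<lambda>g. c' g \<odot>\<^sub>A a g)"
proof -
  have "asum (\<lambda>g. x g \<odot>\<^sub>A a g) = asum (\<lambda>g. c g \<odot>\<^sub>A a g \<oplus>\<^sub>A c' g \<odot>\<^sub>A a g)"
    using assms by (intro asum_cong) (auto simp: A.M.smult_l_distr)
  also have "\<dots> = asum (\<lambda>g. c g \<odot>\<^sub>A a g) \<oplus>\<^sub>A asum (\<lambda>g. c' g \<odot>\<^sub>A a g)"
    using assms by (intro A.A.finsum_addf) auto
  finally show ?thesis .
qed

lemma asum_smult_smult:
  assumes "\<And>g. g \<in> carrier G \<Longrightarrow> a g \<in> carrier A" "\<And>g. g \<in> carrier G \<Longrightarrow> c g \<in> carrier R" "r \<in> carrier R"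
    "\<And>g. g \<in> carrier G \<Longrightarrow> x g = r \<otimes>\<^sub>R c g"
  shows "asum (\<lambda>g. x g \<odot>\<^sub>A a g) = r \<odot>\<^sub>A asum (\<lambda>g. c g \<odot>\<^sub>A a g)"
proof -
  have "asum (\<lambda>g. x g \<odot>\<^sub>A a g) = asum (\<lambda>g. r \<odot>\<^sub>A (c g \<odot>\<^sub>A a g))"
    using assms by (intro asum_cong) (auto simp: A.M.smult_assoc1)
  also have "\<dots> = r \<odot>\<^sub>A asum (\<lambda>g. c g \<odot>\<^sub>A a g)"
    using assms by (intro A.smult_finsum[symmetric]) auto
  finally show ?thesis .
qed

end

text \<open>
  In a spanning set \<open>B\<close> of least cardinality, \<open>b\<close> lies outside of some subspace that contains \<open>B - {b}\<close>;
  a functional that separates the two is the coordinate of \<open>b\<close>.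
\<close>

lemma (in vspace) dual_basis:
  assumes "finite S" "S \<subseteq> carrier M" "\<forall>V. subsp V \<longrightarrow> S \<subseteq> V \<longrightarrow> carrier M \<subseteq> V"
  shows "\<exists>B f. finite B \<and> B \<subseteq> carrier M \<and> (\<forall>b\<in>B. functional (f b)) \<and>
    (\<forall>b\<in>B. \<forall>b'\<in>B. f b b' = (if b' = b then \<one>\<^sub>K else \<zero>\<^sub>K)) \<and>
    (\<forall>a\<in>carrier M. a = (\<Oplus>\<^sub>M b\<in>B. f b a \<odot>\<^sub>M b))"
proof -
  define P where "P S \<longleftrightarrow> finite S \<and> S \<subseteq> carrier M \<and> (\<forall>V. subsp V \<longrightarrow> S \<subseteq> V \<longrightarrow> carrier M \<subseteq> V)" for S
  have "P S" unfolding P_def using assms by simp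
  from ex_has_least_nat[of P S card, OF this] obtain B where PB: "P B" and min: "\<forall>S. P S \<longrightarrow> card B \<le> card S"
    by blast
  have B: "finite B" "B \<subseteq> carrier M" and span: "\<forall>V. subsp V \<longrightarrow> B \<subseteq> V \<longrightarrow> carrier M \<subseteq> V"
    using PB by (simp_all add: P_def)
  have "\<exists>f. functional f \<and> (\<forall>b'\<in>B. f b' = (if b' = b then \<one>\<^sub>K else \<zero>\<^sub>K))" if b: "b \<in> B" for b
  proof -
    have "\<not> P (B - {b})" using min card_Diff1_less[OF B(1) b] by (auto dest: leD)
    then obtain V where V: "subsp V" "B - {b} \<subseteq> V" "\<not> carrier M \<subseteq> V" using B unfolding P_def by blast
    then have bV: "b \<notin> V" using span b by blast
    obtain f where f: "functional f" "\<forall>x\<in>V. f x = \<zero>\<^sub>K" "f b = \<one>\<^sub>K"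
      by (rule separating_functional[OF V(1) subsetD[OF B(2) b] bV])
    show ?thesis using f V(2) by (intro exI[where x = f]) auto
  qed
  then obtain f where f: "\<forall>b\<in>B. functional (f b) \<and> (\<forall>b'\<in>B. f b b' = (if b' = b then \<one>\<^sub>K else \<zero>\<^sub>K))"
    using bchoice[of B "\<lambda>b f. functional f \<and> (\<forall>b'\<in>B. f b' = (if b' = b then \<one>\<^sub>K else \<zero>\<^sub>K))"] by auto
  have fb: "f b a \<in> carrier K" "f b (a \<oplus>\<^sub>M a') = f b a \<oplus>\<^sub>K f b a'" "r \<in> carrier K \<Longrightarrow> f b (r \<odot>\<^sub>M a) = r \<otimes>\<^sub>K f b a"
    if "b \<in> B" "a \<in> carrier M" "a' \<in> carrier M" for a a' b r
    using f that by (auto intro: functionalD)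
  have bc: "b \<in> carrier M" if "b \<in> B" for b using B that by auto
  let ?V = "{a \<in> carrier M. a = (\<Oplus>\<^sub>M b\<in>B. f b a \<odot>\<^sub>M b)}"
  have f0: "f b \<zero>\<^sub>M = \<zero>\<^sub>K" if "b \<in> B" for b using fb(1)[OF that M.M.zero_closed M.M.zero_closed] fb(3)[OF that, of "\<zero>\<^sub>M" "\<zero>\<^sub>M" "\<zero>\<^sub>K"] by simp
  have "subsp ?V"
  proof (rule subspI)
    have "(\<Oplus>\<^sub>M b\<in>B. f b \<zero>\<^sub>M \<odot>\<^sub>M b) = (\<Oplus>\<^sub>M b\<in>B. \<zero>\<^sub>M)" using f0 bc by (intro M.M.fsum_cong) auto
    then show "\<zero>\<^sub>M \<in> ?V" by (simp add: M.M.finsum_zero)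
    fix x y assume xy: "x \<in> ?V" "y \<in> ?V"
    have "x \<oplus>\<^sub>M y = (\<Oplus>\<^sub>M b\<in>B. f b x \<odot>\<^sub>M b) \<oplus>\<^sub>M (\<Oplus>\<^sub>M b\<in>B. f b y \<odot>\<^sub>M b)" using xy by simp
    also have "\<dots> = (\<Oplus>\<^sub>M b\<in>B. f b x \<odot>\<^sub>M b \<oplus>\<^sub>M f b y \<odot>\<^sub>M b)"
      using xy fb bc by (intro M.M.finsum_addf[symmetric]) auto
    also have "\<dots> = (\<Oplus>\<^sub>M b\<in>B. f b (x \<oplus>\<^sub>M y) \<odot>\<^sub>M b)"
      using xy fb bc by (intro M.M.fsum_cong) (auto simp: M.smult_l_distr)
    finally show "x \<oplus>\<^sub>M y \<in> ?V" using xy by simp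
  next
    fix r x assume rx: "r \<in> carrier K" "x \<in> ?V"
    have "r \<odot>\<^sub>M x = r \<odot>\<^sub>M (\<Oplus>\<^sub>M b\<in>B. f b x \<odot>\<^sub>M b)" using rx by simp
    also have "\<dots> = (\<Oplus>\<^sub>M b\<in>B. r \<odot>\<^sub>M (f b x \<odot>\<^sub>M b))"
      using rx fb(1) bc by (intro M.M.finsum_hom[where h = "\<lambda>v. r \<odot>\<^sub>M v"] M.M.abelian_monoid_axioms) (auto simp: M.smult_r_distr)
    also have "\<dots> = (\<Oplus>\<^sub>M b\<in>B. f b (r \<odot>\<^sub>M x) \<odot>\<^sub>M b)"
      using rx fb bc by (intro M.M.fsum_cong) (auto simp: M.smult_assoc1)
    finally show "r \<odot>\<^sub>M x \<in> ?V" using rx by simp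
  qed auto
  moreover have "B \<subseteq> ?V"
  proof
    fix b assume b: "b \<in> B"
    have "(\<Oplus>\<^sub>M b'\<in>B. f b' b \<odot>\<^sub>M b') = b"
      using b bc f B(1) by (subst M.M.finsum_single[where i = b]) auto
    then show "b \<in> ?V" using bc[OF b] by simp
  qed
  ultimately have "carrier M \<subseteq> ?V" using span by blast
  then show ?thesis using B f by (intro exI[where x = B] exI[where x = f]) auto
qed

text \<open>
  Moebius inversion over subsets: the numbers of \<open>a\<close> with \<open>Y \<subseteq> \<alpha> a\<close>, for all \<open>Y\<close>, determine
  the numbers of \<open>a\<close> with \<open>Y = \<alpha> a\<close>.
\<close>

lemma card_fibres_eq:
  assumes "finite P" "finite A" "finite B" "\<And>a. a \<in> A \<Longrightarrow> \<alpha> a \<subseteq> P" "\<And>b. b \<in> B \<Longrightarrow> \<beta> b \<subseteq> P"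
    and eq: "\<And>Y. Y \<subseteq> P \<Longrightarrow> card {a\<in>A. Y \<subseteq> \<alpha> a} = card {b\<in>B. Y \<subseteq> \<beta> b}"
  shows "Y \<subseteq> P \<Longrightarrow> card {a\<in>A. \<alpha> a = Y} = card {b\<in>B. \<beta> b = Y}"
proof (induction "card (P - Y)" arbitrary: Y rule: less_induct)
  case less
  let ?S = "{Z. Y \<subseteq> Z \<and> Z \<subseteq> P}"
  have split: "card {c\<in>C. Y \<subseteq> \<gamma> c} = card {c\<in>C. \<gamma> c = Y} + (\<Sum>Z\<in>?S - {Y}. card {c\<in>C. \<gamma> c = Z})"
    if C: "finite C" "\<And>c. c \<in> C \<Longrightarrow> \<gamma> c \<subseteq> P" for C and \<gamma> :: "_ \<Rightarrow> _ set"
  proof -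
    have fS: "finite ?S" using assms(1) by (auto intro: finite_subset[of _ "Pow P"])
    have "card {c\<in>C. Y \<subseteq> \<gamma> c} = (\<Sum>Z\<in>?S. \<Sum>c\<in>{c \<in> {c\<in>C. Y \<subseteq> \<gamma> c}. \<gamma> c = Z}. 1)"
      using C fS by (subst sum.group) auto
    also have "\<dots> = (\<Sum>Z\<in>?S. card {c\<in>C. \<gamma> c = Z})"
    proof (rule sum.cong[OF refl])
      fix Z assume "Z \<in> ?S"
      then have "{c \<in> {c\<in>C. Y \<subseteq> \<gamma> c}. \<gamma> c = Z} = {c\<in>C. \<gamma> c = Z}" by auto
      then show "(\<Sum>c\<in>{c \<in> {c\<in>C. Y \<subseteq> \<gamma> c}. \<gamma> c = Z}. 1) = card {c\<in>C. \<gamma> c = Z}" by simp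
    qed
    also have "\<dots> = card {c\<in>C. \<gamma> c = Y} + (\<Sum>Z\<in>?S - {Y}. card {c\<in>C. \<gamma> c = Z})"
      using fS less.prems by (subst sum.remove[of _ Y]) auto
    finally show ?thesis .
  qed
  have "card {a\<in>A. \<alpha> a = Z} = card {b\<in>B. \<beta> b = Z}" if "Z \<in> ?S - {Y}" for Z
  proof (rule less.hyps)
    show "card (P - Z) < card (P - Y)" using that assms(1) by (intro psubset_card_mono) auto
  qed (use that in auto)
  then have "(\<Sum>Z\<in>?S - {Y}. card {a\<in>A. \<alpha> a = Z}) = (\<Sum>Z\<in>?S - {Y}. card {b\<in>B. \<beta> b = Z})"
    by (rule sum.cong[OF refl])
  then show ?case using split[of A \<alpha>] split[of B \<beta>] assms eq[OF less.prems] by simp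
qed

context torsor_galg
begin

sublocale HF: galg_fin K G H by unfold_locales

text \<open>
  Over a finite field, count. With a basis \<open>B\<close> of \<open>T\<close>, the canonical map identifies \<open>T\<^sup>B = T \<otimes> T\<close> with
  the functions from \<open>G\<close> to \<open>T\<close>, that is, with \<open>H\<^sup>B\<close>, and this identification respects the
  action of the group algebra. So a set \<open>Y\<close> of elements of the group algebra kills as many elements of \<open>T\<close>
  as of \<open>H\<close>. Hence as many elements of \<open>T\<close> as of \<open>H\<close> have annihilator \<open>0\<close>, and the delta function
  at \<open>1\<close> is one.
\<close>

lemma normal_basis_finite:
  assumes fin: "finite (carrier K)"
  shows "\<exists>v. normal_generator v"
proof -
  let ?M = "carrier G \<rightarrow>\<^sub>E carrier K"
  obtain n :: nat and x y where xy: "\<And>i. i < n \<Longrightarrow> x i \<in> carrier T" "\<And>i. i < n \<Longrightarrow> y i \<in> carrier T"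
    "\<And>g. g \<in> carrier G \<Longrightarrow> (\<Oplus>\<^sub>T i\<in>{..<n}. x i \<cdot> g \<otimes>\<^sub>T y i) = (if g = \<one> then \<one>\<^sub>T else \<zero>\<^sub>T)"
    by (rule galois_coordinates) (rule that)
  have "\<exists>B f. finite B \<and> B \<subseteq> carrier T \<and> (\<forall>b\<in>B. V.functional (f b)) \<and>
    (\<forall>b\<in>B. \<forall>b'\<in>B. f b b' = (if b' = b then \<one>\<^sub>K else \<zero>\<^sub>K)) \<and>
    (\<forall>a\<in>carrier T. a = (\<Oplus>\<^sub>T b\<in>B. f b a \<odot>\<^sub>T b))"
  proof (rule V.dual_basis[of "y ` {..<n}"])
    show "\<forall>W. V.subsp W \<longrightarrow> y ` {..<n} \<subseteq> W \<longrightarrow> carrier T \<subseteq> W"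
    proof (intro allI impI subsetI)
      fix W a assume W: "V.subsp W" "y ` {..<n} \<subseteq> W" and a: "a \<in> carrier T"
      obtain r where r: "\<forall>i<n. r i \<in> carrier K" "a = (\<Oplus>\<^sub>T i\<in>{..<n}. r i \<odot>\<^sub>T y i)"
        using coordinates_span[OF xy a] by blast
      show "a \<in> W" unfolding r(2) by (rule V.subsp_finsum[OF W(1)]) (use r W in \<open>auto intro: V.subspD(4)\<close>)
    qed
  qed (use xy in auto)
  then obtain B f where B: "finite B" "B \<subseteq> carrier T" and ff: "\<forall>b\<in>B. V.functional (f b)"
    and fd: "\<forall>b\<in>B. \<forall>b'\<in>B. f b b' = (if b' = b then \<one>\<^sub>K else \<zero>\<^sub>K)"
    and fe: "\<forall>a\<in>carrier T. a = (\<Oplus>\<^sub>T b\<in>B. f b a \<odot>\<^sub>T b)"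
    by blast
  have bc: "b \<in> carrier T" if "b \<in> B" for b using B that by auto
  have f: "f b a \<in> carrier K" "f b (a \<oplus>\<^sub>T a') = f b a \<oplus>\<^sub>K f b a'" "r \<in> carrier K \<Longrightarrow> f b (r \<odot>\<^sub>T a) = r \<otimes>\<^sub>K f b a"
    if "b \<in> B" "a \<in> carrier T" "a' \<in> carrier T" for a a' b r
    using bspec[OF ff that(1)] that by (auto intro: V.functionalD)
  have fK: "f b a \<in> carrier K" if "b \<in> B" "a \<in> carrier T" for a b using f(1)[OF that that(2)] .
  have fm: "f b (r \<odot>\<^sub>T a) = r \<otimes>\<^sub>K f b a" if "b \<in> B" "a \<in> carrier T" "r \<in> carrier K" for r a b
    using f(3)[OF that(1,2,2,3)] .
  note f = fK f(2) fm
  have f0: "f b \<zero>\<^sub>T = \<zero>\<^sub>K" if "b \<in> B" for b using f(1)[OF that A.A.zero_closed] f(3)[OF that, of "\<zero>\<^sub>T" "\<zero>\<^sub>K"] by simp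
  have fsum: "f b (\<Oplus>\<^sub>T i\<in>I. u i) = (\<Oplus>\<^sub>K i\<in>I. f b (u i))" if "b \<in> B" "\<And>i. i \<in> I \<Longrightarrow> u i \<in> carrier T" for b and I :: "'x set" and u
    using that f0 f by (intro A.A.finsum_hom R.abelian_monoid_axioms) auto
  have Bne: "B \<noteq> {}"
  proof
    assume "B = {}"
    then have "\<one>\<^sub>T = \<zero>\<^sub>T" using bspec[OF fe A.A.one_closed] by (simp add: A.A.finsum_empty)
    with one_not_zero show False ..
  qed
  have coord: "a = a'" if "a \<in> carrier T" "a' \<in> carrier T" "\<And>b. b \<in> B \<Longrightarrow> f b a = f b a'" for a a'
  proof -
    have "a = (\<Oplus>\<^sub>T b\<in>B. f b a \<odot>\<^sub>T b)" using fe that by blast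
    also have "\<dots> = (\<Oplus>\<^sub>T b\<in>B. f b a' \<odot>\<^sub>T b)" using that f bc by (intro A.A.fsum_cong) auto
    also have "\<dots> = a'" using fe that by metis
    finally show ?thesis .
  qed
  have finT: "finite (carrier T)"
  proof (rule finite_imageD)
    have "(\<lambda>a. \<lambda>b\<in>B. f b a) ` carrier T \<subseteq> B \<rightarrow>\<^sub>E carrier K" using f by auto
    then show "finite ((\<lambda>a. \<lambda>b\<in>B. f b a) ` carrier T)"
      by (rule finite_subset) (intro finite_PiE B(1) fin)
    show "inj_on (\<lambda>a. \<lambda>b\<in>B. f b a) (carrier T)"
    proof (rule inj_onI)
      fix a a' assume aa: "a \<in> carrier T" "a' \<in> carrier T" and eq: "(\<lambda>b\<in>B. f b a) = (\<lambda>b\<in>B. f b a')"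
      have "f b a = f b a'" if "b \<in> B" for b using fun_cong[OF eq, of b] that by simp
      then show "a = a'" by (rule coord[OF aa])
    qed
  qed
  have finM: "finite ?M" using G.fin fin by (intro finite_PiE) auto
  define \<tau> where "\<tau> a = finprod TxT (\<lambda>b. a b \<otimes>\<otimes> b) B" for a
  have \<tau>c: "\<tau> a \<in> carrier TxT" if "\<forall>b\<in>B. a b \<in> carrier T" for a
    unfolding \<tau>_def using that bc by (intro TT.T.finprod_closed) auto
  have \<tau>surj: "\<exists>a. (\<forall>b\<in>B. a b \<in> carrier T) \<and> t = \<tau> a" if "t \<in> carrier TxT" for t
    using that
  proof (induction t rule: TT.tensor_induct)
    case (tens u w)
    have "u \<otimes>\<otimes> w = u \<otimes>\<otimes> (\<Oplus>\<^sub>T b\<in>B. f b w \<odot>\<^sub>T b)" using fe tens by metis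
    also have "\<dots> = finprod TxT (\<lambda>b. u \<otimes>\<otimes> (f b w \<odot>\<^sub>T b)) B"
      unfolding finsum_def using tens f bc
      by (intro comm_monoid.finprod_hom[OF A.A.a_comm_monoid, where h = "\<lambda>v. u \<otimes>\<otimes> v"] TT.T.comm_monoid_axioms)
        (auto simp: TT.tens_add_right)
    also have "\<dots> = \<tau> (\<lambda>b. f b w \<odot>\<^sub>T u)"
      unfolding \<tau>_def using tens f bc by (intro TT.T.finprod_cong') (auto simp: TT.tens_smult)
    finally show ?case using tens f by (intro exI[where x = "\<lambda>b. f b w \<odot>\<^sub>T u"]) auto
  next
    case (mult t u)
    obtain a a' where a: "\<forall>b\<in>B. a b \<in> carrier T" "t = \<tau> a" "\<forall>b\<in>B. a' b \<in> carrier T" "u = \<tau> a'" using mult by blast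
    have "t \<otimes>\<^sub>TxT u = \<tau> (\<lambda>b. a b \<oplus>\<^sub>T a' b)"
    proof -
      have "\<tau> (\<lambda>b. a b \<oplus>\<^sub>T a' b) = finprod TxT (\<lambda>b. (a b \<otimes>\<otimes> b) \<otimes>\<^sub>TxT (a' b \<otimes>\<otimes> b)) B"
        unfolding \<tau>_def using a(1,3) bc by (intro TT.T.finprod_cong' TT.tens_add_left) auto
      also have "\<dots> = t \<otimes>\<^sub>TxT u"
        unfolding a(2,4) \<tau>_def using a(1,3) bc by (intro TT.T.finprod_multf) auto
      finally show ?thesis ..
    qed
    then show ?case using a by (intro exI[where x = "\<lambda>b. a b \<oplus>\<^sub>T a' b"]) auto
  qed
  have \<tau>inj: "a b = a' b" if a: "\<forall>b\<in>B. a b \<in> carrier T" "\<forall>b\<in>B. a' b \<in> carrier T" and eq: "\<tau> a = \<tau> a'" and b: "b \<in> B" for a a' b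
  proof -
    let ?\<Phi> = "\<lambda>u w. f b w \<odot>\<^sub>T u"
    have bal: "TT.balanced (add_monoid T) ?\<Phi>"
      using f[OF b] by (auto simp: TT.balanced_def A.M.smult_l_distr A.M.smult_r_distr A.M.smult_assoc1[symmetric] R.m_comm)
    note lt = TT.lift_tens[OF A.A.a_comm_group bal]
    interpret lh: group_hom TxT "add_monoid T" "tensor_lift (add_monoid T) ?\<Phi>"
      using TT.lift_hom[OF A.A.a_comm_group bal] A.A.a_group by unfold_locales
    have lta: "tensor_lift (add_monoid T) ?\<Phi> (\<tau> a) = a b" if a: "\<forall>b\<in>B. a b \<in> carrier T" for a
    proof -
      have "tensor_lift (add_monoid T) ?\<Phi> (\<tau> a) = finprod (add_monoid T) (\<lambda>b'. tensor_lift (add_monoid T) ?\<Phi> (a b' \<otimes>\<otimes> b')) B"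
        unfolding \<tau>_def using a bc lh.hom_mult lh.hom_one lh.hom_closed
        by (intro TT.T.finprod_hom A.A.a_comm_monoid) auto
      also have "\<dots> = (\<Oplus>\<^sub>T b'\<in>B. f b b' \<odot>\<^sub>T a b')"
        unfolding finsum_def[symmetric] using a bc f[OF b] lt by (intro A.A.fsum_cong) auto
      also have "\<dots> = a b"
        using a b B(1) fd by (subst A.A.finsum_single[where i = b]) auto
      finally show ?thesis .
    qed
    show ?thesis using lta[OF a(1)] lta[OF a(2)] eq by simp
  qed
  have can\<tau>: "canonical_map G T (\<tau> a) h = (\<Oplus>\<^sub>T b\<in>B. a b \<cdot> h \<otimes>\<^sub>T b)"
    if "\<forall>b\<in>B. a b \<in> carrier T" "h \<in> carrier G" for a h
    unfolding \<tau>_def using that bc by (subst can_finprod) (auto simp: canonical_tens intro!: A.A.fsum_cong)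
  \<comment> \<open>the identification of \<open>T\<^sup>B\<close> with \<open>H\<^sup>B\<close>\<close>
  define \<epsilon> where "\<epsilon> a = (\<lambda>b\<in>B. \<lambda>h\<in>carrier G. f b (canonical_map G T (\<tau> a) h))" for a
  have canc: "canonical_map G T (\<tau> a) h \<in> carrier T" if "\<forall>b\<in>B. a b \<in> carrier T" "h \<in> carrier G" for a h
    using canonical_closed[OF \<tau>c[OF that(1)]] that(2) by auto
  have \<epsilon>c: "\<epsilon> a b \<in> ?M" if "\<forall>b\<in>B. a b \<in> carrier T" "b \<in> B" for a b
    using that f canc[OF that(1)] by (auto simp: \<epsilon>_def)
  have \<epsilon>inj: "a b = a' b" if a: "\<forall>b\<in>B. a b \<in> carrier T" "\<forall>b\<in>B. a' b \<in> carrier T" and b: "b \<in> B"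
    and eq: "\<And>b. b \<in> B \<Longrightarrow> \<epsilon> a b = \<epsilon> a' b" for a a' b
  proof (rule \<tau>inj[OF a _ b])
    show "\<tau> a = \<tau> a'"
    proof (rule can_inj[OF \<tau>c[OF a(1)] \<tau>c[OF a(2)]])
      fix h assume h: "h \<in> carrier G"
      show "canonical_map G T (\<tau> a) h = canonical_map G T (\<tau> a') h"
      proof (rule coord)
        fix b assume "b \<in> B"
        then show "f b (canonical_map G T (\<tau> a) h) = f b (canonical_map G T (\<tau> a') h)"
          using fun_cong[OF eq, of b h] h by (simp add: \<epsilon>_def)
      qed (rule canc[OF a(1) h], rule canc[OF a(2) h])
    qed
  qed
  have \<epsilon>surj: "\<exists>a. (\<forall>b\<in>B. a b \<in> carrier T) \<and> (\<forall>b\<in>B. \<epsilon> a b = w b)" if w: "\<forall>b\<in>B. w b \<in> ?M" for w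
  proof -
    have wc: "w b h \<in> carrier K" if "b \<in> B" "h \<in> carrier G" for b h using w that by auto
    let ?F = "\<lambda>h\<in>carrier G. (\<Oplus>\<^sub>T b\<in>B. w b h \<odot>\<^sub>T b)"
    have "?F \<in> carrier G \<rightarrow>\<^sub>E carrier T" using wc bc by (auto intro!: A.A.fsum_closed)
    then obtain t where t: "t \<in> carrier TxT" "canonical_map G T t = ?F" by (rule can_surj)
    obtain a where a: "\<forall>b\<in>B. a b \<in> carrier T" "t = \<tau> a" using \<tau>surj[OF t(1)] by blast
    have "\<epsilon> a b = w b" if b: "b \<in> B" for b
    proof (rule PiE_ext[OF \<epsilon>c bspec[OF w b]])
      fix h assume h: "h \<in> carrier G"
      have "\<epsilon> a b h = f b (\<Oplus>\<^sub>T b\<in>B. w b h \<odot>\<^sub>T b)" using b h t(2) a(2) by (simp add: \<epsilon>_def)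
      also have "\<dots> = (\<Oplus>\<^sub>K b'\<in>B. w b' h \<otimes>\<^sub>K f b b')"
        using b h wc bc f by (subst fsum) (auto intro!: R.fsum_cong)
      also have "\<dots> = w b h" using b h wc B(1) fd by (subst R.finsum_single[where i = b]) auto
      finally show "\<epsilon> a b h = w b h" .
    qed (use a b in auto)
    then show ?thesis using a by blast
  qed
  have equiv: "\<epsilon> (\<lambda>b. normal_sum (a b) c) b = HF.normal_sum (\<epsilon> a b) c"
    if a: "\<forall>b\<in>B. a b \<in> carrier T" and c: "c \<in> ?M" and b: "b \<in> B" for a c b
  proof (rule PiE_ext)
    have nc: "\<forall>b\<in>B. normal_sum (a b) c \<in> carrier T" using a c by (blast intro: normal_sum_closed)
    have cc: "c g \<in> carrier K" if "g \<in> carrier G" for g using c that by auto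
    show "\<epsilon> (\<lambda>b. normal_sum (a b) c) b \<in> ?M" using \<epsilon>c[OF nc b] .
    show "HF.normal_sum (\<epsilon> a b) c \<in> ?M" using HF.normal_sum_closed[of "\<epsilon> a b" c] \<epsilon>c[OF a b] c by simp
    fix h assume h: "h \<in> carrier G"
    have "canonical_map G T (\<tau> (\<lambda>b. normal_sum (a b) c)) h = (\<Oplus>\<^sub>T b\<in>B. normal_sum (a b) c \<cdot> h \<otimes>\<^sub>T b)"
      by (rule can\<tau>[OF nc h])
    also have "\<dots> = (\<Oplus>\<^sub>T b\<in>B. asum (\<lambda>g. c g \<odot>\<^sub>T (a b \<cdot> (g \<otimes> h) \<otimes>\<^sub>T b)))"
    proof (rule A.A.fsum_cong)
      fix b assume b: "b \<in> B"
      have "normal_sum (a b) c \<cdot> h = asum (\<lambda>g. c g \<odot>\<^sub>T a b \<cdot> (g \<otimes> h))"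
        unfolding normal_sum_def using bspec[OF a b] cc h by (subst A.act_finsum) (auto simp: A.act_smult A.act_act intro!: asum_cong)
      then have "normal_sum (a b) c \<cdot> h \<otimes>\<^sub>T b = asum (\<lambda>g. (c g \<odot>\<^sub>T a b \<cdot> (g \<otimes> h)) \<otimes>\<^sub>T b)"
        using bspec[OF a b] cc h bc[OF b] by (simp add: A.finsum_mult)
      also have "\<dots> = asum (\<lambda>g. c g \<odot>\<^sub>T (a b \<cdot> (g \<otimes> h) \<otimes>\<^sub>T b))"
        using bspec[OF a b] cc h bc[OF b] by (intro asum_cong) (auto simp: A.smult_mult_left)
      finally show "normal_sum (a b) c \<cdot> h \<otimes>\<^sub>T b = asum (\<lambda>g. c g \<odot>\<^sub>T (a b \<cdot> (g \<otimes> h) \<otimes>\<^sub>T b))" .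
    qed (use a cc h bc in \<open>auto intro!: asum_closed\<close>)
    also have "\<dots> = asum (\<lambda>g. \<Oplus>\<^sub>T b\<in>B. c g \<odot>\<^sub>T (a b \<cdot> (g \<otimes> h) \<otimes>\<^sub>T b))"
      using a cc h bc B(1) by (intro asum_swap) auto
    also have "\<dots> = asum (\<lambda>g. c g \<odot>\<^sub>T canonical_map G T (\<tau> a) (g \<otimes> h))"
    proof (rule asum_cong)
      fix g assume g: "g \<in> carrier G"
      have "c g \<odot>\<^sub>T canonical_map G T (\<tau> a) (g \<otimes> h) = c g \<odot>\<^sub>T (\<Oplus>\<^sub>T b\<in>B. a b \<cdot> (g \<otimes> h) \<otimes>\<^sub>T b)"
        using can\<tau>[OF a] g h by simp
      also have "\<dots> = (\<Oplus>\<^sub>T b\<in>B. c g \<odot>\<^sub>T (a b \<cdot> (g \<otimes> h) \<otimes>\<^sub>T b))"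
        using a cc g h bc by (intro A.smult_finsum) auto
      finally show "(\<Oplus>\<^sub>T b\<in>B. c g \<odot>\<^sub>T (a b \<cdot> (g \<otimes> h) \<otimes>\<^sub>T b)) = c g \<odot>\<^sub>T canonical_map G T (\<tau> a) (g \<otimes> h)" ..
    qed (use a cc h canc in auto)
    finally have "\<epsilon> (\<lambda>b. normal_sum (a b) c) b h = f b (asum (\<lambda>g. c g \<odot>\<^sub>T canonical_map G T (\<tau> a) (g \<otimes> h)))"
      using b h by (simp add: \<epsilon>_def)
    also have "\<dots> = (\<Oplus>\<^sub>K g\<in>carrier G. f b (c g \<odot>\<^sub>T canonical_map G T (\<tau> a) (g \<otimes> h)))"
      using b cc h canc[OF a] by (intro fsum) auto
    also have "\<dots> = (\<Oplus>\<^sub>K g\<in>carrier G. (c g \<odot>\<^sub>H gact H (\<epsilon> a b) g) h)"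
      using b cc h canc[OF a] f[OF b] by (intro R.fsum_cong) (auto simp: \<epsilon>_def)
    also have "\<dots> = HF.normal_sum (\<epsilon> a b) c h"
      unfolding HF.normal_sum_def
      by (rule fun_sum[OF h, symmetric]) (rule H.M.smult_closed, use cc in blast, rule H.act_closed, use \<epsilon>c[OF a b] in simp_all)
    finally show "\<epsilon> (\<lambda>b. normal_sum (a b) c) b h = HF.normal_sum (\<epsilon> a b) c h" .
  qed
  have \<epsilon>0: "\<epsilon> (\<lambda>b. \<zero>\<^sub>T) b = \<zero>\<^sub>H" if b: "b \<in> B" for b
  proof (rule fun_eqI)
    fix h assume h: "h \<in> carrier G"
    have "canonical_map G T (\<tau> (\<lambda>b. \<zero>\<^sub>T)) h = (\<Oplus>\<^sub>T b\<in>B. \<zero>\<^sub>T \<cdot> h \<otimes>\<^sub>T b)"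
      by (rule can\<tau>[of "\<lambda>b. \<zero>\<^sub>T"]) (use h in simp_all)
    also have "\<dots> = (\<Oplus>\<^sub>T b\<in>B. \<zero>\<^sub>T)" using h bc by (intro A.A.fsum_cong) auto
    finally have "canonical_map G T (\<tau> (\<lambda>b. \<zero>\<^sub>T)) h = (\<Oplus>\<^sub>T b\<in>B. \<zero>\<^sub>T)" .
    then show "\<epsilon> (\<lambda>b. \<zero>\<^sub>T) b h = \<zero>\<^sub>H h" using b h f0 by (simp add: \<epsilon>_def A.A.finsum_zero)
  qed (use \<epsilon>c[of "\<lambda>b. \<zero>\<^sub>T" b] b in simp, rule H.A.zero_closed)
  define NT where "NT v = {c \<in> ?M. normal_sum v c = \<zero>\<^sub>T }" for v
  define NH where "NH w = {c \<in> ?M. HF.normal_sum w c = \<zero>\<^sub>H }" for w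
  have iff: "(\<forall>b\<in>B. c \<in> NT (a b)) \<longleftrightarrow> (\<forall>b\<in>B. c \<in> NH (\<epsilon> a b))" if a: "\<forall>b\<in>B. a b \<in> carrier T" and c: "c \<in> ?M" for a c
  proof -
    have nc: "\<forall>b\<in>B. normal_sum (a b) c \<in> carrier T" using a c by (blast intro: normal_sum_closed)
    have "(\<forall>b\<in>B. normal_sum (a b) c = \<zero>\<^sub>T) \<longleftrightarrow> (\<forall>b\<in>B. \<epsilon> (\<lambda>b. normal_sum (a b) c) b = \<zero>\<^sub>H)"
    proof
      assume z: "\<forall>b\<in>B. normal_sum (a b) c = \<zero>\<^sub>T"
      then have "\<tau> (\<lambda>b. normal_sum (a b) c) = \<tau> (\<lambda>b. \<zero>\<^sub>T)"
        unfolding \<tau>_def using bc by (intro TT.T.finprod_cong') auto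
      then show "\<forall>b\<in>B. \<epsilon> (\<lambda>b. normal_sum (a b) c) b = \<zero>\<^sub>H" using \<epsilon>0 by (simp add: \<epsilon>_def)
    next
      assume z: "\<forall>b\<in>B. \<epsilon> (\<lambda>b. normal_sum (a b) c) b = \<zero>\<^sub>H"
      show "\<forall>b\<in>B. normal_sum (a b) c = \<zero>\<^sub>T"
        using \<epsilon>inj[of "\<lambda>b. normal_sum (a b) c" "\<lambda>b. \<zero>\<^sub>T"] nc z \<epsilon>0 by simp
    qed
    then show ?thesis using c equiv[OF a c] by (simp add: NT_def NH_def)
  qed
  have count: "card {v \<in> carrier T. Y \<subseteq> NT v} = card {w \<in> ?M. Y \<subseteq> NH w}" if Y: "Y \<subseteq> ?M" for Y
  proof -
    let ?N = "{v \<in> carrier T. Y \<subseteq> NT v}" and ?W = "{w \<in> ?M. Y \<subseteq> NH w}"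
    have iffY: "(\<forall>b\<in>B. Y \<subseteq> NT (a b)) \<longleftrightarrow> (\<forall>b\<in>B. Y \<subseteq> NH (\<epsilon> a b))" if a: "\<forall>b\<in>B. a b \<in> carrier T" for a
      using iff[OF a] Y by (simp add: subset_iff) blast
    have "bij_betw \<epsilon> (B \<rightarrow>\<^sub>E ?N) (B \<rightarrow>\<^sub>E ?W)"
    proof (rule bij_betw_imageI)
      show "inj_on \<epsilon> (B \<rightarrow>\<^sub>E ?N)"
      proof (rule inj_onI)
        fix a a' assume a: "a \<in> B \<rightarrow>\<^sub>E ?N" "a' \<in> B \<rightarrow>\<^sub>E ?N" "\<epsilon> a = \<epsilon> a'"
        have ac: "\<forall>b\<in>B. a b \<in> carrier T" "\<forall>b\<in>B. a' b \<in> carrier T" using a(1,2) by auto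
        show "a = a'" by (rule PiE_ext[OF a(1,2)]) (rule \<epsilon>inj[OF ac], simp_all add: a(3))
      qed
      show "\<epsilon> ` (B \<rightarrow>\<^sub>E ?N) = B \<rightarrow>\<^sub>E ?W"
      proof (intro equalityI subsetI)
        fix w assume "w \<in> \<epsilon> ` (B \<rightarrow>\<^sub>E ?N)"
        then obtain a where a: "a \<in> B \<rightarrow>\<^sub>E ?N" "w = \<epsilon> a" by auto
        have ac: "\<forall>b\<in>B. a b \<in> carrier T" using a(1) by auto
        have "Y \<subseteq> NT (a b)" if "b \<in> B" for b using a(1) that by auto
        then have "Y \<subseteq> NH (\<epsilon> a b)" if "b \<in> B" for b using iffY[OF ac] that by blast
        then have "\<epsilon> a b \<in> ?W" if "b \<in> B" for b using \<epsilon>c[OF ac that] that by simp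
        then show "w \<in> B \<rightarrow>\<^sub>E ?W" unfolding a(2) by (intro PiE_I) (auto simp: \<epsilon>_def)
      next
        fix w assume w: "w \<in> B \<rightarrow>\<^sub>E ?W"
        have wM: "\<forall>b\<in>B. w b \<in> ?M" and wY: "\<forall>b\<in>B. Y \<subseteq> NH (w b)" using PiE_mem[OF w] by simp_all
        obtain a0 where a0: "\<forall>b\<in>B. a0 b \<in> carrier T" "\<forall>b\<in>B. \<epsilon> a0 b = w b" using \<epsilon>surj[OF wM] by blast
        let ?a = "\<lambda>b\<in>B. a0 b"
        have "\<tau> ?a = \<tau> a0" unfolding \<tau>_def using a0 bc by (intro TT.T.finprod_cong') auto
        then have ea: "\<epsilon> ?a = \<epsilon> a0" by (simp add: \<epsilon>_def)
        have ac: "\<forall>b\<in>B. ?a b \<in> carrier T" using a0 by simp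
        have "\<forall>b\<in>B. Y \<subseteq> NH (\<epsilon> ?a b)" unfolding ea using wY a0(2) by simp
        then have "\<forall>b\<in>B. Y \<subseteq> NT (?a b)" using iffY[OF ac] by blast
        then have "?a \<in> B \<rightarrow>\<^sub>E ?N" using a0(1) by (intro PiE_I) auto
        moreover have "w = \<epsilon> ?a"
        proof
          fix b show "w b = \<epsilon> ?a b"
            using a0(2) ea PiE_arb[OF w, of b] by (cases "b \<in> B") (auto simp: \<epsilon>_def)
        qed
        ultimately show "w \<in> \<epsilon> ` (B \<rightarrow>\<^sub>E ?N)" using imageI[of ?a "B \<rightarrow>\<^sub>E ?N" \<epsilon>] by (simp only:)
      qed
    qed
    then have "card (B \<rightarrow>\<^sub>E ?N) = card (B \<rightarrow>\<^sub>E ?W)" by (rule bij_betw_same_card)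
    then have "card ?N ^ card B = card ?W ^ card B" using B(1) by (simp add: card_PiE)
    then show ?thesis using Bne B(1) by (simp add: power_eq_iff_eq_base card_gt_0_iff)
  qed
  have z: "\<zero>\<^sub>H \<in> ?M" using H.A.zero_closed by simp
  have NHd: "NH (e \<one>) = {\<zero>\<^sub>H }"
  proof -
    have val: "HF.normal_sum (e \<one>) c h = c (inv h)" if c: "c \<in> ?M" and h: "h \<in> carrier G" for c h
    proof -
      have cc: "c g \<in> carrier K" if "g \<in> carrier G" for g using c that by auto
      have "HF.normal_sum (e \<one>) c h = (\<Oplus>\<^sub>K g\<in>carrier G. (c g \<odot>\<^sub>H gact H (e \<one>) g) h)"
        unfolding HF.normal_sum_def
        by (rule fun_sum[OF h]) (rule H.M.smult_closed, use cc in blast, rule H.act_closed, simp_all add: delta_closed del: fun_alg_simps)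
      also have "\<dots> = c (inv h)"
        using cc h by (subst R.finsum_single[where i = "inv h"]) (auto simp: delta_fun_def G.inv_equality[symmetric] dest: G.inv_equality)
      finally show ?thesis .
    qed
    show ?thesis
    proof (intro equalityI subsetI)
      fix c assume "c \<in> NH (e \<one>)"
      then have c: "c \<in> ?M" and c0: "HF.normal_sum (e \<one>) c = \<zero>\<^sub>H" by (simp_all add: NH_def)
      have "c = \<zero>\<^sub>H"
      proof (rule PiE_ext[OF c z])
        fix g assume g: "g \<in> carrier G"
        then show "c g = \<zero>\<^sub>H g" using val[OF c, of "inv g"] c0 by simp
      qed
      then show "c \<in> {\<zero>\<^sub>H }" by simp
    next
      fix c assume "c \<in> {\<zero>\<^sub>H }"
      then have c: "c = \<zero>\<^sub>H" by simp
      have "HF.normal_sum (e \<one>) \<zero>\<^sub>H \<in> carrier H"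
        using z by (intro HF.normal_sum_closed) (simp_all add: delta_closed del: fun_alg_simps)
      then have "HF.normal_sum (e \<one>) \<zero>\<^sub>H = \<zero>\<^sub>H"
        by (rule fun_eqI) (use val[OF z] H.A.zero_closed in simp_all)
      then show "c \<in> NH (e \<one>)" using z unfolding c NH_def by simp
    qed
  qed
  have "card {v \<in> carrier T. NT v = {\<zero>\<^sub>H }} = card {w \<in> ?M. NH w = {\<zero>\<^sub>H }}"
    by (rule card_fibres_eq[OF finM finT finM _ _ count]) (use z in \<open>auto simp: NT_def NH_def\<close>)
  moreover have "e \<one> \<in> {w \<in> ?M. NH w = {\<zero>\<^sub>H }}" using NHd delta_closed[of "\<one>"] by simp
  then have "0 < card {w \<in> ?M. NH w = {\<zero>\<^sub>H }}" using finM by (auto simp: card_gt_0_iff)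
  ultimately have "{v \<in> carrier T. NT v = {\<zero>\<^sub>H }} \<noteq> {}" using finT by (metis card.empty less_nat_zero_code)
  then obtain v where v: "v \<in> carrier T" "NT v = {\<zero>\<^sub>H }" by blast
  have "inj_on (normal_sum v) ?M"
  proof (rule inj_onI)
    fix c c' assume c: "c \<in> ?M" "c' \<in> ?M" "normal_sum v c = normal_sum v c'"
    have cc: "c g \<in> carrier K" "c' g \<in> carrier K" if "g \<in> carrier G" for g using c that by auto
    let ?d = "\<lambda>g\<in>carrier G. c g \<ominus>\<^sub>K c' g"
    have d: "?d \<in> ?M" using cc by auto
    have "normal_sum v ?d \<oplus>\<^sub>T normal_sum v c' = normal_sum v c"
      unfolding normal_sum_def using cc v(1)
      by (intro asum_smult_add[symmetric]) (auto simp: a_minus_def R.a_assoc R.l_neg)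
    then have "normal_sum v ?d = \<zero>\<^sub>T"
      using c(3) normal_sum_closed[OF v(1) d] normal_sum_closed[OF v(1) c(2)] by (simp add: A.A.add.r_cancel_one)
    then have "?d \<in> NT v" using d by (simp add: NT_def)
    then have d0: "?d = \<zero>\<^sub>H" using v(2) by simp
    show "c = c'"
    proof (rule PiE_ext[OF c(1,2)])
      fix g assume g: "g \<in> carrier G"
      then show "c g = c' g" using fun_cong[OF d0, of g] cc[OF g] by (simp add: R.r_right_minus_eq)
    qed
  qed
  moreover have "card (carrier T) = card ?M" using count[of "{}"] by simp
  moreover have "normal_sum v ` ?M \<subseteq> carrier T" using normal_sum_closed[OF v(1)] by auto
  ultimately have "bij_betw (normal_sum v) ?M (carrier T)"
    using finT by (intro bij_betw_imageI card_subset_eq) (auto simp: card_image)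
  then show ?thesis using v(1) by (auto simp: normal_generator_def)
qed

end

theorem (in torsor_galg) normal_basis: "\<exists>v. normal_generator v"
proof (cases "finite (carrier K)")
  case True
  then show ?thesis by (rule normal_basis_finite)
next
  case False
  interpret L: algebraic_closure "K.alg_closure" "R.indexed_const ` carrier K" by (rule K.alg_closureE)
  interpret torsor_split K G T "K.alg_closure" "R.indexed_const" by unfold_locales (rule K.alg_closureE)
  obtain p where "p \<in> ring_hom T K.alg_closure"
    "\<And>x a. x \<in> carrier K \<Longrightarrow> a \<in> carrier T \<Longrightarrow> p (x \<odot>\<^sub>T a) = R.indexed_const x \<otimes>\<^sub>K.alg_closure p a"
    using point by metis
  then interpret torsor_point K G T "K.alg_closure" "R.indexed_const" p by unfold_locales
  show ?thesis by (rule normal_basis_infinite[OF False])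
qed

section \<open>Cleft extensions\<close>

context galois_galg
begin

text \<open>
  A generator \<open>v\<close> of a normal basis defines the colinear map \<open>\<gamma>(e_g) = v \<cdot> g\<inverse>\<close>. By bijectivity of the
  canonical map, the system \<open>\<Sum>g. (v \<cdot> (g h)) b_g = f(h)\<close> has exactly one solution \<open>b\<close> for each \<open>f\<close>.
  The solution for the delta function at \<open>1\<close> is a right convolution inverse of \<open>\<gamma>\<close>, and it is also a left
  inverse, because convolution with \<open>\<gamma>\<close> from the left is injective.
\<close>

lemma normal_system:
  assumes v: "normal_generator v" and f: "\<And>h. h \<in> carrier G \<Longrightarrow> f h \<in> carrier T"
  obtains b where "\<And>g. g \<in> carrier G \<Longrightarrow> b g \<in> carrier T"
    "\<And>h. h \<in> carrier G \<Longrightarrow> asum (\<lambda>g. v \<cdot> (g \<otimes> h) \<otimes>\<^sub>T b g) = f h"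
proof -
  have vc: "v \<in> carrier T" and bij: "bij_betw (normal_sum v) (carrier G \<rightarrow>\<^sub>E carrier K) (carrier T)"
    using v by (simp_all add: normal_generator_def)
  define \<tau> where "\<tau> b = finprod TxT (\<lambda>g. (v \<cdot> g) \<otimes>\<otimes> b g) (carrier G)" for b
  have \<tau>surj: "\<exists>b. (\<forall>g\<in>carrier G. b g \<in> carrier T) \<and> t = \<tau> b" if "t \<in> carrier TxT" for t
    using that
  proof (induction t rule: TT.tensor_induct)
    case (tens u w)
    have "u \<in> normal_sum v ` (carrier G \<rightarrow>\<^sub>E carrier K)" using bij tens by (simp add: bij_betw_def)
    then obtain c where c: "c \<in> carrier G \<rightarrow>\<^sub>E carrier K" "u = normal_sum v c" by auto
    have cc: "c g \<in> carrier K" if "g \<in> carrier G" for g using c that by auto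
    have "u \<otimes>\<otimes> w = finprod TxT (\<lambda>g. (c g \<odot>\<^sub>T v \<cdot> g) \<otimes>\<otimes> w) (carrier G)"
      unfolding c(2) normal_sum_def finsum_def using tens cc vc
      by (intro comm_monoid.finprod_hom[OF A.A.a_comm_monoid, where h = "\<lambda>u. u \<otimes>\<otimes> w"] TT.T.comm_monoid_axioms)
        (auto simp: TT.tens_add_left)
    also have "\<dots> = \<tau> (\<lambda>g. c g \<odot>\<^sub>T w)"
      unfolding \<tau>_def using tens cc vc by (intro TT.T.finprod_cong') (auto simp: TT.tens_smult)
    finally show ?case using tens cc by (intro exI[where x = "\<lambda>g. c g \<odot>\<^sub>T w"]) auto
  next
    case (mult t u)
    obtain b b' where b: "\<forall>g\<in>carrier G. b g \<in> carrier T" "t = \<tau> b" "\<forall>g\<in>carrier G. b' g \<in> carrier T" "u = \<tau> b'" using mult by blast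
    have "t \<otimes>\<^sub>TxT u = \<tau> (\<lambda>g. b g \<oplus>\<^sub>T b' g)"
    proof -
      have "\<tau> (\<lambda>g. b g \<oplus>\<^sub>T b' g) = finprod TxT (\<lambda>g. ((v \<cdot> g) \<otimes>\<otimes> b g) \<otimes>\<^sub>TxT ((v \<cdot> g) \<otimes>\<otimes> b' g)) (carrier G)"
        unfolding \<tau>_def using b(1,3) vc by (intro TT.T.finprod_cong' TT.tens_add_right) auto
      also have "\<dots> = t \<otimes>\<^sub>TxT u"
        unfolding b(2,4) \<tau>_def using b(1,3) vc by (intro TT.T.finprod_multf) auto
      finally show ?thesis ..
    qed
    then show ?case using b by (intro exI[where x = "\<lambda>g. b g \<oplus>\<^sub>T b' g"]) auto
  qed
  obtain t where t: "t \<in> carrier TxT" "canonical_map G T t = (\<lambda>h\<in>carrier G. f h)"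
    by (rule can_surj[of "\<lambda>h\<in>carrier G. f h"]) (use f in auto)
  obtain b where b: "\<forall>g\<in>carrier G. b g \<in> carrier T" "t = \<tau> b" using \<tau>surj[OF t(1)] by blast
  show ?thesis
  proof (rule that[of b])
    fix h assume h: "h \<in> carrier G"
    have "canonical_map G T (\<tau> b) h = asum (\<lambda>g. v \<cdot> (g \<otimes> h) \<otimes>\<^sub>T b g)"
      unfolding \<tau>_def using b vc h
      by (subst can_finprod) (auto simp: canonical_tens A.act_act intro!: asum_cong)
    then show "asum (\<lambda>g. v \<cdot> (g \<otimes> h) \<otimes>\<^sub>T b g) = f h" using t(2) b(2) h by simp
  qed (use b in auto)
qed

lemma normal_system_unique:
  assumes v: "normal_generator v" and b: "\<And>g. g \<in> carrier G \<Longrightarrow> b g \<in> carrier T" "\<And>g. g \<in> carrier G \<Longrightarrow> b' g \<in> carrier T"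
    and eq: "\<And>h. h \<in> carrier G \<Longrightarrow> asum (\<lambda>g. v \<cdot> (g \<otimes> h) \<otimes>\<^sub>T b g) = asum (\<lambda>g. v \<cdot> (g \<otimes> h) \<otimes>\<^sub>T b' g)"
    and q: "q \<in> carrier G"
  shows "b q = b' q"
proof -
  have vc: "v \<in> carrier T" and bij: "bij_betw (normal_sum v) (carrier G \<rightarrow>\<^sub>E carrier K) (carrier T)"
    using v by (simp_all add: normal_generator_def)
  define \<tau> where "\<tau> b = finprod TxT (\<lambda>g. (v \<cdot> g) \<otimes>\<otimes> b g) (carrier G)" for b
  have \<tau>c: "\<tau> b \<in> carrier TxT" if "\<forall>g\<in>carrier G. b g \<in> carrier T" for b
    unfolding \<tau>_def using that vc by (intro TT.T.finprod_closed) auto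
  have can\<tau>: "canonical_map G T (\<tau> b) h = asum (\<lambda>g. v \<cdot> (g \<otimes> h) \<otimes>\<^sub>T b g)"
    if "\<forall>g\<in>carrier G. b g \<in> carrier T" "h \<in> carrier G" for b h
    unfolding \<tau>_def using that vc by (subst can_finprod) (auto simp: canonical_tens A.act_act intro!: asum_cong)
  have bb: "\<forall>g\<in>carrier G. b g \<in> carrier T" "\<forall>g\<in>carrier G. b' g \<in> carrier T" using b by auto
  have \<tau>eq: "\<tau> b = \<tau> b'"
    by (rule can_inj[OF \<tau>c[OF bb(1)] \<tau>c[OF bb(2)]]) (simp add: can\<tau>[OF bb(1)] can\<tau>[OF bb(2)] eq)
  define c where "c a = inv_into (carrier G \<rightarrow>\<^sub>E carrier K) (normal_sum v) a" for a
  have c: "c a \<in> carrier G \<rightarrow>\<^sub>E carrier K" "normal_sum v (c a) = a" if "a \<in> carrier T" for a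
  proof -
    have "a \<in> normal_sum v ` (carrier G \<rightarrow>\<^sub>E carrier K)" using that bij by (simp add: bij_betw_def)
    from inv_into_into[OF this] f_inv_into_f[OF this] show "c a \<in> carrier G \<rightarrow>\<^sub>E carrier K" "normal_sum v (c a) = a"
      unfolding c_def .
  qed
  have cu: "c (normal_sum v x) = x" if "x \<in> carrier G \<rightarrow>\<^sub>E carrier K" for x
    using that bij unfolding c_def by (simp add: bij_betw_def)
  have cc: "c a g \<in> carrier K" if "a \<in> carrier T" "g \<in> carrier G" for a g using c(1)[OF that(1)] that(2) by auto
  have cadd: "c (a \<oplus>\<^sub>T a') q = c a q \<oplus>\<^sub>K c a' q" if a: "a \<in> carrier T" "a' \<in> carrier T" for a a'
  proof -
    let ?x = "\<lambda>g\<in>carrier G. c a g \<oplus>\<^sub>K c a' g"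
    have "normal_sum v ?x = normal_sum v (c a) \<oplus>\<^sub>T normal_sum v (c a')"
      unfolding normal_sum_def using cc a vc
      by (intro asum_smult_add) auto
    moreover have "?x \<in> carrier G \<rightarrow>\<^sub>E carrier K" using cc a by auto
    ultimately show ?thesis using cu[of ?x] c(2) a q by simp
  qed
  have csm: "c (r \<odot>\<^sub>T a) q = r \<otimes>\<^sub>K c a q" if a: "r \<in> carrier K" "a \<in> carrier T" for r a
  proof -
    let ?x = "\<lambda>g\<in>carrier G. r \<otimes>\<^sub>K c a g"
    have "normal_sum v ?x = r \<odot>\<^sub>T normal_sum v (c a)"
      unfolding normal_sum_def using cc a vc
      by (intro asum_smult_smult) auto
    moreover have "?x \<in> carrier G \<rightarrow>\<^sub>E carrier K" using cc a by auto
    ultimately show ?thesis using cu[of ?x] c(2) a q by simp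
  qed
  have cv: "c (v \<cdot> g) q = (if g = q then \<one>\<^sub>K else \<zero>\<^sub>K)" if g: "g \<in> carrier G" for g
  proof -
    have "normal_sum v (e g) = v \<cdot> g"
      unfolding normal_sum_def delta_fun_def using g vc by (subst A.A.finsum_single[where i = g]) auto
    then show ?thesis using cu[of "e g"] delta_closed[of g] q by (auto simp: delta_fun_def)
  qed
  let ?\<Phi> = "\<lambda>u w. c u q \<odot>\<^sub>T w"
  have bal: "TT.balanced (add_monoid T) ?\<Phi>"
    using cadd csm cc q by (auto simp: TT.balanced_def A.M.smult_l_distr A.M.smult_r_distr A.M.smult_assoc1[symmetric] R.m_comm)
  note lt = TT.lift_tens[OF A.A.a_comm_group bal]
  interpret lh: group_hom TxT "add_monoid T" "tensor_lift (add_monoid T) ?\<Phi>"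
    using TT.lift_hom[OF A.A.a_comm_group bal] A.A.a_group by unfold_locales
  have ltb: "tensor_lift (add_monoid T) ?\<Phi> (\<tau> b) = b q" if b: "\<forall>g\<in>carrier G. b g \<in> carrier T" for b
  proof -
    have "tensor_lift (add_monoid T) ?\<Phi> (\<tau> b) = finprod (add_monoid T) (\<lambda>g. tensor_lift (add_monoid T) ?\<Phi> ((v \<cdot> g) \<otimes>\<otimes> b g)) (carrier G)"
      unfolding \<tau>_def using b vc lh.hom_mult lh.hom_one lh.hom_closed
      by (intro TT.T.finprod_hom A.A.a_comm_monoid) auto
    also have "\<dots> = asum (\<lambda>g. c (v \<cdot> g) q \<odot>\<^sub>T b g)"
      unfolding finsum_def[symmetric] using b vc cc q lt by (intro asum_cong) auto
    also have "\<dots> = b q"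
      using b q cv cc vc by (subst A.A.finsum_single[where i = q]) auto
    finally show ?thesis .
  qed
  show ?thesis using ltb[OF bb(1)] ltb[OF bb(2)] \<tau>eq by simp
qed

theorem normal_cleft:
  assumes v: "normal_generator v"
  shows "cleft K G T"
proof -
  have vc: "v \<in> carrier T" using v by (simp add: normal_generator_def)
  obtain b where b: "\<And>g. g \<in> carrier G \<Longrightarrow> b g \<in> carrier T"
    and b1: "\<And>h. h \<in> carrier G \<Longrightarrow> asum (\<lambda>g. v \<cdot> (g \<otimes> h) \<otimes>\<^sub>T b g) = (if h = \<one> then \<one>\<^sub>T else \<zero>\<^sub>T)"
    by (rule normal_system[OF v, of "\<lambda>h. if h = \<one> then \<one>\<^sub>T else \<zero>\<^sub>T"]) auto
  define \<gamma> where "\<gamma> x = asum (\<lambda>g. x g \<odot>\<^sub>T v \<cdot> inv g)" for x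
  define \<gamma>' where "\<gamma>' x = asum (\<lambda>g. x g \<odot>\<^sub>T b g)" for x
  have lin: "linear_map K H T (\<lambda>x. asum (\<lambda>g. x g \<odot>\<^sub>T a g))" if a: "\<And>g. g \<in> carrier G \<Longrightarrow> a g \<in> carrier T" for a
    unfolding linear_map_def
  proof (intro conjI ballI)
    show "(\<lambda>x. asum (\<lambda>g. x g \<odot>\<^sub>T a g)) \<in> carrier H \<rightarrow> carrier T" using a by (auto intro!: asum_closed simp: PiE_iff)
    fix x y assume x: "x \<in> carrier H" and y: "y \<in> carrier H"
    show "asum (\<lambda>g. (x \<oplus>\<^sub>H y) g \<odot>\<^sub>T a g) = asum (\<lambda>g. x g \<odot>\<^sub>T a g) \<oplus>\<^sub>T asum (\<lambda>g. y g \<odot>\<^sub>T a g)"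
      using x y a by (intro asum_smult_add) (auto simp: PiE_iff)
  next
    fix r x assume r: "r \<in> carrier K" and x: "x \<in> carrier H"
    show "asum (\<lambda>g. (r \<odot>\<^sub>H x) g \<odot>\<^sub>T a g) = r \<odot>\<^sub>T asum (\<lambda>g. x g \<odot>\<^sub>T a g)"
      using x r a by (intro asum_smult_smult) (auto simp: PiE_iff)
  qed
  have e\<gamma>: "asum (\<lambda>h. e g h \<odot>\<^sub>T a h) = a g" if "g \<in> carrier G" "\<And>g. g \<in> carrier G \<Longrightarrow> a g \<in> carrier T" for g a
    using that by (subst A.A.finsum_single[where i = g]) (auto simp: delta_fun_def)
  have col: "\<gamma> (gact H x g) = \<gamma> x \<cdot> g" if x: "x \<in> carrier H" and g: "g \<in> carrier G" for x g
  proof -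
    have xc: "x h \<in> carrier K" if "h \<in> carrier G" for h using x that by auto
    have "\<gamma> x \<cdot> g = asum (\<lambda>h. x h \<odot>\<^sub>T v \<cdot> (inv h \<otimes> g))"
      unfolding \<gamma>_def using xc vc g by (subst A.act_finsum) (auto simp: A.act_smult A.act_act intro!: asum_cong)
    also have "\<dots> = asum (\<lambda>h. x (g \<otimes> h) \<odot>\<^sub>T v \<cdot> (inv (g \<otimes> h) \<otimes> g))"
      using xc vc g by (intro asum_left[symmetric]) auto
    also have "\<dots> = \<gamma> (gact H x g)"
      unfolding \<gamma>_def using xc vc g by (intro asum_cong) (auto simp: G.inv_mult_group G.m_assoc)
    finally show ?thesis ..
  qed
  have conv: "sweedler K G H T (\<lambda>x1 x2. \<gamma> x1 \<otimes>\<^sub>T \<beta> x2) x = asum (\<lambda>g. v \<cdot> inv g \<otimes>\<^sub>T \<beta> (gact H x g))"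
    if x: "x \<in> carrier H" and \<beta>: "\<And>x. x \<in> carrier H \<Longrightarrow> \<beta> x \<in> carrier T" for \<beta> x
    unfolding sweedler_def \<gamma>_def using vc e\<gamma>[of _ "\<lambda>g. v \<cdot> inv g"] \<beta>[OF H.act_closed[OF x]]
    by (intro asum_cong) (auto simp del: fun_alg_simps)
  have r1: "sweedler K G H T (\<lambda>x1 x2. \<gamma> x1 \<otimes>\<^sub>T \<gamma>' x2) x = counit G x \<odot>\<^sub>T \<one>\<^sub>T" if x: "x \<in> carrier H" for x
  proof -
    have xc: "x h \<in> carrier K" if "h \<in> carrier G" for h using x that by auto
    have "sweedler K G H T (\<lambda>x1 x2. \<gamma> x1 \<otimes>\<^sub>T \<gamma>' x2) x = asum (\<lambda>g. v \<cdot> inv g \<otimes>\<^sub>T \<gamma>' (gact H x g))"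
      unfolding \<gamma>'_def using b by (intro conv[OF x] asum_closed) (auto simp: PiE_iff)
    also have "\<dots> = asum (\<lambda>g. v \<cdot> inv g \<otimes>\<^sub>T asum (\<lambda>h. x h \<odot>\<^sub>T b (inv g \<otimes> h)))"
    proof (rule asum_cong)
      fix g assume g: "g \<in> carrier G"
      have "\<gamma>' (gact H x g) = asum (\<lambda>h. x (g \<otimes> h) \<odot>\<^sub>T b (inv g \<otimes> (g \<otimes> h)))"
        unfolding \<gamma>'_def using xc b g by (intro asum_cong) (auto simp: G.m_assoc[symmetric])
      also have "\<dots> = asum (\<lambda>h. x h \<odot>\<^sub>T b (inv g \<otimes> h))" using xc b g by (intro asum_left) auto
      finally show "v \<cdot> inv g \<otimes>\<^sub>T \<gamma>' (gact H x g) = v \<cdot> inv g \<otimes>\<^sub>T asum (\<lambda>h. x h \<odot>\<^sub>T b (inv g \<otimes> h))" by simp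
    qed (use vc xc b in \<open>auto intro!: asum_closed\<close>)
    also have "\<dots> = asum (\<lambda>g. asum (\<lambda>h. x h \<odot>\<^sub>T (v \<cdot> inv g \<otimes>\<^sub>T b (inv g \<otimes> h))))"
      using vc xc b by (intro asum_cong) (auto simp: A.mult_finsum A.smult_mult_right intro!: asum_cong asum_closed)
    also have "\<dots> = asum (\<lambda>h. asum (\<lambda>g. x h \<odot>\<^sub>T (v \<cdot> inv g \<otimes>\<^sub>T b (inv g \<otimes> h))))"
      using vc xc b by (intro asum_swap) auto
    also have "\<dots> = asum (\<lambda>h. x h \<odot>\<^sub>T (if inv h = \<one> then \<one>\<^sub>T else \<zero>\<^sub>T))"
    proof (rule asum_cong)
      fix h assume h: "h \<in> carrier G"
      have "asum (\<lambda>g. x h \<odot>\<^sub>T (v \<cdot> inv g \<otimes>\<^sub>T b (inv g \<otimes> h))) = x h \<odot>\<^sub>T asum (\<lambda>g. v \<cdot> inv g \<otimes>\<^sub>T b (inv g \<otimes> h))"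
        using vc xc b h by (intro A.smult_finsum[symmetric]) auto
      also have "asum (\<lambda>g. v \<cdot> inv g \<otimes>\<^sub>T b (inv g \<otimes> h)) = asum (\<lambda>g. v \<cdot> g \<otimes>\<^sub>T b (g \<otimes> h))"
        using vc b h by (intro asum_inv[where f = "\<lambda>g. v \<cdot> g \<otimes>\<^sub>T b (g \<otimes> h)"]) auto
      also have "\<dots> = asum (\<lambda>g. v \<cdot> ((g \<otimes> h) \<otimes> inv h) \<otimes>\<^sub>T b (g \<otimes> h))"
        using vc b h by (intro asum_cong) (auto simp: G.m_assoc)
      also have "\<dots> = asum (\<lambda>g. v \<cdot> (g \<otimes> inv h) \<otimes>\<^sub>T b g)"
        using vc b h by (intro asum_right) auto
      also have "\<dots> = (if inv h = \<one> then \<one>\<^sub>T else \<zero>\<^sub>T)" using h by (intro b1) auto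
      finally show "asum (\<lambda>g. x h \<odot>\<^sub>T (v \<cdot> inv g \<otimes>\<^sub>T b (inv g \<otimes> h))) = x h \<odot>\<^sub>T (if inv h = \<one> then \<one>\<^sub>T else \<zero>\<^sub>T)" .
    qed (use xc in auto)
    also have "\<dots> = counit G x \<odot>\<^sub>T \<one>\<^sub>T"
      using xc by (subst A.A.finsum_single[where i = "\<one>"]) (auto simp: counit_def G.inv_eq_1_iff)
    finally show ?thesis .
  qed
  define B where "B q = asum (\<lambda>g. b g \<otimes>\<^sub>T v \<cdot> (inv q \<otimes> g))" for q
  have Bc: "B q \<in> carrier T" if "q \<in> carrier G" for q unfolding B_def using that b vc by (intro asum_closed) auto
  have Bq: "B q = (if q = \<one> then \<one>\<^sub>T else \<zero>\<^sub>T)" if q: "q \<in> carrier G" for q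
  proof (rule normal_system_unique[OF v Bc _ _ q])
    fix h assume h: "h \<in> carrier G"
    have "asum (\<lambda>k. v \<cdot> (k \<otimes> h) \<otimes>\<^sub>T B k) = asum (\<lambda>k. asum (\<lambda>m. (v \<cdot> (k \<otimes> h) \<otimes>\<^sub>T b (k \<otimes> m)) \<otimes>\<^sub>T v \<cdot> m))"
    proof (rule asum_cong)
      fix k assume k: "k \<in> carrier G"
      have "B k = asum (\<lambda>m. b (k \<otimes> m) \<otimes>\<^sub>T v \<cdot> (inv k \<otimes> (k \<otimes> m)))"
        unfolding B_def using k vc b by (intro asum_left[symmetric]) auto
      also have "\<dots> = asum (\<lambda>m. b (k \<otimes> m) \<otimes>\<^sub>T v \<cdot> m)"
        using k vc b by (intro asum_cong) (auto simp: G.m_assoc[symmetric])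
      finally show "v \<cdot> (k \<otimes> h) \<otimes>\<^sub>T B k = asum (\<lambda>m. (v \<cdot> (k \<otimes> h) \<otimes>\<^sub>T b (k \<otimes> m)) \<otimes>\<^sub>T v \<cdot> m)"
        using k h vc b by (auto simp: A.mult_finsum A.A.m_assoc intro!: asum_cong)
    qed (use vc b h in \<open>auto intro!: asum_closed\<close>)
    also have "\<dots> = asum (\<lambda>m. asum (\<lambda>k. (v \<cdot> (k \<otimes> h) \<otimes>\<^sub>T b (k \<otimes> m)) \<otimes>\<^sub>T v \<cdot> m))"
      using vc b h by (intro asum_swap) auto
    also have "\<dots> = asum (\<lambda>m. (if inv m \<otimes> h = \<one> then \<one>\<^sub>T else \<zero>\<^sub>T) \<otimes>\<^sub>T v \<cdot> m)"
    proof (rule asum_cong)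
      fix m assume m: "m \<in> carrier G"
      have "asum (\<lambda>k. (v \<cdot> (k \<otimes> h) \<otimes>\<^sub>T b (k \<otimes> m)) \<otimes>\<^sub>T v \<cdot> m)
          = asum (\<lambda>k. v \<cdot> (k \<otimes> h) \<otimes>\<^sub>T b (k \<otimes> m)) \<otimes>\<^sub>T v \<cdot> m"
        using vc b h m by (intro A.finsum_mult[symmetric]) auto
      also have "asum (\<lambda>k. v \<cdot> (k \<otimes> h) \<otimes>\<^sub>T b (k \<otimes> m))
          = asum (\<lambda>k. v \<cdot> ((k \<otimes> m) \<otimes> (inv m \<otimes> h)) \<otimes>\<^sub>T b (k \<otimes> m))"
      proof (rule asum_cong)
        fix k assume k: "k \<in> carrier G"
        have "(k \<otimes> m) \<otimes> (inv m \<otimes> h) = k \<otimes> h"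
          using k m h G.m_assoc[of k m "inv m \<otimes> h"] G.m_assoc[of m "inv m" h] by simp
        then show "v \<cdot> (k \<otimes> h) \<otimes>\<^sub>T b (k \<otimes> m) = v \<cdot> ((k \<otimes> m) \<otimes> (inv m \<otimes> h)) \<otimes>\<^sub>T b (k \<otimes> m)" by simp
      qed (use vc b h m in auto)
      also have "\<dots> = asum (\<lambda>k. v \<cdot> (k \<otimes> (inv m \<otimes> h)) \<otimes>\<^sub>T b k)"
        using vc b h m by (intro asum_right[where f = "\<lambda>k. v \<cdot> (k \<otimes> (inv m \<otimes> h)) \<otimes>\<^sub>T b k"]) auto
      also have "\<dots> = (if inv m \<otimes> h = \<one> then \<one>\<^sub>T else \<zero>\<^sub>T)" using h m by (intro b1) auto
      finally show "asum (\<lambda>k. (v \<cdot> (k \<otimes> h) \<otimes>\<^sub>T b (k \<otimes> m)) \<otimes>\<^sub>T v \<cdot> m)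
          = (if inv m \<otimes> h = \<one> then \<one>\<^sub>T else \<zero>\<^sub>T) \<otimes>\<^sub>T v \<cdot> m" .
    qed (use vc in auto)
    also have "\<dots> = v \<cdot> h"
    proof -
      have "inv m \<otimes> h = \<one> \<longleftrightarrow> m = h" if "m \<in> carrier G" for m
        using that h G.inv_equality[of "inv m" h] by auto
      then show ?thesis using h vc by (subst A.A.finsum_single[where i = h]) auto
    qed
    also have "\<dots> = asum (\<lambda>k. v \<cdot> (k \<otimes> h) \<otimes>\<^sub>T (if k = \<one> then \<one>\<^sub>T else \<zero>\<^sub>T))"
      using vc h by (subst A.A.finsum_single[where i = "\<one>"]) auto
    finally show "asum (\<lambda>k. v \<cdot> (k \<otimes> h) \<otimes>\<^sub>T B k) = asum (\<lambda>k. v \<cdot> (k \<otimes> h) \<otimes>\<^sub>T (if k = \<one> then \<one>\<^sub>T else \<zero>\<^sub>T))" .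
  qed auto
  have r2: "sweedler K G H T (\<lambda>x1 x2. \<gamma>' x1 \<otimes>\<^sub>T \<gamma> x2) x = counit G x \<odot>\<^sub>T \<one>\<^sub>T" if x: "x \<in> carrier H" for x
  proof -
    have xc: "x h \<in> carrier K" if "h \<in> carrier G" for h using x that by auto
    have "sweedler K G H T (\<lambda>x1 x2. \<gamma>' x1 \<otimes>\<^sub>T \<gamma> x2) x = asum (\<lambda>g. asum (\<lambda>q. x q \<odot>\<^sub>T (b g \<otimes>\<^sub>T v \<cdot> (inv q \<otimes> g))))"
      unfolding sweedler_def
    proof (rule asum_cong)
      fix g assume g: "g \<in> carrier G"
      have "\<gamma> (gact H x g) = asum (\<lambda>q. x q \<odot>\<^sub>T v \<cdot> (inv q \<otimes> g))"
        unfolding col[OF x g] unfolding \<gamma>_def using xc vc g by (subst A.act_finsum) (auto simp: A.act_smult A.act_act intro!: asum_cong)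
      then show "\<gamma>' (e g) \<otimes>\<^sub>T \<gamma> (gact H x g) = asum (\<lambda>q. x q \<odot>\<^sub>T (b g \<otimes>\<^sub>T v \<cdot> (inv q \<otimes> g)))"
        unfolding \<gamma>'_def using xc vc b g e\<gamma>[OF g b] by (auto simp: A.mult_finsum A.smult_mult_right intro!: asum_cong)
    qed (use xc vc b in \<open>auto intro!: asum_closed\<close>)
    also have "\<dots> = asum (\<lambda>q. asum (\<lambda>g. x q \<odot>\<^sub>T (b g \<otimes>\<^sub>T v \<cdot> (inv q \<otimes> g))))"
      using xc vc b by (intro asum_swap) auto
    also have "\<dots> = asum (\<lambda>q. x q \<odot>\<^sub>T B q)"
      unfolding B_def using xc vc b by (intro asum_cong A.smult_finsum[symmetric]) (auto intro!: asum_closed)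
    also have "\<dots> = asum (\<lambda>q. x q \<odot>\<^sub>T (if q = \<one> then \<one>\<^sub>T else \<zero>\<^sub>T))"
      using xc by (intro asum_cong) (auto simp: Bq)
    also have "\<dots> = counit G x \<odot>\<^sub>T \<one>\<^sub>T"
      using xc by (subst A.A.finsum_single[where i = "\<one>"]) (auto simp: counit_def)
    finally show ?thesis .
  qed
  have lins: "linear_map K H T \<gamma>" "linear_map K H T \<gamma>'"
    unfolding \<gamma>_def[abs_def] \<gamma>'_def[abs_def] using vc b by (intro lin; simp)+
  show ?thesis
    unfolding cleft_def Let_def
    by (intro exI[where x = \<gamma>] exI[where x = \<gamma>'] conjI ballI lins col r1 r2)
qed

end

section \<open>Twisted forms\<close>

lemma galg_isomorphic_sym:
  assumes A: "galg R G A" and iso: "galg_isomorphic R G A C"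
  shows "galg_isomorphic R G C A"
proof -
  interpret A: galg R G A by (rule A)
  obtain h where h: "h \<in> ring_iso A C" "\<forall>r\<in>carrier R. \<forall>a\<in>carrier A. h (r \<odot>\<^sub>A a) = r \<odot>\<^sub>C h a"
    "\<forall>g\<in>carrier G. \<forall>a\<in>carrier A. h (gact A a g) = gact C (h a) g"
    using iso unfolding galg_isomorphic_def by blast
  let ?h = "inv_into (carrier A) h"
  have bij: "bij_betw h (carrier A) (carrier C)" using h(1) by (simp add: ring_iso_def)
  have hc: "?h x \<in> carrier A" "h (?h x) = x" if "x \<in> carrier C" for x
    using that bij by (auto simp: bij_betw_def inv_into_into f_inv_into_f)
  have inv: "?h (h a) = a" if "a \<in> carrier A" for a using that bij by (simp add: bij_betw_def)
  show ?thesis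
    unfolding galg_isomorphic_def
  proof (intro bexI[of _ ?h] conjI ballI)
    show "?h \<in> ring_iso C A" by (rule ring_iso_set_sym[OF A.A.ring_axioms h(1)])
    show "?h (r \<odot>\<^sub>C x) = r \<odot>\<^sub>A ?h x" if "r \<in> carrier R" "x \<in> carrier C" for r x
      using h(2) hc[OF that(2)] that inv[of "r \<odot>\<^sub>A ?h x"] by simp
    show "?h (gact C x g) = gact A (?h x) g" if "g \<in> carrier G" "x \<in> carrier C" for g x
      using h(3) hc[OF that(2)] that inv[of "gact A (?h x) g"] by simp
  qed
qed

lemma galg_isomorphic_trans:
  assumes "galg_isomorphic R G A C" "galg_isomorphic R G C D"
  shows "galg_isomorphic R G A D"
proof -
  obtain h where h: "h \<in> ring_iso A C" "\<forall>r\<in>carrier R. \<forall>a\<in>carrier A. h (r \<odot>\<^sub>A a) = r \<odot>\<^sub>C h a"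
    "\<forall>g\<in>carrier G. \<forall>a\<in>carrier A. h (gact A a g) = gact C (h a) g"
    using assms(1) unfolding galg_isomorphic_def by blast
  obtain h' where h': "h' \<in> ring_iso C D" "\<forall>r\<in>carrier R. \<forall>a\<in>carrier C. h' (r \<odot>\<^sub>C a) = r \<odot>\<^sub>D h' a"
    "\<forall>g\<in>carrier G. \<forall>a\<in>carrier C. h' (gact C a g) = gact D (h' a) g"
    using assms(2) unfolding galg_isomorphic_def by blast
  have hc: "h a \<in> carrier C" if "a \<in> carrier A" for a using h(1) that by (auto simp: ring_iso_def ring_hom_def)
  show ?thesis
    unfolding galg_isomorphic_def
    by (intro bexI[of _ "h' \<circ> h"] ring_iso_set_trans[OF h(1) h'(1)]) (use h h' hc in auto)
qed

context twist_pair
begin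

text \<open>
  Twisting changes neither the tensor product nor the underlying map, so bijectivity carries over.
\<close>

lemma twisted_base_change_iso:
  assumes D: "galg S G D" and \<phi>: "\<phi> \<in> ring_hom R S" and f: "galg_semihom R \<phi> G A D f"
    and bij: "bij_betw (base_ext.ext D f) (carrier (base_change R \<phi> S A)) (carrier D)"
  shows "galg_isomorphic S G (base_change R \<phi> S C) (twist_by S G (\<lambda>a b. \<phi> (c a b)) D)"
proof -
  let ?D' = "twist_by S G (\<lambda>a b. \<phi> (c a b)) D"
  interpret C: galg R G C by (rule twisted_galg)
  interpret D: galg S G D by fact
  interpret S: lazy_coeffs S G "\<lambda>a b. \<phi> (c a b)" "\<lambda>a b. \<phi> (d a b)"
    by (rule lazy_coeffs_hom[OF D.M.R.cring_axioms \<phi>])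
  interpret TD: twist_pair S G "\<lambda>a b. \<phi> (c a b)" "\<lambda>a b. \<phi> (d a b)" D ?D'
    by unfold_locales (rule twisted_twist_by)
  interpret EA: base_ext R G A S \<phi> by unfold_locales (rule \<phi>)
  interpret EC: base_ext R G C S \<phi> by unfold_locales (rule \<phi>)
  have f': "galg_semihom R \<phi> G C ?D' f"
    by (rule twisted_semihom[OF D \<phi> f twisted_twist_by])
  have tg: "EC.TT = EA.TT" by (rule tensor_group_cong(2); simp add: twC)
  have "EC.ext ?D' f = EA.ext D f" unfolding EC.ext_def EA.ext_def by (simp add: twist_by_def)
  moreover have "carrier EC.E = carrier EA.E" by (simp add: EC.E_carrier EA.E_carrier tg)
  moreover have "carrier ?D' = carrier D" by (simp add: twist_by_def)
  ultimately have "bij_betw (EC.ext ?D' f) (carrier EC.E) (carrier ?D')" using bij by simp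
  then show ?thesis
    unfolding galg_isomorphic_iff_semihom using EC.ext_semihom[OF TD.twisted_galg f'] by blast
qed

end

context cring_fin_group
begin

lemma fun_alg_ext_semihom:
  assumes "cring S" and \<phi>: "\<phi> \<in> ring_hom R S"
  shows "galg_semihom R \<phi> G H (fun_alg S G) (\<lambda>x. \<lambda>g\<in>carrier G. \<phi> (x g))"
proof -
  have \<phi>': "\<And>r. r \<in> carrier R \<Longrightarrow> \<phi> r \<in> carrier S" "\<phi> \<one>\<^sub>R = \<one>\<^sub>S"
    "\<And>r r'. r \<in> carrier R \<Longrightarrow> r' \<in> carrier R \<Longrightarrow> \<phi> (r \<otimes>\<^sub>R r') = \<phi> r \<otimes>\<^sub>S \<phi> r'"
    "\<And>r r'. r \<in> carrier R \<Longrightarrow> r' \<in> carrier R \<Longrightarrow> \<phi> (r \<oplus>\<^sub>R r') = \<phi> r \<oplus>\<^sub>S \<phi> r'"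
    using \<phi> by (auto simp: ring_hom_def)
  show ?thesis
    unfolding galg_semihom_def fun_alg_def
    by (intro conjI ballI ring_hom_memI) (auto simp: \<phi>' PiE_iff intro!: restrict_ext)
qed

lemma fun_alg_ext_bij:
  assumes S: "cring S" and \<phi>: "\<phi> \<in> ring_hom R S"
  shows "bij_betw (base_ext.ext (fun_alg S G) (\<lambda>x. \<lambda>g\<in>carrier G. \<phi> (x g)))
    (carrier (base_change R \<phi> S H)) (carrier (fun_alg S G))"
proof -
  interpret S: cring S by fact
  interpret SG: cring_fin_group S G by unfold_locales
  interpret E: base_ext R G H S \<phi> by unfold_locales (rule \<phi>)
  let ?f = "\<lambda>x. \<lambda>g\<in>carrier G. \<phi> (x g)"
  note f = fun_alg_ext_semihom[OF S \<phi>]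
  note ep = E.ext_pure[OF SG.fun_alg_galg f] and ea = E.ext_add[OF SG.fun_alg_galg f] and ec = E.ext_closed[OF SG.fun_alg_galg f]
  let ?\<Psi> = "E.ext SG.H ?f"
  define \<beta> where "\<beta> y = (\<Oplus>\<^sub>E.E g\<in>carrier G. E.pure (e g) (y g))" for y
  have pc: "E.pure (e g) (y g) \<in> carrier E.E" if "y \<in> carrier SG.H" "g \<in> carrier G" for y g
    using that delta_closed[of g] by (intro E.pure_closed) (auto simp: PiE_iff)
  have \<beta>c: "\<beta> y \<in> carrier E.E" if "y \<in> carrier SG.H" for y
    unfolding \<beta>_def using pc[OF that] by (rule E.E.fsum_closed)
  have \<Psi>0: "?\<Psi> \<zero>\<^sub>E.E = \<zero>\<^sub>SG.H"
    using ec[OF E.E.zero_closed] ea[OF E.E.zero_closed E.E.zero_closed] SG.H.A.add.r_cancel_one'[of "?\<Psi> \<zero>\<^sub>E.E" "?\<Psi> \<zero>\<^sub>E.E"] by simp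
  have "bij_betw ?\<Psi> (carrier E.E) (carrier SG.H)"
  proof (rule bij_betw_byWitness[where f' = \<beta>])
    show "?\<Psi> ` carrier E.E \<subseteq> carrier SG.H" "\<beta> ` carrier SG.H \<subseteq> carrier E.E" using ec \<beta>c by blast+
    show "\<forall>y\<in>carrier SG.H. ?\<Psi> (\<beta> y) = y"
    proof
      fix y assume y: "y \<in> carrier SG.H"
      have yc: "y g \<in> carrier S" if "g \<in> carrier G" for g using y that by auto
      have "?\<Psi> (\<beta> y) = (\<Oplus>\<^sub>SG.H g\<in>carrier G. ?\<Psi> (E.pure (e g) (y g)))"
        unfolding \<beta>_def by (rule E.E.finsum_hom[OF SG.H.A.abelian_monoid_axioms ea \<Psi>0 ec pc[OF y]])
      also have "\<dots> = (\<Oplus>\<^sub>SG.H g\<in>carrier G. y g \<odot>\<^sub>SG.H SG.e g)"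
      proof (rule SG.H.A.fsum_cong)
        fix g assume g: "g \<in> carrier G"
        have "?f (e g) = SG.e g"
          using \<phi> ring_hom_zero[OF \<phi> R.ring_axioms S.ring_axioms] by (auto simp: delta_fun_def ring_hom_def intro!: restrict_ext)
        then show "?\<Psi> (E.pure (e g) (y g)) = y g \<odot>\<^sub>SG.H SG.e g" using ep[OF delta_closed yc[OF g], of g] by simp
      qed (use yc in \<open>blast intro: SG.H.M.smult_closed SG.delta_closed\<close>)
      also have "\<dots> = y" using SG.fun_expand[OF y] ..
      finally show "?\<Psi> (\<beta> y) = y" .
    qed
    have \<beta>a: "\<beta> (y \<oplus>\<^sub>SG.H y') = \<beta> y \<oplus>\<^sub>E.E \<beta> y'" if y: "y \<in> carrier SG.H" "y' \<in> carrier SG.H" for y y'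
    proof -
      have "\<beta> (y \<oplus>\<^sub>SG.H y') = (\<Oplus>\<^sub>E.E g\<in>carrier G. E.pure (e g) (y g) \<oplus>\<^sub>E.E E.pure (e g) (y' g))"
        unfolding \<beta>_def
      proof (rule E.E.fsum_cong)
        fix g assume g: "g \<in> carrier G"
        then show "E.pure (e g) ((y \<oplus>\<^sub>SG.H y') g) = E.pure (e g) (y g) \<oplus>\<^sub>E.E E.pure (e g) (y' g)"
          using y delta_closed[of g] E.pure_add_right[of "e g" "y g" "y' g"] by (auto simp: PiE_iff)
      qed (use pc y in auto)
      also have "\<dots> = \<beta> y \<oplus>\<^sub>E.E \<beta> y'"
        unfolding \<beta>_def using pc[OF y(1)] pc[OF y(2)] by (intro E.E.finsum_addf) blast+
      finally show ?thesis .
    qed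
    show "\<forall>t\<in>carrier E.E. \<beta> (?\<Psi> t) = t"
    proof
      fix t assume "t \<in> carrier E.E"
      then show "\<beta> (?\<Psi> t) = t"
      proof (induction t rule: E.E_induct)
        case (pure a x)
        have ac: "a g \<in> carrier R" if "g \<in> carrier G" for g using pure that by auto
        have "\<beta> (?\<Psi> (E.pure a x)) = (\<Oplus>\<^sub>E.E g\<in>carrier G. E.pure (a g \<odot>\<^sub>H e g) x)"
          unfolding \<beta>_def ep[OF pure]
        proof (rule E.E.fsum_cong)
          fix g assume g: "g \<in> carrier G"
          show "E.pure (e g) ((x \<odot>\<^sub>SG.H ?f a) g) = E.pure (a g \<odot>\<^sub>H e g) x"
            using E.pure_smult[OF ac[OF g] delta_closed pure(2), of g] g pure(2) ac[OF g] by (simp add: S.m_comm)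
          show "E.pure (a g \<odot>\<^sub>H e g) x \<in> carrier E.E"
            by (rule E.pure_closed[OF H.M.smult_closed[OF ac[OF g] delta_closed] pure(2)])
        qed
        also have "\<dots> = E.pure (\<Oplus>\<^sub>H g\<in>carrier G. a g \<odot>\<^sub>H e g) x"
          using pure(2) ac delta_closed
          by (intro H.A.finsum_hom[where h = "\<lambda>a. E.pure a x", symmetric] E.E.abelian_monoid_axioms)
            (auto simp: E.pure_add_left E.E_zero simp del: fun_alg_simps)
        also have "(\<Oplus>\<^sub>H g\<in>carrier G. a g \<odot>\<^sub>H e g) = a" using fun_expand[OF pure(1)] ..
        finally show ?case .
      next
        case (add t u)
        show ?case by (simp only: ea[OF add(1,2)] \<beta>a[OF ec[OF add(1)] ec[OF add(2)]] add(3,4))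
      qed
    qed
  qed
  then show ?thesis .
qed

end

context lazy_coeffs
begin

lemma twisted_fun_alg_base_change:
  assumes "cring S" "\<phi> \<in> ring_hom R S" "twisted R G c H C"
  shows "galg_isomorphic S G (base_change R \<phi> S C) (twist_by S G (\<lambda>a b. \<phi> (c a b)) (fun_alg S G))"
proof -
  interpret S: cring S by fact
  interpret SG: cring_fin_group S G by unfold_locales
  interpret twist_pair R G c d H C by unfold_locales (rule assms(3))
  show ?thesis
    by (rule twisted_base_change_iso[OF SG.fun_alg_galg assms(2) fun_alg_ext_semihom[OF assms(1,2)] fun_alg_ext_bij[OF assms(1,2)]])
qed

end

lemma (in torsor_split) twisted_torsor_base_change:
  assumes "lazy_coeffs K G c d" "twisted K G c T V"
  shows "galg_isomorphic L G (base_change K \<phi> L V) (twist_by L G (\<lambda>a b. \<phi> (c a b)) (fun_alg L G))"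
proof -
  obtain p where "p \<in> ring_hom T L"
    "\<And>x a. x \<in> carrier K \<Longrightarrow> a \<in> carrier T \<Longrightarrow> p (x \<odot>\<^sub>T a) = \<phi> x \<otimes>\<^sub>L p a"
    using point by metis
  then interpret torsor_point K G T L \<phi> p by unfold_locales
  interpret lazy_coeffs K G c d by fact
  interpret TV: twist_pair K G c d T V by unfold_locales (rule assms(2))
  show ?thesis
    by (rule TV.twisted_base_change_iso[OF LG.fun_alg_galg \<phi> orbit_semihom torsor_splits])
qed

text \<open>
  A normal basis of \<open>T\<close> is one of \<open>V\<close>, which has the same module and the same action. This makes \<open>V\<close> cleft without a normal
  basis theorem for noncommutative Galois objects.
\<close>

theorem (in torsor_galg) twisted_cleft_galois:
  assumes "lazy_coeffs K G c d" and tw: "twisted K G c T V"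
  shows "cleft_galois_object K G V"
proof -
  interpret lazy_coeffs K G c d by fact
  interpret TV: twist_pair K G c d T V by unfold_locales (rule tw)
  interpret V': galg K G V by (rule TV.twisted_galg)
  have nz: "carrier V \<noteq> {\<zero>\<^sub>V }" using nonzero by (simp add: TV.twC)
  have cV: "canonical_map_bijective K G V" using TV.canonical_map_bijective_twisted can by simp
  interpret GV: galois_galg K G V by unfold_locales (rule nz, rule cV)
  obtain v where v: "normal_generator v" using normal_basis by blast
  have vc: "v \<in> carrier T" using v by (simp add: normal_generator_def)
  have eq: "GV.normal_sum v x = normal_sum v x" if x: "x \<in> carrier G \<rightarrow>\<^sub>E carrier K" for x
  proof -
    have xc: "x g \<in> carrier K" if "g \<in> carrier G" for g using x that by auto
    have "GV.normal_sum v x = (\<Oplus>\<^sub>V g\<in>carrier G. x g \<odot>\<^sub>T v \<cdot> g)"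
      unfolding GV.normal_sum_def using xc vc by (intro V'.A.fsum_cong) (auto simp: TV.twC)
    also have "\<dots> = normal_sum v x"
      unfolding normal_sum_def using xc vc
      by (intro finsum_struct_cong[OF A.A.is_abelian_group TV.twC(1-3)]) auto
    finally show ?thesis .
  qed
  have "GV.normal_generator v"
    using v unfolding GV.normal_generator_def normal_generator_def TV.twC(1)
    by (auto simp: bij_betw_cong[OF eq] simp del: restrict_PiE_iff)
  then have "cleft K G V" by (rule GV.normal_cleft)
  moreover have "carrier (invariants G T) = {x \<odot>\<^sub>T \<one>\<^sub>T | x. x \<in> carrier K}"
  proof (intro equalityI subsetI)
    fix u assume "u \<in> carrier (invariants G T)"
    then have "u \<in> carrier T" "\<And>g. g \<in> carrier G \<Longrightarrow> u \<cdot> g = u" by (auto simp: invariants_def)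
    then show "u \<in> {x \<odot>\<^sub>T \<one>\<^sub>T | x. x \<in> carrier K}" by (rule coinvariants) auto
  next
    fix u assume "u \<in> {x \<odot>\<^sub>T \<one>\<^sub>T | x. x \<in> carrier K}"
    then obtain x where "x \<in> carrier K" "u = x \<odot>\<^sub>T \<one>\<^sub>T" by blast
    then show "u \<in> carrier (invariants G T)" by (simp add: invariants_def A.act_smult)
  qed
  ultimately show ?thesis
    unfolding cleft_galois_object_def using V'.galg nz cV TV.twisted_invariants by simp
qed

text \<open>
  Untwisting: if \<open>A\<close> embeds into the twist of a commutative algebra \<open>D\<close> by \<open>c\<close>, then its twist by \<open>d\<close> embeds into
  \<open>D\<close> itself and inherits all identities, associativity and commutativity among them.
\<close>

lemma (in lazy_coeffs) untwist:
  assumes A: "galg R G A" and D: "galg S G D" "cring D" and \<phi>: "\<phi> \<in> ring_hom R S"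
    and f: "galg_semihom R \<phi> G A (twist_by S G (\<lambda>a b. \<phi> (c a b)) D) f" and inj: "inj_on f (carrier A)"
  shows "galg R G (twist_by R G d A)" "cring (twist_by R G d A)" "twisted R G c (twist_by R G d A) A"
proof -
  let ?c = "\<lambda>a b. \<phi> (c a b)" and ?d = "\<lambda>a b. \<phi> (d a b)"
  let ?D' = "twist_by S G ?c D" and ?T = "twist_by R G d A"
  interpret GA: galg R G A by fact
  interpret GD: galg S G D by fact
  interpret DC: cring D by fact
  interpret A: galg_fin R G A by unfold_locales
  interpret S: lazy_coeffs S G ?c ?d by (rule lazy_coeffs_hom[OF GD.M.R.cring_axioms \<phi>])
  interpret D: galg_fin S G D by unfold_locales
  interpret TD: twist_pair S G ?c ?d D ?D' by unfold_locales (rule twisted_twist_by)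
  interpret D': galg S G ?D' by (rule TD.twisted_galg)
  have Ds: "carrier ?D' = carrier D" "\<zero>\<^sub>?D' = \<zero>\<^sub>D" "x \<oplus>\<^sub>?D' y = x \<oplus>\<^sub>D y" "r \<odot>\<^sub>?D' x = r \<odot>\<^sub>D x" "gact ?D' x g = gact D x g" for x y r g
    by (simp_all add: twist_by_def)
  have Ts [simp]: "carrier ?T = carrier A" "\<zero>\<^sub>?T = \<zero>\<^sub>A" "x \<oplus>\<^sub>?T y = x \<oplus>\<^sub>A y" "r \<odot>\<^sub>?T x = r \<odot>\<^sub>A x" "gact ?T x g = gact A x g" for x y r g
    by (simp_all add: twist_by_def)
  have \<phi>c: "\<phi> r \<in> carrier S" if "r \<in> carrier R" for r using \<phi> that by (auto simp: ring_hom_def)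
  have f0: "f \<zero>\<^sub>A = \<zero>\<^sub>D"
    using f ring_hom_zero[OF _ GA.A.ring_axioms D'.A.ring_axioms, of f] by (auto simp: galg_semihom_def Ds)
  have f': "a \<in> carrier A \<Longrightarrow> f a \<in> carrier D"
    "a \<in> carrier A \<Longrightarrow> b \<in> carrier A \<Longrightarrow> f (a \<oplus>\<^sub>A b) = f a \<oplus>\<^sub>D f b"
    "a \<in> carrier A \<Longrightarrow> b \<in> carrier A \<Longrightarrow> f (a \<otimes>\<^sub>A b) = f a \<otimes>\<^sub>?D' f b"
    "f \<one>\<^sub>A = \<one>\<^sub>?D'"
    "r \<in> carrier R \<Longrightarrow> a \<in> carrier A \<Longrightarrow> f (r \<odot>\<^sub>A a) = \<phi> r \<odot>\<^sub>D f a"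
    "g \<in> carrier G \<Longrightarrow> a \<in> carrier A \<Longrightarrow> f (gact A a g) = gact D (f a) g" for a b r g
    using f by (auto simp: galg_semihom_def ring_hom_def Ds)
  have fsum: "f (A.asum F) = (\<Oplus>\<^sub>D g\<in>carrier G. f (F g))" if "\<And>g. g \<in> carrier G \<Longrightarrow> F g \<in> carrier A" for F
    using that f' f0 by (intro GA.A.finsum_hom GD.A.abelian_monoid_axioms) auto
  have untw: "twisted S G ?d ?D' D"
    by (rule D.twisted_sym[OF S.c_closed S.d_closed S.dc S.sum_units(1) S.sum_units(3) twisted_twist_by])
  have mc: "a \<otimes>\<^sub>?T b \<in> carrier A" if "a \<in> carrier A" "b \<in> carrier A" for a b
    using that by (simp add: twist_by_def A.twist_mult_closed)
  have fm: "f (a \<otimes>\<^sub>?T b) = f a \<otimes>\<^sub>D f b" if ab: "a \<in> carrier A" "b \<in> carrier A" for a b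
  proof -
    have cl: "d g h \<odot>\<^sub>A (gact A a g \<otimes>\<^sub>A gact A b h) \<in> carrier A" if "g \<in> carrier G" "h \<in> carrier G" for g h
      using that ab by auto
    have Dcl: "?d g h \<odot>\<^sub>D (gact D (f a) g \<otimes>\<^sub>?D' gact D (f b) h) \<in> carrier D" if "g \<in> carrier G" "h \<in> carrier G" for g h
      using that ab f'(1) D'.A.m_closed[of "gact D (f a) g" "gact D (f b) h"] by (auto simp: Ds)
    note sc = finsum_struct_cong[OF GD.A.is_abelian_group Ds(1,2,3)]
    have "f (a \<otimes>\<^sub>?T b) = f (A.asum (\<lambda>g. A.asum (\<lambda>h. d g h \<odot>\<^sub>A (gact A a g \<otimes>\<^sub>A gact A b h))))"
      by (simp add: twist_by_def twist_mult_def)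
    also have "\<dots> = (\<Oplus>\<^sub>D g\<in>carrier G. f (A.asum (\<lambda>h. d g h \<odot>\<^sub>A (gact A a g \<otimes>\<^sub>A gact A b h))))"
      using cl by (intro fsum A.asum_closed)
    also have "\<dots> = (\<Oplus>\<^sub>D g\<in>carrier G. \<Oplus>\<^sub>D h\<in>carrier G. ?d g h \<odot>\<^sub>D (gact D (f a) g \<otimes>\<^sub>?D' gact D (f b) h))"
    proof (rule GD.A.fsum_cong)
      fix g assume g: "g \<in> carrier G"
      have "f (A.asum (\<lambda>h. d g h \<odot>\<^sub>A (gact A a g \<otimes>\<^sub>A gact A b h))) = (\<Oplus>\<^sub>D h\<in>carrier G. f (d g h \<odot>\<^sub>A (gact A a g \<otimes>\<^sub>A gact A b h)))"
        using cl[OF g] by (rule fsum)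
      also have "\<dots> = (\<Oplus>\<^sub>D h\<in>carrier G. ?d g h \<odot>\<^sub>D (gact D (f a) g \<otimes>\<^sub>?D' gact D (f b) h))"
        using g ab Dcl[OF g] by (intro GD.A.fsum_cong) (auto simp: f')
      finally show "f (A.asum (\<lambda>h. d g h \<odot>\<^sub>A (gact A a g \<otimes>\<^sub>A gact A b h))) = (\<Oplus>\<^sub>D h\<in>carrier G. ?d g h \<odot>\<^sub>D (gact D (f a) g \<otimes>\<^sub>?D' gact D (f b) h))" .
    qed (use Dcl in \<open>blast intro: D.asum_closed\<close>)
    also have "\<dots> = twist_mult G ?d ?D' (f a) (f b)"
    proof -
      have "twist_mult G ?d ?D' (f a) (f b) = (\<Oplus>\<^sub>?D' g\<in>carrier G. \<Oplus>\<^sub>D h\<in>carrier G. ?d g h \<odot>\<^sub>D (gact D (f a) g \<otimes>\<^sub>?D' gact D (f b) h))"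
        unfolding twist_mult_def Ds using Dcl by (intro D'.A.fsum_cong sc) (auto simp: Ds intro!: D.asum_closed)
      also have "\<dots> = (\<Oplus>\<^sub>D g\<in>carrier G. \<Oplus>\<^sub>D h\<in>carrier G. ?d g h \<odot>\<^sub>D (gact D (f a) g \<otimes>\<^sub>?D' gact D (f b) h))"
        using Dcl by (intro sc D.asum_closed) auto
      finally show ?thesis ..
    qed
    also have "\<dots> = f a \<otimes>\<^sub>D f b"
      using twistedD(6)[OF untw, of "f a" "f b"] ab f'(1) by (simp add: Ds)
    finally show ?thesis .
  qed
  have ud: "inv\<^bsub>R\<^esub> (twist_sum R G d) \<in> carrier R" using sum_units(2) by auto
  have onec: "\<one>\<^sub>?T \<in> carrier A" using ud by (simp add: twist_by_def)
  have fone: "f \<one>\<^sub>?T = \<one>\<^sub>D"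
  proof -
    have "\<phi> (inv\<^bsub>R\<^esub> (twist_sum R G d)) = inv\<^bsub>S\<^esub> (twist_sum S G ?d)"
      using sum_units S.sum_units twist_sum_hom[OF GD.M.R.cring_axioms \<phi>] by simp
    then show ?thesis
      using twistedD(7)[OF untw] ud by (simp add: twist_by_def f' Ds)
  qed
  note fs = f'(1,2,5,6) fm fone mc onec
  have I: "x = y" if "x \<in> carrier A" "y \<in> carrier A" "f x = f y" for x y using inj_onD[OF inj that(3,1,2)] .
  have mon: "monoid ?T"
    by (rule monoidI) (auto simp: fs GD.A.m_assoc intro!: I)
  have rT: "ring ?T"
  proof (rule ringI[OF _ mon])
    show "abelian_group ?T" by (rule abelian_group_cong[OF GA.A.is_abelian_group]) auto
  qed (auto simp: fs GD.A.l_distr GD.A.r_distr intro!: I)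
  show cT: "cring ?T"
    by (rule cring.intro[OF rT], rule monoid.monoid_comm_monoidI[OF mon]) (auto simp: fs DC.m_comm intro!: I)
  show "galg R G ?T"
    by (rule galgI[OF G.group_axioms R.cring_axioms rT])
      (auto simp: fs GA.M.smult_l_distr GA.M.smult_r_distr GA.M.smult_assoc1 GA.act_add GA.act_smult GA.act_act
        GD.smult_mult_left GD.smult_mult_right GD.act_mult \<phi>c intro!: I)
  show "twisted R G c ?T A"
    by (rule A.twisted_sym[OF d_closed c_closed cd sum_units(2,4) twisted_twist_by])
qed

section \<open>Twisting a family of torsors\<close>

lemma (in galg_fin) twisted_twist:
  assumes "bilinear_form R G s"
  shows "twisted R G (coeff s) A (twist R G s A)"
  using twist_unit_coeff[OF assms]
  by (simp add: twisted_def twist_def sweedler_def twist_mult_def coeff_def twist_sum_def)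

locale comm_galg_fin = galg_fin R G A + AC: cring A
  for R :: "('r, 'q) ring_scheme" and G :: "('g, 'm) monoid_scheme" (structure) and A :: "('r, 'a, 'g) galg"
begin

abbreviation B where "B \<equiv> invariants G A"
abbreviation AB where "AB \<equiv> change_scalars (\<lambda>b. b) A"

lemma inv_simps [simp]:
  "b \<in> carrier B \<longleftrightarrow> b \<in> carrier A \<and> (\<forall>g\<in>carrier G. b \<cdot> g = b)"
  "b \<oplus>\<^sub>B b' = b \<oplus>\<^sub>A b'" "b \<otimes>\<^sub>B b' = b \<otimes>\<^sub>A b'" "\<one>\<^sub>B = \<one>\<^sub>A" "r \<odot>\<^sub>B b = r \<odot>\<^sub>A b"
  by (simp_all add: invariants_def)

lemma change_simps [simp]:
  "carrier (change_scalars j C) = carrier C" "\<zero>\<^bsub>change_scalars j C\<^esub> = \<zero>\<^sub>C" "\<one>\<^bsub>change_scalars j C\<^esub> = \<one>\<^sub>C"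
  "x \<oplus>\<^bsub>change_scalars j C\<^esub> y = x \<oplus>\<^sub>C y" "x \<otimes>\<^bsub>change_scalars j C\<^esub> y = x \<otimes>\<^sub>C y"
  "b \<odot>\<^bsub>change_scalars j C\<^esub> x = j b \<otimes>\<^sub>C x" "gact (change_scalars j C) = gact C"
  by (simp_all add: change_scalars_def)

lemma B_cring: "cring B"
proof -
  have "subring {a \<in> carrier A. \<forall>g\<in>carrier G. a \<cdot> g = a} A"
  proof (rule A.A.subringI)
    fix h assume h: "h \<in> {a \<in> carrier A. \<forall>g\<in>carrier G. a \<cdot> g = a}"
    then have "h \<in> carrier A" by simp
    then have "\<ominus>\<^sub>A h = (\<ominus>\<^sub>R \<one>\<^sub>R) \<odot>\<^sub>A h" by (simp add: A.M.smult_l_minus)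
    then show "\<ominus>\<^sub>A h \<in> {a \<in> carrier A. \<forall>g\<in>carrier G. a \<cdot> g = a}" using h by (simp add: A.act_smult)
  qed (auto simp: A.act_add A.act_mult)
  then have "subcring {a \<in> carrier A. \<forall>g\<in>carrier G. a \<cdot> g = a} A" by (rule AC.subcringI')
  then show ?thesis unfolding invariants_def by (subst A.A.subcring_iff[symmetric]) auto
qed

lemma AB_ring: "ring AB"
proof (rule ringI)
  show "abelian_group AB" by (rule abelian_group_cong[OF A.A.is_abelian_group]) auto
  show "monoid AB" by (rule monoidI) (auto simp: A.A.m_assoc)
qed (auto simp: A.A.l_distr A.A.r_distr)

lemma AB_galg: "galg B G AB"
  by (rule galgI[OF G.group_axioms B_cring AB_ring])
    (auto simp: A.A.l_distr A.A.r_distr A.A.m_assoc AC.m_lcomm A.act_add A.act_mult A.act_act)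

lemma scalar_hom: "(\<lambda>r. r \<odot>\<^sub>A \<one>\<^sub>A) \<in> ring_hom R B"
  by (rule ring_hom_memI)
    (auto simp: A.act_smult A.M.smult_l_distr A.smult_mult_left A.M.smult_assoc1)

text \<open>
  Over the ring of invariants, the twist of \<open>A\<close> by \<open>s\<close> is the twist by the image of \<open>s\<close>. Invariants multiply
  in the twist as \<open>b * a = s(1,1) b a\<close>, which is why scalars act through \<open>b \<mapsto> s(1,1)\<inverse> b\<close>.
\<close>

lemma twisted_change_scalars:
  assumes bil: "bilinear_form R G s" and lazy: "lazy_coeffs R G (coeff s) d"
  shows "twisted B G (\<lambda>g h. coeff s g h \<odot>\<^sub>A \<one>\<^sub>A) AB
    (change_scalars (twist_ident R G s A) (twist R G s A))"
proof -
  interpret lazy_coeffs R G "coeff s" d by (rule lazy)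
  interpret TA: twist_pair R G "coeff s" d A "twist R G s A" by unfold_locales (rule twisted_twist[OF bil])
  interpret AB: galg B G AB by (rule AB_galg)
  let ?\<eta> = "\<lambda>r. r \<odot>\<^sub>A \<one>\<^sub>A"
  interpret LB: lazy_coeffs B G "\<lambda>g h. ?\<eta> (coeff s g h)" "\<lambda>g h. ?\<eta> (d g h)"
    by (rule lazy_coeffs_hom[OF B_cring scalar_hom])
  let ?V = "change_scalars (twist_ident R G s A) (twist R G s A)"
  have u: "twist_unit R G s = inv\<^bsub>R\<^esub> (twist_sum R G (coeff s))"
    by (simp add: twist_unit_coeff[OF bil] twist_sum_def)
  have ts: "twist_sum R G (coeff s) \<in> carrier R" "inv\<^bsub>R\<^esub> (twist_sum R G (coeff s)) \<in> carrier R"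
    "inv\<^bsub>R\<^esub> (twist_sum R G (coeff s)) \<otimes>\<^sub>R twist_sum R G (coeff s) = \<one>\<^sub>R"
    using sum_units(1) by auto
  have sm: "b \<odot>\<^sub>?V a = b \<otimes>\<^sub>A a" if b: "b \<in> carrier B" and a: "a \<in> carrier A" for a b
  proof -
    have bc: "b \<in> carrier A" "\<And>g. g \<in> carrier G \<Longrightarrow> b \<cdot> g = b" using b by auto
    have "twist_mult G (coeff s) A b a = asum (\<lambda>g. asum (\<lambda>h. b \<otimes>\<^sub>A (coeff s g h \<odot>\<^sub>A (\<one>\<^sub>A \<cdot> g \<otimes>\<^sub>A a \<cdot> h))))"
      unfolding twist_mult_def using bc a by (intro asum_cong asum_closed) (auto simp: A.smult_mult_right)
    also have "\<dots> = asum (\<lambda>g. b \<otimes>\<^sub>A asum (\<lambda>h. coeff s g h \<odot>\<^sub>A (\<one>\<^sub>A \<cdot> g \<otimes>\<^sub>A a \<cdot> h)))"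
      using bc a by (intro asum_cong A.mult_finsum[symmetric]) (auto intro!: asum_closed)
    also have "\<dots> = b \<otimes>\<^sub>A twist_mult G (coeff s) A \<one>\<^sub>A a"
      unfolding twist_mult_def using bc a by (intro A.mult_finsum[symmetric]) (auto intro!: asum_closed)
    also have "\<dots> = twist_sum R G (coeff s) \<odot>\<^sub>A (b \<otimes>\<^sub>A a)"
      using bc a ts by (simp add: TA.tmult_one A.smult_mult_right)
    finally have m: "twist_mult G (coeff s) A b a = twist_sum R G (coeff s) \<odot>\<^sub>A (b \<otimes>\<^sub>A a)" .
    have "b \<odot>\<^sub>?V a = inv\<^bsub>R\<^esub> (twist_sum R G (coeff s)) \<odot>\<^sub>A twist_mult G (coeff s) A b a"
      using TA.tmult_bilinear(3)[OF a bc(1) bc(1) ts(2)] bc a ts by (simp add: twist_ident_def u TA.twC)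
    then show ?thesis using bc a ts by (simp add: m A.M.smult_assoc1[symmetric])
  qed
  have mu: "a \<otimes>\<^sub>?V b = twist_mult G (\<lambda>g h. ?\<eta> (coeff s g h)) AB a b" if ab: "a \<in> carrier A" "b \<in> carrier A" for a b
  proof -
    have cl: "coeff s g h \<odot>\<^sub>A (a \<cdot> g \<otimes>\<^sub>A b \<cdot> h) \<in> carrier A" if "g \<in> carrier G" "h \<in> carrier G" for g h
      using ab that by auto
    have eq: "?\<eta> (coeff s g h) \<odot>\<^sub>AB (gact AB a g \<otimes>\<^sub>AB gact AB b h) = coeff s g h \<odot>\<^sub>A (a \<cdot> g \<otimes>\<^sub>A b \<cdot> h)"
      if "g \<in> carrier G" "h \<in> carrier G" for g h
      using ab that by (simp add: A.smult_mult_left)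
    note sc = finsum_struct_cong[OF A.A.is_abelian_group, of AB]
    have i: "(\<Oplus>\<^sub>AB h\<in>carrier G. ?\<eta> (coeff s g h) \<odot>\<^sub>AB (gact AB a g \<otimes>\<^sub>AB gact AB b h))
        = asum (\<lambda>h. coeff s g h \<odot>\<^sub>A (a \<cdot> g \<otimes>\<^sub>A b \<cdot> h))" if g: "g \<in> carrier G" for g
    proof -
      have "(\<Oplus>\<^sub>AB h\<in>carrier G. ?\<eta> (coeff s g h) \<odot>\<^sub>AB (gact AB a g \<otimes>\<^sub>AB gact AB b h))
          = (\<Oplus>\<^sub>AB h\<in>carrier G. coeff s g h \<odot>\<^sub>A (a \<cdot> g \<otimes>\<^sub>A b \<cdot> h))"
        by (rule AB.A.fsum_cong) (use eq[OF g] cl[OF g] in simp_all)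
      also have "\<dots> = asum (\<lambda>h. coeff s g h \<odot>\<^sub>A (a \<cdot> g \<otimes>\<^sub>A b \<cdot> h))"
        by (rule sc) (use cl[OF g] in simp_all)
      finally show ?thesis .
    qed
    have "twist_mult G (\<lambda>g h. ?\<eta> (coeff s g h)) AB a b = (\<Oplus>\<^sub>AB g\<in>carrier G. asum (\<lambda>h. coeff s g h \<odot>\<^sub>A (a \<cdot> g \<otimes>\<^sub>A b \<cdot> h)))"
      unfolding twist_mult_def by (rule AB.A.fsum_cong) (use cl in \<open>simp_all only: i change_simps(1), auto intro!: asum_closed\<close>)
    also have "\<dots> = asum (\<lambda>g. asum (\<lambda>h. coeff s g h \<odot>\<^sub>A (a \<cdot> g \<otimes>\<^sub>A b \<cdot> h)))"
      by (rule sc) (use cl in \<open>auto intro!: asum_closed\<close>)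
    also have "\<dots> = a \<otimes>\<^sub>?V b" using ab by (simp add: TA.twC twist_mult_def)
    finally show ?thesis ..
  qed
  have "inv\<^bsub>B\<^esub> (twist_sum B G (\<lambda>g h. ?\<eta> (coeff s g h))) = ?\<eta> (inv\<^bsub>R\<^esub> (twist_sum R G (coeff s)))"
    using sum_units(4) LB.sum_units(4) twist_sum_hom(2)[OF B_cring scalar_hom] by simp
  then have one: "\<one>\<^sub>?V = inv\<^bsub>B\<^esub> (twist_sum B G (\<lambda>g h. ?\<eta> (coeff s g h))) \<odot>\<^sub>AB \<one>\<^sub>AB"
    using ts by (simp add: TA.twC)
  show ?thesis
    unfolding twisted_def using sm mu one by (simp add: TA.twC)
qed

lemma twisted_specialise:
  assumes bil: "bilinear_form R G s" and lazy: "lazy_coeffs R G (coeff s) d"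
    and K: "cring K" and \<phi>: "\<phi> \<in> ring_hom B K" "\<forall>r\<in>carrier R. \<phi> (r \<odot>\<^sub>B \<one>\<^sub>B) = \<iota> r"
  shows "twisted K G (\<lambda>g h. \<iota> (coeff s g h)) (specialise B (\<lambda>b. b) A \<phi> K)
    (specialise B (twist_ident R G s A) (twist R G s A) \<phi> K)"
proof -
  interpret lazy_coeffs R G "coeff s" d by (rule lazy)
  interpret AB: galg B G AB by (rule AB_galg)
  interpret LB: lazy_coeffs B G "\<lambda>g h. coeff s g h \<odot>\<^sub>A \<one>\<^sub>A" "\<lambda>g h. d g h \<odot>\<^sub>A \<one>\<^sub>A"
    by (rule lazy_coeffs_hom[OF B_cring scalar_hom])
  interpret TB: twist_pair B G "\<lambda>g h. coeff s g h \<odot>\<^sub>A \<one>\<^sub>A" "\<lambda>g h. d g h \<odot>\<^sub>A \<one>\<^sub>A" AB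
      "change_scalars (twist_ident R G s A) (twist R G s A)"
    by unfold_locales (rule twisted_change_scalars[OF bil lazy])
  have "(\<lambda>g h. \<phi> (coeff s g h \<odot>\<^sub>A \<one>\<^sub>A)) = (\<lambda>g h. \<iota> (coeff s g h))"
  proof (intro ext)
    fix g h
    have "coeff s g h \<in> carrier R" unfolding coeff_def by (rule bilinear_closed[OF bil delta_closed delta_closed])
    then show "\<phi> (coeff s g h \<odot>\<^sub>A \<one>\<^sub>A) = \<iota> (coeff s g h)" using \<phi>(2) by simp
  qed
  then show ?thesis using TB.base_change_twisted[OF K \<phi>(1)] by (simp add: specialise_def)
qed

end

lemma torsor_galg_of_torsor:
  assumes "field K" "finite (carrier G)" "torsor K G T"
  shows "torsor_galg K G T"
proof -
  have K: "field K" by fact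
  interpret K: field K by fact
  have T: "G_algebra K G T" "cring T" "carrier T \<noteq> {\<zero>\<^sub>T }" "canonical_map_bijective K G T"
    using assms(3) by (simp_all add: torsor_def)
  have "group G" using T(1) by (simp add: G_algebra_def)
  then have "cring_fin_group K G"
    by (intro cring_fin_group.intro fin_group.intro fin_group_axioms.intro K.cring_axioms assms(2))
  then show ?thesis
    by (intro torsor_galg.intro galois_galg.intro galg_fin.intro galg.intro galois_galg_axioms.intro
        torsor_galg_axioms.intro K T)
qed

lemma (in cring_fin_group) fun_alg_cring: "cring H"
proof (rule cring.intro[OF H.A.ring_axioms], rule H.A.monoid_comm_monoidI)
  show "x \<otimes>\<^sub>H y = y \<otimes>\<^sub>H x" if "x \<in> carrier H" "y \<in> carrier H" for x y
    by (rule fun_eqI[OF H.A.m_closed[OF that] H.A.m_closed[OF that(2,1)]])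
      (use that in \<open>simp add: PiE_iff R.m_comm\<close>)
qed

theorem theoremA1:
  fixes k :: "'k ring"
    and G :: "('g, 'm) monoid_scheme"
    and s :: "('g \<Rightarrow> 'k) \<Rightarrow> ('g \<Rightarrow> 'k) \<Rightarrow> 'k"
    and U :: "('k, 'u, 'g) galg"
  assumes "field k"
    and "group G" and "finite (carrier G)"
    and "lazy_two_cocycle k G s"
    and "classical_versal TYPE('c) TYPE('t) k G U"
  shows "versal_for_forms TYPE('c) TYPE('t) k G
           (twist k G s (fun_alg k G))
           (invariants G U) (twist_ident k G s U) (twist k G s U)"
proof -
  interpret k: field k by fact
  interpret G: group G by fact
  interpret kG: cring_fin_group k G by unfold_locales fact
  let ?c = "kG.coeff s"
  have bil: "bilinear_form k G s" using assms(4) by (simp add: lazy_two_cocycle_def two_cocycle_def Let_def)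
  obtain d where "lazy_coeffs k G ?c d" using kG.lazy_coeffs_of_cocycle[OF assms(4)] .
  then interpret kC: lazy_coeffs k G ?c d .
  let ?B = "invariants G U"
  note versal = assms(5)[unfolded classical_versal_def Let_def]
  have "G_algebra k G U" "cring U" using versal by (simp_all add: affine_variety_def)
  then interpret U: comm_galg_fin k G U
    by (intro comm_galg_fin.intro galg_fin.intro galg.intro kG.cring_fin_group_axioms)
  interpret Hk: galg_fin k G kG.H by unfold_locales
  let ?A = "twist k G s kG.H"
  interpret A: twist_pair k G ?c d kG.H ?A by unfold_locales (rule Hk.twisted_twist[OF bil])
  {
    fix K :: "'c ring" and \<iota>
    assume K: "field K" and \<iota>: "\<iota> \<in> ring_hom k K"
    interpret K: field K by (rule K)
    let ?L = "field.alg_closure K" and ?\<psi> = "ring.indexed_const K"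
    interpret L: algebraic_closure ?L "?\<psi> ` carrier K" by (rule K.alg_closureE)
    have \<psi>: "?\<psi> \<in> ring_hom K ?L" by (rule K.alg_closureE)
    have \<psi>\<iota>: "?\<psi> \<circ> \<iota> \<in> ring_hom k ?L" by (rule ring_hom_trans[OF \<iota> \<psi>])
    interpret LG: cring_fin_group ?L G by unfold_locales
    let ?cK = "\<lambda>g h. \<iota> (?c g h)"
    have KC: "lazy_coeffs K G ?cK (\<lambda>g h. \<iota> (d g h))" by (rule kC.lazy_coeffs_hom[OF K.cring_axioms \<iota>])
    let ?D = "twist_by ?L G (\<lambda>g h. ?\<psi> (?cK g h)) LG.H"
    have AL: "galg_isomorphic ?L G (base_change k (?\<psi> \<circ> \<iota>) ?L ?A) ?D"
      using kC.twisted_fun_alg_base_change[OF L.cring_axioms \<psi>\<iota> A.tw] by (simp add: comp_def)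
    interpret gA: galg k G ?A by (rule A.twisted_galg)
    interpret EA: base_ext k G ?A ?L "?\<psi> \<circ> \<iota>" by unfold_locales (rule \<psi>\<iota>)
    have tw: "twisted K G ?cK (specialise ?B (\<lambda>b. b) U \<phi> K) (specialise ?B (twist_ident k G s U) (twist k G s U) \<phi> K)"
      if "\<phi> \<in> points k ?B K \<iota>" for \<phi>
      using that by (intro U.twisted_specialise[OF bil kC.lazy_coeffs_axioms K.cring_axioms]) (simp_all add: points_def)
    have "form_of k G ?A K \<iota> (specialise ?B (twist_ident k G s U) (twist k G s U) \<phi> K)"
      if \<phi>: "\<phi> \<in> points k ?B K \<iota>" for \<phi>
    proof -
      let ?T = "specialise ?B (\<lambda>b. b) U \<phi> K"
      have "torsor K G ?T" using versal K \<iota> \<phi> by blast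
      then interpret T: torsor_galg K G ?T by (rule torsor_galg_of_torsor[OF K assms(3)])
      interpret T: torsor_split K G ?T ?L ?\<psi> by unfold_locales (rule \<psi>)
      have "galg_isomorphic ?L G (base_change K ?\<psi> ?L (specialise ?B (twist_ident k G s U) (twist k G s U) \<phi> K)) ?D"
        by (rule T.twisted_torsor_base_change[OF KC tw[OF \<phi>]])
      then show ?thesis
        unfolding form_of_def using T.twisted_cleft_galois[OF KC tw[OF \<phi>]]
          galg_isomorphic_trans[OF _ galg_isomorphic_sym[OF EA.E_galg AL]] by blast
    qed
    moreover have "\<exists>\<phi>\<in>points k ?B K \<iota>. galg_isomorphic K G A' (specialise ?B (twist_ident k G s U) (twist k G s U) \<phi> K)"
      if form: "form_of k G ?A K \<iota> A'" for A' :: "('c, 't, 'g) galg"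
    proof -
      have A': "cleft_galois_object K G A'"
        and iso: "galg_isomorphic ?L G (base_change K ?\<psi> ?L A') ?D"
        using form galg_isomorphic_trans[OF _ AL] by (auto simp: form_of_def)
      interpret A': galg K G A' using A' by (intro galg.intro) (simp add: cleft_galois_object_def)
      interpret E: base_ext K G A' ?L ?\<psi> by unfold_locales (rule \<psi>)
      obtain h where h: "galg_semihom ?L (\<lambda>r. r) G E.E ?D h" "bij_betw h (carrier E.E) (carrier ?D)"
        using iso unfolding galg_isomorphic_iff_semihom by blast
      define f where "f a = h (E.pure a \<one>\<^sub>?L)" for a
      have f: "galg_semihom K ?\<psi> G A' ?D f"
        using h(1) E.E_inclusion unfolding galg_semihom_def f_def by (auto simp: ring_hom_def)
      have inj: "inj_on f (carrier A')"
      proof (rule inj_onI)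
        fix a b assume ab: "a \<in> carrier A'" "b \<in> carrier A'" "f a = f b"
        then have "E.pure a \<one>\<^sub>?L = E.pure b \<one>\<^sub>?L"
          using inj_onD[OF bij_betw_imp_inj_on[OF h(2)]] by (simp add: f_def E.pure_closed)
        then show "a = b" by (rule E.pure_inject[OF K L.one_not_zero ab(1,2)])
      qed
      let ?T = "twist_by K G (\<lambda>g h. \<iota> (d g h)) A'"
      note T = lazy_coeffs.untwist[OF KC A'.galg_axioms LG.fun_alg_galg LG.fun_alg_cring \<psi> f inj]
      interpret T: galg K G ?T by (rule T(1))
      interpret KC: lazy_coeffs K G ?cK "\<lambda>g h. \<iota> (d g h)" by (rule KC)
      interpret TA: twist_pair K G ?cK "\<lambda>g h. \<iota> (d g h)" ?T A' by unfold_locales (rule T(3))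
      have "torsor K G ?T"
        using A' T(2) T.galg TA.canonical_map_bijective_twisted
        by (simp add: torsor_def cleft_galois_object_def twist_by_def)
      then obtain \<phi> where \<phi>: "\<phi> \<in> points k ?B K \<iota>" "galg_isomorphic K G ?T (specialise ?B (\<lambda>b. b) U \<phi> K)"
        using versal K \<iota> by blast
      then obtain h' where h': "galg_semihom K (\<lambda>r. r) G ?T (specialise ?B (\<lambda>b. b) U \<phi> K) h'"
        "bij_betw h' (carrier ?T) (carrier (specialise ?B (\<lambda>b. b) U \<phi> K))"
        unfolding galg_isomorphic_iff_semihom by blast
      have "torsor K G (specialise ?B (\<lambda>b. b) U \<phi> K)" using versal K \<iota> \<phi>(1) by blast
      then have gS: "galg K G (specialise ?B (\<lambda>b. b) U \<phi> K)" by (intro galg.intro) (simp add: torsor_def)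
      have "galg_semihom K (\<lambda>r. r) G A' (specialise ?B (twist_ident k G s U) (twist k G s U) \<phi> K) h'"
        by (rule TA.twisted_semihom[OF gS _ h'(1) tw[OF \<phi>(1)]]) (simp add: ring_hom_def)
      moreover have "bij_betw h' (carrier A') (carrier (specialise ?B (twist_ident k G s U) (twist k G s U) \<phi> K))"
        using h'(2) twistedD(1)[OF tw[OF \<phi>(1)]] by (simp add: twist_by_def)
      ultimately show ?thesis using \<phi>(1) unfolding galg_isomorphic_iff_semihom by blast
    qed
    ultimately have "(\<forall>A' :: ('c, 't, 'g) galg. form_of k G ?A K \<iota> A' \<longrightarrow>
         (\<exists>\<phi>\<in>points k ?B K \<iota>. galg_isomorphic K G A' (specialise ?B (twist_ident k G s U) (twist k G s U) \<phi> K))) \<and>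
      (\<forall>\<phi>\<in>points k ?B K \<iota>. form_of k G ?A K \<iota> (specialise ?B (twist_ident k G s U) (twist k G s U) \<phi> K))"
      by blast
  }
  then show ?thesis unfolding versal_for_forms_def by blast
qed

end
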